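(* Let $\mathcal{G}$ be a locally compact étale groupoid. The map $\Theta:\mathcal{L}(L^2(\beta_{\mathrm{r}}\mathcal{G}\rtimes\mathcal{G}))^{\beta_{\mathrm{r}}\mathcal{G}\rtimes\mathcal{G}}\to\mathcal{L}(L^2(\mathcal{G}))$ given by $\Theta(T)=\kappa\circ T\circ\iota$ is a $C^*$-monomorphism (an injective $*$-homomorphism, taking values in adjointable operators), which extends the $*$-isomorphism $$\overline{\mathbb{C}_u[\beta_{\mathrm{r}}\mathcal{G}\rtimes\mathcal{G}]^{\beta_{\mathrm{r}}\mathcal{G}\rtimes\mathcal{G}}}\xrightarrow{\ \cong\ }C_u^*(\mathcal{G})$$ (closure in the norm of $\mathcal{L}(L^2(\beta_{\mathrm{r}}\mathcal{G}\rtimes\mathcal{G}))$) determined by $\Lambda(f)\mapsto\theta(f)$ for $f\in C_c(\beta_{\mathrm{r}}\mathcal{G}\rtimes\mathcal{G})$, where $(\theta(f)\xi)(\gamma)=\sum_{\alpha\in\mathcal{G}_{\mathrm{s}(\gamma)}}f(\gamma,\gamma\alpha^{-1})\xi(\alpha)$ for $\xi\in L^2(\mathcal{G})$ and $\gamma\in\mathcal{G}$.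
   Context: Locally compact spaces are assumed Hausdorff. A locally compact étale groupoid $\mathcal{H}$ is a topological groupoid with locally compact topology whose range map $\mathrm{r}$ (hence source map $\mathrm{s}$) is a local homeomorphism; $\mathcal{H}^{(0)}$ is its unit space and $\mathcal{H}_x=\mathrm{s}^{-1}(x)$. For $A,B\subseteq\mathcal{H}$, $A\cdot B=\{\alpha\beta:\alpha\in A,\beta\in B,\mathrm{s}(\alpha)=\mathrm{r}(\beta)\}$. For such $\mathcal{H}$: $L^2(\mathcal{H})$ is the Hilbert $C_0(\mathcal{H}^{(0)})$-module completing $C_c(\mathcal{H})$ for $\langle\eta,\xi\rangle(x)=\sum_{\gamma\in\mathcal{H}_x}\overline{\eta(\gamma)}\xi(\gamma)$, with $(\xi f)(\gamma)=\xi(\gamma)f(\mathrm{s}(\gamma))$; its elements are regarded as functions on $\mathcal{H}$; $\mathcal{L}(L^2(\mathcal{H}))$ is the $C^*$-algebra of adjointable operators; functions in $C_b(\mathcal{H})$ act by pointwise multiplication. $\Lambda(f)$, $f\in C_c(\mathcal{H})$, is $(\Lambda(f)\xi)(\gamma)=\sum_{\alpha\in\mathcal{H}_{\mathrm{s}(\gamma)}}f(\gamma\alpha^{-1})\xi(\alpha)$. For $g\in C_c(\mathcal{H})$, $\rho(g)$ is the bounded operator $(\rho(g)\xi)(\gamma)=\sum_{\beta\in\mathcal{H}_{\mathrm{s}(\gamma)}}g(\beta)\xi(\gamma\beta^{-1})$; $T$ is $\mathcal{H}$-equivariant if $T\rho(g)=\rho(g)T$ for all $g\in C_c(\mathcal{H})$;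 $\mathcal{L}(L^2(\mathcal{H}))^{\mathcal{H}}$ is the algebra of equivariant operators. $f,g\in C_b(\mathcal{H})$ are $K$-separated ($K\subseteq\mathcal{H}$) if $(K\cdot\mathrm{supp}(f))\cap\mathrm{supp}(g)=\emptyset$ and $\mathrm{supp}(f)\cap(K\cdot\mathrm{supp}(g))=\emptyset$. $T$ is compactly supported if there is a compact $K\subseteq\mathcal{H}$ with $gTf=0$ for all $K$-separated $f,g\in C_b(\mathcal{H})$. $\mathbb{C}_u[\mathcal{H}]$ is the set of compactly supported operators, $C_u^*(\mathcal{H})$ its norm closure, and $\mathbb{C}_u[\mathcal{H}]^{\mathcal{H}}$ the set of equivariant elements of $\mathbb{C}_u[\mathcal{H}]$ (which equals $\Lambda(C_c(\mathcal{H}))$). Fibrewise Stone–Čech compactification: let $C_0(\mathcal{G},\mathrm{r})\subseteq C_b(\mathcal{G})$ be the norm closure of the set of $g\in C_b(\mathcal{G})$ for which there is a compact $K\subseteq\mathcal{G}^{(0)}$ with $\mathrm{supp}(g)\subseteq\mathrm{r}^{-1}(K)$. $\beta_{\mathrm{r}}\mathcal{G}$ is its Gelfand spectrum; it contains $\mathcal{G}$ as an open dense subset, and $\mathrm{r}$ extends to a continuous proper map $\mathrm{r}_\beta:\beta_{\mathrm{r}}\mathcal{G}\to\mathcal{G}^{(0)}$. The left multiplication action of $\mathcal{G}$ on $(\mathcal{G},\mathrm{r})$ extends uniquely to a continuous $\mathcal{G}$-action $(\gamma,z)\mapsto\gamma z$ ($\mathrm{s}(\gamma)=\mathrm{r}_\beta(z)$)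 on $(\beta_{\mathrm{r}}\mathcal{G},\mathrm{r}_\beta)$. The semi-direct product $\beta_{\mathrm{r}}\mathcal{G}\rtimes\mathcal{G}=\{(z,\gamma)\in\beta_{\mathrm{r}}\mathcal{G}\times\mathcal{G}:\mathrm{r}_\beta(z)=\mathrm{r}(\gamma)\}$ is a locally compact étale groupoid with unit space $\beta_{\mathrm{r}}\mathcal{G}$, range $z$, source $\gamma^{-1}z$, product $(z,\gamma)(\gamma^{-1}z,\gamma')=(z,\gamma\gamma')$, inverse $(\gamma^{-1}z,\gamma^{-1})$. $\iota:L^2(\mathcal{G})\to L^2(\beta_{\mathrm{r}}\mathcal{G}\rtimes\mathcal{G})$ is the isometry extending $(\iota\xi)(z,\gamma)=\xi(\gamma)$, $\xi\in C_c(\mathcal{G})$; $\kappa:L^2(\beta_{\mathrm{r}}\mathcal{G}\rtimes\mathcal{G})\to L^2(\mathcal{G})$ is the contraction extending $(\kappa\eta)(\gamma)=\eta(\gamma,\gamma)$, $\eta\in C_c(\beta_{\mathrm{r}}\mathcal{G}\rtimes\mathcal{G})$. *)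

theory Defs
  imports "HOL-Analysis.Analysis"
begin

section \<open>Locally compact etale groupoids\<close>

text \<open>A groupoid is given by its space of arrows; units are identified with their identity arrows,
  so range and source take values in the arrows. The product is meaningful only on pairs
  \<open>(g, h)\<close> with \<open>gsrc H g = grng H h\<close>.\<close>

record 'a groupoid =
  gtop :: "'a topology"
  grng :: "'a \<Rightarrow> 'a"
  gsrc :: "'a \<Rightarrow> 'a"
  gmul :: "'a \<Rightarrow> 'a \<Rightarrow> 'a"
  ginv :: "'a \<Rightarrow> 'a"

definition arrows :: "'a groupoid \<Rightarrow> 'a set" where
  "arrows H = topspace (gtop H)"

definition units :: "'a groupoid \<Rightarrow> 'a set" where
  "units H = grng H ` arrows H"

definition unit_space :: "'a groupoid \<Rightarrow> 'a topology" where
  "unit_space H = subtopology (gtop H) (units H)"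

definition fibre :: "'a groupoid \<Rightarrow> 'a \<Rightarrow> 'a set" where
  "fibre H x = {g \<in> arrows H. gsrc H g = x}"

definition is_groupoid :: "'a groupoid \<Rightarrow> bool" where
  "is_groupoid H \<longleftrightarrow>
     (\<forall>g\<in>arrows H. grng H g \<in> arrows H \<and> gsrc H g \<in> arrows H \<and> ginv H g \<in> arrows H) \<and>
     (\<forall>g\<in>arrows H. grng H (grng H g) = grng H g \<and> gsrc H (grng H g) = grng H g \<and>
                   grng H (gsrc H g) = gsrc H g \<and> gsrc H (gsrc H g) = gsrc H g) \<and>
     (\<forall>g\<in>arrows H. \<forall>h\<in>arrows H. gsrc H g = grng H h \<longrightarrow>
        gmul H g h \<in> arrows H \<and> grng H (gmul H g h) = grng H g \<and> gsrc H (gmul H g h) = gsrc H h) \<and>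
     (\<forall>g\<in>arrows H. \<forall>h\<in>arrows H. \<forall>k\<in>arrows H. gsrc H g = grng H h \<longrightarrow> gsrc H h = grng H k \<longrightarrow>
        gmul H (gmul H g h) k = gmul H g (gmul H h k)) \<and>
     (\<forall>g\<in>arrows H. gmul H (grng H g) g = g \<and> gmul H g (gsrc H g) = g) \<and>
     (\<forall>g\<in>arrows H. grng H (ginv H g) = gsrc H g \<and> gsrc H (ginv H g) = grng H g \<and>
                   gmul H g (ginv H g) = grng H g \<and> gmul H (ginv H g) g = gsrc H g)"

definition topological_groupoid :: "'a groupoid \<Rightarrow> bool" where
  "topological_groupoid H \<longleftrightarrow> is_groupoid H \<and>
     continuous_map (subtopology (prod_topology (gtop H) (gtop H)) {(g, h). gsrc H g = grng H h})
       (gtop H) (\<lambda>(g, h). gmul H g h) \<and>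
     continuous_map (gtop H) (gtop H) (ginv H)"

definition local_homeomorphism :: "'a topology \<Rightarrow> 'b topology \<Rightarrow> ('a \<Rightarrow> 'b) \<Rightarrow> bool" where
  "local_homeomorphism X Y f \<longleftrightarrow>
     (\<forall>x\<in>topspace X. \<exists>U. openin X U \<and> x \<in> U \<and> openin Y (f ` U) \<and>
        homeomorphic_map (subtopology X U) (subtopology Y (f ` U)) f)"

definition lc_etale_groupoid :: "'a groupoid \<Rightarrow> bool" where
  "lc_etale_groupoid H \<longleftrightarrow> topological_groupoid H \<and>
     locally_compact_space (gtop H) \<and> Hausdorff_space (gtop H) \<and>
     local_homeomorphism (gtop H) (unit_space H) (grng H)"

section \<open>Function spaces\<close>

text \<open>Functions on a space \<open>X\<close> are represented by total functions vanishing off \<open>topspace X\<close>,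
  so that equality of total functions is equality of functions on \<open>X\<close>.\<close>

definition supp_on :: "'a topology \<Rightarrow> ('a \<Rightarrow> complex) \<Rightarrow> 'a set" where
  "supp_on X f = X closure_of {x \<in> topspace X. f x \<noteq> 0}"

definition Cb :: "'a topology \<Rightarrow> ('a \<Rightarrow> complex) set" where
  "Cb X = {f. continuous_map X euclidean f \<and> bounded (f ` topspace X) \<and> (\<forall>x. x \<notin> topspace X \<longrightarrow> f x = 0)}"

definition Cc :: "'a topology \<Rightarrow> ('a \<Rightarrow> complex) set" where
  "Cc X = {f. continuous_map X euclidean f \<and> compactin X (supp_on X f) \<and>
              (\<forall>x. x \<notin> topspace X \<longrightarrow> f x = 0)}"

section \<open>The Hilbert module and its operators\<close>

definition l2inner :: "'a groupoid \<Rightarrow> ('a \<Rightarrow> complex) \<Rightarrow> ('a \<Rightarrow> complex) \<Rightarrow> 'a \<Rightarrow> complex" where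
  "l2inner H \<eta> \<xi> x = (\<Sum>\<^sub>\<infinity>g\<in>fibre H x. cnj (\<eta> g) * \<xi> g)"

text \<open>Among the functions with uniformly bounded \<open>\<ell>\<^sup>2\<close>-norms on the source fibres (a Banach
  space for the supremum of these norms) the completion of \<open>Cc\<close> is the closure of \<open>Cc\<close>.\<close>

definition L2 :: "'a groupoid \<Rightarrow> ('a \<Rightarrow> complex) set" where
  "L2 H = {\<xi>. (\<forall>g. g \<notin> arrows H \<longrightarrow> \<xi> g = 0) \<and>
     (\<forall>\<epsilon>>0. \<exists>\<eta>\<in>Cc (gtop H). \<forall>x\<in>units H.
        (\<lambda>g. (cmod (\<xi> g - \<eta> g))\<^sup>2) summable_on fibre H x \<and>
        (\<Sum>\<^sub>\<infinity>g\<in>fibre H x. (cmod (\<xi> g - \<eta> g))\<^sup>2) \<le> \<epsilon>\<^sup>2)}"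

text \<open>The point \<open>0\<close> is inserted only to cover the empty groupoid.\<close>

definition l2norm :: "'a groupoid \<Rightarrow> ('a \<Rightarrow> complex) \<Rightarrow> real" where
  "l2norm H \<xi> = Sup (insert 0 ((\<lambda>x. sqrt (Re (l2inner H \<xi> \<xi> x))) ` units H))"

type_synonym ('a, 'b) oper = "('a \<Rightarrow> complex) \<Rightarrow> ('b \<Rightarrow> complex)"

text \<open>Operators on \<open>L2 H\<close> are total maps with value \<open>0\<close> off \<open>L2 H\<close>; \<open>on_L2\<close> enforces this, and
  makes the value vanish off the arrows of the target groupoid \<open>K\<close>.\<close>

definition on_L2 :: "'a groupoid \<Rightarrow> 'b groupoid \<Rightarrow> ('a, 'b) oper \<Rightarrow> ('a, 'b) oper" where
  "on_L2 H K F = (\<lambda>\<xi> g. if \<xi> \<in> L2 H \<and> g \<in> arrows K then F \<xi> g else 0)"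

definition is_adjoint :: "'a groupoid \<Rightarrow> ('a, 'a) oper \<Rightarrow> ('a, 'a) oper \<Rightarrow> bool" where
  "is_adjoint H T S \<longleftrightarrow> (\<forall>\<xi>\<in>L2 H. S \<xi> \<in> L2 H) \<and> (\<forall>\<xi>. \<xi> \<notin> L2 H \<longrightarrow> S \<xi> = (\<lambda>_. 0)) \<and>
     (\<forall>\<xi>\<in>L2 H. \<forall>\<eta>\<in>L2 H. \<forall>x\<in>units H. l2inner H \<eta> (T \<xi>) x = l2inner H (S \<eta>) \<xi> x)"

text \<open>As usual for Hilbert modules, linearity over the scalars and over \<open>C\<^sub>0\<close> of the unit space, as
  well as boundedness, are consequences of adjointability.\<close>

definition adjointable :: "'a groupoid \<Rightarrow> ('a, 'a) oper set" where
  "adjointable H = {T. (\<forall>\<xi>\<in>L2 H. T \<xi> \<in> L2 H) \<and> (\<forall>\<xi>. \<xi> \<notin> L2 H \<longrightarrow> T \<xi> = (\<lambda>_. 0)) \<and>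
                       (\<exists>S. is_adjoint H T S)}"

definition adj :: "'a groupoid \<Rightarrow> ('a, 'a) oper \<Rightarrow> ('a, 'a) oper" where
  "adj H T = (THE S. is_adjoint H T S)"

definition opnorm :: "'a groupoid \<Rightarrow> ('a, 'a) oper \<Rightarrow> real" where
  "opnorm H T = (SUP \<xi>\<in>{\<xi> \<in> L2 H. l2norm H \<xi> \<le> 1}. l2norm H (T \<xi>))"

definition op_closure :: "'a groupoid \<Rightarrow> ('a, 'a) oper set \<Rightarrow> ('a, 'a) oper set" where
  "op_closure H A = {T \<in> adjointable H. \<forall>\<epsilon>>0. \<exists>S\<in>A. opnorm H (\<lambda>\<xi> g. T \<xi> g - S \<xi> g) < \<epsilon>}"

definition Lambda_op :: "'a groupoid \<Rightarrow> ('a \<Rightarrow> complex) \<Rightarrow> ('a, 'a) oper" where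
  "Lambda_op H f = on_L2 H H (\<lambda>\<xi> g. \<Sum>\<^sub>\<infinity>a\<in>fibre H (gsrc H g). f (gmul H g (ginv H a)) * \<xi> a)"

definition rho_op :: "'a groupoid \<Rightarrow> ('a \<Rightarrow> complex) \<Rightarrow> ('a, 'a) oper" where
  "rho_op H f = on_L2 H H (\<lambda>\<xi> g. \<Sum>\<^sub>\<infinity>b\<in>fibre H (gsrc H g). f b * \<xi> (gmul H g (ginv H b)))"

definition equivariant :: "'a groupoid \<Rightarrow> ('a, 'a) oper \<Rightarrow> bool" where
  "equivariant H T \<longleftrightarrow> (\<forall>f\<in>Cc (gtop H). T \<circ> rho_op H f = rho_op H f \<circ> T)"

definition equivariant_ops :: "'a groupoid \<Rightarrow> ('a, 'a) oper set" where
  "equivariant_ops H = {T \<in> adjointable H. equivariant H T}"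

section \<open>Compactly supported operators and the uniform algebra\<close>

definition set_mul :: "'a groupoid \<Rightarrow> 'a set \<Rightarrow> 'a set \<Rightarrow> 'a set" where
  "set_mul H A B = {gmul H a b | a b. a \<in> A \<and> b \<in> B \<and> gsrc H a = grng H b}"

definition K_separated ::
    "'a groupoid \<Rightarrow> 'a set \<Rightarrow> ('a \<Rightarrow> complex) \<Rightarrow> ('a \<Rightarrow> complex) \<Rightarrow> bool" where
  "K_separated H K f g \<longleftrightarrow>
     set_mul H K (supp_on (gtop H) f) \<inter> supp_on (gtop H) g = {} \<and>
     supp_on (gtop H) f \<inter> set_mul H K (supp_on (gtop H) g) = {}"

definition compactly_supported :: "'a groupoid \<Rightarrow> ('a, 'a) oper \<Rightarrow> bool" where
  "compactly_supported H T \<longleftrightarrow>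
     (\<exists>K. compactin (gtop H) K \<and>
        (\<forall>f\<in>Cb (gtop H). \<forall>g\<in>Cb (gtop H). K_separated H K f g \<longrightarrow>
           (\<forall>\<xi>\<in>L2 H. (\<lambda>a. g a * T (\<lambda>b. f b * \<xi> b) a) = (\<lambda>_. 0))))"

definition Cu_alg :: "'a groupoid \<Rightarrow> ('a, 'a) oper set" where
  "Cu_alg H = {T \<in> adjointable H. compactly_supported H T}"

definition Cu_star :: "'a groupoid \<Rightarrow> ('a, 'a) oper set" where
  "Cu_star H = op_closure H (Cu_alg H)"

definition Cu_alg_equivariant :: "'a groupoid \<Rightarrow> ('a, 'a) oper set" where
  "Cu_alg_equivariant H = {T \<in> Cu_alg H. equivariant H T}"

section \<open>Homomorphisms of concrete C*-algebras\<close>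

definition cstar_subalgebra :: "'a groupoid \<Rightarrow> ('a, 'a) oper set \<Rightarrow> bool" where
  "cstar_subalgebra H A \<longleftrightarrow> A \<subseteq> adjointable H \<and> (\<lambda>_ _. 0) \<in> A \<and>
     (\<forall>S\<in>A. \<forall>T\<in>A. (\<lambda>\<xi> g. S \<xi> g + T \<xi> g) \<in> A \<and> S \<circ> T \<in> A) \<and>
     (\<forall>c. \<forall>T\<in>A. (\<lambda>\<xi> g. c * T \<xi> g) \<in> A) \<and>
     (\<forall>T\<in>A. adj H T \<in> A) \<and>
     op_closure H A \<subseteq> A"

definition star_hom :: "'a groupoid \<Rightarrow> ('a, 'a) oper set \<Rightarrow> 'b groupoid \<Rightarrow> ('b, 'b) oper set \<Rightarrow>
    (('a, 'a) oper \<Rightarrow> ('b, 'b) oper) \<Rightarrow> bool" where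
  "star_hom H A K B \<Phi> \<longleftrightarrow> cstar_subalgebra H A \<and> cstar_subalgebra K B \<and>
     (\<forall>T\<in>A. \<Phi> T \<in> B) \<and>
     (\<forall>S\<in>A. \<forall>T\<in>A. \<Phi> (\<lambda>\<xi> g. S \<xi> g + T \<xi> g) = (\<lambda>\<xi> g. \<Phi> S \<xi> g + \<Phi> T \<xi> g)) \<and>
     (\<forall>c. \<forall>T\<in>A. \<Phi> (\<lambda>\<xi> g. c * T \<xi> g) = (\<lambda>\<xi> g. c * \<Phi> T \<xi> g)) \<and>
     (\<forall>S\<in>A. \<forall>T\<in>A. \<Phi> (S \<circ> T) = \<Phi> S \<circ> \<Phi> T) \<and>
     (\<forall>T\<in>A. \<Phi> (adj H T) = adj K (\<Phi> T))"

definition cstar_mono :: "'a groupoid \<Rightarrow> ('a, 'a) oper set \<Rightarrow> 'b groupoid \<Rightarrow> ('b, 'b) oper set \<Rightarrow>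
    (('a, 'a) oper \<Rightarrow> ('b, 'b) oper) \<Rightarrow> bool" where
  "cstar_mono H A K B \<Phi> \<longleftrightarrow> star_hom H A K B \<Phi> \<and> inj_on \<Phi> A"

definition star_iso :: "'a groupoid \<Rightarrow> ('a, 'a) oper set \<Rightarrow> 'b groupoid \<Rightarrow> ('b, 'b) oper set \<Rightarrow>
    (('a, 'a) oper \<Rightarrow> ('b, 'b) oper) \<Rightarrow> bool" where
  "star_iso H A K B \<Phi> \<longleftrightarrow> star_hom H A K B \<Phi> \<and> bij_betw \<Phi> A B"

section \<open>The fibrewise Stone--Cech compactification\<close>

definition C0r :: "'a groupoid \<Rightarrow> ('a \<Rightarrow> complex) set" where
  "C0r G = {f \<in> Cb (gtop G). \<forall>\<epsilon>>0. \<exists>h\<in>Cb (gtop G).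
     (\<exists>K. compactin (unit_space G) K \<and> supp_on (gtop G) h \<subseteq> {g \<in> arrows G. grng G g \<in> K}) \<and>
     (\<forall>g\<in>arrows G. cmod (f g - h g) \<le> \<epsilon>)}"

text \<open>Points of the Gelfand spectrum of a C*-algebra \<open>A\<close> of functions: the nonzero
  *-homomorphisms to the complex numbers, extended by \<open>0\<close> off \<open>A\<close>.\<close>

definition characters :: "('a \<Rightarrow> complex) set \<Rightarrow> (('a \<Rightarrow> complex) \<Rightarrow> complex) set" where
  "characters A = {\<phi>. (\<forall>f. f \<notin> A \<longrightarrow> \<phi> f = 0) \<and> (\<exists>f\<in>A. \<phi> f \<noteq> 0) \<and>
     (\<forall>f\<in>A. \<forall>h\<in>A. \<phi> (\<lambda>x. f x + h x) = \<phi> f + \<phi> h \<and> \<phi> (\<lambda>x. f x * h x) = \<phi> f * \<phi> h) \<and>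
     (\<forall>c. \<forall>f\<in>A. \<phi> (\<lambda>x. c * f x) = c * \<phi> f) \<and>
     (\<forall>f\<in>A. \<phi> (\<lambda>x. cnj (f x)) = cnj (\<phi> f))}"

type_synonym 'a beta_pt = "('a \<Rightarrow> complex) \<Rightarrow> complex"

text \<open>The topology is that of pointwise convergence.\<close>

definition beta_r :: "'a groupoid \<Rightarrow> 'a beta_pt topology" where
  "beta_r G = subtopology (product_topology (\<lambda>_. euclidean) UNIV) (characters (C0r G))"

definition beta_emb :: "'a groupoid \<Rightarrow> 'a \<Rightarrow> 'a beta_pt" where
  "beta_emb G g = (\<lambda>f. if f \<in> C0r G then f g else 0)"

text \<open>The extension of the range map and of the left multiplication action. Both are unique (on
  \<open>beta_r G\<close>, resp. on the composable pairs) by density, so that the choice is immaterial.\<close>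

definition r_beta :: "'a groupoid \<Rightarrow> 'a beta_pt \<Rightarrow> 'a" where
  "r_beta G = (SOME p. continuous_map (beta_r G) (unit_space G) p \<and>
                       (\<forall>g\<in>arrows G. p (beta_emb G g) = grng G g))"

definition continuous_action ::
    "'a groupoid \<Rightarrow> 'z topology \<Rightarrow> ('z \<Rightarrow> 'a) \<Rightarrow> ('a \<Rightarrow> 'z \<Rightarrow> 'z) \<Rightarrow> bool" where
  "continuous_action G Z p act \<longleftrightarrow>
     continuous_map (subtopology (prod_topology (gtop G) Z) {(g, z). gsrc G g = p z}) Z
       (\<lambda>(g, z). act g z) \<and>
     (\<forall>g\<in>arrows G. \<forall>z\<in>topspace Z. gsrc G g = p z \<longrightarrow> p (act g z) = grng G g) \<and>
     (\<forall>z\<in>topspace Z. act (p z) z = z) \<and>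
     (\<forall>g\<in>arrows G. \<forall>h\<in>arrows G. \<forall>z\<in>topspace Z. gsrc G g = grng G h \<longrightarrow> gsrc G h = p z \<longrightarrow>
        act (gmul G g h) z = act g (act h z))"

definition beta_act :: "'a groupoid \<Rightarrow> 'a \<Rightarrow> 'a beta_pt \<Rightarrow> 'a beta_pt" where
  "beta_act G = (SOME act. continuous_action G (beta_r G) (r_beta G) act \<and>
     (\<forall>g\<in>arrows G. \<forall>h\<in>arrows G. gsrc G g = grng G h \<longrightarrow>
        act g (beta_emb G h) = beta_emb G (gmul G g h)))"

text \<open>A point \<open>z\<close> of \<open>beta_r G\<close>, viewed as a unit, is the arrow \<open>(z, r_beta G z)\<close>. So the unit
  \<open>z\<close> appears below as \<open>(z, grng G g)\<close>, and \<open>g\<^sup>-\<^sup>1 z\<close> as \<open>(g\<^sup>-\<^sup>1 z, gsrc G g)\<close>.\<close>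

definition semidirect :: "'a groupoid \<Rightarrow> ('a beta_pt \<times> 'a) groupoid" where
  "semidirect G = \<lparr>
     gtop = subtopology (prod_topology (beta_r G) (gtop G)) {(z, g). r_beta G z = grng G g},
     grng = (\<lambda>(z, g). (z, grng G g)),
     gsrc = (\<lambda>(z, g). (beta_act G (ginv G g) z, gsrc G g)),
     gmul = (\<lambda>(z, g) (z', g'). (z, gmul G g g')),
     ginv = (\<lambda>(z, g). (beta_act G (ginv G g) z, ginv G g)) \<rparr>"

section \<open>The maps between the two Hilbert modules\<close>

text \<open>Evaluation at an arrow is contractive for \<open>l2norm\<close>, so the continuous extensions from \<open>Cc\<close>
  to \<open>L2\<close> of these two maps are given by the same pointwise formulas.\<close>

definition iota :: "'a groupoid \<Rightarrow> ('a, 'a beta_pt \<times> 'a) oper" where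
  "iota G = on_L2 G (semidirect G) (\<lambda>\<xi> (z, g). \<xi> g)"

definition kappa :: "'a groupoid \<Rightarrow> ('a beta_pt \<times> 'a, 'a) oper" where
  "kappa G = on_L2 (semidirect G) G (\<lambda>\<eta> g. \<eta> (beta_emb G g, g))"

definition Theta :: "'a groupoid \<Rightarrow> ('a beta_pt \<times> 'a, 'a beta_pt \<times> 'a) oper \<Rightarrow> ('a, 'a) oper" where
  "Theta G T = kappa G \<circ> T \<circ> iota G"

definition theta :: "'a groupoid \<Rightarrow> ('a beta_pt \<times> 'a \<Rightarrow> complex) \<Rightarrow> ('a, 'a) oper" where
  "theta G f = on_L2 G G (\<lambda>\<xi> g.
     \<Sum>\<^sub>\<infinity>a\<in>fibre G (gsrc G g). f (beta_emb G g, gmul G g (ginv G a)) * \<xi> a)"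

end

theory Submission
  imports Defs
begin

text \<open>An equivariant operator \<open>T\<close> on \<open>L\<^sup>2(\<beta>\<^sub>rG \<rtimes> G)\<close> acts fibrewise and is invariant under right translations, so its
  fibre over a point \<open>g\<close> of \<open>G \<subseteq> \<beta>\<^sub>rG\<close> is unitarily equivalent to its fibre over \<open>s g\<close>, which is the fibre of
  \<open>\<Theta> T\<close>. Since \<open>G\<close> is dense in \<open>\<beta>\<^sub>rG\<close> and fibre norms of elements of \<open>L\<^sup>2\<close> are continuous, \<open>\<Theta>\<close> is isometric. The matrix
  coefficients \<open>t (g, a)\<close> of a compactly supported operator on \<open>L\<^sup>2(G)\<close> are continuous, and \<open>t (g, \<gamma>\<^sup>-\<^sup>1 g)\<close>, as a
  function of \<open>(g, \<gamma>)\<close>, extends by the universal property of \<open>\<beta>\<^sub>rG\<close> to some \<open>f\<close> in \<open>C\<^sub>c(\<beta>\<^sub>rG \<rtimes> G)\<close> with \<open>\<theta> f = T\<close>;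
  hence the image of the closure of the operators \<open>\<Lambda> f\<close> is all of \<open>C\<^sub>u\<^sup>*(G)\<close>. Uniqueness holds because *-homomorphisms
  of C*-algebras are contractive.\<close>

section \<open>Square summable functions on a set\<close>

text \<open>Adjointability comes without boundedness, so \<open>opnorm\<close> is a supremum whose
  finiteness must first be earned: a uniform boundedness argument supplies it, and a cut-off along
  units turns it into an estimate on each single fibre. From then on \<open>near\<close> carries the
  norm estimates fibre by fibre. Fibre sums are tamed by splitting elements of \<open>Cc\<close>
  into pieces supported in open bisections, where at most one term survives. The maps
  \<open>r_beta\<close> and \<open>beta_act\<close> are only chosen by description, so their
  existence has to be proved. The tool is that finitely many values of a character are approximated
  by evaluation at an arrow. The action is built from bumps in bisections; independence of the bump
  holds because a character over \<open>s u\<close> sees only the germ at \<open>u\<close>. A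
  coefficient at \<open>(g, inv c \<cdot> g)\<close>, with \<open>c\<close> the arrow of a bisection
  whose range is \<open>r g\<close>, depends on \<open>g\<close> alone and, once cut off by a bump,
  lies in \<open>C0r\<close>: this is why it extends. Contractivity of star-homomorphisms comes from
  an algebraic fixed point equation in place of spectral theory.\<close>

definition sqs :: "'a set \<Rightarrow> ('a \<Rightarrow> complex) \<Rightarrow> bool" where
  "sqs A f \<longleftrightarrow> (\<lambda>a. (cmod (f a))\<^sup>2) summable_on A"

definition en :: "'a set \<Rightarrow> ('a \<Rightarrow> complex) \<Rightarrow> real" where
  "en A f = sqrt (\<Sum>\<^sub>\<infinity>a\<in>A. (cmod (f a))\<^sup>2)"

lemma en_nonneg [simp]: "0 \<le> en A f"
  by (simp add: en_def infsum_nonneg)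

lemma en_square: "(en A f)\<^sup>2 = (\<Sum>\<^sub>\<infinity>a\<in>A. (cmod (f a))\<^sup>2)"
  by (simp add: en_def infsum_nonneg)

lemma sqs_cong: "(\<And>a. a \<in> A \<Longrightarrow> f a = g a) \<Longrightarrow> sqs A f \<longleftrightarrow> sqs A g"
  unfolding sqs_def by (rule summable_on_cong) auto

lemma en_cong: "(\<And>a. a \<in> A \<Longrightarrow> f a = g a) \<Longrightarrow> en A f = en A g"
  unfolding en_def by (metis (mono_tags, lifting) infsum_cong)

lemma L2_set_le_en:
  assumes "sqs A f" "finite F" "F \<subseteq> A"
  shows "L2_set (\<lambda>a. cmod (f a)) F \<le> en A f"
  unfolding L2_set_def en_def
  using assms by (intro real_sqrt_le_mono finite_sum_le_infsum) (auto simp: sqs_def)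

lemma sqs_bounded:
  assumes "\<And>F. finite F \<Longrightarrow> F \<subseteq> A \<Longrightarrow> L2_set (\<lambda>a. cmod (f a)) F \<le> C"
  shows "sqs A f" "en A f \<le> C"
proof -
  have C: "0 \<le> C"
    using assms[of "{}"] by simp
  have *: "(\<Sum>a\<in>F. (cmod (f a))\<^sup>2) \<le> C\<^sup>2" if "finite F" "F \<subseteq> A" for F
    using assms[OF that] unfolding L2_set_def by (simp add: sqrt_le_D)
  show "sqs A f"
    unfolding sqs_def
    by (rule nonneg_bdd_above_summable_on) (auto intro!: bdd_aboveI2[where M = "C\<^sup>2"] *)
  then have "(\<Sum>\<^sub>\<infinity>a\<in>A. (cmod (f a))\<^sup>2) \<le> C\<^sup>2"
    using * by (intro infsum_le_finite_sums) (auto simp: sqs_def)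
  then show "en A f \<le> C"
    unfolding en_def using C real_le_lsqrt by blast
qed

lemma sqs_zero [simp]: "sqs A (\<lambda>_. 0)" and en_zero [simp]: "en A (\<lambda>_. 0) = 0"
  by (auto simp: sqs_def en_def)

lemma sqs_add: "sqs A f \<Longrightarrow> sqs A g \<Longrightarrow> sqs A (\<lambda>a. f a + g a)"
  and en_add: "sqs A f \<Longrightarrow> sqs A g \<Longrightarrow> en A (\<lambda>a. f a + g a) \<le> en A f + en A g"
proof -
  assume fg: "sqs A f" "sqs A g"
  have *: "L2_set (\<lambda>a. cmod (f a + g a)) F \<le> en A f + en A g" if "finite F" "F \<subseteq> A" for F
  proof -
    have "L2_set (\<lambda>a. cmod (f a + g a)) F \<le> L2_set (\<lambda>a. cmod (f a) + cmod (g a)) F"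
      by (rule L2_set_mono) (auto intro: norm_triangle_ineq)
    also have "\<dots> \<le> L2_set (\<lambda>a. cmod (f a)) F + L2_set (\<lambda>a. cmod (g a)) F"
      by (rule L2_set_triangle_ineq)
    also have "\<dots> \<le> en A f + en A g"
      using fg that by (intro add_mono L2_set_le_en)
    finally show ?thesis .
  qed
  show "sqs A (\<lambda>a. f a + g a)" "en A (\<lambda>a. f a + g a) \<le> en A f + en A g"
    using sqs_bounded[OF *] by auto
qed

lemma sqs_dominated: "sqs A f \<Longrightarrow> 0 \<le> C \<Longrightarrow> (\<And>a. a \<in> A \<Longrightarrow> cmod (g a) \<le> C * cmod (f a)) \<Longrightarrow> sqs A g"
  and en_dominated: "sqs A f \<Longrightarrow> 0 \<le> C \<Longrightarrow> (\<And>a. a \<in> A \<Longrightarrow> cmod (g a) \<le> C * cmod (f a)) \<Longrightarrow> en A g \<le> C * en A f"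
proof -
  assume f: "sqs A f" and C: "0 \<le> C" and g: "\<And>a. a \<in> A \<Longrightarrow> cmod (g a) \<le> C * cmod (f a)"
  have *: "L2_set (\<lambda>a. cmod (g a)) F \<le> C * en A f" if "finite F" "F \<subseteq> A" for F
  proof -
    have "L2_set (\<lambda>a. cmod (g a)) F \<le> L2_set (\<lambda>a. C * cmod (f a)) F"
      using that g by (intro L2_set_mono) auto
    also have "\<dots> = C * L2_set (\<lambda>a. cmod (f a)) F"
      using C by (simp add: L2_set_right_distrib)
    also have "\<dots> \<le> C * en A f"
      using f that C by (intro mult_left_mono L2_set_le_en)
    finally show ?thesis .
  qed
  show "sqs A g" "en A g \<le> C * en A f"
    using sqs_bounded[OF *] by auto
qed

lemma sqs_scale: "sqs A f \<Longrightarrow> sqs A (\<lambda>a. c * f a)"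
  by (rule sqs_dominated[where C = "cmod c"]) (auto simp: norm_mult)

lemma en_scale: "en A (\<lambda>a. c * f a) = cmod c * en A f"
proof -
  have "(\<Sum>\<^sub>\<infinity>a\<in>A. (cmod (c * f a))\<^sup>2) = (cmod c)\<^sup>2 * (\<Sum>\<^sub>\<infinity>a\<in>A. (cmod (f a))\<^sup>2)"
    by (simp add: norm_mult power_mult_distrib infsum_cmult_right')
  then show ?thesis
    by (simp add: en_def real_sqrt_mult)
qed

lemma sqs_diff: "sqs A f \<Longrightarrow> sqs A g \<Longrightarrow> sqs A (\<lambda>a. f a - g a)"
  using sqs_add[of A f "\<lambda>a. - 1 * g a"] sqs_scale[of A g "-1"] by simp

lemma en_uminus: "en A (\<lambda>a. - f a) = en A f"
  using en_scale[of A "-1" f] by simp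

lemma en_diff_commute: "en A (\<lambda>a. f a - g a) = en A (\<lambda>a. g a - f a)"
  using en_uminus[of A "\<lambda>a. f a - g a"] by simp

lemma en_triangle:
  "sqs A (\<lambda>a. f a - g a) \<Longrightarrow> sqs A (\<lambda>a. g a - h a) \<Longrightarrow>
    en A (\<lambda>a. f a - h a) \<le> en A (\<lambda>a. f a - g a) + en A (\<lambda>a. g a - h a)"
  using en_add[of A "\<lambda>a. f a - g a" "\<lambda>a. g a - h a"] by simp

lemma en_diff_le:
  assumes "sqs A f" "sqs A g"
  shows "\<bar>en A f - en A g\<bar> \<le> en A (\<lambda>a. f a - g a)"
proof -
  have "en A f \<le> en A (\<lambda>a. f a - g a) + en A g"
    using en_add[OF sqs_diff[OF assms] assms(2)] by simp
  moreover have "en A g \<le> en A (\<lambda>a. g a - f a) + en A f"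
    using en_add[OF sqs_diff[OF assms(2,1)] assms(1)] by simp
  ultimately show ?thesis
    by (simp add: en_diff_commute[of A f g])
qed

lemma cmod_le_en: "sqs A f \<Longrightarrow> a \<in> A \<Longrightarrow> cmod (f a) \<le> en A f"
  using L2_set_le_en[of A f "{a}"] by simp

lemma inner_summable: "sqs A f \<Longrightarrow> sqs A g \<Longrightarrow> (\<lambda>a. cnj (f a) * g a) summable_on A"
  and Cauchy_Schwarz_infsum: "sqs A f \<Longrightarrow> sqs A g \<Longrightarrow> cmod (\<Sum>\<^sub>\<infinity>a\<in>A. cnj (f a) * g a) \<le> en A f * en A g"
proof -
  assume fg: "sqs A f" "sqs A g"
  have *: "(\<Sum>a\<in>F. cmod (cnj (f a) * g a)) \<le> en A f * en A g" if "finite F" "F \<subseteq> A" for F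
  proof -
    have "(\<Sum>a\<in>F. cmod (cnj (f a) * g a)) = (\<Sum>a\<in>F. \<bar>cmod (f a)\<bar> * \<bar>cmod (g a)\<bar>)"
      by (simp add: norm_mult)
    also have "\<dots> \<le> L2_set (\<lambda>a. cmod (f a)) F * L2_set (\<lambda>a. cmod (g a)) F"
      by (rule L2_set_mult_ineq)
    also have "\<dots> \<le> en A f * en A g"
      using fg that by (intro mult_mono L2_set_le_en) auto
    finally show ?thesis .
  qed
  have abs: "(\<lambda>a. cmod (cnj (f a) * g a)) summable_on A"
    by (rule nonneg_bdd_above_summable_on) (auto intro!: bdd_aboveI2[where M = "en A f * en A g"] *)
  then show "(\<lambda>a. cnj (f a) * g a) summable_on A"
    by (rule abs_summable_summable)
  have "cmod (\<Sum>\<^sub>\<infinity>a\<in>A. cnj (f a) * g a) \<le> (\<Sum>\<^sub>\<infinity>a\<in>A. cmod (cnj (f a) * g a))"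
    using abs by (rule norm_infsum_bound)
  also have "\<dots> \<le> en A f * en A g"
    using abs * by (intro infsum_le_finite_sums) auto
  finally show "cmod (\<Sum>\<^sub>\<infinity>a\<in>A. cnj (f a) * g a) \<le> en A f * en A g" .
qed

lemma inner_self:
  assumes "sqs A f"
  shows "(\<Sum>\<^sub>\<infinity>a\<in>A. cnj (f a) * f a) = of_real ((en A f)\<^sup>2)"
proof -
  have "(\<Sum>\<^sub>\<infinity>a\<in>A. cnj (f a) * f a) = (\<Sum>\<^sub>\<infinity>a\<in>A. of_real ((cmod (f a))\<^sup>2))"
    by (intro infsum_cong) (metis complex_norm_square mult.commute)
  also have "\<dots> = of_real (\<Sum>\<^sub>\<infinity>a\<in>A. (cmod (f a))\<^sup>2)"
    using assms by (intro infsumI has_sum_of_real has_sum_infsum) (simp add: sqs_def)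
  finally show ?thesis
    by (simp add: en_square)
qed

lemma sqs_finite_support: "finite {a \<in> A. f a \<noteq> 0} \<Longrightarrow> sqs A f"
  unfolding sqs_def
  using summable_on_cong_neutral[of "{a \<in> A. f a \<noteq> 0}" A "\<lambda>a. (cmod (f a))\<^sup>2" "\<lambda>a. (cmod (f a))\<^sup>2"]
  by auto

lemma infsum_single:
  fixes f :: "'a \<Rightarrow> 'b::{t2_space, comm_monoid_add}"
  assumes "a \<in> A" "\<And>b. b \<in> A \<Longrightarrow> b \<noteq> a \<Longrightarrow> f b = 0"
  shows "infsum f A = f a"
proof -
  have "infsum f A = infsum f {a}"
    using assms by (intro infsum_cong_neutral) auto
  then show ?thesis by simp
qed

text \<open>Fatou's lemma for counting measure: every finite partial sum passes to the limit.\<close>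

lemma en_pointwise_limit:
  assumes lim: "\<And>a. a \<in> A \<Longrightarrow> (\<lambda>n. f n a) \<longlonglongrightarrow> g a"
    and bound: "\<And>n. N \<le> n \<Longrightarrow> sqs A (f n) \<and> en A (f n) \<le> C"
  shows "sqs A g" "en A g \<le> C"
proof -
  have *: "L2_set (\<lambda>a. cmod (g a)) F \<le> C" if F: "finite F" "F \<subseteq> A" for F
  proof (rule tendsto_upperbound)
    show "(\<lambda>n. L2_set (\<lambda>a. cmod (f n a)) F) \<longlonglongrightarrow> L2_set (\<lambda>a. cmod (g a)) F"
      unfolding L2_set_def using F by (intro tendsto_intros lim) auto
    show "eventually (\<lambda>n. L2_set (\<lambda>a. cmod (f n a)) F \<le> C) sequentially"
    proof (rule eventually_sequentiallyI)
      fix n assume "N \<le> n"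
      then show "L2_set (\<lambda>a. cmod (f n a)) F \<le> C"
        using bound[of n] L2_set_le_en[OF _ F, of "f n"] by auto
    qed
  qed simp
  show "sqs A g" "en A g \<le> C"
    using sqs_bounded[OF *] by auto
qed

text \<open>Made for convolution with a function on a bisection: on a fibre it moves coefficients
  along a partial injection \<open>\<tau>\<close> and multiplies them by a bounded factor, with zero
  off the domain \<open>D\<close>.\<close>

lemma en_partial_injection:
  assumes f: "sqs B f" and inj: "inj_on \<tau> D" and D: "D \<subseteq> A" "\<tau> ` D \<subseteq> B" and C: "0 \<le> C"
    and g: "\<And>a. a \<in> D \<Longrightarrow> cmod (g a) \<le> C * cmod (f (\<tau> a))" and g0: "\<And>a. a \<in> A - D \<Longrightarrow> g a = 0"
  shows "sqs A g" "en A g \<le> C * en B f"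
proof -
  have *: "L2_set (\<lambda>a. cmod (g a)) F \<le> C * en B f" if F: "finite F" "F \<subseteq> A" for F
  proof -
    have "(\<Sum>a\<in>F. (cmod (g a))\<^sup>2) = (\<Sum>a\<in>F \<inter> D. (cmod (g a))\<^sup>2)"
      using F g0 by (intro sum.mono_neutral_right) auto
    then have "L2_set (\<lambda>a. cmod (g a)) F = L2_set (\<lambda>a. cmod (g a)) (F \<inter> D)"
      by (simp add: L2_set_def)
    also have "\<dots> \<le> L2_set (\<lambda>a. C * cmod (f (\<tau> a))) (F \<inter> D)"
      using g by (intro L2_set_mono) auto
    also have "\<dots> = C * L2_set (\<lambda>a. cmod (f (\<tau> a))) (F \<inter> D)"
      using C by (simp add: L2_set_right_distrib)
    also have "L2_set (\<lambda>a. cmod (f (\<tau> a))) (F \<inter> D) = L2_set (\<lambda>b. cmod (f b)) (\<tau> ` (F \<inter> D))"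
      unfolding L2_set_def by (subst sum.reindex) (auto intro: inj_on_subset[OF inj] simp: comp_def)
    also have "\<dots> \<le> en B f"
      using F D by (intro L2_set_le_en f) auto
    finally show ?thesis
      using C by (simp add: mult_left_mono)
  qed
  show "sqs A g" "en A g \<le> C * en B f"
    using sqs_bounded[OF *] by auto
qed

section \<open>Locally compact Hausdorff spaces\<close>

lemma continuous_map_local:
  assumes "\<And>x. x \<in> topspace X \<Longrightarrow> \<exists>U. openin X U \<and> x \<in> U \<and> continuous_map (subtopology X U) Y f"
  shows "continuous_map X Y f"
proof -
  let ?I = "{U. openin X U \<and> continuous_map (subtopology X U) Y f}"
  show ?thesis
    by (rule pasting_lemma[where I = ?I and T = id and f = "\<lambda>_. f"]) (use assms in auto)
qed

text \<open>Allows a function to be replaced locally by a formula that makes sense only on an open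
  set, such as a quotient or an expression in a local section.\<close>

lemma continuous_map_transfer:
  assumes "\<And>x. x \<in> topspace X \<Longrightarrow>
      \<exists>U g. openin X U \<and> x \<in> U \<and> continuous_map (subtopology X U) Y g \<and> (\<forall>y\<in>U. f y = g y)"
  shows "continuous_map X Y f"
proof (rule continuous_map_local)
  fix x assume "x \<in> topspace X"
  then obtain U g where U: "openin X U" "x \<in> U" "continuous_map (subtopology X U) Y g" "\<forall>y\<in>U. f y = g y"
    using assms by blast
  have "continuous_map (subtopology X U) Y f"
    by (rule continuous_map_eq[OF U(3)]) (use U in auto)
  then show "\<exists>U. openin X U \<and> x \<in> U \<and> continuous_map (subtopology X U) Y f"
    using U by blast
qed

lemma continuous_map_mult:
  fixes f g :: "'a \<Rightarrow> 'b::real_normed_algebra"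
  assumes "continuous_map X euclidean f" "continuous_map X euclidean g"
  shows "continuous_map X euclidean (\<lambda>x. f x * g x)"
  using assms by (fastforce simp: continuous_map_atin intro: tendsto_mult)

lemma continuous_map_compose_real:
  assumes "continuous_map X euclidean f" "continuous_on UNIV h"
  shows "continuous_map X euclidean (\<lambda>x. h (f x))"
  using continuous_map_compose[OF assms(1), of euclidean h] assms(2)
  by (simp add: comp_def)

lemma continuous_map_sum':
  fixes f :: "'i \<Rightarrow> 'a \<Rightarrow> 'b::real_normed_vector"
  assumes "finite I" "\<And>i. i \<in> I \<Longrightarrow> continuous_map X euclidean (f i)"
  shows "continuous_map X euclidean (\<lambda>x. \<Sum>i\<in>I. f i x)"
  using assms
  by (induction I rule: finite_induct) (auto intro!: continuous_map_add)

lemma supp_on_subset: "supp_on X f \<subseteq> topspace X"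
  by (simp add: supp_on_def closure_of_subset_topspace)

lemma closedin_supp_on: "closedin X (supp_on X f)"
  by (simp add: supp_on_def)

lemma in_supp_on: "x \<in> topspace X \<Longrightarrow> f x \<noteq> 0 \<Longrightarrow> x \<in> supp_on X f"
  unfolding supp_on_def using closure_of_subset[of "{x \<in> topspace X. f x \<noteq> 0}" X] by blast

lemma supp_on_minimal: "closedin X C \<Longrightarrow> (\<And>x. x \<in> topspace X \<Longrightarrow> f x \<noteq> 0 \<Longrightarrow> x \<in> C) \<Longrightarrow> supp_on X f \<subseteq> C"
  unfolding supp_on_def by (intro closure_of_minimal) auto

lemma CbI:
  assumes "continuous_map X euclidean f" "\<And>x. x \<in> topspace X \<Longrightarrow> cmod (f x) \<le> C"
    "\<And>x. x \<notin> topspace X \<Longrightarrow> f x = 0"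
  shows "f \<in> Cb X"
proof -
  have "bounded (f ` topspace X)"
    using assms(2) by (intro boundedI[of _ C]) auto
  then show ?thesis
    using assms by (simp add: Cb_def)
qed

lemma Cb_bounded: "f \<in> Cb X \<Longrightarrow> \<exists>C\<ge>0. \<forall>x. cmod (f x) \<le> C"
proof -
  assume f: "f \<in> Cb X"
  then obtain C where "\<forall>x\<in>topspace X. cmod (f x) \<le> C"
    by (auto simp: Cb_def bounded_iff)
  then have "cmod (f x) \<le> max C 0" for x
    using f by (cases "x \<in> topspace X") (auto simp: Cb_def le_max_iff_disj)
  then show ?thesis
    by (intro exI[of _ "max C 0"]) auto
qed

lemma CcI:
  assumes f: "continuous_map X euclidean f" "\<And>x. x \<notin> topspace X \<Longrightarrow> f x = 0"
    and C: "Hausdorff_space X" "compactin X C" "\<And>x. x \<in> topspace X \<Longrightarrow> f x \<noteq> 0 \<Longrightarrow> x \<in> C"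
  shows "f \<in> Cc X" "supp_on X f \<subseteq> C"
proof -
  show "supp_on X f \<subseteq> C"
    using C by (intro supp_on_minimal compactin_imp_closedin) auto
  then show "f \<in> Cc X"
    unfolding Cc_def using f C by (auto intro: closed_compactin closedin_supp_on)
qed

lemma Cc_continuous: "f \<in> Cc X \<Longrightarrow> continuous_map X euclidean f"
  and Cc_compact: "f \<in> Cc X \<Longrightarrow> compactin X (supp_on X f)"
  and Cc_zero_outside: "f \<in> Cc X \<Longrightarrow> x \<notin> topspace X \<Longrightarrow> f x = 0"
  by (auto simp: Cc_def)

lemma Cc_supp: "f \<in> Cc X \<Longrightarrow> f x \<noteq> 0 \<Longrightarrow> x \<in> supp_on X f"
  using Cc_zero_outside in_supp_on by metis

lemma Cc_subset_Cb: "f \<in> Cc X \<Longrightarrow> f \<in> Cb X"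
proof -
  assume f: "f \<in> Cc X"
  have "compact (f ` supp_on X f)"
    using image_compactin[OF Cc_compact[OF f] Cc_continuous[OF f]] by simp
  then obtain C where "\<And>x. x \<in> supp_on X f \<Longrightarrow> cmod (f x) \<le> C"
    using compact_imp_bounded[THEN bounded_iff[THEN iffD1]] by (metis imageI)
  then have "cmod (f x) \<le> max C 0" for x
    using Cc_supp[OF f, of x] by (cases "f x = 0") (auto simp: le_max_iff_disj)
  then show "f \<in> Cb X"
    using f by (intro CbI[where C = "max C 0"]) (auto simp: Cc_def)
qed

lemma zero_in_Cc: "(\<lambda>_. 0) \<in> Cc X"
  by (simp add: Cc_def supp_on_def)

lemma Cb_mult_Cc:
  assumes "Hausdorff_space X" "b \<in> Cb X" "f \<in> Cc X"
  shows "(\<lambda>x. b x * f x) \<in> Cc X"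
  using assms Cc_compact[OF assms(3)] Cc_supp[OF assms(3)]
  by (intro CcI(1)[of _ _ "supp_on X f"] continuous_map_mult) (auto simp: Cb_def Cc_def)

lemma Cc_scale: "Hausdorff_space X \<Longrightarrow> f \<in> Cc X \<Longrightarrow> (\<lambda>x. c * f x) \<in> Cc X"
  using Cc_compact[of f X] Cc_supp[of f X]
  by (intro CcI(1)[of _ _ "supp_on X f"] continuous_map_mult) (auto simp: Cc_def)

lemma Cc_add:
  assumes "Hausdorff_space X" "f \<in> Cc X" "g \<in> Cc X"
  shows "(\<lambda>x. f x + g x) \<in> Cc X"
proof (rule CcI(1)[of _ _ "supp_on X f \<union> supp_on X g"])
  show "compactin X (supp_on X f \<union> supp_on X g)"
    using assms by (intro compactin_Un Cc_compact)
  show "x \<in> supp_on X f \<union> supp_on X g" if "f x + g x \<noteq> 0" for x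
    using Cc_supp[OF assms(2), of x] Cc_supp[OF assms(3), of x] that by (cases "f x = 0") auto
qed (use assms in \<open>auto intro!: continuous_map_add simp: Cc_def\<close>)

lemma Cc_cnj: "Hausdorff_space X \<Longrightarrow> f \<in> Cc X \<Longrightarrow> (\<lambda>x. cnj (f x)) \<in> Cc X"
  using Cc_compact[of f X] Cc_supp[of f X]
  by (intro CcI(1)[of _ _ "supp_on X f"] continuous_map_compose_real[of X f cnj])
     (auto simp: Cc_def intro: continuous_intros)

lemma Cc_diff:
  assumes "Hausdorff_space X" "f \<in> Cc X" "g \<in> Cc X"
  shows "(\<lambda>x. f x - g x) \<in> Cc X"
  using Cc_add[OF assms(1,2) Cc_scale[OF assms(1,3), of "-1"]] by simp

text \<open>Each point of \<open>K\<close> has a compact neighbourhood inside \<open>U\<close>, and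
  finitely many of their interiors cover \<open>K\<close>.\<close>

lemma compact_neighbourhood:
  assumes X: "locally_compact_space X" "Hausdorff_space X" and K: "compactin X K" "openin X U" "K \<subseteq> U"
  obtains V L where "openin X V" "compactin X L" "K \<subseteq> V" "V \<subseteq> L" "L \<subseteq> U"
proof -
  have nb: "neighbourhood_base_of (\<lambda>C. compactin X C \<and> closedin X C) X"
    using X locally_compact_regular_space_neighbourhood_base[of X]
      locally_compact_Hausdorff_imp_regular_space[of X] by simp
  have "\<forall>x\<in>U. \<exists>V L. openin X V \<and> compactin X L \<and> x \<in> V \<and> V \<subseteq> L \<and> L \<subseteq> U"
  proof
    fix x assume "x \<in> U"
    with nb[unfolded neighbourhood_base_of, rule_format, of U x] K(2)
    show "\<exists>V L. openin X V \<and> compactin X L \<and> x \<in> V \<and> V \<subseteq> L \<and> L \<subseteq> U"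
      by auto
  qed
  from bchoice[OF this] obtain V where
    "\<forall>x\<in>U. \<exists>L. openin X (V x) \<and> compactin X L \<and> x \<in> V x \<and> V x \<subseteq> L \<and> L \<subseteq> U" ..
  from bchoice[OF this] obtain L where
    VL: "\<forall>x\<in>U. openin X (V x) \<and> compactin X (L x) \<and> x \<in> V x \<and> V x \<subseteq> L x \<and> L x \<subseteq> U" ..
  have "\<And>W. W \<in> V ` K \<Longrightarrow> openin X W" "K \<subseteq> \<Union>(V ` K)"
    using K(3) VL by auto
  then obtain F where F: "finite F" "F \<subseteq> V ` K" "K \<subseteq> \<Union>F"
    using compactinD[OF K(1)] by metis
  obtain I where I: "I \<subseteq> K" "finite I" "F = V ` I"
    using finite_subset_image[OF F(1,2)] by blast
  show thesis
  proof
    have I': "x \<in> U" if "x \<in> I" for x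
      using that I(1) K(3) by auto
    show "openin X (\<Union>x\<in>I. V x)"
      using VL I' by (intro openin_Union) auto
    show "K \<subseteq> (\<Union>x\<in>I. V x)"
      using F(3) I(3) by simp
    show "(\<Union>x\<in>I. V x) \<subseteq> (\<Union>x\<in>I. L x)"
      using VL I' by (intro UN_mono) auto
    show "(\<Union>x\<in>I. L x) \<subseteq> U"
      using VL I' by (intro UN_least) auto
    show "compactin X (\<Union>x\<in>I. L x)"
      using I VL K(3) by (intro compactin_Union) auto
  qed
qed

lemma compact_bump:
  assumes X: "locally_compact_space X" "Hausdorff_space X" and K: "compactin X K" "openin X U" "K \<subseteq> U"
  obtains f where "f \<in> Cc X" "supp_on X f \<subseteq> U" "\<And>x. x \<in> K \<Longrightarrow> f x = 1"
    "\<And>x. \<exists>t. 0 \<le> t \<and> t \<le> 1 \<and> f x = of_real t"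
proof -
  obtain V L where VL: "openin X V" "compactin X L" "K \<subseteq> V" "V \<subseteq> L" "L \<subseteq> U"
    using compact_neighbourhood[OF assms] by blast
  have "completely_regular_space X"
    using X locally_compact_regular_imp_completely_regular_space by blast
  \<comment> \<open>The Urysohn function is made to vanish off \<open>V\<close>, not merely off
    \<open>U\<close>, so that its support stays in the compact set \<open>L\<close>.\<close>
  moreover have "closedin X (topspace X - V)" "disjnt K (topspace X - V)"
    using VL by (auto simp: disjnt_def)
  ultimately obtain f where f: "continuous_map X (subtopology euclidean {0..1::real}) f"
      "f ` (topspace X - V) \<subseteq> {0}" "f ` K \<subseteq> {1}"
    using Urysohn_completely_regular_compact_closed[of 0 "1::real" X K "topspace X - V"] K(1) by auto
  define g where "g x = (if x \<in> topspace X then complex_of_real (f x) else 0)" for x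
  have "continuous_map X euclidean f"
    using f(1) continuous_map_into_fulltopology by blast
  then have "continuous_map X euclidean (\<lambda>x. complex_of_real (f x))"
    by (rule continuous_map_compose_real) (intro continuous_intros)
  then have "continuous_map X euclidean g"
    by (rule continuous_map_eq) (auto simp: g_def)
  moreover have "x \<in> L" if "x \<in> topspace X" "g x \<noteq> 0" for x
    using that f(2) VL by (force simp: g_def)
  ultimately have "g \<in> Cc X" "supp_on X g \<subseteq> L"
    using CcI[of X g L] X(2) VL(2) by (auto simp: g_def)
  moreover have "g x = 1" if "x \<in> K" for x
    using that f(3) compactin_subset_topspace[OF K(1)] by (force simp: g_def)
  moreover have "\<exists>t. 0 \<le> t \<and> t \<le> 1 \<and> g x = of_real t" for x
    using f(1) by (cases "x \<in> topspace X") (auto simp: g_def continuous_map_in_subtopology intro!: exI[of _ "f x"] exI[of _ 0])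
  ultimately show thesis
    using that VL(5) by blast
qed

section \<open>Etale groupoids\<close>

locale etale =
  fixes H :: "'a groupoid"
  assumes lc_etale: "lc_etale_groupoid H"
begin

abbreviation X where "X \<equiv> gtop H"
abbreviation r where "r \<equiv> grng H"
abbreviation s where "s \<equiv> gsrc H"
abbreviation mul (infixl "\<cdot>" 75) where "g \<cdot> h \<equiv> gmul H g h"
abbreviation inv where "inv \<equiv> ginv H"

lemma Hausdorff: "Hausdorff_space X"
  and locally_compact: "locally_compact_space X"
  and topological: "topological_groupoid H"
  and range_local_homeo: "local_homeomorphism X (unit_space H) r"
  using lc_etale by (auto simp: lc_etale_groupoid_def)

lemma grp: "is_groupoid H"
  using topological by (simp add: topological_groupoid_def)

lemma topspace_X [simp]: "topspace X = arrows H"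
  by (simp add: arrows_def)

section \<open>Algebra of arrows, inverses and source fibres\<close>

lemma closed_arrows [simp]: "g \<in> arrows H \<Longrightarrow> r g \<in> arrows H" "g \<in> arrows H \<Longrightarrow> s g \<in> arrows H"
    "g \<in> arrows H \<Longrightarrow> inv g \<in> arrows H"
  and range_source_unit [simp]: "g \<in> arrows H \<Longrightarrow> r (r g) = r g" "g \<in> arrows H \<Longrightarrow> s (r g) = r g"
    "g \<in> arrows H \<Longrightarrow> r (s g) = s g" "g \<in> arrows H \<Longrightarrow> s (s g) = s g"
  and unit_laws [simp]: "g \<in> arrows H \<Longrightarrow> r g \<cdot> g = g" "g \<in> arrows H \<Longrightarrow> g \<cdot> s g = g"
  and inverse_laws [simp]: "g \<in> arrows H \<Longrightarrow> r (inv g) = s g" "g \<in> arrows H \<Longrightarrow> s (inv g) = r g"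
    "g \<in> arrows H \<Longrightarrow> g \<cdot> inv g = r g" "g \<in> arrows H \<Longrightarrow> inv g \<cdot> g = s g"
  using grp by (auto simp: is_groupoid_def)

lemma mul_closed [simp]:
  assumes "g \<in> arrows H" "h \<in> arrows H" "s g = r h"
  shows "g \<cdot> h \<in> arrows H" "r (g \<cdot> h) = r g" "s (g \<cdot> h) = s h"
  using grp assms by (auto simp: is_groupoid_def)

lemma mul_assoc:
  assumes "g \<in> arrows H" "h \<in> arrows H" "k \<in> arrows H" "s g = r h" "s h = r k"
  shows "(g \<cdot> h) \<cdot> k = g \<cdot> (h \<cdot> k)"
  using grp assms by (auto simp: is_groupoid_def)

lemma cancel [simp]:
  assumes "g \<in> arrows H" "h \<in> arrows H"
  shows "s g = r h \<Longrightarrow> inv g \<cdot> (g \<cdot> h) = h" "r g = r h \<Longrightarrow> g \<cdot> (inv g \<cdot> h) = h"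
    "s g = r h \<Longrightarrow> (g \<cdot> h) \<cdot> inv h = g" "s g = s h \<Longrightarrow> (g \<cdot> inv h) \<cdot> h = g"
proof -
  show "inv g \<cdot> (g \<cdot> h) = h" if "s g = r h"
    using assms that mul_assoc[of "inv g" g h] by simp
  show "g \<cdot> (inv g \<cdot> h) = h" if "r g = r h"
    using assms that mul_assoc[of g "inv g" h] by simp
  show "(g \<cdot> h) \<cdot> inv h = g" if "s g = r h"
    using assms that mul_assoc[of g h "inv h"] unit_laws(2)[of g] by simp
  show "(g \<cdot> inv h) \<cdot> h = g" if "s g = s h"
    using assms that mul_assoc[of g "inv h" h] unit_laws(2)[of g] by simp
qed

lemma left_cancel:
  assumes "g \<in> arrows H" "h \<in> arrows H" "k \<in> arrows H" "s g = r h" "s g = r k" "g \<cdot> h = g \<cdot> k"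
  shows "h = k"
  using assms cancel(1) by metis

lemma inv_unique:
  assumes "g \<in> arrows H" "h \<in> arrows H" "s g = r h" "g \<cdot> h = r g"
  shows "h = inv g"
  using assms left_cancel[of g h "inv g"] by simp

lemma inv_inv [simp]: "g \<in> arrows H \<Longrightarrow> inv (inv g) = g"
  using inv_unique[of "inv g" g] by simp

lemma inv_mul:
  assumes "g \<in> arrows H" "h \<in> arrows H" "s g = r h"
  shows "inv (g \<cdot> h) = inv h \<cdot> inv g"
proof -
  have "(g \<cdot> h) \<cdot> (inv h \<cdot> inv g) = r g"
    using assms mul_assoc[of g h "inv h \<cdot> inv g"] by simp
  then show ?thesis
    using assms inv_unique[of "g \<cdot> h" "inv h \<cdot> inv g"] by simp
qed

lemma units_iff: "x \<in> units H \<longleftrightarrow> x \<in> arrows H \<and> r x = x"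
  unfolding units_def using closed_arrows(1) range_source_unit(1) by (metis image_iff)

lemma unit_arrow: "x \<in> units H \<Longrightarrow> x \<in> arrows H"
  and unit_range [simp]: "x \<in> units H \<Longrightarrow> r x = x"
  and unit_source [simp]: "x \<in> units H \<Longrightarrow> s x = x"
  and unit_inv [simp]: "x \<in> units H \<Longrightarrow> inv x = x"
proof -
  assume x: "x \<in> units H"
  show *: "x \<in> arrows H" "r x = x"
    using x units_iff by auto
  show "s x = x"
    using range_source_unit(2)[OF *(1)] * by simp
  then show "inv x = x"
    using inv_unique[of x x] unit_laws(1)[of x] * by simp
qed

lemma range_in_units [simp]: "g \<in> arrows H \<Longrightarrow> r g \<in> units H"
  and source_in_units [simp]: "g \<in> arrows H \<Longrightarrow> s g \<in> units H"
  by (auto simp: units_iff)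

lemma units_subset: "units H \<subseteq> arrows H"
  by (auto simp: units_iff)

lemma fibre_iff: "g \<in> fibre H x \<longleftrightarrow> g \<in> arrows H \<and> s g = x"
  by (auto simp: fibre_def)

lemma fibre_non_unit: "x \<notin> units H \<Longrightarrow> fibre H x = {}"
  by (auto simp: fibre_iff)

text \<open>This is the identification of the fibres over \<open>r c\<close> and \<open>s c\<close>
  under which equivariant operators turn out to be invariant.\<close>

lemma bij_right_translation:
  assumes "c \<in> arrows H"
  shows "bij_betw (\<lambda>h. h \<cdot> c) (fibre H (r c)) (fibre H (s c))"
  by (rule bij_betwI[where g = "\<lambda>k. k \<cdot> inv c"]) (use assms in \<open>auto simp: fibre_iff\<close>)

section \<open>Continuity of the structure maps; openness of range, source and units\<close>

lemma continuous_inv: "continuous_map X X inv"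
  using topological by (simp add: topological_groupoid_def)

lemma continuous_mul:
  assumes "continuous_map Y X a" "continuous_map Y X b" "\<And>y. y \<in> topspace Y \<Longrightarrow> s (a y) = r (b y)"
  shows "continuous_map Y X (\<lambda>y. a y \<cdot> b y)"
proof -
  have "continuous_map Y (subtopology (prod_topology X X) {(g, h). s g = r h}) (\<lambda>y. (a y, b y))"
    using assms by (intro continuous_map_into_subtopology continuous_map_pairedI) auto
  moreover have "continuous_map (subtopology (prod_topology X X) {(g, h). s g = r h}) X (\<lambda>(g, h). g \<cdot> h)"
    using topological by (simp add: topological_groupoid_def)
  ultimately show ?thesis
    by (auto dest: continuous_map_compose simp: comp_def)
qed

lemma continuous_range: "continuous_map X X r"
proof -
  have "continuous_map X X (\<lambda>g. g \<cdot> inv g)"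
    by (rule continuous_mul) (auto intro: continuous_inv)
  then show ?thesis
    by (rule continuous_map_eq) auto
qed

lemma continuous_source: "continuous_map X X s"
proof -
  have "continuous_map X X (r \<circ> inv)"
    by (rule continuous_map_compose[OF continuous_inv continuous_range])
  then show ?thesis
    by (rule continuous_map_eq) auto
qed

lemma continuous_inv': "continuous_map Y X a \<Longrightarrow> continuous_map Y X (\<lambda>y. inv (a y))"
  and continuous_range': "continuous_map Y X a \<Longrightarrow> continuous_map Y X (\<lambda>y. r (a y))"
  and continuous_source': "continuous_map Y X a \<Longrightarrow> continuous_map Y X (\<lambda>y. s (a y))"
  using continuous_map_compose[of Y X a X] continuous_inv continuous_range continuous_source
  by (auto simp: comp_def)

lemma range_chart:
  assumes "g \<in> arrows H"
  obtains U where "openin X U" "g \<in> U" "openin (unit_space H) (r ` U)" "inj_on r U"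
    "\<And>V. openin X V \<Longrightarrow> V \<subseteq> U \<Longrightarrow> openin (unit_space H) (r ` V)"
proof -
  obtain U where U: "openin X U" "g \<in> U" "openin (unit_space H) (r ` U)"
      "homeomorphic_map (subtopology X U) (subtopology (unit_space H) (r ` U)) r"
    using range_local_homeo assms unfolding local_homeomorphism_def by auto
  have sub: "U \<subseteq> arrows H"
    using U(1) openin_subset by fastforce
  have "inj_on r (topspace (subtopology X U))" "open_map (subtopology X U) (subtopology (unit_space H) (r ` U)) r"
    using U(4) homeomorphic_eq_everything_map by blast+
  moreover have "topspace (subtopology X U) = U"
    using sub by auto
  ultimately have inj: "inj_on r U" and op: "open_map (subtopology X U) (subtopology (unit_space H) (r ` U)) r"
    by auto
  have "openin (unit_space H) (r ` V)" if V: "openin X V" "V \<subseteq> U" for V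
  proof -
    have "openin (subtopology X U) V"
      using U(1) V openin_open_subtopology by blast
    then have "openin (subtopology (unit_space H) (r ` U)) (r ` V)"
      using op by (simp add: open_map_def)
    then show ?thesis
      using U(3) openin_open_subtopology by blast
  qed
  then show thesis
    using that U inj by blast
qed

text \<open>If \<open>r\<close> is injective on a neighbourhood \<open>U\<close> of a unit, then \<open>r g \<in> U\<close> forces \<open>g = r g\<close> for
  \<open>g \<in> U\<close>.\<close>

lemma openin_units: "openin X (units H)"
proof (subst openin_subopen, intro ballI)
  fix x assume x: "x \<in> units H"
  obtain U where U: "openin X U" "x \<in> U" "inj_on r U"
    using range_chart[of x] unit_arrow[OF x] by metis
  let ?V = "{g \<in> topspace X. r g \<in> U} \<inter> U"
  have "openin X ?V"
    using U continuous_range by (intro openin_Int openin_continuous_map_preimage)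
  moreover have "?V \<subseteq> units H"
  proof
    fix g assume g: "g \<in> ?V"
    then have "r (r g) = r g" by simp
    then have "r g = g"
      using g inj_onD[OF U(3), of "r g" g] by simp
    then show "g \<in> units H"
      using g by (simp add: units_iff)
  qed
  ultimately show "\<exists>T. openin X T \<and> x \<in> T \<and> T \<subseteq> units H"
    using U x unit_arrow by (intro exI[of _ ?V]) auto
qed

lemma closedin_units: "closedin X (units H)"
proof -
  have *: "units H = {g \<in> topspace X. r g = id g}"
    by (auto simp: units_iff)
  show ?thesis
    unfolding * by (rule closedin_continuous_maps_eq[OF Hausdorff continuous_range continuous_map_id])
qed

lemma openin_unit_space: "openin (unit_space H) V \<longleftrightarrow> openin X V \<and> V \<subseteq> units H"
  unfolding unit_space_def by (simp add: openin_open_subtopology[OF openin_units])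

lemma topspace_unit_space [simp]: "topspace (unit_space H) = units H"
  using units_subset by (auto simp: unit_space_def)

lemma compactin_unit_space: "compactin (unit_space H) K \<longleftrightarrow> compactin X K \<and> K \<subseteq> units H"
  by (simp add: unit_space_def compactin_subtopology)

lemma open_range: "openin X V \<Longrightarrow> openin X (r ` V)"
proof (subst openin_subopen, intro ballI)
  fix x assume V: "openin X V" and "x \<in> r ` V"
  then obtain g where g: "g \<in> V" "x = r g" by blast
  then have "g \<in> arrows H"
    using V openin_subset by fastforce
  then obtain U where U: "openin X U" "g \<in> U" "\<And>V. openin X V \<Longrightarrow> V \<subseteq> U \<Longrightarrow> openin (unit_space H) (r ` V)"
    using range_chart by metis
  have "openin X (r ` (U \<inter> V))"
    using U V openin_unit_space by auto
  then show "\<exists>T. openin X T \<and> x \<in> T \<and> T \<subseteq> r ` V"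
    using g U by (intro exI[of _ "r ` (U \<inter> V)"]) auto
qed

lemma inv_image: "V \<subseteq> arrows H \<Longrightarrow> inv ` V = {g \<in> topspace X. inv g \<in> V}"
  using inv_inv by (force simp: image_iff)

lemma openin_inv: "openin X V \<Longrightarrow> openin X (inv ` V)"
  using inv_image[of V] openin_subset[of X V] openin_continuous_map_preimage[OF continuous_inv, of V] by auto

lemma open_source: "openin X V \<Longrightarrow> openin X (s ` V)"
proof -
  assume V: "openin X V"
  then have "V \<subseteq> arrows H"
    using openin_subset by fastforce
  then have "s ` V = r ` inv ` V"
    by (force simp: image_image)
  then show ?thesis
    using open_range[OF openin_inv[OF V]] by simp
qed

text \<open>Injectivity of both maps matters: sums over source fibres collapse through
  \<open>s\<close>, convolutions collapse through \<open>r\<close>.\<close>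

definition bisection :: "'a set \<Rightarrow> bool" where
  "bisection U \<longleftrightarrow> openin X U \<and> inj_on r U \<and> inj_on s U"

lemma bisection_open: "bisection U \<Longrightarrow> openin X U"
  and bisection_arrow: "bisection U \<Longrightarrow> g \<in> U \<Longrightarrow> g \<in> arrows H"
  using openin_subset by (fastforce simp: bisection_def)+

text \<open>As \<open>s\<close> is \<open>r\<close> after inversion, a chart of \<open>r\<close> at
  \<open>inv g\<close>, inverted, is injective for \<open>s\<close>; it is intersected with a chart
  of \<open>r\<close> at \<open>g\<close>.\<close>

lemma bisection_neighbourhood:
  assumes "openin X W" "g \<in> W"
  obtains U where "bisection U" "g \<in> U" "U \<subseteq> W"
proof -
  have g: "g \<in> arrows H"
    using assms openin_subset by fastforce
  obtain U where U: "openin X U" "g \<in> U" "inj_on r U"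
    using range_chart[OF g] by metis
  obtain U' where U': "openin X U'" "inv g \<in> U'" "inj_on r U'"
    using range_chart[of "inv g"] g by (metis closed_arrows(3))
  let ?U = "U \<inter> inv ` U' \<inter> W"
  have sub: "U' \<subseteq> arrows H"
    using U' openin_subset by fastforce
  have "inj_on s (inv ` U')"
    using U'(3) subsetD[OF sub] by (auto simp: inj_on_def)
  then have "bisection ?U"
    unfolding bisection_def using U U' assms openin_inv by (auto intro: inj_on_subset)
  moreover have "g \<in> inv ` U'"
    using U'(2) g by (metis image_eqI inv_inv)
  ultimately show thesis
    using that[of ?U] U assms by auto
qed

lemma bisection_inv: "bisection U \<Longrightarrow> bisection (inv ` U)"
  unfolding bisection_def
proof (intro conjI)
  assume U: "openin X U \<and> inj_on r U \<and> inj_on s U"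
  then have sub: "g \<in> arrows H" if "g \<in> U" for g
    using that openin_subset by fastforce
  show "openin X (inv ` U)" "inj_on r (inv ` U)" "inj_on s (inv ` U)"
    using U sub openin_inv by (auto simp: inj_on_def)
qed

text \<open>Treats range and source together. Since \<open>q\<close> is open, the preimage of an
  open \<open>V\<close> under the section is the open image of \<open>U \<inter> V\<close>.\<close>

lemma bisection_section:
  assumes U: "bisection U" and q: "q = r \<or> q = s"
  shows "openin X (q ` U)" "inj_on q U" "continuous_map X X q"
    "continuous_map (subtopology X (q ` U)) X (inv_into U q)"
proof -
  show *: "openin X (q ` U)" "inj_on q U" "continuous_map X X q"
    using U q open_range open_source continuous_range continuous_source by (auto simp: bisection_def)
  have sub: "U \<subseteq> arrows H"
    using U bisection_arrow by blast
  have qU: "q ` U \<subseteq> arrows H"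
    using *(1) openin_subset by fastforce
  show "continuous_map (subtopology X (q ` U)) X (inv_into U q)"
    unfolding continuous_map_def
  proof (intro conjI allI impI)
    show "inv_into U q \<in> topspace (subtopology X (q ` U)) \<rightarrow> topspace X"
    proof
      fix x assume "x \<in> topspace (subtopology X (q ` U))"
      then have "inv_into U q x \<in> U"
        by (intro inv_into_into) simp
      then show "inv_into U q x \<in> topspace X"
        using sub by auto
    qed
    fix V assume V: "openin X V"
    have eq: "{x \<in> topspace (subtopology X (q ` U)). inv_into U q x \<in> V} = q ` (U \<inter> V)"
    proof (intro set_eqI iffI)
      fix x assume "x \<in> {x \<in> topspace (subtopology X (q ` U)). inv_into U q x \<in> V}"
      then have x: "x \<in> q ` U" "inv_into U q x \<in> V" by auto
      then show "x \<in> q ` (U \<inter> V)"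
        using f_inv_into_f[OF x(1)] inv_into_into[OF x(1)] by (metis IntI image_eqI)
    next
      fix x assume "x \<in> q ` (U \<inter> V)"
      then obtain u where u: "u \<in> U" "u \<in> V" "x = q u" by blast
      then show "x \<in> {x \<in> topspace (subtopology X (q ` U)). inv_into U q x \<in> V}"
        using inv_into_f_f[OF *(2) u(1)] qU by auto
    qed
    have "openin X (U \<inter> V)"
      using U V by (auto simp: bisection_def)
    then have "openin X (q ` (U \<inter> V))"
      using q open_range open_source by blast
    moreover have "q ` (U \<inter> V) \<subseteq> q ` U"
      by blast
    ultimately show "openin (subtopology X (q ` U)) {x \<in> topspace (subtopology X (q ` U)). inv_into U q x \<in> V}"
      unfolding eq openin_open_subtopology[OF *(1)] by blast
  qed
qed

lemma bisection_section_compose: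
  assumes U: "bisection U" and q: "q = r \<or> q = s" and p: "continuous_map Y X p"
  shows "openin Y {y \<in> topspace Y. p y \<in> q ` U}"
    "continuous_map (subtopology Y {y \<in> topspace Y. p y \<in> q ` U}) X (\<lambda>y. inv_into U q (p y))"
proof -
  show "openin Y {y \<in> topspace Y. p y \<in> q ` U}"
    using bisection_section(1)[OF U q] p by (rule openin_continuous_map_preimage[rotated])
  have "continuous_map (subtopology Y {y \<in> topspace Y. p y \<in> q ` U}) (subtopology X (q ` U)) p"
    using p by (intro continuous_map_into_subtopology continuous_map_from_subtopology) auto
  then show "continuous_map (subtopology Y {y \<in> topspace Y. p y \<in> q ` U}) X (\<lambda>y. inv_into U q (p y))"
    using continuous_map_compose[OF _ bisection_section(4)[OF U q]] by (auto simp: comp_def)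
qed

text \<open>Outside \<open>p -` (q ` supp \<phi>)\<close>, the complement of which is open because \<open>q ` supp \<phi>\<close> is compact,
  the function is zero.\<close>

lemma bisection_extend:
  fixes k :: "'b \<Rightarrow> complex"
  assumes U: "bisection U" and q: "q = r \<or> q = s" and p: "continuous_map Y X p"
    and \<phi>: "\<phi> \<in> Cc X" "supp_on X \<phi> \<subseteq> U"
    and k: "continuous_map (subtopology Y {y \<in> topspace Y. p y \<in> q ` U}) euclidean k"
  shows "continuous_map Y euclidean (\<lambda>y. if p y \<in> q ` U then \<phi> (inv_into U q (p y)) * k y else 0)"
    (is "continuous_map Y euclidean ?F")
proof (rule continuous_map_transfer)
  fix y assume y: "y \<in> topspace Y"
  let ?A = "{y \<in> topspace Y. p y \<in> q ` U}"
  let ?C = "topspace X - q ` supp_on X \<phi>"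
  show "\<exists>W g. openin Y W \<and> y \<in> W \<and> continuous_map (subtopology Y W) euclidean g \<and> (\<forall>z\<in>W. ?F z = g z)"
  proof (cases "p y \<in> q ` U")
    case True
    have "continuous_map (subtopology Y ?A) euclidean (\<lambda>y. \<phi> (inv_into U q (p y)))"
      using continuous_map_compose[OF bisection_section_compose(2)[OF U q p] Cc_continuous[OF \<phi>(1)]]
      by (simp add: comp_def)
    then have "continuous_map (subtopology Y ?A) euclidean (\<lambda>y. \<phi> (inv_into U q (p y)) * k y)"
      using k by (rule continuous_map_mult)
    then show ?thesis
      using True y bisection_section_compose(1)[OF U q p] by (intro exI[of _ ?A] exI) auto
  next
    case False
    have "compactin X (q ` supp_on X \<phi>)"
      using image_compactin[OF Cc_compact[OF \<phi>(1)] bisection_section(3)[OF U q]] .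
    then have "openin X ?C"
      using Hausdorff compactin_imp_closedin by blast
    then have "openin Y {z \<in> topspace Y. p z \<in> ?C}"
      using p by (rule openin_continuous_map_preimage[rotated])
    moreover have "?F z = 0" if "p z \<in> ?C" for z
      using that Cc_supp[OF \<phi>(1), of "inv_into U q (p z)"] f_inv_into_f[of "p z" q U] by auto (metis image_eqI)
    moreover have "p y \<in> ?C"
      using False \<phi>(2) y p by (auto simp: continuous_map_def Pi_iff)
    ultimately show ?thesis
      using y by (intro exI[of _ "{z \<in> topspace Y. p z \<in> ?C}"] exI[of _ "\<lambda>_. 0"]) auto
  qed
qed

lemma bump:
  assumes "openin X W" "g \<in> W"
  obtains \<phi> U where "\<phi> \<in> Cc X" "bisection U" "g \<in> U" "U \<subseteq> W" "supp_on X \<phi> \<subseteq> U" "\<phi> g = 1"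
    "\<And>h. cmod (\<phi> h) \<le> 1"
proof -
  obtain U where U: "bisection U" "g \<in> U" "U \<subseteq> W"
    using bisection_neighbourhood assms by blast
  have "compactin X {g}" "{g} \<subseteq> U"
    using U bisection_arrow by auto
  then obtain f where f: "f \<in> Cc X" "supp_on X f \<subseteq> U" "f g = 1" "\<And>x. \<exists>t. 0 \<le> t \<and> t \<le> 1 \<and> f x = complex_of_real t"
    using compact_bump[OF locally_compact Hausdorff _ bisection_open[OF U(1)]] by (metis singletonI)
  moreover have "cmod (f x) \<le> 1" for x
    using f(4)[of x] by auto
  ultimately show thesis
    using that U by blast
qed

text \<open>Plays the role of a partition of unity: finitely many bisections cover the support, and
  bumps split off one summand at a time. Additive statements about \<open>Cc\<close> thereby need a
  proof only for functions living on one bisection.\<close>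

lemma Cc_induct [consumes 1, case_names add bisection]:
  assumes f: "f \<in> Cc X"
    and add: "\<And>f g. f \<in> Cc X \<Longrightarrow> g \<in> Cc X \<Longrightarrow> P f \<Longrightarrow> P g \<Longrightarrow> P (\<lambda>x. f x + g x)"
    and bis: "\<And>f U. f \<in> Cc X \<Longrightarrow> bisection U \<Longrightarrow> supp_on X f \<subseteq> U \<Longrightarrow> P f"
  shows "P f"
proof -
  have *: "P f" if "finite F" "\<And>U. U \<in> F \<Longrightarrow> bisection U" "f \<in> Cc X" "supp_on X f \<subseteq> \<Union>F" for F f
    using that
  proof (induction F arbitrary: f rule: finite_induct)
    case empty
    then show ?case
      using bis[of f "{}"] by (auto simp: bisection_def)
  next
    case (insert U F)
    let ?K = "supp_on X f"
    have U: "bisection U" and V: "openin X (\<Union>F)"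
      using insert.prems bisection_open by auto
    \<comment> \<open>What the other sets leave uncovered is compact and lies in \<open>U\<close>.
      The bump \<open>\<omega>\<close> is 1 on a whole open neighbourhood \<open>W\<close> of it, so
      even the closed support of the second summand misses \<open>W\<close> and is covered by
      \<open>F\<close>.\<close>
    have "compactin X (?K - \<Union>F)"
      using V by (intro closed_compactin[OF Cc_compact[OF insert.prems(2)]]) (auto intro: closedin_supp_on)
    moreover have "?K - \<Union>F \<subseteq> U"
      using insert.prems(3) by auto
    ultimately obtain W L where WL: "openin X W" "compactin X L" "?K - \<Union>F \<subseteq> W" "W \<subseteq> L" "L \<subseteq> U"
      using compact_neighbourhood[OF locally_compact Hausdorff _ bisection_open[OF U]] by blast
    obtain \<omega> where \<omega>: "\<omega> \<in> Cc X" "supp_on X \<omega> \<subseteq> U" "\<And>x. x \<in> L \<Longrightarrow> \<omega> x = 1"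
      using compact_bump[OF locally_compact Hausdorff WL(2) bisection_open[OF U] WL(5)] by metis
    have 1: "(\<lambda>x. \<omega> x * f x) \<in> Cc X"
      using Cb_mult_Cc[OF Hausdorff Cc_subset_Cb] \<omega> insert.prems by blast
    moreover have "supp_on X (\<lambda>x. \<omega> x * f x) \<subseteq> supp_on X \<omega>"
      by (rule supp_on_minimal) (auto intro: closedin_supp_on in_supp_on)
    ultimately have P1: "P (\<lambda>x. \<omega> x * f x)"
      using bis[OF _ U] \<omega>(2) by blast
    have 2: "(\<lambda>x. f x - \<omega> x * f x) \<in> Cc X"
      using Cc_diff[OF Hausdorff insert.prems(2) 1] .
    have "supp_on X (\<lambda>x. f x - \<omega> x * f x) \<subseteq> ?K - W"
    proof (rule supp_on_minimal)
      show "closedin X (?K - W)"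
        using WL(1) closedin_supp_on by blast
      fix x assume "x \<in> topspace X" "f x - \<omega> x * f x \<noteq> 0"
      then show "x \<in> ?K - W"
        using \<omega>(3)[of x] WL(4) in_supp_on[of x X f] by auto
    qed
    then have "P (\<lambda>x. f x - \<omega> x * f x)"
      using WL(3) insert.prems(1) by (intro insert.IH 2) auto
    then show ?case
      using add[OF 1 2 P1] by simp
  qed
  have "\<And>U. U \<in> Collect bisection \<Longrightarrow> openin X U" "supp_on X f \<subseteq> \<Union>(Collect bisection)"
    using bisection_open bisection_neighbourhood[OF openin_topspace] supp_on_subset[of X f]
    by (auto, metis subsetD topspace_X)
  then obtain F where "finite F" "F \<subseteq> Collect bisection" "supp_on X f \<subseteq> \<Union>F"
    using compactinD[OF Cc_compact[OF f]] by metis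
  then show ?thesis
    using *[of F f] f by auto
qed

text \<open>Finitely many bisections cover \<open>K\<close>, and each contains at most one arrow of
  given source and at most one of given range; their number is the uniform bound.\<close>

lemma compact_fibre_bound:
  assumes "compactin X K"
  obtains n where "\<And>x. finite (K \<inter> fibre H x)" "\<And>x. card (K \<inter> fibre H x) \<le> n"
    "\<And>x. finite {g \<in> K. r g = x}"
proof -
  have sub: "K \<subseteq> arrows H"
    using assms compactin_subset_topspace by fastforce
  have "\<And>U. U \<in> Collect bisection \<Longrightarrow> openin X U" "K \<subseteq> \<Union>(Collect bisection)"
    using bisection_open bisection_neighbourhood[OF openin_topspace] sub
    by (auto, metis subsetD topspace_X)
  then obtain F where F: "finite F" "F \<subseteq> Collect bisection" "K \<subseteq> \<Union>F"
    using compactinD[OF assms] by metis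
  have *: "\<exists>h. U \<inter> fibre H x \<subseteq> {h}" "\<exists>h. {g \<in> U. r g = x} \<subseteq> {h}" if "U \<in> F" for U x
  proof -
    have "inj_on r U" "inj_on s U"
      using that F(2) by (auto simp: bisection_def)
    then show "\<exists>h. U \<inter> fibre H x \<subseteq> {h}" "\<exists>h. {g \<in> U. r g = x} \<subseteq> {h}"
      by (auto simp: inj_on_def fibre_iff subset_iff) metis+
  qed
  have fin: "finite (U \<inter> fibre H x)" "card (U \<inter> fibre H x) \<le> 1" "finite {g \<in> U. r g = x}" if U: "U \<in> F" for U x
  proof -
    obtain h h' where "U \<inter> fibre H x \<subseteq> {h}" "{g \<in> U. r g = x} \<subseteq> {h'}"
      using *(1)[OF U, of x] *(2)[OF U, of x] by metis
    then show "finite (U \<inter> fibre H x)" "card (U \<inter> fibre H x) \<le> 1" "finite {g \<in> U. r g = x}"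
      using finite_subset card_mono[of "{h}" "U \<inter> fibre H x"] by auto
  qed
  have sub1: "K \<inter> fibre H x \<subseteq> (\<Union>U\<in>F. U \<inter> fibre H x)" for x
    using F(3) by auto
  have sub2: "{g \<in> K. r g = x} \<subseteq> (\<Union>U\<in>F. {g \<in> U. r g = x})" for x
    using F(3) by auto
  show thesis
  proof
    show "finite (K \<inter> fibre H x)" for x
      by (rule finite_subset[OF sub1 finite_UN_I[OF F(1) fin(1)]])
    show "finite {g \<in> K. r g = x}" for x
      by (rule finite_subset[OF sub2 finite_UN_I[OF F(1) fin(3)]])
    have "card (K \<inter> fibre H x) \<le> card (\<Union>U\<in>F. U \<inter> fibre H x)" for x
      by (rule card_mono[OF finite_UN_I[OF F(1) fin(1)] sub1])
    also have "\<dots> x \<le> (\<Sum>U\<in>F. card (U \<inter> fibre H x))" for x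
      using F(1) fin(1) by (intro card_UN_le)
    also have "\<dots> x \<le> (\<Sum>U\<in>F. 1)" for x
      using fin(2) by (intro sum_mono)
    finally show "card (K \<inter> fibre H x) \<le> card F" for x
      by simp
  qed
qed

lemma Cc_fibre_finite: "f \<in> Cc X \<Longrightarrow> finite {g \<in> fibre H x. f g \<noteq> 0}"
proof -
  assume f: "f \<in> Cc X"
  obtain n where "\<And>x. finite (supp_on X f \<inter> fibre H x)"
    using compact_fibre_bound[OF Cc_compact[OF f]] by metis
  then show ?thesis
    by (rule finite_subset[rotated]) (use Cc_supp[OF f] in auto)
qed

lemma infsum_bisection:
  assumes U: "bisection U" and \<phi>: "\<phi> \<in> Cc X" "supp_on X \<phi> \<subseteq> U"
  shows "(\<Sum>\<^sub>\<infinity>g\<in>fibre H x. \<phi> g * k g) =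
    (if x \<in> s ` U then \<phi> (inv_into U s x) * k (inv_into U s x) else 0)"
proof (cases "x \<in> s ` U")
  case True
  let ?u = "inv_into U s x"
  have u: "?u \<in> U" "s ?u = x" "?u \<in> arrows H"
    using True inv_into_into f_inv_into_f bisection_arrow[OF U] by metis+
  have "\<phi> g = 0" if "g \<in> fibre H x" "g \<noteq> ?u" for g
  proof (rule ccontr)
    assume "\<phi> g \<noteq> 0"
    then have "g \<in> U" using Cc_supp[OF \<phi>(1)] \<phi>(2) by blast
    then show False
      using that u U by (auto simp: bisection_def fibre_iff dest: inj_onD)
  qed
  then show ?thesis
    using True u infsum_single[of ?u "fibre H x" "\<lambda>g. \<phi> g * k g"] by (auto simp: fibre_iff)
next
  case False
  have "\<phi> g = 0" if "g \<in> fibre H x" for g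
    using False that Cc_supp[OF \<phi>(1)] \<phi>(2) by (auto simp: fibre_iff)
  then show ?thesis
    using False by (auto intro: infsum_0)
qed

text \<open>For a summand on a bisection the fibre sum is the summand transported along the section
  of \<open>s\<close> and extended by zero. Continuity of inner products starts here.\<close>

lemma continuous_fibre_sum:
  assumes "f \<in> Cc X"
  shows "continuous_map X euclidean (\<lambda>x. \<Sum>\<^sub>\<infinity>g\<in>fibre H x. f g)"
  using assms
proof (induction rule: Cc_induct)
  case (add f g)
  have "(\<Sum>\<^sub>\<infinity>h\<in>fibre H x. f h + g h) = (\<Sum>\<^sub>\<infinity>h\<in>fibre H x. f h) + (\<Sum>\<^sub>\<infinity>h\<in>fibre H x. g h)" for x
    using add Cc_fibre_finite[of f x] Cc_fibre_finite[of g x]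
    by (intro infsum_add) (auto intro: finite_nonzero_values_imp_summable_on)
  then show ?case
    using add by (simp add: continuous_map_add)
next
  case (bisection f U)
  note bis = bisection
  have "continuous_map X euclidean (\<lambda>x. if x \<in> s ` U then f (inv_into U s x) * 1 else 0)"
    using bisection_extend[OF bis(2) disjI2[OF refl] continuous_map_id[unfolded id_def] bis(1,3), where k = "\<lambda>_. 1"] by simp
  then show ?case
    using infsum_bisection[OF bis(2,1,3), where k = "\<lambda>_. 1"] by simp
qed

end

section \<open>The Hilbert module\<close>

lemma continuous_map_uniform_approx:
  fixes f :: "'a \<Rightarrow> 'b::real_normed_vector"
  assumes "\<And>\<epsilon>. \<epsilon> > 0 \<Longrightarrow> \<exists>g. continuous_map X euclidean g \<and> (\<forall>x\<in>topspace X. norm (f x - g x) \<le> \<epsilon>)"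
  shows "continuous_map X euclidean f"
  unfolding continuous_map
proof (intro conjI allI impI)
  show "f ` topspace X \<subseteq> topspace euclidean" by simp
  fix V :: "'b set" assume "openin euclidean V"
  then have V: "open V" by simp
  show "openin X {x \<in> topspace X. f x \<in> V}"
  proof (subst openin_subopen, intro ballI)
    fix x assume x: "x \<in> {x \<in> topspace X. f x \<in> V}"
    then obtain e where e: "e > 0" "\<And>y. dist y (f x) < e \<Longrightarrow> y \<in> V"
      using V unfolding open_dist by blast
    obtain g where g: "continuous_map X euclidean g" "\<And>y. y \<in> topspace X \<Longrightarrow> norm (f y - g y) \<le> e / 4"
      using assms[of "e / 4"] e by auto
    let ?W = "{y \<in> topspace X. g y \<in> ball (g x) (e / 4)}"
    have "openin X ?W"
      using g(1) by (rule openin_continuous_map_preimage) simp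
    moreover have "f y \<in> V" if y: "y \<in> ?W" for y
    proof (rule e(2))
      have "norm (f y - g y) \<le> e / 4" "norm (f x - g x) \<le> e / 4" "norm (g x - g y) < e / 4"
        using g(2) x y by (auto simp: dist_norm)
      moreover have "norm (f y - f x) \<le> norm (f y - g y) + norm (g x - g y) + norm (f x - g x)"
        using norm_triangle_ineq4[of "(f y - g y) - (g x - g y)" "f x - g x"]
          norm_triangle_ineq4[of "f y - g y" "g x - g y"] by simp
      ultimately show "dist (f y) (f x) < e"
        using e(1) by (simp add: dist_norm)
    qed
    ultimately show "\<exists>T. openin X T \<and> x \<in> T \<and> T \<subseteq> {x \<in> topspace X. f x \<in> V}"
      using x e(1) by (intro exI[of _ ?W]) auto
  qed
qed

lemma l2inner_add_right:
  assumes "sqs (fibre H x) \<eta>" "sqs (fibre H x) \<xi>" "sqs (fibre H x) \<zeta>"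
  shows "l2inner H \<eta> (\<lambda>g. \<xi> g + \<zeta> g) x = l2inner H \<eta> \<xi> x + l2inner H \<eta> \<zeta> x"
  unfolding l2inner_def distrib_left using assms by (intro infsum_add inner_summable)

lemma l2inner_scale_right: "l2inner H \<eta> (\<lambda>g. c * \<xi> g) x = c * l2inner H \<eta> \<xi> x"
  unfolding l2inner_def by (simp add: mult.left_commute infsum_cmult_right')

lemma l2inner_cnj: "cnj (l2inner H \<eta> \<xi> x) = l2inner H \<xi> \<eta> x"
proof -
  have "cnj (l2inner H \<eta> \<xi> x) = (\<Sum>\<^sub>\<infinity>g\<in>fibre H x. cnj (cnj (\<eta> g) * \<xi> g))"
    unfolding l2inner_def by (rule infsum_cnj[symmetric])
  then show ?thesis
    by (simp add: l2inner_def mult.commute)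
qed

lemma l2inner_add_left:
  assumes "sqs (fibre H x) \<eta>" "sqs (fibre H x) \<xi>" "sqs (fibre H x) \<zeta>"
  shows "l2inner H (\<lambda>g. \<xi> g + \<zeta> g) \<eta> x = l2inner H \<xi> \<eta> x + l2inner H \<zeta> \<eta> x"
  using l2inner_add_right[OF assms, THEN arg_cong[of _ _ cnj]] by (simp add: l2inner_cnj)

lemma l2inner_scale_left: "l2inner H (\<lambda>g. c * \<xi> g) \<eta> x = cnj c * l2inner H \<xi> \<eta> x"
  using l2inner_scale_right[of H \<eta> c \<xi> x, THEN arg_cong[of _ _ cnj]] by (simp add: l2inner_cnj)

lemma l2inner_diff_right:
  assumes "sqs (fibre H x) \<eta>" "sqs (fibre H x) \<xi>" "sqs (fibre H x) \<zeta>"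
  shows "l2inner H \<eta> (\<lambda>g. \<xi> g - \<zeta> g) x = l2inner H \<eta> \<xi> x - l2inner H \<eta> \<zeta> x"
  using l2inner_add_right[OF assms(1,2) sqs_scale[OF assms(3), of "-1"]]
  by (simp add: l2inner_scale_right[of H \<eta> "-1", simplified])

lemma l2inner_diff_left:
  assumes "sqs (fibre H x) \<eta>" "sqs (fibre H x) \<xi>" "sqs (fibre H x) \<zeta>"
  shows "l2inner H (\<lambda>g. \<xi> g - \<zeta> g) \<eta> x = l2inner H \<xi> \<eta> x - l2inner H \<zeta> \<eta> x"
  using l2inner_diff_right[OF assms, THEN arg_cong[of _ _ cnj]] by (simp add: l2inner_cnj)

lemma l2inner_Cauchy_Schwarz:
  "sqs (fibre H x) \<eta> \<Longrightarrow> sqs (fibre H x) \<xi> \<Longrightarrow>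
    cmod (l2inner H \<eta> \<xi> x) \<le> en (fibre H x) \<eta> * en (fibre H x) \<xi>"
  unfolding l2inner_def by (rule Cauchy_Schwarz_infsum)

lemma l2inner_self: "sqs (fibre H x) \<xi> \<Longrightarrow> l2inner H \<xi> \<xi> x = of_real ((en (fibre H x) \<xi>)\<^sup>2)"
  unfolding l2inner_def by (rule inner_self)

lemma l2inner_cong:
  "(\<And>g. g \<in> fibre H x \<Longrightarrow> \<eta> g = \<eta>' g) \<Longrightarrow> (\<And>g. g \<in> fibre H x \<Longrightarrow> \<xi> g = \<xi>' g) \<Longrightarrow>
    l2inner H \<eta> \<xi> x = l2inner H \<eta>' \<xi>' x"
  unfolding l2inner_def by (rule infsum_cong) simp

lemma l2inner_perturb:
  assumes "sqs (fibre H x) \<eta>" "sqs (fibre H x) \<eta>'" "sqs (fibre H x) \<xi>" "sqs (fibre H x) \<xi>'"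
  shows "cmod (l2inner H \<eta> \<xi> x - l2inner H \<eta>' \<xi>' x) \<le>
    en (fibre H x) (\<lambda>g. \<eta> g - \<eta>' g) * en (fibre H x) \<xi> + en (fibre H x) \<eta>' * en (fibre H x) (\<lambda>g. \<xi> g - \<xi>' g)"
proof -
  have "l2inner H \<eta> \<xi> x - l2inner H \<eta>' \<xi>' x =
      l2inner H (\<lambda>g. \<eta> g - \<eta>' g) \<xi> x + l2inner H \<eta>' (\<lambda>g. \<xi> g - \<xi>' g) x"
    using assms by (simp add: l2inner_diff_left l2inner_diff_right)
  then show ?thesis
    using norm_triangle_mono[OF l2inner_Cauchy_Schwarz l2inner_Cauchy_Schwarz] assms sqs_diff by metis
qed

context etale
begin

abbreviation nrm :: "'a \<Rightarrow> ('a \<Rightarrow> complex) \<Rightarrow> real" where "nrm x \<xi> \<equiv> en (fibre H x) \<xi>"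

text \<open>Fibres over non-units are empty; therefore fibrewise statements can be quantified over
  all points, without a restriction to units.\<close>

lemma nrm_non_unit [simp]: "x \<notin> units H \<Longrightarrow> nrm x \<xi> = 0"
  and sqs_non_unit [simp]: "x \<notin> units H \<Longrightarrow> sqs (fibre H x) \<xi>"
  by (simp_all add: fibre_non_unit en_def sqs_def)

lemma Cc_sqs: "f \<in> Cc X \<Longrightarrow> sqs (fibre H x) f"
  by (rule sqs_finite_support[OF Cc_fibre_finite])

text \<open>The support meets every fibre in at most \<open>n\<close> arrows for a common
  \<open>n\<close>, and each contributes at most the square of the supremum of
  \<open>f\<close>.\<close>

lemma Cc_bounded:
  assumes f: "f \<in> Cc X"
  obtains C where "\<And>x. nrm x f \<le> C"
proof -
  obtain n where n: "\<And>x. finite (supp_on X f \<inter> fibre H x)" "\<And>x. card (supp_on X f \<inter> fibre H x) \<le> n"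
    using compact_fibre_bound[OF Cc_compact[OF f]] by metis
  obtain B where B: "B \<ge> 0" "\<And>x. cmod (f x) \<le> B"
    using Cb_bounded[OF Cc_subset_Cb[OF f]] by blast
  have *: "L2_set (\<lambda>a. cmod (f a)) F \<le> sqrt (n * B\<^sup>2)" if F: "finite F" "F \<subseteq> fibre H x" for F x
  proof -
    have "(\<Sum>a\<in>F. (cmod (f a))\<^sup>2) = (\<Sum>a\<in>F \<inter> supp_on X f. (cmod (f a))\<^sup>2)"
      using F Cc_supp[OF f] by (intro sum.mono_neutral_right) auto
    also have "\<dots> \<le> (\<Sum>a\<in>F \<inter> supp_on X f. B\<^sup>2)"
      using B by (intro sum_mono power_mono) auto
    also have "\<dots> = card (F \<inter> supp_on X f) * B\<^sup>2"
      by simp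
    also have "\<dots> \<le> n * B\<^sup>2"
    proof (intro mult_right_mono)
      have "card (F \<inter> supp_on X f) \<le> card (supp_on X f \<inter> fibre H x)"
        by (rule card_mono[OF n(1)]) (use F in auto)
      then show "real (card (F \<inter> supp_on X f)) \<le> real n"
        using n(2)[of x] by simp
    qed simp
    finally show ?thesis
      unfolding L2_set_def by (rule real_sqrt_le_mono)
  qed
  show thesis
    by (rule that, rule sqs_bounded(2)[OF *])
qed

section \<open>Membership in \<open>L2\<close> and its closure properties\<close>

lemma L2_iff:
  "\<xi> \<in> L2 H \<longleftrightarrow> (\<forall>g. g \<notin> arrows H \<longrightarrow> \<xi> g = 0) \<and>
    (\<forall>\<epsilon>>0. \<exists>\<eta>\<in>Cc X. \<forall>x. sqs (fibre H x) (\<lambda>g. \<xi> g - \<eta> g) \<and> nrm x (\<lambda>g. \<xi> g - \<eta> g) \<le> \<epsilon>)"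
proof -
  have "(\<forall>x\<in>units H. (\<lambda>g. (cmod (\<xi> g - \<eta> g))\<^sup>2) summable_on fibre H x \<and>
        (\<Sum>\<^sub>\<infinity>g\<in>fibre H x. (cmod (\<xi> g - \<eta> g))\<^sup>2) \<le> \<epsilon>\<^sup>2) \<longleftrightarrow>
      (\<forall>x. sqs (fibre H x) (\<lambda>g. \<xi> g - \<eta> g) \<and> nrm x (\<lambda>g. \<xi> g - \<eta> g) \<le> \<epsilon>)" if "\<epsilon> > 0" for \<eta> \<epsilon>
  proof -
    have "(\<Sum>\<^sub>\<infinity>g\<in>fibre H x. (cmod (\<xi> g - \<eta> g))\<^sup>2) \<le> \<epsilon>\<^sup>2 \<longleftrightarrow> nrm x (\<lambda>g. \<xi> g - \<eta> g) \<le> \<epsilon>" for x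
      using that en_square[of "fibre H x" "\<lambda>g. \<xi> g - \<eta> g"] abs_le_square_iff[of "nrm x (\<lambda>g. \<xi> g - \<eta> g)" \<epsilon>] by simp
    moreover have "sqs (fibre H x) (\<lambda>g. \<xi> g - \<eta> g) \<and> nrm x (\<lambda>g. \<xi> g - \<eta> g) \<le> \<epsilon>" if "x \<notin> units H" for x
      using that \<open>\<epsilon> > 0\<close> by simp
    ultimately show ?thesis
      unfolding sqs_def by blast
  qed
  then show ?thesis
    unfolding L2_def by auto
qed

lemma L2_zero_outside: "\<xi> \<in> L2 H \<Longrightarrow> g \<notin> arrows H \<Longrightarrow> \<xi> g = 0"
  by (simp add: L2_iff)

lemma L2_approx:
  assumes "\<xi> \<in> L2 H" "\<epsilon> > 0"
  obtains \<eta> where "\<eta> \<in> Cc X" "\<And>x. sqs (fibre H x) (\<lambda>g. \<xi> g - \<eta> g)" "\<And>x. nrm x (\<lambda>g. \<xi> g - \<eta> g) \<le> \<epsilon>"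
  using assms unfolding L2_iff by meson

lemma Cc_in_L2: "f \<in> Cc X \<Longrightarrow> f \<in> L2 H"
  unfolding L2_iff by (auto simp: Cc_def intro!: bexI[of _ f])

lemma L2_sqs:
  assumes "\<xi> \<in> L2 H"
  shows "sqs (fibre H x) \<xi>"
proof -
  obtain \<eta> where \<eta>: "\<eta> \<in> Cc X" "sqs (fibre H x) (\<lambda>g. \<xi> g - \<eta> g)"
    using L2_approx[OF assms, of 1] by (metis zero_less_one)
  show ?thesis
    using sqs_add[OF \<eta>(2) Cc_sqs[OF \<eta>(1)]] by simp
qed

lemma L2_bounded:
  assumes "\<xi> \<in> L2 H"
  obtains C where "\<And>x. nrm x \<xi> \<le> C"
proof -
  obtain \<eta> where \<eta>: "\<eta> \<in> Cc X" "\<And>x. sqs (fibre H x) (\<lambda>g. \<xi> g - \<eta> g)" "\<And>x. nrm x (\<lambda>g. \<xi> g - \<eta> g) \<le> 1"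
    using L2_approx[OF assms, of 1] by (metis zero_less_one)
  obtain C where C: "\<And>x. nrm x \<eta> \<le> C"
    using Cc_bounded[OF \<eta>(1)] by metis
  have "nrm x \<xi> \<le> 1 + C" for x
    using en_add[OF \<eta>(2) Cc_sqs[OF \<eta>(1)], of x] \<eta>(3)[of x] C[of x] by simp
  then show thesis
    using that by blast
qed

text \<open>By an \<open>\<epsilon> / 2\<close> argument approximants may come from
  \<open>L2 H\<close> itself, so later membership proofs can take them from wherever they are
  available.\<close>

lemma L2_closed:
  assumes "\<And>g. g \<notin> arrows H \<Longrightarrow> \<xi> g = 0"
    and "\<And>\<epsilon>. \<epsilon> > 0 \<Longrightarrow> \<exists>\<eta>\<in>L2 H. \<forall>x. sqs (fibre H x) (\<lambda>g. \<xi> g - \<eta> g) \<and> nrm x (\<lambda>g. \<xi> g - \<eta> g) \<le> \<epsilon>"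
  shows "\<xi> \<in> L2 H"
  unfolding L2_iff
proof (intro conjI allI impI)
  fix \<epsilon> :: real assume "\<epsilon> > 0"
  then obtain \<eta> where \<eta>: "\<eta> \<in> L2 H" "\<And>x. sqs (fibre H x) (\<lambda>g. \<xi> g - \<eta> g)" "\<And>x. nrm x (\<lambda>g. \<xi> g - \<eta> g) \<le> \<epsilon> / 2"
    using assms(2)[of "\<epsilon> / 2"] by auto
  obtain \<zeta> where \<zeta>: "\<zeta> \<in> Cc X" "\<And>x. sqs (fibre H x) (\<lambda>g. \<eta> g - \<zeta> g)" "\<And>x. nrm x (\<lambda>g. \<eta> g - \<zeta> g) \<le> \<epsilon> / 2"
    using L2_approx[OF \<eta>(1), of "\<epsilon> / 2"] \<open>\<epsilon> > 0\<close> by (metis half_gt_zero)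
  have "sqs (fibre H x) (\<lambda>g. \<xi> g - \<zeta> g)" for x
    using sqs_add[OF \<eta>(2) \<zeta>(2)] by simp
  moreover have "nrm x (\<lambda>g. \<xi> g - \<zeta> g) \<le> \<epsilon>" for x
    using en_triangle[OF \<eta>(2) \<zeta>(2), of x] \<eta>(3)[of x] \<zeta>(3)[of x] by simp
  ultimately show "\<exists>\<eta>\<in>Cc X. \<forall>x. sqs (fibre H x) (\<lambda>g. \<xi> g - \<eta> g) \<and> nrm x (\<lambda>g. \<xi> g - \<eta> g) \<le> \<epsilon>"
    using \<zeta>(1) by blast
qed (use assms(1) in auto)

lemma L2_zero [simp]: "(\<lambda>_. 0) \<in> L2 H"
  by (rule Cc_in_L2[OF zero_in_Cc])

lemma L2_add:
  assumes "\<xi> \<in> L2 H" "\<zeta> \<in> L2 H"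
  shows "(\<lambda>g. \<xi> g + \<zeta> g) \<in> L2 H"
proof (rule L2_closed)
  fix \<epsilon> :: real assume e: "\<epsilon> > 0"
  obtain \<eta> where \<eta>: "\<eta> \<in> Cc X" "\<And>x. sqs (fibre H x) (\<lambda>g. \<xi> g - \<eta> g)" "\<And>x. nrm x (\<lambda>g. \<xi> g - \<eta> g) \<le> \<epsilon> / 2"
    using L2_approx[OF assms(1), of "\<epsilon> / 2"] e by (metis half_gt_zero)
  obtain \<theta> where \<theta>: "\<theta> \<in> Cc X" "\<And>x. sqs (fibre H x) (\<lambda>g. \<zeta> g - \<theta> g)" "\<And>x. nrm x (\<lambda>g. \<zeta> g - \<theta> g) \<le> \<epsilon> / 2"
    using L2_approx[OF assms(2), of "\<epsilon> / 2"] e by (metis half_gt_zero)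
  have eq: "(\<lambda>g. \<xi> g + \<zeta> g - (\<eta> g + \<theta> g)) = (\<lambda>g. (\<xi> g - \<eta> g) + (\<zeta> g - \<theta> g))"
    by auto
  have "nrm x (\<lambda>g. \<xi> g + \<zeta> g - (\<eta> g + \<theta> g)) \<le> \<epsilon>" for x
    unfolding eq using en_add[OF \<eta>(2) \<theta>(2), of x] \<eta>(3)[of x] \<theta>(3)[of x] by simp
  moreover have "sqs (fibre H x) (\<lambda>g. \<xi> g + \<zeta> g - (\<eta> g + \<theta> g))" for x
    unfolding eq by (rule sqs_add[OF \<eta>(2) \<theta>(2)])
  ultimately show "\<exists>\<eta>\<in>L2 H. \<forall>x. sqs (fibre H x) (\<lambda>g. \<xi> g + \<zeta> g - \<eta> g) \<and> nrm x (\<lambda>g. \<xi> g + \<zeta> g - \<eta> g) \<le> \<epsilon>"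
    using Cc_in_L2[OF Cc_add[OF Hausdorff \<eta>(1) \<theta>(1)]] by (intro bexI[of _ "\<lambda>g. \<eta> g + \<theta> g"]) auto
qed (simp add: L2_zero_outside[OF assms(1)] L2_zero_outside[OF assms(2)])

lemma Cb_mult_L2:
  assumes "b \<in> Cb X" "\<xi> \<in> L2 H"
  shows "(\<lambda>g. b g * \<xi> g) \<in> L2 H"
proof (rule L2_closed)
  obtain B where B: "B \<ge> 0" "\<And>g. cmod (b g) \<le> B"
    using Cb_bounded[OF assms(1)] by blast
  fix \<epsilon> :: real assume e: "\<epsilon> > 0"
  \<comment> \<open>Dividing by \<open>B + 1\<close> instead of \<open>B\<close> also covers
    \<open>B = 0\<close>; the same device recurs below.\<close>
  then obtain \<eta> where \<eta>: "\<eta> \<in> Cc X" "\<And>x. sqs (fibre H x) (\<lambda>g. \<xi> g - \<eta> g)" "\<And>x. nrm x (\<lambda>g. \<xi> g - \<eta> g) \<le> \<epsilon> / (B + 1)"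
    using L2_approx[OF assms(2), of "\<epsilon> / (B + 1)"] B(1) by (metis add_nonneg_pos divide_pos_pos zero_less_one)
  have *: "cmod (b g * \<xi> g - b g * \<eta> g) \<le> B * cmod (\<xi> g - \<eta> g)" for g
    using B(2)[of g] by (simp add: norm_mult mult_right_mono flip: right_diff_distrib)
  have "B * nrm x (\<lambda>g. \<xi> g - \<eta> g) \<le> B * (\<epsilon> / (B + 1))" for x
    using \<eta>(3) B(1) by (intro mult_left_mono) auto
  also have "B * (\<epsilon> / (B + 1)) \<le> \<epsilon>"
    using e B(1) by (simp add: field_simps)
  finally have "nrm x (\<lambda>g. b g * \<xi> g - b g * \<eta> g) \<le> \<epsilon>" for x
    using en_dominated[OF \<eta>(2) B(1) *, of x] by (meson order_trans)
  then show "\<exists>\<eta>\<in>L2 H. \<forall>x. sqs (fibre H x) (\<lambda>g. b g * \<xi> g - \<eta> g) \<and> nrm x (\<lambda>g. b g * \<xi> g - \<eta> g) \<le> \<epsilon>"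
    using Cc_in_L2[OF Cb_mult_Cc[OF Hausdorff assms(1) \<eta>(1)]] sqs_dominated[OF \<eta>(2) B(1) *]
    by (intro bexI[of _ "\<lambda>g. b g * \<eta> g"]) auto
qed (simp add: L2_zero_outside[OF assms(2)])

lemma L2_scale: "\<xi> \<in> L2 H \<Longrightarrow> (\<lambda>g. c * \<xi> g) \<in> L2 H"
proof -
  assume \<xi>: "\<xi> \<in> L2 H"
  \<comment> \<open>The constant is cut off to 0 outside the arrows, since elements of
    \<open>Cb X\<close> vanish there; on an element of \<open>L2 H\<close> this changes
    nothing.\<close>
  have "continuous_map X euclidean (\<lambda>g. if g \<in> arrows H then c else 0)"
    by (rule continuous_map_eq[of _ _ "\<lambda>_. c"]) auto
  then have "(\<lambda>g. if g \<in> arrows H then c else 0) \<in> Cb X"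
    by (rule CbI[where C = "cmod c"]) auto
  then have "(\<lambda>g. (if g \<in> arrows H then c else 0) * \<xi> g) \<in> L2 H"
    by (rule Cb_mult_L2[OF _ \<xi>])
  moreover have "(\<lambda>g. (if g \<in> arrows H then c else 0) * \<xi> g) = (\<lambda>g. c * \<xi> g)"
    using L2_zero_outside[OF \<xi>] by auto
  ultimately show ?thesis by simp
qed

lemma L2_diff: "\<xi> \<in> L2 H \<Longrightarrow> \<zeta> \<in> L2 H \<Longrightarrow> (\<lambda>g. \<xi> g - \<zeta> g) \<in> L2 H"
  using L2_add[OF _ L2_scale[of \<zeta> "-1"]] by simp

lemma cmod_le_nrm: "\<xi> \<in> L2 H \<Longrightarrow> g \<in> arrows H \<Longrightarrow> cmod (\<xi> g) \<le> nrm (s g) \<xi>"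
  by (rule cmod_le_en) (auto simp: L2_sqs fibre_iff)

text \<open>Evaluation at an arrow is bounded by the fibre norm, so approximation in
  \<open>L2\<close> is uniform on arrows.\<close>

lemma L2_continuous: "\<xi> \<in> L2 H \<Longrightarrow> continuous_map X euclidean \<xi>"
proof (rule continuous_map_uniform_approx)
  fix \<epsilon> :: real assume "\<xi> \<in> L2 H" "\<epsilon> > 0"
  then obtain \<eta> where \<eta>: "\<eta> \<in> Cc X" "\<And>x. sqs (fibre H x) (\<lambda>g. \<xi> g - \<eta> g)" "\<And>x. nrm x (\<lambda>g. \<xi> g - \<eta> g) \<le> \<epsilon>"
    using L2_approx by metis
  have "norm (\<xi> g - \<eta> g) \<le> \<epsilon>" if "g \<in> arrows H" for g
    using cmod_le_en[OF \<eta>(2), of g "s g"] \<eta>(3)[of "s g"] that by (simp add: fibre_iff)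
  then show "\<exists>g. continuous_map X euclidean g \<and> (\<forall>x\<in>topspace X. norm (\<xi> x - g x) \<le> \<epsilon>)"
    using Cc_continuous[OF \<eta>(1)] by auto
qed

lemma continuous_inner:
  assumes "\<eta> \<in> L2 H" "\<xi> \<in> L2 H"
  shows "continuous_map X euclidean (l2inner H \<eta> \<xi>)"
proof (rule continuous_map_uniform_approx)
  fix \<epsilon> :: real assume e: "\<epsilon> > 0"
  obtain A where A: "\<And>x. nrm x \<xi> \<le> A" using L2_bounded[OF assms(2)] by metis
  obtain B where B: "\<And>x. nrm x \<eta> \<le> B" using L2_bounded[OF assms(1)] by metis
  have AB: "0 \<le> A" "0 \<le> B"
    using A[of undefined] B[of undefined] en_nonneg order_trans by blast+
  \<comment> \<open>The bound by 1 keeps the fibre norms of \<open>\<eta>'\<close> below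
    \<open>B + 1\<close>; the second bound absorbs the total error
    \<open>\<delta> * A + (B + 1) * \<delta>\<close>.\<close>
  define \<delta> where "\<delta> = min 1 (\<epsilon> / (A + B + 1))"
  have d: "\<delta> > 0" "\<delta> \<le> 1"
    using e AB by (auto simp: \<delta>_def)
  have "\<delta> * (A + B + 1) \<le> \<epsilon> / (A + B + 1) * (A + B + 1)"
    using AB by (intro mult_right_mono) (auto simp: \<delta>_def)
  then have d3: "\<delta> * (A + B + 1) \<le> \<epsilon>"
    using AB by simp
  obtain \<eta>' where \<eta>': "\<eta>' \<in> Cc X" "\<And>x. nrm x (\<lambda>g. \<eta> g - \<eta>' g) \<le> \<delta>"
    using L2_approx[OF assms(1) d(1)] by metis
  obtain \<xi>' where \<xi>': "\<xi>' \<in> Cc X" "\<And>x. nrm x (\<lambda>g. \<xi> g - \<xi>' g) \<le> \<delta>"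
    using L2_approx[OF assms(2) d(1)] by metis
  have "norm (l2inner H \<eta> \<xi> x - l2inner H \<eta>' \<xi>' x) \<le> \<epsilon>" for x
  proof -
    have sq: "sqs (fibre H x) \<eta>" "sqs (fibre H x) \<eta>'" "sqs (fibre H x) \<xi>" "sqs (fibre H x) \<xi>'"
      using assms \<eta>' \<xi>' L2_sqs Cc_sqs by auto
    have "nrm x \<eta>' \<le> B + 1"
      using en_diff_le[OF sq(1,2)] \<eta>'(2)[of x] B[of x] d(2) by simp
    then have "nrm x (\<lambda>g. \<eta> g - \<eta>' g) * nrm x \<xi> + nrm x \<eta>' * nrm x (\<lambda>g. \<xi> g - \<xi>' g) \<le> \<delta> * A + (B + 1) * \<delta>"
      using \<eta>'(2)[of x] \<xi>'(2)[of x] A[of x] AB d(1) by (intro add_mono mult_mono) auto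
    also have "\<dots> \<le> \<epsilon>"
      using d3 by (simp add: algebra_simps)
    finally show ?thesis
      using l2inner_perturb[OF sq] by linarith
  qed
  moreover have "continuous_map X euclidean (l2inner H \<eta>' \<xi>')"
  proof -
    have "(\<lambda>g. cnj (\<eta>' g) * \<xi>' g) \<in> Cc X"
      by (intro Cb_mult_Cc[OF Hausdorff Cc_subset_Cb] Cc_cnj[OF Hausdorff] \<eta>' \<xi>')
    then show ?thesis
      unfolding l2inner_def[abs_def] by (rule continuous_fibre_sum)
  qed
  ultimately show "\<exists>g. continuous_map X euclidean g \<and> (\<forall>x\<in>topspace X. norm (l2inner H \<eta> \<xi> x - g x) \<le> \<epsilon>)"
    by blast
qed

lemma nrm_eq: "\<xi> \<in> L2 H \<Longrightarrow> nrm x \<xi> = sqrt (Re (l2inner H \<xi> \<xi> x))"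
  by (simp add: l2inner_self L2_sqs)

lemma continuous_nrm: "\<xi> \<in> L2 H \<Longrightarrow> continuous_map X euclidean (\<lambda>x. nrm x \<xi>)"
  unfolding nrm_eq
  by (rule continuous_map_compose_real[OF continuous_inner, of \<xi> \<xi> "\<lambda>c. sqrt (Re c)"]) (auto intro!: continuous_intros)

text \<open>Evaluations are contractive, so the sequence converges at every arrow; Fatou on each
  fibre then makes the convergence uniform over fibres, and \<open>L2_closed\<close> puts the limit
  into \<open>L2 H\<close>.\<close>

lemma L2_complete:
  assumes \<xi>: "\<And>n. \<xi> n \<in> L2 H"
    and Cauchy: "\<And>\<epsilon>. \<epsilon> > 0 \<Longrightarrow> \<exists>N. \<forall>m\<ge>N. \<forall>n\<ge>N. \<forall>x. nrm x (\<lambda>g. \<xi> m g - \<xi> n g) \<le> \<epsilon>"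
  obtains \<zeta> where "\<zeta> \<in> L2 H" "\<And>g. (\<lambda>n. \<xi> n g) \<longlonglongrightarrow> \<zeta> g"
    "\<And>\<epsilon>. \<epsilon> > 0 \<Longrightarrow> \<exists>N. \<forall>n\<ge>N. \<forall>x. nrm x (\<lambda>g. \<zeta> g - \<xi> n g) \<le> \<epsilon>"
proof -
  have "convergent (\<lambda>n. \<xi> n g)" for g
  proof (cases "g \<in> arrows H")
    case True
    have "Cauchy (\<lambda>n. \<xi> n g)"
      unfolding Cauchy_def
    proof (intro allI impI)
      fix e :: real assume "e > 0"
      then obtain N where N: "\<And>m n. m \<ge> N \<Longrightarrow> n \<ge> N \<Longrightarrow> nrm (s g) (\<lambda>g. \<xi> m g - \<xi> n g) \<le> e / 2"
        using Cauchy[of "e / 2"] by auto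
      have "dist (\<xi> m g) (\<xi> n g) < e" if "m \<ge> N" "n \<ge> N" for m n
        using cmod_le_nrm[OF L2_diff[OF \<xi> \<xi>] True, of m n] N[OF that] \<open>e > 0\<close> by (simp add: dist_norm)
      then show "\<exists>M. \<forall>m\<ge>M. \<forall>n\<ge>M. dist (\<xi> m g) (\<xi> n g) < e"
        by blast
    qed
    then show ?thesis
      by (rule Cauchy_convergent)
  next
    case False
    then show ?thesis
      using L2_zero_outside[OF \<xi>] by (simp add: convergent_const)
  qed
  then obtain \<zeta> where \<zeta>: "\<And>g. (\<lambda>n. \<xi> n g) \<longlonglongrightarrow> \<zeta> g"
    unfolding convergent_def by metis
  have *: "\<exists>N. \<forall>n\<ge>N. \<forall>x. sqs (fibre H x) (\<lambda>g. \<zeta> g - \<xi> n g) \<and> nrm x (\<lambda>g. \<zeta> g - \<xi> n g) \<le> \<epsilon>" if "\<epsilon> > 0" for \<epsilon>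
  proof -
    obtain N where N: "\<And>m n x. m \<ge> N \<Longrightarrow> n \<ge> N \<Longrightarrow> nrm x (\<lambda>g. \<xi> m g - \<xi> n g) \<le> \<epsilon>"
      using Cauchy[OF \<open>\<epsilon> > 0\<close>] by blast
    have "sqs (fibre H x) (\<lambda>g. \<zeta> g - \<xi> n g) \<and> nrm x (\<lambda>g. \<zeta> g - \<xi> n g) \<le> \<epsilon>" if "n \<ge> N" for n x
    proof -
      have "(\<lambda>m. \<xi> m a - \<xi> n a) \<longlonglongrightarrow> \<zeta> a - \<xi> n a" for a
        by (intro tendsto_intros \<zeta>)
      then show ?thesis
        using en_pointwise_limit[of "fibre H x" "\<lambda>m g. \<xi> m g - \<xi> n g" "\<lambda>g. \<zeta> g - \<xi> n g" N \<epsilon>]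
          N that L2_sqs[OF L2_diff[OF \<xi> \<xi>]] by blast
    qed
    then show ?thesis by blast
  qed
  have "\<zeta> \<in> L2 H"
  proof (rule L2_closed)
    show "\<zeta> g = 0" if "g \<notin> arrows H" for g
      using \<zeta>[of g] L2_zero_outside[OF \<xi> that] by (simp add: LIMSEQ_const_iff)
    show "\<exists>\<eta>\<in>L2 H. \<forall>x. sqs (fibre H x) (\<lambda>g. \<zeta> g - \<eta> g) \<and> nrm x (\<lambda>g. \<zeta> g - \<eta> g) \<le> \<epsilon>" if "\<epsilon> > 0" for \<epsilon>
      using *[OF that] \<xi> by blast
  qed
  then show thesis
    using that \<zeta> * by metis
qed

lemma nrm_le_l2norm:
  assumes "\<xi> \<in> L2 H"
  shows "nrm x \<xi> \<le> l2norm H \<xi>"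
proof -
  obtain C where C: "\<And>x. nrm x \<xi> \<le> C"
    using L2_bounded[OF assms] by metis
  have bdd: "bdd_above (insert 0 ((\<lambda>x. sqrt (Re (l2inner H \<xi> \<xi> x))) ` units H))"
    using C unfolding nrm_eq[OF assms, symmetric] by (auto intro!: bdd_aboveI2)
  show ?thesis
  proof (cases "x \<in> units H")
    case True
    then show ?thesis
      unfolding l2norm_def nrm_eq[OF assms] using bdd by (intro cSup_upper) auto
  next
    case False
    then show ?thesis
      unfolding l2norm_def using bdd by (auto intro: cSup_upper)
  qed
qed

lemma l2norm_nonneg: "\<xi> \<in> L2 H \<Longrightarrow> 0 \<le> l2norm H \<xi>"
  using nrm_le_l2norm en_nonneg order_trans by blast

lemma l2norm_least:
  assumes "\<xi> \<in> L2 H" "0 \<le> C" "\<And>x. nrm x \<xi> \<le> C"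
  shows "l2norm H \<xi> \<le> C"
  unfolding l2norm_def using assms by (intro cSup_least) (auto simp flip: nrm_eq)

lemma delta_exists:
  assumes "openin X W" "g \<in> W"
  obtains \<delta> where "\<delta> \<in> Cc X" "\<delta> g = 1" "\<And>h. h \<in> fibre H (s g) \<Longrightarrow> h \<noteq> g \<Longrightarrow> \<delta> h = 0"
    "supp_on X \<delta> \<subseteq> W"
proof -
  obtain \<phi> U where U: "\<phi> \<in> Cc X" "bisection U" "g \<in> U" "U \<subseteq> W" "supp_on X \<phi> \<subseteq> U" "\<phi> g = 1"
    using bump[OF assms] by metis
  have "\<phi> h = 0" if "h \<in> fibre H (s g)" "h \<noteq> g" for h
  proof (rule ccontr)
    assume "\<phi> h \<noteq> 0"
    then have "h \<in> U" using Cc_supp[OF U(1)] U(5) by blast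
    then show False
      using that U(2,3) by (auto simp: bisection_def fibre_iff dest: inj_onD)
  qed
  then show thesis
    using that U by blast
qed

text \<open>A Kronecker delta on the fibre through \<open>g\<close>, realised in
  \<open>Cc X\<close>. Its values on other fibres are arbitrary, which is harmless because
  adjointable operators act fibrewise; \<open>T (delta h) g\<close> is thus the matrix coefficient
  of \<open>T\<close> at \<open>(g, h)\<close>.\<close>

definition delta :: "'a \<Rightarrow> 'a \<Rightarrow> complex" where
  "delta g = (SOME \<delta>. \<delta> \<in> Cc X \<and> \<delta> g = 1 \<and> (\<forall>h\<in>fibre H (s g). h \<noteq> g \<longrightarrow> \<delta> h = 0))"

lemma delta:
  assumes "g \<in> arrows H"
  shows "delta g \<in> Cc X" "delta g g = 1" "h \<in> fibre H (s g) \<Longrightarrow> delta g h = (if h = g then 1 else 0)"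
proof -
  have "\<exists>\<delta>. \<delta> \<in> Cc X \<and> \<delta> g = 1 \<and> (\<forall>h\<in>fibre H (s g). h \<noteq> g \<longrightarrow> \<delta> h = 0)"
    using delta_exists[OF openin_topspace, of g] assms by (metis topspace_X)
  from someI_ex[OF this] show "delta g \<in> Cc X" "delta g g = 1"
    "h \<in> fibre H (s g) \<Longrightarrow> delta g h = (if h = g then 1 else 0)"
    unfolding delta_def[symmetric] by auto
qed

lemma delta_L2: "g \<in> arrows H \<Longrightarrow> delta g \<in> L2 H"
  by (simp add: Cc_in_L2 delta(1))

lemma inner_single:
  assumes "g \<in> fibre H x" "\<And>h. h \<in> fibre H x \<Longrightarrow> h \<noteq> g \<Longrightarrow> \<eta> h = 0"
  shows "l2inner H \<eta> \<xi> x = cnj (\<eta> g) * \<xi> g"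
  unfolding l2inner_def by (rule infsum_single) (use assms in auto)

lemma inner_delta:
  assumes "g \<in> arrows H"
  shows "l2inner H (delta g) \<xi> (s g) = \<xi> g"
  using inner_single[of g "s g" "delta g"] delta[OF assms] assms by (simp add: fibre_iff)

lemma inner_delta_right:
  assumes "g \<in> arrows H"
  shows "l2inner H \<xi> (delta g) (s g) = cnj (\<xi> g)"
  using inner_delta[OF assms, of \<xi>] l2inner_cnj[of H "delta g" \<xi> "s g"] by simp

lemma nrm_delta: "g \<in> arrows H \<Longrightarrow> nrm (s g) (delta g) = 1"
  using nrm_eq[OF delta_L2] inner_delta[of g "delta g"] delta(2) by simp

lemma L2_eqI:
  assumes "\<xi> \<in> L2 H" "\<zeta> \<in> L2 H" "\<And>g. g \<in> arrows H \<Longrightarrow> \<xi> g = \<zeta> g"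
  shows "\<xi> = \<zeta>"
  using assms L2_zero_outside by (intro ext) metis

end

section \<open>Adjointable operators\<close>

context etale
begin

text \<open>The constant \<open>K x\<close> may vary with the fibre and survives in the error bound,
  so that limits of operators keep fibrewise estimates; the common bound \<open>B\<close> only
  serves to make the sequence uniformly Cauchy.\<close>

lemma L2_geometric_limit:
  assumes \<xi>: "\<And>n. \<xi> n \<in> L2 H"
    and step: "\<And>n x. nrm x (\<lambda>g. \<xi> (Suc n) g - \<xi> n g) \<le> K x * q ^ n"
    and K: "\<And>x. K x \<le> B" and q: "0 \<le> q" "q < 1"
  obtains \<zeta> where "\<zeta> \<in> L2 H" "\<And>g. (\<lambda>n. \<xi> n g) \<longlonglongrightarrow> \<zeta> g"
    "\<And>n x. nrm x (\<lambda>g. \<zeta> g - \<xi> n g) \<le> K x * q ^ n / (1 - q)"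
proof -
  have K0: "0 \<le> K x" for x
    using step[of x 0] en_nonneg[of "fibre H x"] by (metis mult.right_neutral order_trans power_0)
  have sq: "sqs (fibre H x) (\<lambda>g. \<xi> m g - \<xi> n g)" for m n x
    by (intro L2_sqs L2_diff \<xi>)
  \<comment> \<open>The numerator \<open>q ^ n - q ^ (n + k)\<close> is the exact partial geometric
    sum, which makes the induction close.\<close>
  have *: "nrm x (\<lambda>g. \<xi> (n + k) g - \<xi> n g) \<le> K x * (q ^ n - q ^ (n + k)) / (1 - q)" for n k x
  proof (induction k)
    case (Suc k)
    have "nrm x (\<lambda>g. \<xi> (n + Suc k) g - \<xi> n g) \<le> K x * q ^ (n + k) + K x * (q ^ n - q ^ (n + k)) / (1 - q)"
      using en_triangle[of "fibre H x" "\<xi> (n + Suc k)" "\<xi> (n + k)" "\<xi> n"] sq[of x] step[of x "n + k"] Suc.IH by simp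
    also have "\<dots> = K x * (q ^ n - q ^ (n + Suc k)) / (1 - q)"
      using q by (simp add: field_simps)
    finally show ?case .
  qed simp
  have le: "nrm x (\<lambda>g. \<xi> m g - \<xi> n g) \<le> K x * q ^ n / (1 - q)" if "n \<le> m" for m n x
  proof -
    have "K x * (q ^ n - q ^ m) / (1 - q) \<le> K x * q ^ n / (1 - q)"
      using K0[of x] q by (intro divide_right_mono mult_left_mono) auto
    then show ?thesis
      using *[of x n "m - n"] that by simp
  qed
  have Cauchy: "\<exists>N. \<forall>m\<ge>N. \<forall>n\<ge>N. \<forall>x. nrm x (\<lambda>g. \<xi> m g - \<xi> n g) \<le> \<epsilon>" if "\<epsilon> > 0" for \<epsilon>
  proof -
    have "(\<lambda>n. B * q ^ n / (1 - q)) \<longlonglongrightarrow> B * 0 / (1 - q)"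
      using q by (intro tendsto_intros LIMSEQ_power_zero) auto
    then have "eventually (\<lambda>n. B * q ^ n / (1 - q) < \<epsilon>) sequentially"
      using that by (simp add: order_tendstoD(2))
    then obtain N where N: "\<And>n. n \<ge> N \<Longrightarrow> B * q ^ n / (1 - q) < \<epsilon>"
      by (auto simp: eventually_sequentially)
    have le': "nrm x (\<lambda>g. \<xi> m g - \<xi> n g) \<le> \<epsilon>" if "N \<le> n" "n \<le> m" for m n x
    proof -
      have "K x * q ^ n / (1 - q) \<le> B * q ^ n / (1 - q)"
        using K[of x] q by (intro divide_right_mono mult_right_mono) auto
      then show ?thesis
        using le[OF that(2), of x] N[OF that(1)] by linarith
    qed
    have "nrm x (\<lambda>g. \<xi> m g - \<xi> n g) \<le> \<epsilon>" if "N \<le> n" "N \<le> m" for m n x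
      using le'[of n m x] le'[of m n x] that en_diff_commute[of "fibre H x" "\<xi> m" "\<xi> n"] by (cases "n \<le> m") auto
    then show ?thesis by blast
  qed
  obtain \<zeta> where \<zeta>: "\<zeta> \<in> L2 H" "\<And>g. (\<lambda>n. \<xi> n g) \<longlonglongrightarrow> \<zeta> g"
    using L2_complete[OF \<xi> Cauchy] by metis
  have "nrm x (\<lambda>g. \<zeta> g - \<xi> n g) \<le> K x * q ^ n / (1 - q)" for n x
  proof (rule en_pointwise_limit(2))
    show "(\<lambda>m. \<xi> m a - \<xi> n a) \<longlonglongrightarrow> \<zeta> a - \<xi> n a" for a
      by (intro tendsto_intros \<zeta>)
    show "n \<le> m \<Longrightarrow> sqs (fibre H x) (\<lambda>g. \<xi> m g - \<xi> n g) \<and> nrm x (\<lambda>g. \<xi> m g - \<xi> n g) \<le> K x * q ^ n / (1 - q)" for m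
      using le sq by blast
  qed
  then show thesis
    using that \<zeta> by blast
qed

text \<open>The principle of uniform boundedness by a gliding hump: \<open>max \<bar>a + b\<bar> \<bar>a - b\<bar> \<ge> \<bar>b\<bar>\<close>, so a small
  multiple of each \<open>\<zeta> n\<close>, with a suitable sign, can be added without losing the size of the pairing.\<close>

lemma uniform_boundedness:
  assumes Z: "Z \<subseteq> L2 H" and pointwise: "\<And>\<eta>. \<eta> \<in> L2 H \<Longrightarrow> \<exists>M. \<forall>\<zeta>\<in>Z. \<forall>x. cmod (l2inner H \<zeta> \<eta> x) \<le> M"
  shows "\<exists>C. \<forall>\<zeta>\<in>Z. l2norm H \<zeta> \<le> C"
proof (rule ccontr)
  assume "\<not> ?thesis"
  \<comment> \<open>With \<open>w n\<close> the norm of \<open>\<zeta> n\<close>, the pairing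
    reaches \<open>81/100 * w n / 3 ^ n\<close> and later corrections cost at most half of
    \<open>w n / 3 ^ n\<close>. The remaining factor \<open>31/100\<close>, multiplied by 4, still
    exceeds 1.\<close>
  then have "\<forall>n::nat. \<exists>\<zeta>. \<zeta> \<in> Z \<and> l2norm H \<zeta> > 4 * (real n + 1) * 3 ^ n"
    by (meson not_le)
  from choice[OF this] obtain \<zeta> where \<zeta>: "\<And>n. \<zeta> n \<in> Z" "\<And>n. l2norm H (\<zeta> n) > 4 * (real n + 1) * 3 ^ n"
    by blast
  have \<zeta>L: "\<zeta> n \<in> L2 H" for n
    using \<zeta>(1) Z by blast
  define w where "w n = l2norm H (\<zeta> n)" for n
  have w: "w n > 0" "w n > 4 * (real n + 1) * 3 ^ n" for n
  proof -
    show "w n > 4 * (real n + 1) * 3 ^ n"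
      using \<zeta>(2) by (simp add: w_def)
    moreover have "0 < 4 * (real n + 1) * 3 ^ n"
      by simp
    ultimately show "w n > 0"
      by linarith
  qed
  \<comment> \<open>The supremum need not be attained; \<open>9/10\<close> is close enough because
    its square is larger than \<open>1/2\<close>.\<close>
  have "\<exists>x. nrm x (\<zeta> n) > 9/10 * w n" for n
  proof (rule ccontr)
    assume "\<nexists>x. nrm x (\<zeta> n) > 9/10 * w n"
    then have "w n \<le> 9/10 * w n"
      unfolding w_def using w(1)[of n] by (intro l2norm_least[OF \<zeta>L]) (auto simp: not_less w_def)
    then show False
      using w(1)[of n] by simp
  qed
  then obtain x where x: "\<And>n. nrm (x n) (\<zeta> n) > 9/10 * w n"
    by metis
  \<comment> \<open>The hump in the direction of \<open>\<zeta> n\<close> itself, rescaled to fibre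
    norm at most \<open>1 / 3 ^ n\<close> so that the signed series converges.\<close>
  define v where "v n g = complex_of_real (1 / (3 ^ n * w n)) * \<zeta> n g" for n g
  have vL: "v n \<in> L2 H" for n
    unfolding v_def[abs_def] by (rule L2_scale[OF \<zeta>L])
  have v_nrm: "nrm y (v n) \<le> (1/3) ^ n" for n y
  proof -
    have "nrm y (v n) = 1 / (3 ^ n * w n) * nrm y (\<zeta> n)"
      unfolding v_def[abs_def] en_scale using w(1)[of n] by (simp add: norm_divide norm_mult norm_power)
    also have "\<dots> \<le> 1 / (3 ^ n * w n) * w n"
      using nrm_le_l2norm[OF \<zeta>L[of n]] w(1)[of n] unfolding w_def by (intro mult_left_mono) auto
    also have "\<dots> = (1/3) ^ n"
      using w(1)[of n] by (simp add: field_simps)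
    finally show ?thesis .
  qed
  have pair_v: "cmod (l2inner H (\<zeta> n) (v n) (x n)) \<ge> 81/100 * w n / 3 ^ n" for n
  proof -
    have "(9/10 * w n)\<^sup>2 \<le> (nrm (x n) (\<zeta> n))\<^sup>2"
      using x[of n] w(1)[of n] by (intro power_mono) auto
    then have "(9/10 * w n)\<^sup>2 / (3 ^ n * w n) \<le> (nrm (x n) (\<zeta> n))\<^sup>2 / (3 ^ n * w n)"
      using w(1)[of n] by (intro divide_right_mono) auto
    moreover have "cmod (l2inner H (\<zeta> n) (v n) (x n)) = (nrm (x n) (\<zeta> n))\<^sup>2 / (3 ^ n * w n)"
      unfolding v_def[abs_def] l2inner_scale_right l2inner_self[OF L2_sqs[OF \<zeta>L]] using w(1)[of n]
      by (simp add: norm_mult norm_divide norm_power)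
    moreover have "(9/10 * w n)\<^sup>2 / (3 ^ n * w n) = 81/100 * w n / 3 ^ n"
      using w(1)[of n] by (simp add: power2_eq_square field_simps)
    ultimately show ?thesis by simp
  qed
  define E where "E = rec_nat (\<lambda>_. 0) (\<lambda>n \<eta> g. if cmod (l2inner H (\<zeta> n) (\<lambda>g. \<eta> g + v n g) (x n)) \<ge>
     cmod (l2inner H (\<zeta> n) (v n) (x n)) then \<eta> g + v n g else \<eta> g - v n g)"
  have E0: "E 0 = (\<lambda>_. 0)"
    by (simp add: E_def)
  have ES: "E (Suc n) = (if cmod (l2inner H (\<zeta> n) (\<lambda>g. E n g + v n g) (x n)) \<ge>
     cmod (l2inner H (\<zeta> n) (v n) (x n)) then (\<lambda>g. E n g + v n g) else (\<lambda>g. E n g - v n g))" for n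
    by (auto simp: E_def)
  have EL: "E n \<in> L2 H" for n
    by (induction n) (auto simp: E0 ES intro: L2_add L2_diff vL)
  have step: "nrm y (\<lambda>g. E (Suc n) g - E n g) \<le> 1 * (1/3) ^ n" for n y
    using v_nrm[of y n] by (simp add: ES en_uminus)
  have pair_E: "cmod (l2inner H (\<zeta> n) (E (Suc n)) (x n)) \<ge> 81/100 * w n / 3 ^ n" for n
  proof -
    let ?a = "l2inner H (\<zeta> n) (E n) (x n)" and ?b = "l2inner H (\<zeta> n) (v n) (x n)"
    have "l2inner H (\<zeta> n) (\<lambda>g. E n g + v n g) (x n) = ?a + ?b" "l2inner H (\<zeta> n) (\<lambda>g. E n g - v n g) (x n) = ?a - ?b"
      by (intro l2inner_add_right l2inner_diff_right L2_sqs \<zeta>L EL vL)+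
    moreover have "cmod (?a - ?b) \<ge> cmod ?b" if "cmod (?a + ?b) < cmod ?b"
    proof -
      have "cmod (2 * ?b) \<le> cmod (?a + ?b) + cmod (?a - ?b)"
        using norm_triangle_ineq4[of "?a + ?b" "?a - ?b"] by simp
      then show ?thesis
        using that by (simp add: norm_mult)
    qed
    ultimately have "cmod (l2inner H (\<zeta> n) (E (Suc n)) (x n)) \<ge> cmod ?b"
      by (auto simp: ES not_le)
    then show ?thesis
      using pair_v[of n] by linarith
  qed
  obtain \<eta> where \<eta>: "\<eta> \<in> L2 H" "\<And>n y. nrm y (\<lambda>g. \<eta> g - E n g) \<le> 1 * (1/3) ^ n / (1 - 1/3)"
    by (rule L2_geometric_limit[OF EL step order_refl]) (simp, simp, blast)
  have big: "cmod (l2inner H (\<zeta> n) \<eta> (x n)) \<ge> real n + 1" for n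
  proof -
    \<comment> \<open>The tail starts at \<open>Suc n\<close>:
      \<open>(1/3) ^ Suc n / (1 - 1/3)\<close> equals \<open>(1/3) ^ n / 2\<close>.\<close>
    have "cmod (l2inner H (\<zeta> n) (\<lambda>g. \<eta> g - E (Suc n) g) (x n)) \<le> w n * ((1/3) ^ n / 2)"
    proof -
      have "cmod (l2inner H (\<zeta> n) (\<lambda>g. \<eta> g - E (Suc n) g) (x n)) \<le>
          nrm (x n) (\<zeta> n) * nrm (x n) (\<lambda>g. \<eta> g - E (Suc n) g)"
        by (intro l2inner_Cauchy_Schwarz L2_sqs \<zeta>L L2_diff \<eta> EL)
      also have "\<dots> \<le> w n * ((1/3) ^ n / 2)"
        using nrm_le_l2norm[OF \<zeta>L[of n], of "x n"] \<eta>(2)[of "x n" "Suc n"] w(1)[of n] unfolding w_def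
        by (intro mult_mono) auto
      finally show ?thesis .
    qed
    moreover have "l2inner H (\<zeta> n) (\<lambda>g. \<eta> g - E (Suc n) g) (x n) =
        l2inner H (\<zeta> n) \<eta> (x n) - l2inner H (\<zeta> n) (E (Suc n)) (x n)"
      by (intro l2inner_diff_right L2_sqs \<zeta>L \<eta> EL)
    moreover have "cmod (l2inner H (\<zeta> n) (E (Suc n)) (x n)) \<le> cmod (l2inner H (\<zeta> n) \<eta> (x n))
        + cmod (l2inner H (\<zeta> n) \<eta> (x n) - l2inner H (\<zeta> n) (E (Suc n)) (x n))"
      using norm_triangle_ineq4[of "l2inner H (\<zeta> n) \<eta> (x n)" "l2inner H (\<zeta> n) \<eta> (x n) - l2inner H (\<zeta> n) (E (Suc n)) (x n)"]
      by simp
    ultimately have "81/100 * w n / 3 ^ n \<le> cmod (l2inner H (\<zeta> n) \<eta> (x n)) + w n * ((1/3) ^ n / 2)"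
      using pair_E[of n] by simp
    then have "31/100 * (w n / 3 ^ n) \<le> cmod (l2inner H (\<zeta> n) \<eta> (x n))"
      by (simp add: power_one_over field_simps)
    moreover have "w n / 3 ^ n \<ge> 4 * (real n + 1)"
      using w(2)[of n] by (simp add: field_simps)
    ultimately show ?thesis
      by simp
  qed
  obtain M where "\<And>\<zeta> x. \<zeta> \<in> Z \<Longrightarrow> cmod (l2inner H \<zeta> \<eta> x) \<le> M"
    using pointwise[OF \<eta>(1)] by blast
  then have "real n + 1 \<le> M" for n
    using big[of n] \<zeta>(1)[of n] order_trans by blast
  moreover obtain n where "M < real n"
    using reals_Archimedean2 by blast
  ultimately show False
    by (smt (verit))
qed

section \<open>Linearity, fibrewise action and boundedness of adjointable operators\<close>

lemma adjointable_L2: "T \<in> adjointable H \<Longrightarrow> \<xi> \<in> L2 H \<Longrightarrow> T \<xi> \<in> L2 H"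
  and adjointable_outside: "T \<in> adjointable H \<Longrightarrow> \<xi> \<notin> L2 H \<Longrightarrow> T \<xi> = (\<lambda>_. 0)"
  by (auto simp: adjointable_def)

lemma oper_eqI:
  assumes "S \<in> adjointable H" "T \<in> adjointable H"
    and "\<And>\<xi> g. \<xi> \<in> L2 H \<Longrightarrow> g \<in> arrows H \<Longrightarrow> S \<xi> g = T \<xi> g"
  shows "S = T"
proof
  fix \<xi> show "S \<xi> = T \<xi>"
    using assms adjointable_outside adjointable_L2 by (cases "\<xi> \<in> L2 H") (auto intro: L2_eqI)
qed

lemma l2inner_non_unit: "x \<notin> units H \<Longrightarrow> l2inner H \<eta> \<xi> x = 0"
  by (simp add: l2inner_def fibre_non_unit)

lemma is_adjoint_inner:
  "is_adjoint H T S \<Longrightarrow> \<xi> \<in> L2 H \<Longrightarrow> \<eta> \<in> L2 H \<Longrightarrow> l2inner H \<eta> (T \<xi>) x = l2inner H (S \<eta>) \<xi> x"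
  by (cases "x \<in> units H") (auto simp: is_adjoint_def l2inner_non_unit)

text \<open>Pairing with \<open>delta g\<close> reads off the value at \<open>g\<close>. Uniqueness
  of adjoints, linearity and the fibrewise action are all drawn from this formula.\<close>

lemma is_adjoint_eval:
  assumes "is_adjoint H T S" "\<xi> \<in> L2 H" "g \<in> arrows H"
  shows "T \<xi> g = l2inner H (S (delta g)) \<xi> (s g)"
  using is_adjoint_inner[OF assms(1,2) delta_L2[OF assms(3)], of "s g"] inner_delta[OF assms(3)] by simp

lemma is_adjoint_sym:
  assumes "is_adjoint H T S" "T \<in> adjointable H"
  shows "S \<in> adjointable H" "is_adjoint H S T"
proof -
  have "l2inner H \<eta> (S \<xi>) x = l2inner H (T \<eta>) \<xi> x" if "\<xi> \<in> L2 H" "\<eta> \<in> L2 H" for \<xi> \<eta> x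
    using is_adjoint_inner[OF assms(1) that(2,1), of x, THEN arg_cong[of _ _ cnj]] by (simp add: l2inner_cnj)
  then show "is_adjoint H S T"
    using assms(2) by (auto simp: is_adjoint_def adjointable_def)
  then show "S \<in> adjointable H"
    using assms(1) by (auto simp: is_adjoint_def adjointable_def)
qed

lemma is_adjoint_unique:
  assumes "T \<in> adjointable H" "is_adjoint H T S" "is_adjoint H T S'"
  shows "S = S'"
proof (rule oper_eqI)
  show S: "S \<in> adjointable H" and S': "S' \<in> adjointable H"
    by (rule is_adjoint_sym(1)[OF assms(2,1)], rule is_adjoint_sym(1)[OF assms(3,1)])
  show "S \<xi> g = S' \<xi> g" if "\<xi> \<in> L2 H" "g \<in> arrows H" for \<xi> g
    using is_adjoint_eval[OF is_adjoint_sym(2)[OF assms(2,1)] that]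
      is_adjoint_eval[OF is_adjoint_sym(2)[OF assms(3,1)] that] by simp
qed

lemma adj_eqI: "T \<in> adjointable H \<Longrightarrow> is_adjoint H T S \<Longrightarrow> adj H T = S"
  unfolding adj_def using is_adjoint_unique by blast

lemma is_adjoint_adj: "T \<in> adjointable H \<Longrightarrow> is_adjoint H T (adj H T)"
  using adj_eqI by (auto simp: adjointable_def)

lemma adj_adjointable: "T \<in> adjointable H \<Longrightarrow> adj H T \<in> adjointable H"
  using is_adjoint_sym(1)[OF is_adjoint_adj] by blast

lemma adj_adj: "T \<in> adjointable H \<Longrightarrow> adj H (adj H T) = T"
  using adj_eqI[OF adj_adjointable is_adjoint_sym(2)[OF is_adjoint_adj]] by blast

lemma adj_inner: "T \<in> adjointable H \<Longrightarrow> \<xi> \<in> L2 H \<Longrightarrow> \<eta> \<in> L2 H \<Longrightarrow> l2inner H \<eta> (T \<xi>) x = l2inner H (adj H T \<eta>) \<xi> x"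
  by (rule is_adjoint_inner[OF is_adjoint_adj])

lemma adj_inner': "T \<in> adjointable H \<Longrightarrow> \<xi> \<in> L2 H \<Longrightarrow> \<eta> \<in> L2 H \<Longrightarrow> l2inner H \<eta> (adj H T \<xi>) x = l2inner H (T \<eta>) \<xi> x"
  using adj_inner[OF adj_adjointable] adj_adj by metis

lemma adj_eval: "T \<in> adjointable H \<Longrightarrow> \<xi> \<in> L2 H \<Longrightarrow> g \<in> arrows H \<Longrightarrow> T \<xi> g = l2inner H (adj H T (delta g)) \<xi> (s g)"
  by (rule is_adjoint_eval[OF is_adjoint_adj])

text \<open>The value at \<open>g\<close> is an inner product over one fibre with the fixed vector
  \<open>adj H T (delta g)\<close>, and so cannot see the argument elsewhere.\<close>

lemma fibre_local:
  assumes "T \<in> adjointable H" "\<xi> \<in> L2 H" "\<xi>' \<in> L2 H" "\<And>g. g \<in> fibre H x \<Longrightarrow> \<xi> g = \<xi>' g" "g \<in> fibre H x"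
  shows "T \<xi> g = T \<xi>' g"
  using assms adj_eval[OF assms(1)] l2inner_cong[of H x "adj H T (delta g)" "adj H T (delta g)" \<xi> \<xi>']
  by (auto simp: fibre_iff)

lemma adjointable_linear:
  assumes T: "T \<in> adjointable H" and L: "\<xi> \<in> L2 H" "\<zeta> \<in> L2 H"
  shows "T (\<lambda>g. \<xi> g + \<zeta> g) = (\<lambda>g. T \<xi> g + T \<zeta> g)" "T (\<lambda>g. c * \<xi> g) = (\<lambda>g. c * T \<xi> g)"
    "T (\<lambda>g. \<xi> g - \<zeta> g) = (\<lambda>g. T \<xi> g - T \<zeta> g)"
proof -
  have sq: "sqs (fibre H x) (adj H T (delta g))" if "g \<in> arrows H" for g x
    using adjointable_L2[OF adj_adjointable[OF T] delta_L2[OF that]] by (rule L2_sqs)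
  show "T (\<lambda>g. \<xi> g + \<zeta> g) = (\<lambda>g. T \<xi> g + T \<zeta> g)"
    by (rule L2_eqI) (auto simp: adjointable_L2[OF T] L L2_add adj_eval[OF T] l2inner_add_right sq L2_sqs)
  show "T (\<lambda>g. c * \<xi> g) = (\<lambda>g. c * T \<xi> g)"
    by (rule L2_eqI) (auto simp: adjointable_L2[OF T] L L2_scale adj_eval[OF T] l2inner_scale_right)
  show "T (\<lambda>g. \<xi> g - \<zeta> g) = (\<lambda>g. T \<xi> g - T \<zeta> g)"
    by (rule L2_eqI) (auto simp: adjointable_L2[OF T] L L2_diff adj_eval[OF T] l2inner_diff_right sq L2_sqs)
qed

lemma adjointable_zero_vector: "T \<in> adjointable H \<Longrightarrow> T (\<lambda>_. 0) = (\<lambda>_. 0)"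
  using adjointable_linear(2)[of T "\<lambda>_. 0" "\<lambda>_. 0" 0] by simp

lemma l2norm_scale: "\<xi> \<in> L2 H \<Longrightarrow> l2norm H (\<lambda>g. c * \<xi> g) \<le> cmod c * l2norm H \<xi>"
  using l2norm_nonneg nrm_le_l2norm
  by (intro l2norm_least L2_scale) (auto simp: en_scale intro: mult_left_mono)

lemma l2norm_zeroD: "\<xi> \<in> L2 H \<Longrightarrow> l2norm H \<xi> \<le> 0 \<Longrightarrow> \<xi> = (\<lambda>_. 0)"
proof (rule L2_eqI)
  fix g assume \<xi>: "\<xi> \<in> L2 H" "l2norm H \<xi> \<le> 0" and g: "g \<in> arrows H"
  have "cmod (\<xi> g) \<le> 0"
    using cmod_le_nrm[OF \<xi>(1) g] nrm_le_l2norm[OF \<xi>(1), of "s g"] \<xi>(2) by linarith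
  then show "\<xi> g = 0"
    by simp
qed auto

text \<open>The Hellinger-Toeplitz argument: tested against \<open>\<eta>\<close>, the images of the
  unit ball are bounded by the norm of \<open>adj H T \<eta>\<close>, so uniform boundedness
  applies. Only now is the supremum in \<open>opnorm\<close> known to be finite.\<close>

lemma adjointable_unit_ball_bounded:
  assumes T: "T \<in> adjointable H"
  obtains C where "\<And>\<xi>. \<xi> \<in> L2 H \<Longrightarrow> l2norm H \<xi> \<le> 1 \<Longrightarrow> l2norm H (T \<xi>) \<le> C"
proof -
  let ?Z = "T ` {\<xi> \<in> L2 H. l2norm H \<xi> \<le> 1}"
  have "\<exists>C. \<forall>\<zeta>\<in>?Z. l2norm H \<zeta> \<le> C"
  proof (rule uniform_boundedness)
    show "?Z \<subseteq> L2 H"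
      using adjointable_L2[OF T] by auto
    fix \<eta> assume \<eta>: "\<eta> \<in> L2 H"
    have "cmod (l2inner H (T \<xi>) \<eta> x) \<le> l2norm H (adj H T \<eta>)" if "\<xi> \<in> L2 H" "l2norm H \<xi> \<le> 1" for \<xi> x
    proof -
      have T\<eta>: "adj H T \<eta> \<in> L2 H"
        by (rule adjointable_L2[OF adj_adjointable[OF T] \<eta>])
      have "cmod (l2inner H (T \<xi>) \<eta> x) \<le> nrm x \<xi> * nrm x (adj H T \<eta>)"
        unfolding adj_inner'[OF T \<eta> that(1), symmetric]
        by (intro l2inner_Cauchy_Schwarz L2_sqs that T\<eta>)
      also have "\<dots> \<le> 1 * l2norm H (adj H T \<eta>)"
        using nrm_le_l2norm[OF that(1), of x] that(2) nrm_le_l2norm[OF T\<eta>, of x] by (intro mult_mono) auto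
      finally show ?thesis by simp
    qed
    then show "\<exists>M. \<forall>\<zeta>\<in>?Z. \<forall>x. cmod (l2inner H \<zeta> \<eta> x) \<le> M"
      by blast
  qed
  then show thesis
    using that by blast
qed

lemma opnorm_unit_ball:
  assumes "T \<in> adjointable H" "\<xi> \<in> L2 H" "l2norm H \<xi> \<le> 1"
  shows "l2norm H (T \<xi>) \<le> opnorm H T"
  unfolding opnorm_def
proof (rule cSUP_upper)
  obtain C where "\<And>\<xi>. \<xi> \<in> L2 H \<Longrightarrow> l2norm H \<xi> \<le> 1 \<Longrightarrow> l2norm H (T \<xi>) \<le> C"
    using adjointable_unit_ball_bounded[OF assms(1)] by metis
  then show "bdd_above ((\<lambda>\<xi>. l2norm H (T \<xi>)) ` {\<xi> \<in> L2 H. l2norm H \<xi> \<le> 1})"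
    by (intro bdd_aboveI2[where M = C]) auto
qed (use assms in auto)

lemma l2norm_zero [simp]: "l2norm H (\<lambda>_. 0) = 0"
  using l2norm_least[OF L2_zero, of 0] l2norm_nonneg[OF L2_zero] by simp

lemma opnorm_nonneg: "T \<in> adjointable H \<Longrightarrow> 0 \<le> opnorm H T"
  using opnorm_unit_ball[OF _ L2_zero] adjointable_zero_vector by simp

lemma l2norm_le_opnorm:
  assumes T: "T \<in> adjointable H" and \<xi>: "\<xi> \<in> L2 H"
  shows "l2norm H (T \<xi>) \<le> opnorm H T * l2norm H \<xi>"
proof (cases "l2norm H \<xi> = 0")
  case True
  then show ?thesis
    using l2norm_zeroD[OF \<xi>] adjointable_zero_vector[OF T] by simp
next
  case False
  then have pos: "l2norm H \<xi> > 0"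
    using l2norm_nonneg[OF \<xi>] by simp
  let ?\<zeta> = "\<lambda>g. complex_of_real (1 / l2norm H \<xi>) * \<xi> g"
  have \<zeta>: "?\<zeta> \<in> L2 H"
    by (rule L2_scale[OF \<xi>])
  have "l2norm H ?\<zeta> \<le> 1"
    using l2norm_scale[OF \<xi>, of "complex_of_real (1 / l2norm H \<xi>)"] pos by (simp add: norm_divide)
  then have le: "l2norm H (T ?\<zeta>) \<le> opnorm H T"
    by (rule opnorm_unit_ball[OF T \<zeta>])
  have "T \<xi> = T (\<lambda>g. complex_of_real (l2norm H \<xi>) * ?\<zeta> g)"
    using pos by (simp add: mult.assoc[symmetric] flip: of_real_mult)
  also have "\<dots> = (\<lambda>g. complex_of_real (l2norm H \<xi>) * T ?\<zeta> g)"
    by (rule adjointable_linear(2)[OF T \<zeta> \<zeta>])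
  finally have "l2norm H (T \<xi>) \<le> l2norm H \<xi> * l2norm H (T ?\<zeta>)"
    using l2norm_scale[OF adjointable_L2[OF T \<zeta>], of "complex_of_real (l2norm H \<xi>)"] pos by simp
  also have "\<dots> \<le> l2norm H \<xi> * opnorm H T"
    using le pos by simp
  finally show ?thesis
    by (simp add: mult.commute)
qed

lemma Cb_pullback:
  assumes q: "continuous_map Y X q" and f: "f \<in> Cb X"
  shows "(\<lambda>y. if y \<in> topspace Y then f (q y) else 0) \<in> Cb Y"
proof -
  obtain B where "\<And>x. cmod (f x) \<le> B"
    using Cb_bounded[OF f] by blast
  moreover have "continuous_map Y euclidean (\<lambda>y. if y \<in> topspace Y then f (q y) else 0)"
    using continuous_map_compose[OF q, of euclidean f] f by (auto simp: Cb_def comp_def intro: continuous_map_eq)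
  ultimately show ?thesis
    by (intro CbI[where C = B]) auto
qed

text \<open>Since \<open>T\<close> acts fibrewise, \<open>\<xi>\<close> may be cut off to units where its fibre norm is at most
  \<open>nrm x \<xi> + \<epsilon>\<close> before the global norm estimate is applied.\<close>

lemma opnorm_fibre:
  assumes T: "T \<in> adjointable H" and \<xi>: "\<xi> \<in> L2 H"
  shows "nrm x (T \<xi>) \<le> opnorm H T * nrm x \<xi>"
proof (cases "x \<in> units H")
  case True
  have bound: "nrm x (T \<xi>) \<le> opnorm H T * (nrm x \<xi> + \<epsilon>)" if "\<epsilon> > 0" for \<epsilon>
  proof -
    let ?W = "{y \<in> topspace X. nrm y \<xi> \<in> {..<nrm x \<xi> + \<epsilon>}}"
    have "openin X ?W"
      using continuous_nrm[OF \<xi>] by (rule openin_continuous_map_preimage) simp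
    moreover have "x \<in> ?W"
      using True that unit_arrow by auto
    ultimately obtain \<phi> U where \<phi>: "\<phi> \<in> Cc X" "U \<subseteq> ?W" "supp_on X \<phi> \<subseteq> U" "\<phi> x = 1" "\<And>h. cmod (\<phi> h) \<le> 1"
      by (rule bump) blast
    \<comment> \<open>Constant on source fibres: multiplication by it scales the fibre over
      \<open>y\<close> by \<open>\<phi> y\<close> and leaves the fibre over \<open>x\<close>
      unchanged.\<close>
    let ?b = "\<lambda>g. if g \<in> topspace X then \<phi> (s g) else 0"
    let ?\<zeta> = "\<lambda>g. ?b g * \<xi> g"
    have \<zeta>: "?\<zeta> \<in> L2 H"
      by (intro Cb_mult_L2 Cb_pullback continuous_source Cc_subset_Cb \<phi> \<xi>)
    have "nrm y ?\<zeta> \<le> nrm x \<xi> + \<epsilon>" for y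
    proof -
      have "nrm y ?\<zeta> = nrm y (\<lambda>g. \<phi> y * \<xi> g)"
        by (rule en_cong) (auto simp: fibre_iff)
      also have "\<dots> = cmod (\<phi> y) * nrm y \<xi>"
        by (rule en_scale)
      also have "\<dots> \<le> nrm x \<xi> + \<epsilon>"
      proof (cases "\<phi> y = 0")
        case True
        then show ?thesis using that by simp
      next
        case False
        then have "nrm y \<xi> < nrm x \<xi> + \<epsilon>"
          using Cc_supp[OF \<phi>(1)] \<phi>(2,3) by auto
        moreover have "cmod (\<phi> y) * nrm y \<xi> \<le> nrm y \<xi>"
          using \<phi>(5)[of y] by (simp add: mult_left_le_one_le)
        ultimately show ?thesis
          by linarith
      qed
      finally show ?thesis .
    qed
    then have "l2norm H ?\<zeta> \<le> nrm x \<xi> + \<epsilon>"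
      using that by (intro l2norm_least[OF \<zeta>]) auto
    then have "opnorm H T * l2norm H ?\<zeta> \<le> opnorm H T * (nrm x \<xi> + \<epsilon>)"
      by (rule mult_left_mono[OF _ opnorm_nonneg[OF T]])
    moreover have "nrm x (T \<xi>) = nrm x (T ?\<zeta>)"
      using \<phi>(4) by (intro en_cong fibre_local[OF T \<xi> \<zeta>, of x]) (auto simp: fibre_iff)
    ultimately show ?thesis
      using nrm_le_l2norm[OF adjointable_L2[OF T \<zeta>], of x] l2norm_le_opnorm[OF T \<zeta>] by linarith
  qed
  show ?thesis
  proof (rule field_le_epsilon)
    fix e :: real assume "e > 0"
    have "nrm x (T \<xi>) \<le> opnorm H T * (nrm x \<xi> + e / (opnorm H T + 1))"
      using bound[of "e / (opnorm H T + 1)"] \<open>e > 0\<close> opnorm_nonneg[OF T] by simp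
    also have "\<dots> = opnorm H T * nrm x \<xi> + opnorm H T / (opnorm H T + 1) * e"
      by (simp add: distrib_left)
    also have "\<dots> \<le> opnorm H T * nrm x \<xi> + 1 * e"
      using \<open>e > 0\<close> opnorm_nonneg[OF T] by (intro add_left_mono mult_right_mono) auto
    finally show "nrm x (T \<xi>) \<le> opnorm H T * nrm x \<xi> + e" by simp
  qed
qed simp

lemma opnorm_least:
  assumes "\<And>\<xi>. \<xi> \<in> L2 H \<Longrightarrow> T \<xi> \<in> L2 H" "0 \<le> C" "\<And>\<xi> x. \<xi> \<in> L2 H \<Longrightarrow> nrm x (T \<xi>) \<le> C * nrm x \<xi>"
  shows "opnorm H T \<le> C"
  unfolding opnorm_def
proof (rule cSUP_least)
  show "{\<xi> \<in> L2 H. l2norm H \<xi> \<le> 1} \<noteq> {}"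
    using L2_zero l2norm_zero by (metis (mono_tags, lifting) emptyE mem_Collect_eq zero_le_one)
  fix \<xi> assume \<xi>: "\<xi> \<in> {\<xi> \<in> L2 H. l2norm H \<xi> \<le> 1}"
  show "l2norm H (T \<xi>) \<le> C"
  proof (rule l2norm_least)
    fix x
    have "nrm x \<xi> \<le> 1"
      using nrm_le_l2norm[of \<xi> x] \<xi> by auto
    then have "C * nrm x \<xi> \<le> C * 1"
      using assms(2) by (rule mult_left_mono)
    then show "nrm x (T \<xi>) \<le> C"
      using assms(3)[of \<xi> x] \<xi> by auto
  qed (use assms \<xi> in auto)
qed

end

section \<open>Algebras of adjointable operators\<close>

context etale
begin

lemma adjointableI:
  assumes "\<And>\<xi>. \<xi> \<in> L2 H \<Longrightarrow> T \<xi> \<in> L2 H" "\<And>\<xi>. \<xi> \<notin> L2 H \<Longrightarrow> T \<xi> = (\<lambda>_. 0)"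
    "\<And>\<xi>. \<xi> \<in> L2 H \<Longrightarrow> S \<xi> \<in> L2 H" "\<And>\<xi>. \<xi> \<notin> L2 H \<Longrightarrow> S \<xi> = (\<lambda>_. 0)"
    "\<And>\<xi> \<eta> x. \<xi> \<in> L2 H \<Longrightarrow> \<eta> \<in> L2 H \<Longrightarrow> l2inner H \<eta> (T \<xi>) x = l2inner H (S \<eta>) \<xi> x"
  shows "T \<in> adjointable H" "adj H T = S"
proof -
  have "is_adjoint H T S"
    using assms by (auto simp: is_adjoint_def)
  then show "T \<in> adjointable H"
    using assms by (auto simp: adjointable_def)
  then show "adj H T = S"
    using adj_eqI \<open>is_adjoint H T S\<close> by blast
qed

lemma adjointable_zero: "(\<lambda>_ _. 0) \<in> adjointable H" "adj H (\<lambda>_ _. 0) = (\<lambda>_ _. 0)"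
  by (rule adjointableI[where S = "\<lambda>_ _. 0"]; simp add: l2inner_def)+

lemma adjointable_add:
  assumes S: "S \<in> adjointable H" and T: "T \<in> adjointable H"
  shows "(\<lambda>\<xi> g. S \<xi> g + T \<xi> g) \<in> adjointable H"
    "adj H (\<lambda>\<xi> g. S \<xi> g + T \<xi> g) = (\<lambda>\<xi> g. adj H S \<xi> g + adj H T \<xi> g)"
proof -
  note L = adjointable_L2[OF S] adjointable_L2[OF T] adjointable_L2[OF adj_adjointable[OF S]]
    adjointable_L2[OF adj_adjointable[OF T]]
  have *: "l2inner H \<eta> (\<lambda>g. S \<xi> g + T \<xi> g) x = l2inner H (\<lambda>g. adj H S \<eta> g + adj H T \<eta> g) \<xi> x"
    if "\<xi> \<in> L2 H" "\<eta> \<in> L2 H" for \<xi> \<eta> x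
    using that by (simp add: l2inner_add_right l2inner_add_left L2_sqs L adj_inner S T)
  show "(\<lambda>\<xi> g. S \<xi> g + T \<xi> g) \<in> adjointable H"
    "adj H (\<lambda>\<xi> g. S \<xi> g + T \<xi> g) = (\<lambda>\<xi> g. adj H S \<xi> g + adj H T \<xi> g)"
    by (rule adjointableI[where S = "\<lambda>\<xi> g. adj H S \<xi> g + adj H T \<xi> g"];
        simp add: L2_add L * adjointable_outside S T adj_adjointable)+
qed

lemma adjointable_scale:
  assumes T: "T \<in> adjointable H"
  shows "(\<lambda>\<xi> g. c * T \<xi> g) \<in> adjointable H"
    "adj H (\<lambda>\<xi> g. c * T \<xi> g) = (\<lambda>\<xi> g. cnj c * adj H T \<xi> g)"
proof -
  note L = adjointable_L2[OF T] adjointable_L2[OF adj_adjointable[OF T]]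
  have *: "l2inner H \<eta> (\<lambda>g. c * T \<xi> g) x = l2inner H (\<lambda>g. cnj c * adj H T \<eta> g) \<xi> x"
    if "\<xi> \<in> L2 H" "\<eta> \<in> L2 H" for \<xi> \<eta> x
    using that by (simp add: l2inner_scale_right l2inner_scale_left adj_inner T)
  show "(\<lambda>\<xi> g. c * T \<xi> g) \<in> adjointable H"
    "adj H (\<lambda>\<xi> g. c * T \<xi> g) = (\<lambda>\<xi> g. cnj c * adj H T \<xi> g)"
    by (rule adjointableI[where S = "\<lambda>\<xi> g. cnj c * adj H T \<xi> g"];
        simp add: L2_scale L * adjointable_outside T adj_adjointable)+
qed

lemma adjointable_diff:
  assumes "S \<in> adjointable H" "T \<in> adjointable H"
  shows "(\<lambda>\<xi> g. S \<xi> g - T \<xi> g) \<in> adjointable H"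
    "adj H (\<lambda>\<xi> g. S \<xi> g - T \<xi> g) = (\<lambda>\<xi> g. adj H S \<xi> g - adj H T \<xi> g)"
  using adjointable_add[OF assms(1) adjointable_scale(1)[OF assms(2), of "-1"]] adjointable_scale(2)[OF assms(2), of "-1"]
  by simp_all

lemma adjointable_comp:
  assumes S: "S \<in> adjointable H" and T: "T \<in> adjointable H"
  shows "S \<circ> T \<in> adjointable H" "adj H (S \<circ> T) = adj H T \<circ> adj H S"
proof -
  note L = adjointable_L2[OF S] adjointable_L2[OF T] adjointable_L2[OF adj_adjointable[OF S]]
    adjointable_L2[OF adj_adjointable[OF T]]
  show "S \<circ> T \<in> adjointable H" "adj H (S \<circ> T) = adj H T \<circ> adj H S"
    by (rule adjointableI[where S = "adj H T \<circ> adj H S"];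
        simp add: L adj_inner S T adjointable_outside adj_adjointable adjointable_zero_vector)+
qed

text \<open>\<open>near S T c\<close> says that \<open>S - T\<close> has operator norm at most \<open>c\<close>, phrased fibrewise.\<close>

definition near :: "('a, 'a) oper \<Rightarrow> ('a, 'a) oper \<Rightarrow> real \<Rightarrow> bool" where
  "near S T c \<longleftrightarrow> (\<forall>\<xi>\<in>L2 H. \<forall>x. nrm x (\<lambda>g. S \<xi> g - T \<xi> g) \<le> c * nrm x \<xi>)"

lemma nearD: "near S T c \<Longrightarrow> \<xi> \<in> L2 H \<Longrightarrow> nrm x (\<lambda>g. S \<xi> g - T \<xi> g) \<le> c * nrm x \<xi>"
  by (simp add: near_def)

lemma near_opnorm:
  assumes "S \<in> adjointable H" "T \<in> adjointable H"
  shows "near S T (opnorm H (\<lambda>\<xi> g. S \<xi> g - T \<xi> g))"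
    "0 \<le> c \<Longrightarrow> near S T c \<Longrightarrow> opnorm H (\<lambda>\<xi> g. S \<xi> g - T \<xi> g) \<le> c"
  unfolding near_def using opnorm_fibre[OF adjointable_diff(1)[OF assms]]
    opnorm_least[OF adjointable_L2[OF adjointable_diff(1)[OF assms]]] by auto

lemma near_zero_iff:
  assumes "T \<in> adjointable H" "0 \<le> c"
  shows "near T (\<lambda>_ _. 0) c \<longleftrightarrow> opnorm H T \<le> c"
proof
  show "opnorm H T \<le> c" if "near T (\<lambda>_ _. 0) c"
    using near_opnorm(2)[OF assms(1) adjointable_zero(1) assms(2) that] by simp
  show "near T (\<lambda>_ _. 0) c" if "opnorm H T \<le> c"
    unfolding near_def
  proof (intro ballI allI)
    fix \<xi> x assume "\<xi> \<in> L2 H"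
    then show "nrm x (\<lambda>g. T \<xi> g - 0) \<le> c * nrm x \<xi>"
      using opnorm_fibre[OF assms(1), of \<xi> x] mult_right_mono[OF that en_nonneg, of "fibre H x" \<xi>] by simp
  qed
qed

lemma near_mono: "near S T c \<Longrightarrow> c \<le> d \<Longrightarrow> near S T d"
  unfolding near_def by (meson en_nonneg mult_right_mono order_trans)

lemma near_sym: "near S T c \<Longrightarrow> near T S c"
  unfolding near_def by (metis en_diff_commute)

lemma near_trans:
  assumes "near S T c" "near T R d" "S \<in> adjointable H" "T \<in> adjointable H" "R \<in> adjointable H"
  shows "near S R (c + d)"
  unfolding near_def
proof (intro ballI allI)
  fix \<xi> x assume \<xi>: "\<xi> \<in> L2 H"
  have "nrm x (\<lambda>g. S \<xi> g - R \<xi> g) \<le> nrm x (\<lambda>g. S \<xi> g - T \<xi> g) + nrm x (\<lambda>g. T \<xi> g - R \<xi> g)"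
    using assms(3-5) \<xi> by (intro en_triangle L2_sqs L2_diff) (simp_all add: adjointable_L2)
  then show "nrm x (\<lambda>g. S \<xi> g - R \<xi> g) \<le> (c + d) * nrm x \<xi>"
    using nearD[OF assms(1) \<xi>, of x] nearD[OF assms(2) \<xi>, of x] by (simp add: distrib_right)
qed

lemma near_add:
  assumes "near S S' c" "near T T' d" "S \<in> adjointable H" "T \<in> adjointable H" "S' \<in> adjointable H" "T' \<in> adjointable H"
  shows "near (\<lambda>\<xi> g. S \<xi> g + T \<xi> g) (\<lambda>\<xi> g. S' \<xi> g + T' \<xi> g) (c + d)"
  unfolding near_def
proof (intro ballI allI)
  fix \<xi> x assume \<xi>: "\<xi> \<in> L2 H"
  have "nrm x (\<lambda>g. (S \<xi> g - S' \<xi> g) + (T \<xi> g - T' \<xi> g)) \<le> nrm x (\<lambda>g. S \<xi> g - S' \<xi> g) + nrm x (\<lambda>g. T \<xi> g - T' \<xi> g)"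
    using assms(3-6) \<xi> by (intro en_add L2_sqs L2_diff) (simp_all add: adjointable_L2)
  moreover have "(\<lambda>g. (S \<xi> g - S' \<xi> g) + (T \<xi> g - T' \<xi> g)) = (\<lambda>g. S \<xi> g + T \<xi> g - (S' \<xi> g + T' \<xi> g))"
    by auto
  ultimately show "nrm x (\<lambda>g. S \<xi> g + T \<xi> g - (S' \<xi> g + T' \<xi> g)) \<le> (c + d) * nrm x \<xi>"
    using nearD[OF assms(1) \<xi>, of x] nearD[OF assms(2) \<xi>, of x] by (simp add: distrib_right)
qed

lemma near_scale:
  assumes "near S T c"
  shows "near (\<lambda>\<xi> g. a * S \<xi> g) (\<lambda>\<xi> g. a * T \<xi> g) (cmod a * c)"
  unfolding near_def
proof (intro ballI allI)
  fix \<xi> x assume \<xi>: "\<xi> \<in> L2 H"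
  have "nrm x (\<lambda>g. a * S \<xi> g - a * T \<xi> g) = cmod a * nrm x (\<lambda>g. S \<xi> g - T \<xi> g)"
    by (simp add: en_scale flip: right_diff_distrib)
  also have "\<dots> \<le> cmod a * (c * nrm x \<xi>)"
    by (rule mult_left_mono[OF nearD[OF assms \<xi>]]) simp
  finally show "nrm x (\<lambda>g. a * S \<xi> g - a * T \<xi> g) \<le> cmod a * c * nrm x \<xi>"
    by simp
qed

lemma near_comp_left:
  assumes "near S T c" "R \<in> adjointable H" "S \<in> adjointable H" "T \<in> adjointable H"
  shows "near (R \<circ> S) (R \<circ> T) (opnorm H R * c)"
  unfolding near_def
proof (intro ballI allI)
  fix \<xi> x assume \<xi>: "\<xi> \<in> L2 H"
  have L: "S \<xi> \<in> L2 H" "T \<xi> \<in> L2 H"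
    using assms \<xi> adjointable_L2 by auto
  have "nrm x (R (\<lambda>g. S \<xi> g - T \<xi> g)) \<le> opnorm H R * nrm x (\<lambda>g. S \<xi> g - T \<xi> g)"
    by (intro opnorm_fibre assms L2_diff L)
  also have "\<dots> \<le> opnorm H R * (c * nrm x \<xi>)"
    by (rule mult_left_mono[OF nearD[OF assms(1) \<xi>] opnorm_nonneg[OF assms(2)]])
  finally show "nrm x (\<lambda>g. (R \<circ> S) \<xi> g - (R \<circ> T) \<xi> g) \<le> opnorm H R * c * nrm x \<xi>"
    using adjointable_linear(3)[OF assms(2) L] by simp
qed

lemma near_comp_right:
  assumes "near S T c" "R \<in> adjointable H" "0 \<le> c"
  shows "near (S \<circ> R) (T \<circ> R) (c * opnorm H R)"
  unfolding near_def
proof (intro ballI allI)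
  fix \<xi> x assume \<xi>: "\<xi> \<in> L2 H"
  have "nrm x (\<lambda>g. (S \<circ> R) \<xi> g - (T \<circ> R) \<xi> g) \<le> c * nrm x (R \<xi>)"
    using nearD[OF assms(1) adjointable_L2[OF assms(2) \<xi>]] by simp
  also have "\<dots> \<le> c * (opnorm H R * nrm x \<xi>)"
    by (intro mult_left_mono opnorm_fibre assms \<xi>)
  finally show "nrm x (\<lambda>g. (S \<circ> R) \<xi> g - (T \<circ> R) \<xi> g) \<le> c * opnorm H R * nrm x \<xi>"
    by simp
qed

text \<open>The squared fibre norm of \<open>adj H T \<xi>\<close> is the pairing of
  \<open>T (adj H T \<xi>)\<close> with \<open>\<xi>\<close>; Cauchy-Schwarz and cancelling one
  factor give the bound on each fibre.\<close>

lemma opnorm_adj: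
  assumes T: "T \<in> adjointable H"
  shows "opnorm H (adj H T) \<le> opnorm H T"
proof (rule opnorm_least)
  show "adj H T \<xi> \<in> L2 H" if "\<xi> \<in> L2 H" for \<xi>
    by (rule adjointable_L2[OF adj_adjointable[OF T] that])
  fix \<xi> x assume \<xi>: "\<xi> \<in> L2 H"
  let ?n = "nrm x (adj H T \<xi>)"
  have S: "adj H T \<xi> \<in> L2 H" and TS: "T (adj H T \<xi>) \<in> L2 H"
    using adjointable_L2 adj_adjointable T \<xi> by auto
  have "complex_of_real (?n\<^sup>2) = l2inner H (T (adj H T \<xi>)) \<xi> x"
    using l2inner_self[OF L2_sqs[OF S], of x] adj_inner'[OF T \<xi> S, of x] by simp
  then have "?n\<^sup>2 = cmod (l2inner H (T (adj H T \<xi>)) \<xi> x)"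
    by (metis abs_of_nonneg norm_of_real zero_le_power2)
  also have "\<dots> \<le> nrm x (T (adj H T \<xi>)) * nrm x \<xi>"
    by (intro l2inner_Cauchy_Schwarz L2_sqs TS \<xi>)
  also have "\<dots> \<le> opnorm H T * ?n * nrm x \<xi>"
    by (intro mult_right_mono opnorm_fibre T S) simp
  finally have "?n * ?n \<le> (opnorm H T * nrm x \<xi>) * ?n"
    by (simp add: power2_eq_square ac_simps)
  then show "?n \<le> opnorm H T * nrm x \<xi>"
    using opnorm_nonneg[OF T] en_nonneg[of "fibre H x" "adj H T \<xi>"] en_nonneg[of "fibre H x" \<xi>]
    by (cases "?n = 0") (simp_all add: mult_le_cancel_right)
qed (use opnorm_nonneg[OF T] in auto)

lemma near_adj:
  assumes "near S T c" "S \<in> adjointable H" "T \<in> adjointable H" "0 \<le> c"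
  shows "near (adj H S) (adj H T) c"
proof -
  have "opnorm H (\<lambda>\<xi> g. adj H S \<xi> g - adj H T \<xi> g) \<le> opnorm H (\<lambda>\<xi> g. S \<xi> g - T \<xi> g)"
    using opnorm_adj[OF adjointable_diff(1)[OF assms(2,3)]] adjointable_diff(2)[OF assms(2,3)] by simp
  also have "\<dots> \<le> c"
    by (rule near_opnorm(2)[OF assms(2,3,4,1)])
  finally show ?thesis
    using near_mono[OF near_opnorm(1)[OF adj_adjointable[OF assms(2)] adj_adjointable[OF assms(3)]]] by blast
qed

text \<open>The squared fibre norm of \<open>T \<xi>\<close> is the pairing of
  \<open>adj H T (T \<xi>)\<close> with \<open>\<xi>\<close>. This direction of the C*-identity
  reduces norm estimates to self-adjoint operators.\<close>

lemma opnorm_C_star: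
  assumes T: "T \<in> adjointable H"
  shows "(opnorm H T)\<^sup>2 \<le> opnorm H (adj H T \<circ> T)"
proof -
  have TT: "adj H T \<circ> T \<in> adjointable H"
    by (intro adjointable_comp adj_adjointable T)
  have "opnorm H T \<le> sqrt (opnorm H (adj H T \<circ> T))"
  proof (rule opnorm_least)
    fix \<xi> x assume \<xi>: "\<xi> \<in> L2 H"
    have L: "T \<xi> \<in> L2 H" "adj H T (T \<xi>) \<in> L2 H"
      using adjointable_L2 adj_adjointable T \<xi> by auto
    have "complex_of_real ((nrm x (T \<xi>))\<^sup>2) = l2inner H (adj H T (T \<xi>)) \<xi> x"
      using l2inner_self[OF L2_sqs[OF L(1)], of x] adj_inner[OF T \<xi> L(1), of x] by simp
    then have "(nrm x (T \<xi>))\<^sup>2 = cmod (l2inner H (adj H T (T \<xi>)) \<xi> x)"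
      by (metis abs_of_nonneg norm_of_real zero_le_power2)
    also have "\<dots> \<le> nrm x ((adj H T \<circ> T) \<xi>) * nrm x \<xi>"
      using L \<xi> by (auto intro!: l2inner_Cauchy_Schwarz L2_sqs)
    also have "\<dots> \<le> (opnorm H (adj H T \<circ> T) * nrm x \<xi>) * nrm x \<xi>"
      by (intro mult_right_mono opnorm_fibre TT \<xi>) simp
    finally have "nrm x (T \<xi>) \<le> sqrt (opnorm H (adj H T \<circ> T) * (nrm x \<xi>)\<^sup>2)"
      by (intro real_le_rsqrt) (simp add: power2_eq_square ac_simps)
    then show "nrm x (T \<xi>) \<le> sqrt (opnorm H (adj H T \<circ> T)) * nrm x \<xi>"
      by (simp add: real_sqrt_mult)
  qed (use opnorm_nonneg[OF TT] adjointable_L2[OF T] in auto)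
  then have "(opnorm H T)\<^sup>2 \<le> (sqrt (opnorm H (adj H T \<circ> T)))\<^sup>2"
    using opnorm_nonneg[OF T] by (rule power_mono)
  then show ?thesis
    using opnorm_nonneg[OF TT] by simp
qed

text \<open>Evaluation at an arrow is dominated by the fibre norm. Identities between operators are
  carried to norm limits in this way, and limits are seen to be unique.\<close>

lemma near_pointwise:
  assumes S: "S \<in> adjointable H" and T: "\<And>n. T n \<in> adjointable H"
    and near: "\<And>n::nat. near S (T n) (c n)" and c: "c \<longlonglongrightarrow> 0"
    and \<xi>: "\<xi> \<in> L2 H"
  shows "(\<lambda>n. T n \<xi> g) \<longlonglongrightarrow> S \<xi> g"
proof (cases "g \<in> arrows H")
  case True
  have "norm (T n \<xi> g - S \<xi> g) \<le> c n * nrm (s g) \<xi>" for n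
  proof -
    have "norm (T n \<xi> g - S \<xi> g) = cmod (S \<xi> g - T n \<xi> g)"
      by (simp add: norm_minus_commute)
    also have "\<dots> \<le> nrm (s g) (\<lambda>g. S \<xi> g - T n \<xi> g)"
      by (intro cmod_le_nrm L2_diff adjointable_L2[OF S \<xi>] adjointable_L2[OF T \<xi>] True)
    also have "\<dots> \<le> c n * nrm (s g) \<xi>"
      by (rule nearD[OF near \<xi>])
    finally show ?thesis .
  qed
  moreover have "(\<lambda>n. c n * nrm (s g) \<xi>) \<longlonglongrightarrow> 0"
    using tendsto_mult_right[OF c, of "nrm (s g) \<xi>"] by simp
  ultimately have "(\<lambda>n. T n \<xi> g - S \<xi> g) \<longlonglongrightarrow> 0"
    by (intro Lim_null_comparison[of "\<lambda>n. T n \<xi> g - S \<xi> g"]) auto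
  then show ?thesis
    by (simp add: LIM_zero_iff)
next
  case False
  then show ?thesis
    using L2_zero_outside[OF adjointable_L2[OF S \<xi>]] L2_zero_outside[OF adjointable_L2[OF T \<xi>]] by simp
qed

lemma opnorm_zeroD: "S \<in> adjointable H \<Longrightarrow> T \<in> adjointable H \<Longrightarrow> (\<And>\<epsilon>. \<epsilon> > 0 \<Longrightarrow> near S T \<epsilon>) \<Longrightarrow> S = T"
proof -
  assume S: "S \<in> adjointable H" and T: "T \<in> adjointable H" and near: "\<And>\<epsilon>. \<epsilon> > 0 \<Longrightarrow> near S T \<epsilon>"
  show "S = T"
  proof (rule oper_eqI[OF S T])
    fix \<xi> g assume \<xi>: "\<xi> \<in> L2 H"
    have "(\<lambda>n. T \<xi> g) \<longlonglongrightarrow> S \<xi> g"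
      by (rule near_pointwise[of S "\<lambda>_. T" "\<lambda>n. inverse (real (Suc n))"])
         (use S T near \<xi> LIMSEQ_inverse_real_of_nat in auto)
    then show "S \<xi> g = T \<xi> g"
      by (simp add: LIMSEQ_const_iff)
  qed
qed

text \<open>A pointwise limit need not come with an adjoint, so the adjoints are taken to their
  limit in parallel: \<open>near_adj\<close> gives them the same rate, and the adjoint relation
  passes to the limit.\<close>

lemma op_geometric_limit:
  assumes T: "\<And>n. T n \<in> adjointable H" and step: "\<And>n. near (T (Suc n)) (T n) (K * q ^ n)"
    and K: "0 \<le> K" and q: "0 \<le> q" "q < 1"
  obtains S where "S \<in> adjointable H" "\<And>n. near S (T n) (K * q ^ n / (1 - q))"
proof -
  \<comment> \<open>The fibre-dependent constant of \<open>L2_geometric_limit\<close> is taken to be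
    \<open>K * nrm x \<xi>\<close>, which turns its conclusion into a \<open>near\<close>
    estimate.\<close>
  have ex: "\<exists>\<zeta>. \<zeta> \<in> L2 H \<and> (\<forall>n x. nrm x (\<lambda>g. \<zeta> g - T n \<xi> g) \<le> K * nrm x \<xi> * q ^ n / (1 - q))"
    if \<xi>: "\<xi> \<in> L2 H" and T: "\<And>n. T n \<in> adjointable H" and step: "\<And>n. near (T (Suc n)) (T n) (K * q ^ n)" for \<xi> T
  proof -
    have "nrm x (\<lambda>g. T (Suc n) \<xi> g - T n \<xi> g) \<le> (K * nrm x \<xi>) * q ^ n" for n x
      using nearD[OF step \<xi>] by (simp add: ac_simps)
    moreover have "K * nrm x \<xi> \<le> K * l2norm H \<xi>" for x
      by (rule mult_left_mono[OF nrm_le_l2norm[OF \<xi>] K])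
    ultimately show ?thesis
      using L2_geometric_limit[of "\<lambda>n. T n \<xi>" "\<lambda>x. K * nrm x \<xi>" q "K * l2norm H \<xi>"]
        adjointable_L2[OF T \<xi>] q by metis
  qed
  have "\<exists>S. (\<forall>\<xi>. \<xi> \<notin> L2 H \<longrightarrow> S \<xi> = (\<lambda>_. 0)) \<and> (\<forall>\<xi>\<in>L2 H. S \<xi> \<in> L2 H) \<and> (\<forall>n. near S (T n) (K * q ^ n / (1 - q)))"
    if T: "\<And>n. T n \<in> adjointable H" and step: "\<And>n. near (T (Suc n)) (T n) (K * q ^ n)" for T
  proof -
    have "\<forall>\<xi>. \<exists>\<zeta>. \<xi> \<in> L2 H \<longrightarrow> \<zeta> \<in> L2 H \<and> (\<forall>n x. nrm x (\<lambda>g. \<zeta> g - T n \<xi> g) \<le> K * nrm x \<xi> * q ^ n / (1 - q))"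
      using ex[OF _ T step] by blast
    from choice[OF this] obtain S where S: "\<And>\<xi>. \<xi> \<in> L2 H \<Longrightarrow> S \<xi> \<in> L2 H"
        "\<And>\<xi> n x. \<xi> \<in> L2 H \<Longrightarrow> nrm x (\<lambda>g. S \<xi> g - T n \<xi> g) \<le> K * nrm x \<xi> * q ^ n / (1 - q)"
      by blast
    show ?thesis
      using S by (intro exI[of _ "\<lambda>\<xi>. if \<xi> \<in> L2 H then S \<xi> else (\<lambda>_. 0)"]) (auto simp: near_def ac_simps)
  qed note lim = this
  obtain S where S: "\<And>\<xi>. \<xi> \<notin> L2 H \<Longrightarrow> S \<xi> = (\<lambda>_. 0)" "\<And>\<xi>. \<xi> \<in> L2 H \<Longrightarrow> S \<xi> \<in> L2 H"
      "\<And>n. near S (T n) (K * q ^ n / (1 - q))"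
    using lim[OF T step] by blast
  have adjstep: "near (adj H (T (Suc n))) (adj H (T n)) (K * q ^ n)" for n
    using near_adj[OF step T T] K q by simp
  obtain R where R: "\<And>\<xi>. \<xi> \<notin> L2 H \<Longrightarrow> R \<xi> = (\<lambda>_. 0)" "\<And>\<xi>. \<xi> \<in> L2 H \<Longrightarrow> R \<xi> \<in> L2 H"
      "\<And>n. near R (adj H (T n)) (K * q ^ n / (1 - q))"
    using lim[of "\<lambda>n. adj H (T n)", OF adj_adjointable[OF T] adjstep] by blast
  have conv: "(\<lambda>n. K * q ^ n / (1 - q) * c) \<longlonglongrightarrow> 0" for c
  proof -
    have "(\<lambda>n. K * q ^ n / (1 - q) * c) \<longlonglongrightarrow> K * 0 / (1 - q) * c"
      using q by (intro tendsto_intros LIMSEQ_power_zero) auto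
    then show ?thesis by simp
  qed
  have lim_inner: "(\<lambda>n. l2inner H \<eta> (A n \<xi>) x) \<longlonglongrightarrow> l2inner H \<eta> (B \<xi>) x"
    if A: "\<And>n. A n \<xi> \<in> L2 H" "B \<xi> \<in> L2 H" "\<And>n. near B (A n) (K * q ^ n / (1 - q))" and L: "\<xi> \<in> L2 H" "\<eta> \<in> L2 H" for \<xi> \<eta> x A B
  proof -
    have "norm (l2inner H \<eta> (A n \<xi>) x - l2inner H \<eta> (B \<xi>) x) \<le> K * q ^ n / (1 - q) * (nrm x \<xi> * nrm x \<eta>)" for n
    proof -
      have "norm (l2inner H \<eta> (A n \<xi>) x - l2inner H \<eta> (B \<xi>) x) = cmod (l2inner H \<eta> (\<lambda>g. B \<xi> g - A n \<xi> g) x)"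
        by (simp add: l2inner_diff_right L2_sqs A L norm_minus_commute)
      also have "\<dots> \<le> nrm x \<eta> * nrm x (\<lambda>g. B \<xi> g - A n \<xi> g)"
        by (intro l2inner_Cauchy_Schwarz L2_sqs L2_diff A L)
      also have "\<dots> \<le> nrm x \<eta> * (K * q ^ n / (1 - q) * nrm x \<xi>)"
        by (intro mult_left_mono nearD A L) simp
      finally show ?thesis
        by (simp add: ac_simps)
    qed
    then have "(\<lambda>n. l2inner H \<eta> (A n \<xi>) x - l2inner H \<eta> (B \<xi>) x) \<longlonglongrightarrow> 0"
      by (intro Lim_null_comparison[OF always_eventually conv[of "nrm x \<xi> * nrm x \<eta>"]] allI)
    then show ?thesis
      by (simp add: LIM_zero_iff)
  qed
  have "l2inner H \<eta> (S \<xi>) x = l2inner H (R \<eta>) \<xi> x" if L: "\<xi> \<in> L2 H" "\<eta> \<in> L2 H" for \<xi> \<eta> x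
  proof -
    have "(\<lambda>n. l2inner H \<eta> (T n \<xi>) x) \<longlonglongrightarrow> l2inner H \<eta> (S \<xi>) x"
      by (rule lim_inner) (use S L adjointable_L2[OF T] in auto)
    moreover have "(\<lambda>n. cnj (l2inner H \<xi> (adj H (T n) \<eta>) x)) \<longlonglongrightarrow> cnj (l2inner H \<xi> (R \<eta>) x)"
      by (intro tendsto_cnj lim_inner) (use R L adjointable_L2[OF adj_adjointable[OF T]] in auto)
    moreover have "cnj (l2inner H \<xi> (adj H (T n) \<eta>) x) = l2inner H \<eta> (T n \<xi>) x" for n
      using adj_inner'[OF T L(2,1)] by (simp add: l2inner_cnj)
    ultimately show ?thesis
      using LIMSEQ_unique by (auto simp: l2inner_cnj)
  qed
  then have "S \<in> adjointable H"
    by (intro adjointableI(1)[where S = R] S R)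
  then show thesis
    using that S(3) by blast
qed

text \<open>The algebraic part of \<open>cstar_subalgebra\<close>, split off so that passing to the
  closure can be handled once for all algebras below.\<close>

definition star_algebra :: "('a, 'a) oper set \<Rightarrow> bool" where
  "star_algebra B \<longleftrightarrow> B \<subseteq> adjointable H \<and> (\<lambda>_ _. 0) \<in> B \<and>
     (\<forall>S\<in>B. \<forall>T\<in>B. (\<lambda>\<xi> g. S \<xi> g + T \<xi> g) \<in> B \<and> S \<circ> T \<in> B) \<and>
     (\<forall>c. \<forall>T\<in>B. (\<lambda>\<xi> g. c * T \<xi> g) \<in> B) \<and> (\<forall>T\<in>B. adj H T \<in> B)"

lemma cstar_subalgebra_iff: "cstar_subalgebra H B \<longleftrightarrow> star_algebra B \<and> op_closure H B \<subseteq> B"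
  by (auto simp: cstar_subalgebra_def star_algebra_def)

lemma op_closure_iff:
  assumes "B \<subseteq> adjointable H"
  shows "T \<in> op_closure H B \<longleftrightarrow> T \<in> adjointable H \<and> (\<forall>\<epsilon>>0. \<exists>S\<in>B. near T S \<epsilon>)"
proof
  assume T: "T \<in> op_closure H B"
  then have T': "T \<in> adjointable H"
    by (simp add: op_closure_def)
  have "\<exists>S\<in>B. near T S \<epsilon>" if "\<epsilon> > 0" for \<epsilon>
  proof -
    obtain S where S: "S \<in> B" "opnorm H (\<lambda>\<xi> g. T \<xi> g - S \<xi> g) < \<epsilon>"
      using T \<open>\<epsilon> > 0\<close> unfolding op_closure_def by blast
    then have "near T S \<epsilon>"
      using near_mono[OF near_opnorm(1)[OF T']] assms by (meson less_imp_le subsetD)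
    then show ?thesis using S(1) by blast
  qed
  then show "T \<in> adjointable H \<and> (\<forall>\<epsilon>>0. \<exists>S\<in>B. near T S \<epsilon>)"
    using T' by blast
next
  assume T: "T \<in> adjointable H \<and> (\<forall>\<epsilon>>0. \<exists>S\<in>B. near T S \<epsilon>)"
  have "\<exists>S\<in>B. opnorm H (\<lambda>\<xi> g. T \<xi> g - S \<xi> g) < \<epsilon>" if e: "\<epsilon> > 0" for \<epsilon>
  proof -
    \<comment> \<open>Halved because \<open>near\<close> yields a weak inequality for
      \<open>opnorm\<close>, whereas \<open>op_closure\<close> asks for a strict one.\<close>
    obtain S where S: "S \<in> B" "near T S (\<epsilon> / 2)"
      using T e half_gt_zero by blast
    then have "opnorm H (\<lambda>\<xi> g. T \<xi> g - S \<xi> g) \<le> \<epsilon> / 2"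
      using near_opnorm(2)[of T S "\<epsilon> / 2"] assms e T by auto
    then show ?thesis
      using S(1) e by (intro bexI[of _ S]) auto
  qed
  then show "T \<in> op_closure H B"
    using T by (auto simp: op_closure_def)
qed

lemma op_closure_adjointable: "op_closure H B \<subseteq> adjointable H"
  by (auto simp: op_closure_def)

lemma op_closure_superset: "B \<subseteq> adjointable H \<Longrightarrow> B \<subseteq> op_closure H B"
proof
  fix T assume "B \<subseteq> adjointable H" "T \<in> B"
  moreover have "near T T \<epsilon>" if "\<epsilon> > 0" for \<epsilon>
    using that by (simp add: near_def)
  ultimately show "T \<in> op_closure H B"
    using op_closure_iff by blast
qed

lemma op_closure_mono: "B \<subseteq> C \<Longrightarrow> op_closure H B \<subseteq> op_closure H C"
  by (fastforce simp: op_closure_def)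

lemma op_closure_idem:
  assumes B: "B \<subseteq> adjointable H"
  shows "op_closure H (op_closure H B) \<subseteq> op_closure H B"
proof
  fix T assume "T \<in> op_closure H (op_closure H B)"
  then have T: "T \<in> adjointable H" "\<And>\<epsilon>. \<epsilon> > 0 \<Longrightarrow> \<exists>S\<in>op_closure H B. near T S \<epsilon>"
    using op_closure_iff[OF op_closure_adjointable] by auto
  have "\<exists>S\<in>B. near T S \<epsilon>" if e: "\<epsilon> > 0" for \<epsilon>
  proof -
    obtain S where S: "S \<in> op_closure H B" "near T S (\<epsilon> / 2)"
      using T(2) e half_gt_zero by blast
    then obtain R where R: "R \<in> B" "near S R (\<epsilon> / 2)"
      using op_closure_iff[OF B] e half_gt_zero by blast
    have "near T R (\<epsilon> / 2 + \<epsilon> / 2)"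
      using S R T(1) B op_closure_adjointable by (intro near_trans[of T S _ R]) auto
    then show ?thesis
      using R(1) by auto
  qed
  then show "T \<in> op_closure H B"
    using T(1) op_closure_iff[OF B] by blast
qed

lemma cstar_subalgebra_closure:
  assumes B: "star_algebra B"
  shows "cstar_subalgebra H (op_closure H B)"
proof -
  have sub: "B \<subseteq> adjointable H"
    using B by (simp add: star_algebra_def)
  note iff = op_closure_iff[OF sub]
  have "star_algebra (op_closure H B)"
    unfolding star_algebra_def
  proof (intro conjI ballI allI)
    show "op_closure H B \<subseteq> adjointable H"
      by (rule op_closure_adjointable)
    show "(\<lambda>_ _. 0) \<in> op_closure H B"
      using op_closure_superset[OF sub] B by (auto simp: star_algebra_def)
  next
    fix S T assume "S \<in> op_closure H B" "T \<in> op_closure H B"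
    then have S: "S \<in> adjointable H" "\<And>\<epsilon>. \<epsilon> > 0 \<Longrightarrow> \<exists>R\<in>B. near S R \<epsilon>"
        and T: "T \<in> adjointable H" "\<And>\<epsilon>. \<epsilon> > 0 \<Longrightarrow> \<exists>R\<in>B. near T R \<epsilon>"
      by (auto simp: iff)
    show "(\<lambda>\<xi> g. S \<xi> g + T \<xi> g) \<in> op_closure H B"
      unfolding iff
    proof (intro conjI allI impI)
      fix \<epsilon> :: real assume e: "\<epsilon> > 0"
      obtain S' T' where R: "S' \<in> B" "near S S' (\<epsilon> / 2)" "T' \<in> B" "near T T' (\<epsilon> / 2)"
        using S(2)[of "\<epsilon> / 2"] T(2)[of "\<epsilon> / 2"] e by auto
      then have "near (\<lambda>\<xi> g. S \<xi> g + T \<xi> g) (\<lambda>\<xi> g. S' \<xi> g + T' \<xi> g) (\<epsilon> / 2 + \<epsilon> / 2)"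
        using S T sub by (intro near_add) auto
      then show "\<exists>R\<in>B. near (\<lambda>\<xi> g. S \<xi> g + T \<xi> g) R \<epsilon>"
        using R B by (auto simp: star_algebra_def)
    qed (rule adjointable_add(1)[OF S(1) T(1)])
    show "S \<circ> T \<in> op_closure H B"
      unfolding iff
    proof (intro conjI allI impI)
      fix \<epsilon> :: real assume e: "\<epsilon> > 0"
      \<comment> \<open>The product is approximated one factor at a time. The second factor comes
        first, since the tolerance \<open>b\<close> for the first one depends on the norm of the
        chosen \<open>T'\<close>.\<close>
      define a where "a = \<epsilon> / (2 * (opnorm H S + 1))"
      have n: "0 \<le> opnorm H S" "0 \<le> opnorm H T"
        using opnorm_nonneg S T by auto
      then have a: "a > 0" "opnorm H S * a \<le> \<epsilon> / 2"
        using e by (auto simp: a_def field_simps)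
      obtain T' where T': "T' \<in> B" "near T T' a"
        using T(2) a(1) by blast
      define b where "b = \<epsilon> / (2 * (opnorm H T' + 1))"
      have n': "0 \<le> opnorm H T'"
        using opnorm_nonneg T' sub by auto
      then have b: "b > 0" "b * opnorm H T' \<le> \<epsilon> / 2"
        using e by (auto simp: b_def field_simps)
      obtain S' where S': "S' \<in> B" "near S S' b"
        using S(2) b(1) by blast
      have adjs: "S' \<in> adjointable H" "T' \<in> adjointable H"
        using S' T' sub by auto
      have "near (S \<circ> T) (S \<circ> T') (\<epsilon> / 2)"
        by (rule near_mono[OF near_comp_left[OF T'(2) S(1) T(1) adjs(2)] a(2)])
      moreover have "near (S \<circ> T') (S' \<circ> T') (\<epsilon> / 2)"
        using b(1) by (intro near_mono[OF near_comp_right[OF S'(2) adjs(2)] b(2)]) simp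
      ultimately have "near (S \<circ> T) (S' \<circ> T') (\<epsilon> / 2 + \<epsilon> / 2)"
        by (rule near_trans) (intro adjointable_comp S T adjs)+
      then show "\<exists>R\<in>B. near (S \<circ> T) R \<epsilon>"
        using S'(1) T'(1) B by (auto simp: star_algebra_def)
    qed (rule adjointable_comp(1)[OF S(1) T(1)])
  next
    fix c T assume "T \<in> op_closure H B"
    then have T: "T \<in> adjointable H" "\<And>\<epsilon>. \<epsilon> > 0 \<Longrightarrow> \<exists>R\<in>B. near T R \<epsilon>"
      by (auto simp: iff)
    show "(\<lambda>\<xi> g. c * T \<xi> g) \<in> op_closure H B"
      unfolding iff
    proof (intro conjI allI impI)
      fix \<epsilon> :: real assume e: "\<epsilon> > 0"
      have "\<epsilon> / (cmod c + 1) > 0"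
        using e by (simp add: add_nonneg_pos)
      then obtain T' where T': "T' \<in> B" "near T T' (\<epsilon> / (cmod c + 1))"
        using T(2) by blast
      have "cmod c * (\<epsilon> / (cmod c + 1)) \<le> (cmod c + 1) * (\<epsilon> / (cmod c + 1))"
        using e by (intro mult_right_mono) auto
      also have "\<dots> = \<epsilon>"
        using norm_ge_zero[of c] by (simp add: add_nonneg_eq_0_iff)
      finally have "near (\<lambda>\<xi> g. c * T \<xi> g) (\<lambda>\<xi> g. c * T' \<xi> g) \<epsilon>"
        by (rule near_mono[OF near_scale[OF T'(2)]])
      then show "\<exists>R\<in>B. near (\<lambda>\<xi> g. c * T \<xi> g) R \<epsilon>"
        using T'(1) B by (auto simp: star_algebra_def)
    qed (rule adjointable_scale(1)[OF T(1)])
  next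
    fix T assume "T \<in> op_closure H B"
    then have T: "T \<in> adjointable H" "\<And>\<epsilon>. \<epsilon> > 0 \<Longrightarrow> \<exists>R\<in>B. near T R \<epsilon>"
      by (auto simp: iff)
    show "adj H T \<in> op_closure H B"
      unfolding iff
    proof (intro conjI allI impI)
      fix \<epsilon> :: real assume e: "\<epsilon> > 0"
      then obtain T' where T': "T' \<in> B" "near T T' \<epsilon>"
        using T(2) by blast
      then have "near (adj H T) (adj H T') \<epsilon>"
        using e sub T(1) by (intro near_adj) auto
      then show "\<exists>R\<in>B. near (adj H T) R \<epsilon>"
        using T'(1) B by (auto simp: star_algebra_def)
    qed (rule adj_adjointable[OF T(1)])
  qed
  then show ?thesis
    unfolding cstar_subalgebra_iff using op_closure_idem[OF sub] by blast
qed

lemma star_algebra_adjointable: "star_algebra (adjointable H)"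
  unfolding star_algebra_def
  by (auto simp: adjointable_zero adjointable_add adjointable_comp adjointable_scale adj_adjointable)

end

lemma (in etale) opnorm_comp:
  assumes "S \<in> adjointable H" "T \<in> adjointable H"
  shows "opnorm H (S \<circ> T) \<le> opnorm H S * opnorm H T"
proof (rule opnorm_least)
  fix \<xi> x assume \<xi>: "\<xi> \<in> L2 H"
  have "nrm x (S (T \<xi>)) \<le> opnorm H S * nrm x (T \<xi>)"
    by (rule opnorm_fibre[OF assms(1) adjointable_L2[OF assms(2) \<xi>]])
  also have "\<dots> \<le> opnorm H S * (opnorm H T * nrm x \<xi>)"
    by (intro mult_left_mono opnorm_fibre opnorm_nonneg assms \<xi>)
  finally show "nrm x ((S \<circ> T) \<xi>) \<le> opnorm H S * opnorm H T * nrm x \<xi>"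
    by simp
qed (use assms opnorm_nonneg adjointable_L2 in auto)

lemma (in etale) opnorm_half_sum:
  assumes S: "S \<in> adjointable H" and T: "T \<in> adjointable H"
  shows "opnorm H (\<lambda>\<xi> g. 1/2 * (S \<xi> g + T \<xi> g)) \<le> (opnorm H S + opnorm H T) / 2"
proof (rule opnorm_least)
  show "(\<lambda>g. 1/2 * (S \<xi> g + T \<xi> g)) \<in> L2 H" if "\<xi> \<in> L2 H" for \<xi>
    by (intro L2_scale L2_add adjointable_L2[OF S that] adjointable_L2[OF T that])
  fix \<xi> x assume \<xi>: "\<xi> \<in> L2 H"
  have "nrm x (\<lambda>g. S \<xi> g + T \<xi> g) \<le> nrm x (S \<xi>) + nrm x (T \<xi>)"
    by (intro en_add L2_sqs adjointable_L2[OF S \<xi>] adjointable_L2[OF T \<xi>])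
  also have "\<dots> \<le> (opnorm H S + opnorm H T) * nrm x \<xi>"
    using opnorm_fibre[OF S \<xi>, of x] opnorm_fibre[OF T \<xi>, of x] by (simp add: distrib_right)
  finally show "nrm x (\<lambda>g. 1/2 * (S \<xi> g + T \<xi> g)) \<le> (opnorm H S + opnorm H T) / 2 * nrm x \<xi>"
    unfolding en_scale by simp
qed (use opnorm_nonneg[OF S] opnorm_nonneg[OF T] in auto)

text \<open>For self-adjoint \<open>a\<close> of norm less than \<open>1\<close>, \<open>b = 1 - sqrt (1 - a\<^sup>2)\<close> lies in the algebra even if the
  algebra has no unit: it is the fixed point of \<open>b \<mapsto> (a\<^sup>2 + b\<^sup>2) / 2\<close>.\<close>

lemma (in etale) square_root_fixed_point:
  assumes A: "cstar_subalgebra H A" and a: "a \<in> A" "adj H a = a" "opnorm H a < 1"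
  obtains b where "b \<in> A" "adj H b = b" "(\<lambda>\<xi> g. 2 * b \<xi> g) = (\<lambda>\<xi> g. (a \<circ> a) \<xi> g + (b \<circ> b) \<xi> g)"
proof -
  have sub: "A \<subseteq> adjointable H"
    and Aadd: "\<And>S T. S \<in> A \<Longrightarrow> T \<in> A \<Longrightarrow> (\<lambda>\<xi> g. S \<xi> g + T \<xi> g) \<in> A"
    and Acomp: "\<And>S T. S \<in> A \<Longrightarrow> T \<in> A \<Longrightarrow> S \<circ> T \<in> A"
    and Ascale: "\<And>c T. T \<in> A \<Longrightarrow> (\<lambda>\<xi> g. c * T \<xi> g) \<in> A"
    and A0: "(\<lambda>_ _. 0) \<in> A" and Aclosed: "op_closure H A \<subseteq> A"
    using A by (auto simp: cstar_subalgebra_def)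
  have adjA: "\<And>T. T \<in> A \<Longrightarrow> T \<in> adjointable H"
    using sub by blast
  define q where "q = opnorm H a"
  have q: "0 \<le> q" "q < 1"
    using opnorm_nonneg adjA a by (auto simp: q_def)
  define F where "F b = (\<lambda>\<xi> g. 1/2 * ((a \<circ> a) \<xi> g + (b \<circ> b) \<xi> g))" for b :: "('a, 'a) oper"
  define b where "b n = (F ^^ n) (\<lambda>_ _. 0)" for n
  have b0: "b 0 = (\<lambda>_ _. 0)" and bS: "b (Suc n) = F (b n)" for n
    by (simp_all add: b_def)
  have FA: "F T \<in> A" if "T \<in> A" for T
    unfolding F_def by (intro Ascale Aadd Acomp a that)
  have bA: "b n \<in> A" for n
    by (induction n) (auto simp: b0 bS A0 FA)
  have b_adj: "adj H (b n) = b n" for n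
  proof (induction n)
    case 0
    then show ?case by (simp add: b0 adjointable_zero)
  next
    case (Suc n)
    have "adj H (F (b n)) = F (b n)"
      unfolding F_def
      by (simp only: adjointable_scale adjointable_add adjointable_comp adjA a bA Suc.IH) simp
    then show ?case by (simp add: bS)
  qed
  \<comment> \<open>The bound reproduces itself because \<open>(q * q + q * q) / 2 \<le> q\<close>
    for \<open>q < 1\<close>.\<close>
  have b_norm: "opnorm H (b n) \<le> q" for n
  proof (induction n)
    case 0
    then show ?case
      using near_zero_iff[OF adjointable_zero(1) q(1)] q by (simp add: b0 near_def)
  next
    case (Suc n)
    have "opnorm H (b (Suc n)) \<le> (opnorm H (a \<circ> a) + opnorm H (b n \<circ> b n)) / 2"
      unfolding bS F_def by (intro opnorm_half_sum adjointable_comp adjA a bA)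
    also have "\<dots> \<le> (q * q + q * q) / 2"
    proof -
      have "opnorm H (a \<circ> a) \<le> q * q"
        using opnorm_comp[of a a] adjA a by (simp add: q_def)
      moreover have "opnorm H (b n \<circ> b n) \<le> q * q"
        using opnorm_comp[of "b n" "b n"] adjA bA Suc.IH opnorm_nonneg[OF adjA[OF bA]] q(1) mult_mono[OF Suc.IH Suc.IH]
        by (meson order_trans)
      ultimately show ?thesis by simp
    qed
    also have "\<dots> \<le> q"
      using q by (simp add: mult_left_le)
    finally show ?case .
  qed
  \<comment> \<open>The difference of squares is \<open>S\<close> times \<open>S - T\<close> plus
    \<open>S - T\<close> times \<open>T\<close>; nothing is assumed to commute.\<close>
  have near_sq: "near (S \<circ> S) (T \<circ> T) ((opnorm H S + opnorm H T) * c)"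
    if ST: "near S T c" "S \<in> A" "T \<in> A" "0 \<le> c" for S T c
  proof -
    have "near (S \<circ> S) (S \<circ> T) (opnorm H S * c)" "near (S \<circ> T) (T \<circ> T) (c * opnorm H T)"
      using ST adjA near_comp_left near_comp_right by auto
    then have "near (S \<circ> S) (T \<circ> T) (opnorm H S * c + c * opnorm H T)"
      using ST adjA by (intro near_trans[of _ "S \<circ> T"] adjointable_comp) auto
    then show ?thesis
      by (simp add: algebra_simps)
  qed
  have near_F: "near (F S) (F T) ((opnorm H S + opnorm H T) * c / 2)"
    if ST: "near S T c" "S \<in> A" "T \<in> A" "0 \<le> c" for S T c
  proof -
    have "near (a \<circ> a) (a \<circ> a) 0"
      by (simp add: near_def)
    from near_scale[OF near_add[OF this near_sq[OF ST]], of "1/2"] show ?thesis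
      unfolding F_def using ST adjA a by (auto intro!: adjointable_comp)
  qed
  \<comment> \<open>Between operators of norm at most \<open>q\<close> the map \<open>F\<close>
    contracts by \<open>(q + q) / 2\<close>, which is \<open>q\<close>; this is where
    \<open>opnorm H a < 1\<close> enters.\<close>
  have step: "near (b (Suc n)) (b n) (q * q ^ n)" for n
  proof (induction n)
    case 0
    have "near (b 1) (\<lambda>_ _. 0) q"
      using near_zero_iff[OF adjA[OF bA] q(1)] b_norm by blast
    then show ?case by (simp add: b0)
  next
    case (Suc n)
    have "near (b (Suc (Suc n))) (b (Suc n)) ((opnorm H (b (Suc n)) + opnorm H (b n)) * (q * q ^ n) / 2)"
      unfolding bS[of "Suc n"] by (subst (2) bS, rule near_F[OF Suc.IH bA bA]) (use q in auto)
    moreover have "(opnorm H (b (Suc n)) + opnorm H (b n)) * (q * q ^ n) / 2 \<le> (q + q) * (q * q ^ n) / 2"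
      using b_norm q by (intro divide_right_mono mult_right_mono add_mono) auto
    moreover have "(q + q) * (q * q ^ n) / 2 = q * q ^ Suc n"
      by simp
    ultimately show ?case
      using near_mono by metis
  qed
  obtain L where L: "L \<in> adjointable H" "\<And>n. near L (b n) (q * q ^ n / (1 - q))"
    using op_geometric_limit[of b q q] adjA bA step q by metis
  have small: "\<exists>n. q * q ^ n / (1 - q) < \<epsilon>" if "\<epsilon> > 0" for \<epsilon>
  proof -
    have "(\<lambda>n. q * q ^ n / (1 - q)) \<longlonglongrightarrow> q * 0 / (1 - q)"
      using q by (intro tendsto_intros LIMSEQ_power_zero) auto
    then have "eventually (\<lambda>n. q * q ^ n / (1 - q) < \<epsilon>) sequentially"
      using that by (simp add: order_tendstoD(2))
    then show ?thesis
      by (auto simp: eventually_sequentially)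
  qed
  have pos: "0 \<le> q * q ^ n / (1 - q)" for n
    using q by simp
  have "L \<in> op_closure H A"
    unfolding op_closure_iff[OF sub]
  proof (intro conjI allI impI L(1))
    fix \<epsilon> :: real assume "\<epsilon> > 0"
    then obtain n where "q * q ^ n / (1 - q) < \<epsilon>"
      using small by blast
    then have "near L (b n) \<epsilon>"
      using near_mono[OF L(2)] by simp
    then show "\<exists>S\<in>A. near L S \<epsilon>"
      using bA by blast
  qed
  then have LA: "L \<in> A"
    using Aclosed by blast
  have L_adj: "adj H L = L"
  proof (rule opnorm_zeroD[OF adj_adjointable[OF L(1)] L(1)])
    fix \<epsilon> :: real assume "\<epsilon> > 0"
    then obtain n where n: "q * q ^ n / (1 - q) < \<epsilon> / 2"
      using small half_gt_zero by blast
    have "near (adj H L) (b n) (q * q ^ n / (1 - q))"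
      using near_adj[OF L(2) L(1) adjA[OF bA] pos, of n] b_adj by simp
    then have "near (adj H L) L (q * q ^ n / (1 - q) + q * q ^ n / (1 - q))"
      using L adjA bA by (intro near_trans[of _ "b n"] near_sym[OF L(2)] adj_adjointable) auto
    moreover have "q * q ^ n / (1 - q) + q * q ^ n / (1 - q) \<le> \<epsilon>"
      using add_strict_mono[OF n n] by simp
    ultimately show "near (adj H L) L \<epsilon>"
      by (rule near_mono)
  qed
  have fixed: "F L = L"
  proof (rule opnorm_zeroD[OF adjA[OF FA[OF LA]] L(1)])
    fix \<epsilon> :: real assume e: "\<epsilon> > 0"
    \<comment> \<open>The first summand accounts for comparing \<open>F L\<close> with
      \<open>F (b n)\<close>, the final 1 for comparing \<open>b (Suc n)\<close> with
      \<open>L\<close>.\<close>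
    define M where "M = (opnorm H L + q) / 2 + 1"
    have M: "M > 0"
      using opnorm_nonneg[OF L(1)] q by (simp add: M_def add_nonneg_pos)
    then obtain n where n: "q * q ^ n / (1 - q) < \<epsilon> / M"
      using small e by (metis divide_pos_pos)
    let ?c = "q * q ^ n / (1 - q)"
    have "near (F L) (F (b n)) ((opnorm H L + opnorm H (b n)) * ?c / 2)"
      by (rule near_F[OF L(2) LA bA pos])
    moreover have "near (F (b n)) L (q * q ^ Suc n / (1 - q))"
      unfolding bS[symmetric] by (rule near_sym[OF L(2)])
    ultimately have "near (F L) L ((opnorm H L + opnorm H (b n)) * ?c / 2 + q * q ^ Suc n / (1 - q))"
      using adjA FA LA bA by (intro near_trans[of _ "F (b n)"]) auto
    moreover have "(opnorm H L + opnorm H (b n)) * ?c / 2 + q * q ^ Suc n / (1 - q) \<le> \<epsilon>"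
    proof -
      have "q * q ^ Suc n / (1 - q) \<le> ?c"
        using q by (intro divide_right_mono mult_left_mono) (auto intro: mult_left_le_one_le)
      moreover have "(opnorm H L + opnorm H (b n)) * ?c / 2 \<le> (opnorm H L + q) * ?c / 2"
        using b_norm pos by (intro divide_right_mono mult_right_mono) auto
      ultimately have "(opnorm H L + opnorm H (b n)) * ?c / 2 + q * q ^ Suc n / (1 - q) \<le> (opnorm H L + q) * ?c / 2 + ?c"
        by linarith
      also have "\<dots> = M * ?c"
        unfolding M_def by (simp only: distrib_right times_divide_eq_left mult_1)
      also have "\<dots> \<le> \<epsilon>"
        using n M by (simp add: field_simps)
      finally show ?thesis .
    qed
    ultimately show "near (F L) L \<epsilon>"
      by (rule near_mono)
  qed
  have "(\<lambda>\<xi> g. 2 * L \<xi> g) = (\<lambda>\<xi> g. (a \<circ> a) \<xi> g + (L \<circ> L) \<xi> g)"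
  proof (intro ext)
    fix \<xi> g
    show "2 * L \<xi> g = (a \<circ> a) \<xi> g + (L \<circ> L) \<xi> g"
      using fun_cong[OF fun_cong[OF fixed], of \<xi> g] unfolding F_def by simp
  qed
  then show thesis
    using that LA L_adj by blast
qed

text \<open>The equation \<open>2 b = a a + b b\<close> is purely algebraic, so a homomorphism
  preserves it. Paired with \<open>\<xi>\<close>, for the images \<open>a'\<close> and
  \<open>b'\<close>, it says that the squared norms of \<open>a' \<xi>\<close> and
  \<open>b' \<xi>\<close> add up to twice the pairing of \<open>\<xi>\<close> with
  \<open>b' \<xi>\<close>, which is at most the sum of the squared norms of \<open>\<xi>\<close> and
  \<open>b' \<xi>\<close>. Hence \<open>a'\<close> is a contraction; scaling and the C*-identity
  give the general case.\<close>

lemma star_hom_contractive: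
  assumes H: "etale H" and K: "etale K" and hom: "star_hom H A K B \<Psi>" and T: "T \<in> A"
  shows "opnorm K (\<Psi> T) \<le> opnorm H T"
proof -
  interpret h: etale H by (rule H)
  interpret k: etale K by (rule K)
  have A: "cstar_subalgebra H A" and B: "cstar_subalgebra K B"
    and img: "\<And>T. T \<in> A \<Longrightarrow> \<Psi> T \<in> B"
    and add: "\<And>S T. S \<in> A \<Longrightarrow> T \<in> A \<Longrightarrow> \<Psi> (\<lambda>\<xi> g. S \<xi> g + T \<xi> g) = (\<lambda>\<xi> g. \<Psi> S \<xi> g + \<Psi> T \<xi> g)"
    and scale: "\<And>c T. T \<in> A \<Longrightarrow> \<Psi> (\<lambda>\<xi> g. c * T \<xi> g) = (\<lambda>\<xi> g. c * \<Psi> T \<xi> g)"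
    and comp: "\<And>S T. S \<in> A \<Longrightarrow> T \<in> A \<Longrightarrow> \<Psi> (S \<circ> T) = \<Psi> S \<circ> \<Psi> T"
    and adj: "\<And>T. T \<in> A \<Longrightarrow> \<Psi> (adj H T) = adj K (\<Psi> T)"
    using hom by (auto simp: star_hom_def)
  have adjA: "\<And>T. T \<in> A \<Longrightarrow> T \<in> adjointable H" and adjB: "\<And>T. T \<in> B \<Longrightarrow> T \<in> adjointable K"
    and Acomp: "\<And>S T. S \<in> A \<Longrightarrow> T \<in> A \<Longrightarrow> S \<circ> T \<in> A"
    and Ascale: "\<And>c T. T \<in> A \<Longrightarrow> (\<lambda>\<xi> g. c * T \<xi> g) \<in> A"
    and Aadj: "\<And>T. T \<in> A \<Longrightarrow> adj H T \<in> A"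
    using A B by (auto simp: cstar_subalgebra_def)
  have unit: "opnorm K (\<Psi> a) \<le> 1" if a: "a \<in> A" "adj H a = a" "opnorm H a < 1" for a
  proof -
    obtain b where b: "b \<in> A" "adj H b = b" "(\<lambda>\<xi> g. 2 * b \<xi> g) = (\<lambda>\<xi> g. (a \<circ> a) \<xi> g + (b \<circ> b) \<xi> g)"
      using h.square_root_fixed_point[OF A a] by metis
    let ?a = "\<Psi> a" and ?b = "\<Psi> b"
    have a': "?a \<in> adjointable K" "adj K ?a = ?a" and b': "?b \<in> adjointable K" "adj K ?b = ?b"
      using img adjB a b adj[symmetric] by auto
    have eq: "(\<lambda>\<xi> g. 2 * ?b \<xi> g) = (\<lambda>\<xi> g. (?a \<circ> ?a) \<xi> g + (?b \<circ> ?b) \<xi> g)"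
      using arg_cong[OF b(3), of \<Psi>]
      unfolding scale[OF b(1)] add[OF Acomp[OF a(1) a(1)] Acomp[OF b(1) b(1)]]
        comp[OF a(1) a(1)] comp[OF b(1) b(1)] .
    show ?thesis
    proof (rule k.opnorm_least)
      show "?a \<xi> \<in> L2 K" if "\<xi> \<in> L2 K" for \<xi>
        by (rule k.adjointable_L2[OF a'(1) that])
      fix \<xi> x assume \<xi>: "\<xi> \<in> L2 K"
      have L: "?a \<xi> \<in> L2 K" "?b \<xi> \<in> L2 K" "?a (?a \<xi>) \<in> L2 K" "?b (?b \<xi>) \<in> L2 K"
        using \<xi> a' b' k.adjointable_L2 by auto
      have eq': "(\<lambda>g. 2 * ?b \<xi> g) = (\<lambda>g. ?a (?a \<xi>) g + ?b (?b \<xi>) g)"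
        using fun_cong[OF eq, of \<xi>] by simp
      have "2 * l2inner K \<xi> (?b \<xi>) x = l2inner K \<xi> (\<lambda>g. 2 * ?b \<xi> g) x"
        by (rule l2inner_scale_right[symmetric])
      also have "\<dots> = l2inner K \<xi> (?a (?a \<xi>)) x + l2inner K \<xi> (?b (?b \<xi>)) x"
        unfolding eq' by (intro l2inner_add_right k.L2_sqs L \<xi>)
      also have "\<dots> = of_real ((k.nrm x (?a \<xi>))\<^sup>2) + of_real ((k.nrm x (?b \<xi>))\<^sup>2)"
        using k.adj_inner[OF a'(1) L(1) \<xi>, of x] k.adj_inner[OF b'(1) L(2) \<xi>, of x] a' b'
        by (simp add: l2inner_self k.L2_sqs L)
      finally have "complex_of_real ((k.nrm x (?a \<xi>))\<^sup>2 + (k.nrm x (?b \<xi>))\<^sup>2) = 2 * l2inner K \<xi> (?b \<xi>) x"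
        by simp
      then have "(k.nrm x (?a \<xi>))\<^sup>2 + (k.nrm x (?b \<xi>))\<^sup>2 = cmod (2 * l2inner K \<xi> (?b \<xi>) x)"
        by (metis abs_of_nonneg norm_of_real sum_power2_ge_zero)
      also have "\<dots> \<le> 2 * (k.nrm x \<xi> * k.nrm x (?b \<xi>))"
        using l2inner_Cauchy_Schwarz[OF k.L2_sqs[OF \<xi>] k.L2_sqs[OF L(2)], of x] by (simp add: norm_mult)
      also have "\<dots> \<le> (k.nrm x \<xi>)\<^sup>2 + (k.nrm x (?b \<xi>))\<^sup>2"
        using sum_squares_bound[of "k.nrm x \<xi>" "k.nrm x (?b \<xi>)"] by simp
      finally have "(k.nrm x (?a \<xi>))\<^sup>2 \<le> (k.nrm x \<xi>)\<^sup>2"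
        by simp
      then show "k.nrm x (?a \<xi>) \<le> 1 * k.nrm x \<xi>"
        using power2_le_imp_le[OF _ en_nonneg] by simp
    qed simp
  qed
  have selfadj: "opnorm K (\<Psi> a) \<le> opnorm H a" if a: "a \<in> A" "adj H a = a" for a
  proof (rule dense_ge)
    \<comment> \<open>The fixed point requires norm strictly below 1, so the scaling is by a number
      larger than the norm, which is approached only in the limit.\<close>
    fix t assume t: "opnorm H a < t"
    then have t0: "t > 0"
      using h.opnorm_nonneg[OF adjA[OF a(1)]] by linarith
    let ?c = "complex_of_real (1 / t)"
    let ?a = "\<lambda>\<xi> g. ?c * a \<xi> g"
    have "opnorm H ?a \<le> (1 / t) * opnorm H a"
    proof (rule h.opnorm_least)
      show "(\<lambda>g. ?c * a \<xi> g) \<in> L2 H" if "\<xi> \<in> L2 H" for \<xi>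
        by (intro h.L2_scale h.adjointable_L2[OF adjA[OF a(1)] that])
      show "h.nrm x (\<lambda>g. ?c * a \<xi> g) \<le> 1 / t * opnorm H a * h.nrm x \<xi>" if "\<xi> \<in> L2 H" for \<xi> x
        unfolding en_scale using h.opnorm_fibre[OF adjA[OF a(1)] that, of x] t0
        by (simp add: norm_divide divide_right_mono)
    qed (use t0 h.opnorm_nonneg[OF adjA[OF a(1)]] in auto)
    also have "\<dots> < 1"
      using t t0 by simp
    finally have "opnorm K (\<Psi> ?a) \<le> 1"
      using h.adjointable_scale(2)[OF adjA[OF a(1)], of ?c] a by (intro unit Ascale) auto
    then have le: "opnorm K (\<lambda>\<xi> g. ?c * \<Psi> a \<xi> g) \<le> 1"
      unfolding scale[OF a(1)] .
    have \<Psi>a: "\<Psi> a \<in> adjointable K"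
      using img adjB a by blast
    show "opnorm K (\<Psi> a) \<le> t"
    proof (rule k.opnorm_least)
      fix \<xi> x assume \<xi>: "\<xi> \<in> L2 K"
      have "k.nrm x (\<lambda>g. ?c * \<Psi> a \<xi> g) \<le> opnorm K (\<lambda>\<xi> g. ?c * \<Psi> a \<xi> g) * k.nrm x \<xi>"
        by (rule k.opnorm_fibre[OF k.adjointable_scale(1)[OF \<Psi>a] \<xi>])
      also have "\<dots> \<le> 1 * k.nrm x \<xi>"
        by (intro mult_right_mono le) simp
      finally show "k.nrm x (\<Psi> a \<xi>) \<le> t * k.nrm x \<xi>"
        using t0 unfolding en_scale by (simp add: norm_divide field_simps)
    qed (use k.adjointable_L2[OF \<Psi>a] t0 in auto)
  qed
  have TT: "adj H T \<circ> T \<in> A" "adj H (adj H T \<circ> T) = adj H T \<circ> T"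
    using Acomp Aadj T h.adjointable_comp(2)[OF adjA[OF Aadj[OF T]] adjA[OF T]] h.adj_adj[OF adjA[OF T]] by auto
  have "(opnorm K (\<Psi> T))\<^sup>2 \<le> opnorm K (adj K (\<Psi> T) \<circ> \<Psi> T)"
    by (rule k.opnorm_C_star[OF adjB[OF img[OF T]]])
  also have "\<dots> = opnorm K (\<Psi> (adj H T \<circ> T))"
    by (simp add: comp adj T Aadj)
  also have "\<dots> \<le> opnorm H (adj H T \<circ> T)"
    by (rule selfadj[OF TT])
  also have "\<dots> \<le> opnorm H (adj H T) * opnorm H T"
    by (intro h.opnorm_comp adjA Aadj T)
  also have "\<dots> \<le> (opnorm H T)\<^sup>2"
    unfolding power2_eq_square by (intro mult_right_mono h.opnorm_adj h.opnorm_nonneg adjA T)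
  finally show ?thesis
    using h.opnorm_nonneg[OF adjA[OF T]] power2_le_imp_le by blast
qed

section \<open>Convolution operators\<close>

lemma infsum_diff':
  fixes f g :: "'a \<Rightarrow> 'b::real_normed_vector"
  assumes "f summable_on A" "g summable_on A"
  shows "(\<Sum>\<^sub>\<infinity>a\<in>A. f a - g a) = infsum f A - infsum g A"
  using infsum_add[OF assms(1) summable_on_uminus[THEN iffD2, OF assms(2)]] by (simp add: infsum_uminus)

context etale
begin

text \<open>The formula inside \<open>Lambda_op\<close> without the guard by \<open>L2 H\<close>, so
  that it applies to functions known only to be square summable on fibres; \<open>rho\<close>
  relates to \<open>rho_op\<close> in the same way.\<close>

definition conv :: "('a \<Rightarrow> complex) \<Rightarrow> ('a \<Rightarrow> complex) \<Rightarrow> 'a \<Rightarrow> complex" where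
  "conv f \<xi> g = (if g \<in> arrows H then \<Sum>\<^sub>\<infinity>a\<in>fibre H (s g). f (g \<cdot> inv a) * \<xi> a else 0)"

definition rho :: "('a \<Rightarrow> complex) \<Rightarrow> ('a \<Rightarrow> complex) \<Rightarrow> 'a \<Rightarrow> complex" where
  "rho f \<xi> g = (if g \<in> arrows H then \<Sum>\<^sub>\<infinity>b\<in>fibre H (s g). f b * \<xi> (g \<cdot> inv b) else 0)"

lemma Lambda_op_eq: "Lambda_op H f \<xi> = (if \<xi> \<in> L2 H then conv f \<xi> else (\<lambda>_. 0))"
  by (auto simp: Lambda_op_def on_L2_def conv_def)

lemma rho_op_eq: "rho_op H f \<xi> = (if \<xi> \<in> L2 H then rho f \<xi> else (\<lambda>_. 0))"
  by (auto simp: rho_op_def on_L2_def rho_def)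

text \<open>The substitution \<open>c = g \<cdot> inv a\<close> trades the source fibre of
  \<open>g\<close> for arrows of range \<open>r g\<close>, of which a compact set contains only
  finitely many.\<close>

lemma division_fibre:
  assumes "g \<in> arrows H"
  shows "inj_on (\<lambda>a. g \<cdot> inv a) (fibre H (s g))"
    "a \<in> fibre H (s g) \<Longrightarrow> r (g \<cdot> inv a) = r g"
    "a \<in> fibre H (s g) \<Longrightarrow> inv (g \<cdot> inv a) \<cdot> g = a"
proof -
  show *: "inv (g \<cdot> inv a) \<cdot> g = a" if "a \<in> fibre H (s g)" for a
  proof -
    have "inv (g \<cdot> inv a) \<cdot> g = (a \<cdot> inv g) \<cdot> g"
      using that assms inv_mul[of g "inv a"] by (simp add: fibre_iff)
    then show ?thesis
      using that assms by (simp add: fibre_iff)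
  qed
  show "inj_on (\<lambda>a. g \<cdot> inv a) (fibre H (s g))"
    by (rule inj_on_inverseI[where g = "\<lambda>c. inv c \<cdot> g"]) (use * in auto)
  show "r (g \<cdot> inv a) = r g" if "a \<in> fibre H (s g)"
    using that assms by (simp add: fibre_iff)
qed

lemma conv_finite:
  assumes f: "f \<in> Cc X" and g: "g \<in> arrows H"
  shows "finite {a \<in> fibre H (s g). f (g \<cdot> inv a) \<noteq> 0}"
proof -
  obtain n where n: "\<And>x. finite {c \<in> supp_on X f. r c = x}"
    using compact_fibre_bound[OF Cc_compact[OF f]] by metis
  show ?thesis
  proof (rule inj_on_finite[where f = "\<lambda>a. g \<cdot> inv a"])
    show "inj_on (\<lambda>a. g \<cdot> inv a) {a \<in> fibre H (s g). f (g \<cdot> inv a) \<noteq> 0}"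
      by (rule inj_on_subset[OF division_fibre(1)[OF g]]) auto
    show "(\<lambda>a. g \<cdot> inv a) ` {a \<in> fibre H (s g). f (g \<cdot> inv a) \<noteq> 0} \<subseteq> {c \<in> supp_on X f. r c = r g}"
      using Cc_supp[OF f] division_fibre(2)[OF g] by auto
  qed (rule n)
qed

lemma conv_summable: "f \<in> Cc X \<Longrightarrow> g \<in> arrows H \<Longrightarrow> (\<lambda>a. f (g \<cdot> inv a) * \<xi> a) summable_on fibre H (s g)"
  by (rule finite_nonzero_values_imp_summable_on, rule finite_subset[OF _ conv_finite]) auto

lemma conv_add_left: "f \<in> Cc X \<Longrightarrow> f' \<in> Cc X \<Longrightarrow> conv (\<lambda>c. f c + f' c) \<xi> = (\<lambda>g. conv f \<xi> g + conv f' \<xi> g)"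
  by (auto simp: conv_def distrib_right infsum_add conv_summable)

lemma conv_diff_right: "f \<in> Cc X \<Longrightarrow> conv f (\<lambda>a. \<xi> a - \<zeta> a) = (\<lambda>g. conv f \<xi> g - conv f \<zeta> g)"
  by (auto simp: conv_def right_diff_distrib infsum_diff' conv_summable)

lemma rho_summable: "f \<in> Cc X \<Longrightarrow> (\<lambda>b. f b * \<xi> (g \<cdot> inv b)) summable_on fibre H x"
  by (rule finite_nonzero_values_imp_summable_on, rule finite_subset[OF _ Cc_fibre_finite]) auto

lemma rho_add_left: "f \<in> Cc X \<Longrightarrow> f' \<in> Cc X \<Longrightarrow> rho (\<lambda>c. f c + f' c) \<xi> = (\<lambda>g. rho f \<xi> g + rho f' \<xi> g)"
  by (auto simp: rho_def distrib_right infsum_add rho_summable)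

lemma rho_diff_right: "f \<in> Cc X \<Longrightarrow> rho f (\<lambda>a. \<xi> a - \<zeta> a) = (\<lambda>g. rho f \<xi> g - rho f \<zeta> g)"
  by (auto simp: rho_def right_diff_distrib infsum_diff' rho_summable)

lemma bisection_range_section:
  assumes "bisection U" "x \<in> r ` U"
  shows "inv_into U r x \<in> U" "r (inv_into U r x) = x" "inv_into U r x \<in> arrows H"
proof -
  show *: "inv_into U r x \<in> U" "r (inv_into U r x) = x"
    using assms inv_into_into f_inv_into_f by metis+
  show "inv_into U r x \<in> arrows H"
    using bisection_arrow[OF assms(1) *(1)] .
qed

lemma bisection_range_section_eq: "bisection U \<Longrightarrow> u \<in> U \<Longrightarrow> inv_into U r (r u) = u"
  by (simp add: bisection_def)

text \<open>Only \<open>a = inv u \<cdot> g\<close> contributes, where \<open>u\<close> is the arrow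
  of \<open>U\<close> with range \<open>r g\<close>: convolution becomes a weighted left
  translation.\<close>

lemma conv_bisection:
  assumes U: "bisection U" and f: "f \<in> Cc X" "supp_on X f \<subseteq> U" and g: "g \<in> arrows H"
  shows "conv f \<xi> g = (if r g \<in> r ` U then f (inv_into U r (r g)) * \<xi> (inv (inv_into U r (r g)) \<cdot> g) else 0)"
proof (cases "r g \<in> r ` U")
  case True
  let ?u = "inv_into U r (r g)"
  note u = bisection_range_section[OF U True]
  let ?a = "inv ?u \<cdot> g"
  have a: "?a \<in> fibre H (s g)" "g \<cdot> inv ?a = ?u"
  proof -
    show "?a \<in> fibre H (s g)"
      using u g by (simp add: fibre_iff)
    have "g \<cdot> inv ?a = g \<cdot> (inv g \<cdot> ?u)"
      using u g inv_mul[of "inv ?u" g] by simp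
    then show "g \<cdot> inv ?a = ?u"
      using u g by simp
  qed
  have "f (g \<cdot> inv a) * \<xi> a = 0" if "a \<in> fibre H (s g)" "a \<noteq> ?a" for a
  proof (rule ccontr)
    assume "f (g \<cdot> inv a) * \<xi> a \<noteq> 0"
    then have "g \<cdot> inv a \<in> U"
      using Cc_supp[OF f(1)] f(2) by auto
    then have "g \<cdot> inv a = ?u"
      using bisection_range_section_eq[OF U] division_fibre(2)[OF g that(1)] by metis
    then show False
      using division_fibre(3)[OF g that(1)] that(2) by simp
  qed
  then have "(\<Sum>\<^sub>\<infinity>a\<in>fibre H (s g). f (g \<cdot> inv a) * \<xi> a) = f (g \<cdot> inv ?a) * \<xi> ?a"
    by (intro infsum_single a(1))
  then show ?thesis
    using True g a(2) by (simp add: conv_def)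
next
  case False
  have "f (g \<cdot> inv a) = 0" if "a \<in> fibre H (s g)" for a
    using False Cc_supp[OF f(1), of "g \<cdot> inv a"] f(2) division_fibre(2)[OF g that] by (metis image_eqI subsetD)
  then show ?thesis
    using False by (auto simp: conv_def intro!: infsum_0)
qed

text \<open>Composable pairs form a closed subset of the product, because source and range are
  continuous into a Hausdorff space.\<close>

lemma compactin_set_mul:
  assumes K: "compactin X K" and L: "compactin X L"
  shows "compactin X (set_mul H K L)"
proof -
  let ?P = "prod_topology X X"
  let ?D = "{p \<in> topspace ?P. s (fst p) = r (snd p)}"
  have "compactin ?P (K \<times> L)"
    using K L by (simp add: compactin_Times)
  moreover have "closedin ?P ?D"
    by (intro closedin_continuous_maps_eq[OF Hausdorff] continuous_source' continuous_range' continuous_map_fst continuous_map_snd)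
  ultimately have c: "compactin ?P (?D \<inter> (K \<times> L))"
    by (rule closed_Int_compactin[rotated])
  have "compactin (subtopology ?P ?D) (?D \<inter> (K \<times> L))"
    using c by (simp add: compactin_subtopology)
  moreover have "continuous_map (subtopology ?P ?D) X (\<lambda>p. fst p \<cdot> snd p)"
    by (intro continuous_mul continuous_map_from_subtopology continuous_map_fst continuous_map_snd) auto
  ultimately have "compactin X ((\<lambda>p. fst p \<cdot> snd p) ` (?D \<inter> (K \<times> L)))"
    by (rule image_compactin)
  moreover have "(\<lambda>p. fst p \<cdot> snd p) ` (?D \<inter> (K \<times> L)) = set_mul H K L"
  proof (intro set_eqI iffI)
    fix y assume "y \<in> (\<lambda>p. fst p \<cdot> snd p) ` (?D \<inter> (K \<times> L))"
    then obtain a b where "a \<in> K" "b \<in> L" "s a = r b" "y = a \<cdot> b" by auto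
    then show "y \<in> set_mul H K L"
      unfolding set_mul_def by blast
  next
    fix y assume "y \<in> set_mul H K L"
    then obtain a b where ab: "a \<in> K" "b \<in> L" "s a = r b" "y = a \<cdot> b"
      unfolding set_mul_def by blast
    then have "(a, b) \<in> ?D \<inter> (K \<times> L)"
      using compactin_subset_topspace[OF K] compactin_subset_topspace[OF L] by auto
    then show "y \<in> (\<lambda>p. fst p \<cdot> snd p) ` (?D \<inter> (K \<times> L))"
      using ab(4) by (intro image_eqI[of _ _ "(a, b)"]) auto
  qed
  ultimately show ?thesis by simp
qed

lemma compactin_inv: "compactin X K \<Longrightarrow> compactin X (inv ` K)"
  by (rule image_compactin[OF _ continuous_inv])

lemma conv_Cc:
  assumes "f \<in> Cc X" "\<xi> \<in> Cc X"
  shows "conv f \<xi> \<in> Cc X"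
  using assms(1)
proof (induction rule: Cc_induct)
  case (add f g)
  then show ?case
    by (simp add: conv_add_left Cc_add[OF Hausdorff])
next
  case (bisection f U)
  note U = bisection
  let ?A = "{y \<in> topspace X. r y \<in> r ` U}"
  have "continuous_map (subtopology X ?A) X (\<lambda>y. inv (inv_into U r (r y)))"
    by (intro continuous_inv' bisection_section_compose(2)[OF U(2) _ continuous_range]) simp
  then have "continuous_map (subtopology X ?A) X (\<lambda>y. inv (inv_into U r (r y)) \<cdot> y)"
    using continuous_map_from_subtopology[OF continuous_map_id, of X ?A] bisection_range_section[OF U(2)]
    by (intro continuous_mul) (auto simp: id_def)
  then have "continuous_map (subtopology X ?A) euclidean (\<lambda>y. \<xi> (inv (inv_into U r (r y)) \<cdot> y))"
    using continuous_map_compose[OF _ Cc_continuous[OF assms(2)]] by (simp add: comp_def)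
  then have "continuous_map X euclidean (\<lambda>y. if r y \<in> r ` U then f (inv_into U r (r y)) * \<xi> (inv (inv_into U r (r y)) \<cdot> y) else 0)"
    using bisection_extend[OF U(2) disjI1[OF refl] continuous_range U(1,3)] by blast
  then have "continuous_map X euclidean (conv f \<xi>)"
    by (rule continuous_map_eq) (simp add: conv_bisection[OF U(2,1,3)])
  then show ?case
  proof (rule CcI(1)[OF _ _ Hausdorff compactin_set_mul[OF Cc_compact[OF U(1)] Cc_compact[OF assms(2)]]])
    show "conv f \<xi> g = 0" if "g \<notin> topspace X" for g
      using that by (simp add: conv_def)
    fix g assume g: "g \<in> topspace X" "conv f \<xi> g \<noteq> 0"
    then have rg: "r g \<in> r ` U"
      using conv_bisection[OF U(2,1,3), of g \<xi>] by (auto split: if_splits)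
    let ?u = "inv_into U r (r g)"
    note u = bisection_range_section[OF U(2) rg]
    have "?u \<in> supp_on X f" "inv ?u \<cdot> g \<in> supp_on X \<xi>"
      using g rg conv_bisection[OF U(2,1,3), of g \<xi>] Cc_supp U(1) assms(2) by auto
    moreover have "g = ?u \<cdot> (inv ?u \<cdot> g)" "s ?u = r (inv ?u \<cdot> g)"
      using u g by simp_all
    ultimately show "g \<in> set_mul H (supp_on X f) (supp_on X \<xi>)"
      unfolding set_mul_def by blast
  qed
qed

text \<open>On a bisection the weighted translation is a partial injection of each fibre, so the
  supremum of the coefficient function is a bound; sums follow from the triangle inequality.\<close>

lemma conv_bounded:
  assumes "f \<in> Cc X"
  shows "\<exists>C\<ge>0. \<forall>\<zeta> x. sqs (fibre H x) \<zeta> \<longrightarrow> sqs (fibre H x) (conv f \<zeta>) \<and> nrm x (conv f \<zeta>) \<le> C * nrm x \<zeta>"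
  using assms
proof (induction rule: Cc_induct)
  case (add f g)
  then obtain C D where C: "C \<ge> 0" "\<And>\<zeta> x. sqs (fibre H x) \<zeta> \<Longrightarrow> sqs (fibre H x) (conv f \<zeta>) \<and> nrm x (conv f \<zeta>) \<le> C * nrm x \<zeta>"
    and D: "D \<ge> 0" "\<And>\<zeta> x. sqs (fibre H x) \<zeta> \<Longrightarrow> sqs (fibre H x) (conv g \<zeta>) \<and> nrm x (conv g \<zeta>) \<le> D * nrm x \<zeta>"
    by blast
  show ?case
  proof (intro exI[of _ "C + D"] conjI allI impI)
    fix \<zeta> x assume \<zeta>: "sqs (fibre H x) \<zeta>"
    show "sqs (fibre H x) (conv (\<lambda>x. f x + g x) \<zeta>)" "nrm x (conv (\<lambda>x. f x + g x) \<zeta>) \<le> (C + D) * nrm x \<zeta>"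
      using C(2)[OF \<zeta>] D(2)[OF \<zeta>] en_add[of "fibre H x" "conv f \<zeta>" "conv g \<zeta>"]
      by (auto simp: conv_add_left add distrib_right intro: sqs_add)
  qed (use C D in auto)
next
  case (bisection f U)
  note U = bisection
  obtain B where B: "B \<ge> 0" "\<And>c. cmod (f c) \<le> B"
    using Cb_bounded[OF Cc_subset_Cb[OF U(1)]] by blast
  show ?case
  proof (intro exI[of _ B] conjI allI impI B(1))
    fix \<zeta> x assume \<zeta>: "sqs (fibre H x) \<zeta>"
    let ?u = "\<lambda>g. inv_into U r (r g)"
    let ?D = "{g \<in> fibre H x. r g \<in> r ` U}"
    let ?\<tau> = "\<lambda>g. inv (?u g) \<cdot> g"
    have u: "?u g \<in> U" "r (?u g) = r g" "?u g \<in> arrows H" "g \<in> arrows H" if "g \<in> ?D" for g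
      using that bisection_range_section[OF U(2), of "r g"] by (auto simp: fibre_iff)
    have inj: "inj_on ?\<tau> ?D"
    proof (rule inj_onI)
      fix g h assume g: "g \<in> ?D" and h: "h \<in> ?D" and eq: "?\<tau> g = ?\<tau> h"
      have "s (?u g) = r (?\<tau> g)" "s (?u h) = r (?\<tau> h)"
        using u[OF g] u[OF h] by simp_all
      then have "s (?u g) = s (?u h)"
        unfolding eq by simp
      moreover have "inj_on s U"
        using U(2) by (simp add: bisection_def)
      ultimately have "?u g = ?u h"
        using inj_onD u(1)[OF g] u(1)[OF h] by metis
      moreover have "?u g \<cdot> ?\<tau> g = g" "?u h \<cdot> ?\<tau> h = h"
        using u(2-4)[OF g] u(2-4)[OF h] by simp_all
      ultimately show "g = h"
        using eq by metis
    qed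
    have "?\<tau> g \<in> fibre H x" if "g \<in> ?D" for g
      using u(2-4)[OF that] that by (simp add: fibre_iff)
    then have im: "?\<tau> ` ?D \<subseteq> fibre H x"
      by blast
    have val: "cmod (conv f \<zeta> g) \<le> B * cmod (\<zeta> (?\<tau> g))" if "g \<in> ?D" for g
      using that u(4)[OF that] B by (simp add: conv_bisection[OF U(2,1,3)] norm_mult mult_right_mono)
    have zero: "conv f \<zeta> g = 0" if "g \<in> fibre H x - ?D" for g
      using that by (simp add: conv_bisection[OF U(2,1,3)] fibre_iff)
    show "sqs (fibre H x) (conv f \<zeta>)" "nrm x (conv f \<zeta>) \<le> B * nrm x \<zeta>"
      using en_partial_injection[OF \<zeta> inj _ im B(1) val zero] by auto
  qed
qed

lemma conv_L2:
  assumes "f \<in> Cc X" "\<xi> \<in> L2 H"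
  shows "conv f \<xi> \<in> L2 H"
proof (rule L2_closed)
  obtain C where C: "C \<ge> 0" "\<And>\<zeta> x. sqs (fibre H x) \<zeta> \<Longrightarrow> sqs (fibre H x) (conv f \<zeta>) \<and> nrm x (conv f \<zeta>) \<le> C * nrm x \<zeta>"
    using conv_bounded[OF assms(1)] by blast
  fix \<epsilon> :: real assume e: "\<epsilon> > 0"
  then have "\<epsilon> / (C + 1) > 0"
    using C(1) by simp
  then obtain \<eta> where \<eta>: "\<eta> \<in> Cc X" "\<And>x. sqs (fibre H x) (\<lambda>g. \<xi> g - \<eta> g)" "\<And>x. nrm x (\<lambda>g. \<xi> g - \<eta> g) \<le> \<epsilon> / (C + 1)"
    using L2_approx[OF assms(2)] by metis
  have "C * nrm x (\<lambda>g. \<xi> g - \<eta> g) \<le> C * (\<epsilon> / (C + 1))" for x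
    by (rule mult_left_mono[OF \<eta>(3) C(1)])
  also have "C * (\<epsilon> / (C + 1)) \<le> \<epsilon>"
    using e C(1) by (simp add: field_simps)
  finally have "sqs (fibre H x) (\<lambda>g. conv f \<xi> g - conv f \<eta> g) \<and> nrm x (\<lambda>g. conv f \<xi> g - conv f \<eta> g) \<le> \<epsilon>" for x
    using C(2)[OF \<eta>(2), of x] unfolding conv_diff_right[OF assms(1)] by (meson order_trans)
  then show "\<exists>\<eta>\<in>L2 H. \<forall>x. sqs (fibre H x) (\<lambda>g. conv f \<xi> g - \<eta> g) \<and> nrm x (\<lambda>g. conv f \<xi> g - \<eta> g) \<le> \<epsilon>"
    using Cc_in_L2[OF conv_Cc[OF assms(1) \<eta>(1)]] by blast
qed (simp add: conv_def)

text \<open>The involution of the convolution algebra; \<open>Lambda_op\<close> turns it into the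
  adjoint.\<close>

definition fstar :: "('a \<Rightarrow> complex) \<Rightarrow> 'a \<Rightarrow> complex" where
  "fstar f c = (if c \<in> arrows H then cnj (f (inv c)) else 0)"

lemma fstar_Cc:
  assumes "f \<in> Cc X"
  shows "fstar f \<in> Cc X" "supp_on X (fstar f) \<subseteq> inv ` supp_on X f"
proof -
  have "continuous_map X euclidean (\<lambda>c. cnj (f (inv c)))"
    using continuous_map_compose[OF continuous_inv Cc_continuous[OF assms]]
    by (intro continuous_map_compose_real[of X _ cnj]) (auto simp: comp_def intro: continuous_intros)
  then have "continuous_map X euclidean (fstar f)"
    by (rule continuous_map_eq) (simp add: fstar_def)
  moreover have "c \<in> inv ` supp_on X f" if "c \<in> topspace X" "fstar f c \<noteq> 0" for c
  proof -
    have "inv c \<in> supp_on X f"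
      using that Cc_supp[OF assms] by (auto simp: fstar_def split: if_splits)
    then show ?thesis
      using that by (metis image_eqI inv_inv topspace_X)
  qed
  ultimately show "fstar f \<in> Cc X" "supp_on X (fstar f) \<subseteq> inv ` supp_on X f"
    using CcI[OF _ _ Hausdorff compactin_inv[OF Cc_compact[OF assms]], of "fstar f"] by (auto simp: fstar_def)
qed

text \<open>On a bisection the partial translation of a fibre is inverted by the partial translation
  of the inverse bisection, so both sides are the same sum reindexed.\<close>

lemma conv_adjoint:
  assumes "f \<in> Cc X" "sqs (fibre H x) \<eta>" "sqs (fibre H x) \<xi>"
  shows "l2inner H \<eta> (conv f \<xi>) x = l2inner H (conv (fstar f) \<eta>) \<xi> x"
  using assms(1)
proof (induction rule: Cc_induct)
  case (add f g)
  have fs: "fstar (\<lambda>x. f x + g x) = (\<lambda>c. fstar f c + fstar g c)"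
    by (auto simp: fstar_def)
  have "sqs (fibre H x) (conv f \<xi>)" "sqs (fibre H x) (conv g \<xi>)"
      "sqs (fibre H x) (conv (fstar f) \<eta>)" "sqs (fibre H x) (conv (fstar g) \<eta>)"
    using conv_bounded[OF add(1)] conv_bounded[OF add(2)] conv_bounded[OF fstar_Cc(1)[OF add(1)]]
      conv_bounded[OF fstar_Cc(1)[OF add(2)]] assms(2,3) by blast+
  then show ?case
    using add assms(2,3) by (simp add: fs conv_add_left fstar_Cc l2inner_add_right l2inner_add_left)
next
  case (bisection f U)
  note U = bisection
  let ?V = "inv ` U"
  have V: "bisection ?V" "supp_on X (fstar f) \<subseteq> ?V"
    using bisection_inv[OF U(2)] fstar_Cc(2)[OF U(1)] U(3) by blast+
  let ?u = "\<lambda>g. inv_into U r (r g)" and ?v = "\<lambda>k. inv_into ?V r (r k)"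
  let ?D = "{g \<in> fibre H x. r g \<in> r ` U}" and ?E = "{k \<in> fibre H x. r k \<in> r ` ?V}"
  have u: "?u g \<in> U" "r (?u g) = r g" "?u g \<in> arrows H" "g \<in> arrows H" "s g = x" if "g \<in> ?D" for g
    using that bisection_range_section[OF U(2), of "r g"] by (auto simp: fibre_iff)
  have v: "?v k \<in> ?V" "r (?v k) = r k" "?v k \<in> arrows H" "k \<in> arrows H" "s k = x" "inv (?v k) \<in> U" if "k \<in> ?E" for k
  proof -
    show *: "?v k \<in> ?V" "r (?v k) = r k" "?v k \<in> arrows H" "k \<in> arrows H" "s k = x"
      using that bisection_range_section[OF V(1), of "r k"] by (auto simp: fibre_iff)
    show "inv (?v k) \<in> U"
      using *(1) bisection_arrow[OF U(2)] by auto
  qed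
  have uE: "inv (?u g) \<cdot> g \<in> ?E" "?v (inv (?u g) \<cdot> g) = inv (?u g)" if "g \<in> ?D" for g
  proof -
    note u = u[OF that]
    have rk: "r (inv (?u g) \<cdot> g) = r (inv (?u g))" and iV: "inv (?u g) \<in> ?V"
      using u by auto
    then show "inv (?u g) \<cdot> g \<in> ?E"
      using u by (auto simp: fibre_iff intro: image_eqI[of _ r "inv (?u g)"])
    show "?v (inv (?u g) \<cdot> g) = inv (?u g)"
      using bisection_range_section_eq[OF V(1) iV] rk by simp
  qed
  have vD: "inv (?v k) \<cdot> k \<in> ?D" "?u (inv (?v k) \<cdot> k) = inv (?v k)" if "k \<in> ?E" for k
  proof -
    note v = v[OF that]
    have rk: "r (inv (?v k) \<cdot> k) = r (inv (?v k))"
      using v by auto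
    then show "inv (?v k) \<cdot> k \<in> ?D"
      using v by (auto simp: fibre_iff intro: image_eqI[of _ r "inv (?v k)"])
    show "?u (inv (?v k) \<cdot> k) = inv (?v k)"
      using bisection_range_section_eq[OF U(2) v(6)] rk by simp
  qed
  have "l2inner H \<eta> (conv f \<xi>) x = (\<Sum>\<^sub>\<infinity>g\<in>?D. cnj (\<eta> g) * (f (?u g) * \<xi> (inv (?u g) \<cdot> g)))"
    unfolding l2inner_def
    by (rule infsum_cong_neutral) (auto simp: conv_bisection[OF U(2,1,3)] fibre_iff)
  also have "\<dots> = (\<Sum>\<^sub>\<infinity>k\<in>?E. cnj (fstar f (?v k) * \<eta> (inv (?v k) \<cdot> k)) * \<xi> k)"
  proof (rule infsum_reindex_bij_witness[where i = "\<lambda>k. inv (?v k) \<cdot> k" and j = "\<lambda>g. inv (?u g) \<cdot> g"])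
    fix g assume g: "g \<in> ?D"
    show "inv (?v (inv (?u g) \<cdot> g)) \<cdot> (inv (?u g) \<cdot> g) = g"
      unfolding uE(2)[OF g] using u[OF g] by simp
    show "inv (?u g) \<cdot> g \<in> ?E"
      by (rule uE(1)[OF g])
    show "cnj (fstar f (?v (inv (?u g) \<cdot> g)) * \<eta> (inv (?v (inv (?u g) \<cdot> g)) \<cdot> (inv (?u g) \<cdot> g))) * \<xi> (inv (?u g) \<cdot> g) =
        cnj (\<eta> g) * (f (?u g) * \<xi> (inv (?u g) \<cdot> g))"
      unfolding uE(2)[OF g] using u[OF g] by (simp add: fstar_def)
  next
    fix k assume k: "k \<in> ?E"
    show "inv (?u (inv (?v k) \<cdot> k)) \<cdot> (inv (?v k) \<cdot> k) = k"
      unfolding vD(2)[OF k] using v[OF k] by simp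
    show "inv (?v k) \<cdot> k \<in> ?D"
      by (rule vD(1)[OF k])
  qed
  also have "\<dots> = l2inner H (conv (fstar f) \<eta>) \<xi> x"
    unfolding l2inner_def
    by (rule infsum_cong_neutral) (auto simp: conv_bisection[OF V(1) fstar_Cc(1)[OF U(1)] V(2)] fibre_iff)
  finally show ?case .
qed

lemma Lambda_adjointable:
  assumes "f \<in> Cc X"
  shows "Lambda_op H f \<in> adjointable H"
proof (rule adjointableI(1)[where S = "Lambda_op H (fstar f)"])
  show "l2inner H \<eta> (Lambda_op H f \<xi>) x = l2inner H (Lambda_op H (fstar f) \<eta>) \<xi> x" if "\<xi> \<in> L2 H" "\<eta> \<in> L2 H" for \<xi> \<eta> x
    using that by (simp add: Lambda_op_eq conv_adjoint[OF assms] L2_sqs)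
qed (auto simp: Lambda_op_eq conv_L2 assms fstar_Cc)

text \<open>The two defining sums differ only in which argument is called the kernel, so
  \<open>rho\<close> inherits compact supports from \<open>conv\<close>.\<close>

lemma rho_eq_conv:
  assumes "g \<in> arrows H"
  shows "rho f \<xi> g = conv \<xi> f g"
  using assms by (simp add: rho_def conv_def mult.commute)

lemma rho_Cc: "f \<in> Cc X \<Longrightarrow> \<xi> \<in> Cc X \<Longrightarrow> rho f \<xi> \<in> Cc X"
proof -
  assume "f \<in> Cc X" "\<xi> \<in> Cc X"
  moreover have "rho f \<xi> = conv \<xi> f"
    using rho_eq_conv by (fastforce simp: rho_def conv_def)
  ultimately show ?thesis
    by (simp add: conv_Cc)
qed

text \<open>Right translation by \<open>inv u\<close> leads from the fibre over \<open>s u\<close>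
  to the one over \<open>r u\<close>; hence the estimate uses one bound \<open>M\<close> for all
  fibres, not the norm on the same fibre as for \<open>conv\<close>.\<close>

lemma rho_bounded:
  assumes "f \<in> Cc X"
  shows "\<exists>C\<ge>0. \<forall>\<zeta> M. (\<forall>y. sqs (fibre H y) \<zeta> \<and> nrm y \<zeta> \<le> M) \<longrightarrow> (\<forall>x. sqs (fibre H x) (rho f \<zeta>) \<and> nrm x (rho f \<zeta>) \<le> C * M)"
  using assms
proof (induction rule: Cc_induct)
  case (add f g)
  from add(3) obtain C where C: "C \<ge> 0" "\<forall>\<zeta> M. (\<forall>y. sqs (fibre H y) \<zeta> \<and> nrm y \<zeta> \<le> M) \<longrightarrow>
      (\<forall>x. sqs (fibre H x) (rho f \<zeta>) \<and> nrm x (rho f \<zeta>) \<le> C * M)"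
    by (elim exE conjE) (rule that)
  from add(4) obtain D where D: "D \<ge> 0" "\<forall>\<zeta> M. (\<forall>y. sqs (fibre H y) \<zeta> \<and> nrm y \<zeta> \<le> M) \<longrightarrow>
      (\<forall>x. sqs (fibre H x) (rho g \<zeta>) \<and> nrm x (rho g \<zeta>) \<le> D * M)"
    by (elim exE conjE) (rule that)
  show ?case
  proof (intro exI[of _ "C + D"] conjI allI impI)
    fix \<zeta> M x assume \<zeta>: "\<forall>y. sqs (fibre H y) \<zeta> \<and> nrm y \<zeta> \<le> M"
    show "sqs (fibre H x) (rho (\<lambda>x. f x + g x) \<zeta>)" "nrm x (rho (\<lambda>x. f x + g x) \<zeta>) \<le> (C + D) * M"
      using C(2)[THEN spec, THEN spec, THEN mp, OF \<zeta>, THEN spec, of x]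
        D(2)[THEN spec, THEN spec, THEN mp, OF \<zeta>, THEN spec, of x] en_add[of "fibre H x" "rho f \<zeta>" "rho g \<zeta>"]
      by (auto simp: rho_add_left add distrib_right intro: sqs_add)
  qed (use C D in auto)
next
  case (bisection f U)
  note U = bisection
  obtain B where B: "B \<ge> 0" "\<And>c. cmod (f c) \<le> B"
    using Cb_bounded[OF Cc_subset_Cb[OF U(1)]] by blast
  show ?case
  proof (intro exI[of _ B] allI impI conjI B(1))
    fix \<zeta> M x assume \<zeta>: "\<forall>y. sqs (fibre H y) \<zeta> \<and> nrm y \<zeta> \<le> M"
    then have M: "0 \<le> M"
      using en_nonneg order_trans by blast
    have eq: "rho f \<zeta> g = (if x \<in> s ` U then f (inv_into U s x) * \<zeta> (g \<cdot> inv (inv_into U s x)) else 0)"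
      if "g \<in> fibre H x" for g
      using that infsum_bisection[OF U(2,1,3), where x = x and k = "\<lambda>b. \<zeta> (g \<cdot> inv b)"] by (auto simp: rho_def fibre_iff)
    have "sqs (fibre H x) (rho f \<zeta>) \<and> nrm x (rho f \<zeta>) \<le> B * M"
    proof (cases "x \<in> s ` U")
      case True
      let ?u = "inv_into U s x"
      have u: "?u \<in> arrows H" "s ?u = x"
        using True inv_into_into f_inv_into_f bisection_arrow[OF U(2)] by metis+
      have inj: "inj_on (\<lambda>g. g \<cdot> inv ?u) (fibre H x)" and im: "(\<lambda>g. g \<cdot> inv ?u) ` fibre H x \<subseteq> fibre H (r ?u)"
        using bij_right_translation[of "inv ?u"] u by (auto simp: bij_betw_def)
      have val: "cmod (rho f \<zeta> g) \<le> B * cmod (\<zeta> (g \<cdot> inv ?u))" if "g \<in> fibre H x" for g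
        using True B by (simp add: eq[OF that] norm_mult mult_right_mono)
      have "sqs (fibre H (r ?u)) \<zeta>"
        using \<zeta> by blast
      then have "sqs (fibre H x) (rho f \<zeta>) \<and> nrm x (rho f \<zeta>) \<le> B * nrm (r ?u) \<zeta>"
        using en_partial_injection[where \<tau> = "\<lambda>g. g \<cdot> inv ?u" and D = "fibre H x" and A = "fibre H x"
            and g = "rho f \<zeta>", OF _ inj order_refl im B(1) val] by simp
      moreover have "B * nrm (r ?u) \<zeta> \<le> B * M"
        using \<zeta> B(1) by (intro mult_left_mono) auto
      ultimately show ?thesis
        by (meson order_trans)
    next
      case False
      then have "rho f \<zeta> g = 0" if "g \<in> fibre H x" for g
        using eq[OF that] by simp
      then have "sqs (fibre H x) (rho f \<zeta>) \<longleftrightarrow> sqs (fibre H x) (\<lambda>_. 0)" "nrm x (rho f \<zeta>) = nrm x (\<lambda>_. 0)"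
        by (intro sqs_cong en_cong; simp)+
      then show ?thesis
        using M B(1) by simp
    qed
    then show "sqs (fibre H x) (rho f \<zeta>)" "nrm x (rho f \<zeta>) \<le> B * M"
      by auto
  qed
qed

lemma rho_L2:
  assumes "f \<in> Cc X" "\<xi> \<in> L2 H"
  shows "rho f \<xi> \<in> L2 H"
proof (rule L2_closed)
  obtain C where C: "C \<ge> 0" "\<And>\<zeta> M x. (\<forall>y. sqs (fibre H y) \<zeta> \<and> nrm y \<zeta> \<le> M) \<Longrightarrow> sqs (fibre H x) (rho f \<zeta>) \<and> nrm x (rho f \<zeta>) \<le> C * M"
    using rho_bounded[OF assms(1)] by blast
  fix \<epsilon> :: real assume e: "\<epsilon> > 0"
  then have "\<epsilon> / (C + 1) > 0"
    using C(1) by simp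
  then obtain \<eta> where \<eta>: "\<eta> \<in> Cc X" "\<And>x. sqs (fibre H x) (\<lambda>g. \<xi> g - \<eta> g)" "\<And>x. nrm x (\<lambda>g. \<xi> g - \<eta> g) \<le> \<epsilon> / (C + 1)"
    using L2_approx[OF assms(2)] by metis
  have "C * (\<epsilon> / (C + 1)) \<le> \<epsilon>"
    using e C(1) by (simp add: field_simps)
  then have "sqs (fibre H x) (\<lambda>g. rho f \<xi> g - rho f \<eta> g) \<and> nrm x (\<lambda>g. rho f \<xi> g - rho f \<eta> g) \<le> \<epsilon>" for x
    using C(2)[of "\<lambda>g. \<xi> g - \<eta> g" "\<epsilon> / (C + 1)" x] \<eta>(2,3) unfolding rho_diff_right[OF assms(1)] by (meson order_trans)
  then show "\<exists>\<eta>\<in>L2 H. \<forall>x. sqs (fibre H x) (\<lambda>g. rho f \<xi> g - \<eta> g) \<and> nrm x (\<lambda>g. rho f \<xi> g - \<eta> g) \<le> \<epsilon>"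
    using Cc_in_L2[OF rho_Cc[OF assms(1) \<eta>(1)]] by blast
qed (simp add: rho_def)

end

section \<open>Equivariant and compactly supported operators\<close>

context etale
begin

text \<open>A delta as kernel yields translation by a single arrow, so testing equivariance on such
  kernels isolates one arrow at a time.\<close>

lemma rho_delta:
  assumes "c \<in> arrows H" "g \<in> fibre H (s c)"
  shows "rho (delta c) \<xi> g = \<xi> (g \<cdot> inv c)"
proof -
  have "(\<Sum>\<^sub>\<infinity>b\<in>fibre H (s g). delta c b * \<xi> (g \<cdot> inv b)) = delta c c * \<xi> (g \<cdot> inv c)"
    using assms delta(3)[OF assms(1)] by (intro infsum_single) (auto simp: fibre_iff)
  then show ?thesis
    using assms delta(2)[OF assms(1)] by (simp add: rho_def fibre_iff)
qed

text \<open>For adjointable \<open>T\<close> this says that the matrix coefficients satisfy \<open>t (h \<cdot> c) (k \<cdot> c) = t h k\<close>.\<close>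

definition invariant :: "('a, 'a) oper \<Rightarrow> bool" where
  "invariant T \<longleftrightarrow> (\<forall>c\<in>arrows H. \<forall>\<xi>\<in>L2 H. \<forall>\<eta>\<in>L2 H.
     (\<forall>h\<in>fibre H (r c). \<eta> (h \<cdot> c) = \<xi> h) \<longrightarrow> (\<forall>h\<in>fibre H (r c). T \<eta> (h \<cdot> c) = T \<xi> h))"

lemma invariantD:
  "invariant T \<Longrightarrow> c \<in> arrows H \<Longrightarrow> \<xi> \<in> L2 H \<Longrightarrow> \<eta> \<in> L2 H \<Longrightarrow> (\<And>h. h \<in> fibre H (r c) \<Longrightarrow> \<eta> (h \<cdot> c) = \<xi> h) \<Longrightarrow>
    h \<in> fibre H (r c) \<Longrightarrow> T \<eta> (h \<cdot> c) = T \<xi> h"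
  unfolding invariant_def by blast

lemma right_translation_cases:
  assumes "c \<in> arrows H" "g \<in> fibre H (s c)"
  shows "g \<cdot> inv c \<in> fibre H (r c)" "(g \<cdot> inv c) \<cdot> c = g"
  using assms by (auto simp: fibre_iff)

lemma right_translation_fibre:
  assumes "c \<in> arrows H" "h \<in> fibre H (r c)"
  shows "h \<cdot> c \<in> fibre H (s c)" "(h \<cdot> c) \<cdot> inv c = h" "h \<cdot> c \<in> arrows H"
  using assms by (auto simp: fibre_iff)

lemma L2_sum:
  assumes "finite F" "\<And>i. i \<in> F \<Longrightarrow> \<xi> i \<in> L2 H"
  shows "(\<lambda>g. \<Sum>i\<in>F. c i * \<xi> i g) \<in> L2 H"
  using assms
proof (induction F rule: finite_induct)
  case (insert i F)
  have "(\<lambda>g. c i * \<xi> i g) \<in> L2 H" "(\<lambda>g. \<Sum>i\<in>F. c i * \<xi> i g) \<in> L2 H"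
    using insert by (simp_all add: L2_scale)
  from L2_add[OF this] show ?case
    using insert.hyps by simp
qed simp

lemma adjointable_sum:
  assumes T: "T \<in> adjointable H" and F: "finite F" "\<And>i. i \<in> F \<Longrightarrow> \<xi> i \<in> L2 H"
  shows "T (\<lambda>g. \<Sum>i\<in>F. c i * \<xi> i g) = (\<lambda>g. \<Sum>i\<in>F. c i * T (\<xi> i) g)"
  using F
proof (induction F rule: finite_induct)
  case empty
  then show ?case using adjointable_zero_vector[OF T] by simp
next
  case (insert i F)
  have L: "(\<lambda>g. c i * \<xi> i g) \<in> L2 H" "(\<lambda>g. \<Sum>i\<in>F. c i * \<xi> i g) \<in> L2 H"
    using insert by (auto intro: L2_scale L2_sum)
  have "T (\<lambda>g. c i * \<xi> i g + (\<Sum>i\<in>F. c i * \<xi> i g)) = (\<lambda>g. c i * T (\<xi> i) g + (\<Sum>i\<in>F. c i * T (\<xi> i) g))"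
    using adjointable_linear(1)[OF T L] adjointable_linear(2)[OF T insert.prems[OF insertI1] insert.prems[OF insertI1], of "c i"]
      insert.IH insert.prems by simp
  then show ?case
    using insert.hyps by simp
qed

text \<open>One direction tests with \<open>rho (delta c)\<close>. For the other, on a single fibre
  \<open>rho f\<close> is a finite linear combination of such translations, and \<open>T\<close> is
  linear and acts fibrewise.\<close>

lemma equivariant_iff_invariant:
  assumes T: "T \<in> adjointable H"
  shows "equivariant H T \<longleftrightarrow> invariant T"
proof
  assume eq: "equivariant H T"
  show "invariant T"
    unfolding invariant_def
  proof (intro ballI impI)
    fix c \<xi> \<eta> h
    assume c: "c \<in> arrows H" and L: "\<xi> \<in> L2 H" "\<eta> \<in> L2 H" and pair: "\<forall>h\<in>fibre H (r c). \<eta> (h \<cdot> c) = \<xi> h"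
      and h: "h \<in> fibre H (r c)"
    have R: "rho (delta c) \<xi> \<in> L2 H"
      by (intro rho_L2 delta c L)
    have "\<eta> k = rho (delta c) \<xi> k" if "k \<in> fibre H (s c)" for k
      using right_translation_cases[OF c that] pair rho_delta[OF c that] by metis
    then have "T \<eta> (h \<cdot> c) = T (rho (delta c) \<xi>) (h \<cdot> c)"
      using right_translation_fibre[OF c h] by (intro fibre_local[OF T L(2) R, of "s c"]) auto
    also have "\<dots> = rho (delta c) (T \<xi>) (h \<cdot> c)"
    proof -
      have "(T \<circ> rho_op H (delta c)) \<xi> = (rho_op H (delta c) \<circ> T) \<xi>"
        using eq delta(1)[OF c] by (simp add: equivariant_def)
      then show ?thesis
        using L(1) adjointable_L2[OF T L(1)] by (simp add: rho_op_eq)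
    qed
    also have "\<dots> = T \<xi> h"
      using rho_delta[OF c right_translation_fibre(1)[OF c h]] right_translation_fibre(2)[OF c h] by simp
    finally show "T \<eta> (h \<cdot> c) = T \<xi> h" .
  qed
next
  assume inv: "invariant T"
  show "equivariant H T"
    unfolding equivariant_def
  proof (intro ballI ext)
    fix f \<xi> g assume f: "f \<in> Cc X"
    show "(T \<circ> rho_op H f) \<xi> g = (rho_op H f \<circ> T) \<xi> g"
    proof (cases "\<xi> \<in> L2 H \<and> g \<in> arrows H")
      case False
      then show ?thesis
        using adjointable_outside[OF T] adjointable_zero_vector[OF T] L2_zero_outside[OF adjointable_L2[OF T rho_L2[OF f]]]
          adjointable_L2[OF T]
        by (auto simp: rho_op_eq rho_def)
    next
      case True
      then have \<xi>: "\<xi> \<in> L2 H" and g: "g \<in> arrows H" by auto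
      let ?x = "s g"
      let ?F = "{b \<in> fibre H ?x. f b \<noteq> 0}"
      have fin: "finite ?F"
        by (rule Cc_fibre_finite[OF f])
      have expand: "rho f \<zeta> k = (\<Sum>b\<in>?F. f b * \<zeta> (k \<cdot> inv b))" if "k \<in> fibre H ?x" for \<zeta> k
      proof -
        have "(\<Sum>\<^sub>\<infinity>b\<in>fibre H ?x. f b * \<zeta> (k \<cdot> inv b)) = (\<Sum>\<^sub>\<infinity>b\<in>?F. f b * \<zeta> (k \<cdot> inv b))"
          by (rule infsum_cong_neutral) auto
        then show ?thesis
          using that fin by (simp add: rho_def fibre_iff)
      qed
      have RL: "rho (delta b) \<xi> \<in> L2 H" if "b \<in> ?F" for b
        using that \<xi> by (intro rho_L2 delta) (auto simp: fibre_iff)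
      have "T (rho f \<xi>) g = T (\<lambda>k. \<Sum>b\<in>?F. f b * rho (delta b) \<xi> k) g"
      proof (rule fibre_local[where x = ?x, OF T rho_L2[OF f \<xi>] L2_sum[OF fin RL]])
        show "rho f \<xi> k = (\<Sum>b\<in>?F. f b * rho (delta b) \<xi> k)" if k: "k \<in> fibre H ?x" for k
          unfolding expand[OF k] using k by (intro sum.cong) (auto simp: fibre_iff rho_delta)
      qed (use g in \<open>auto simp: fibre_iff\<close>)
      also have "\<dots> = (\<Sum>b\<in>?F. f b * T (rho (delta b) \<xi>) g)"
        using adjointable_sum[OF T fin RL] by simp
      also have "\<dots> = (\<Sum>b\<in>?F. f b * T \<xi> (g \<cdot> inv b))"
      proof (rule sum.cong[OF refl])
        fix b assume b: "b \<in> ?F"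
        then have b': "b \<in> arrows H" "g \<in> fibre H (s b)"
          using g by (auto simp: fibre_iff)
        have "rho (delta b) \<xi> (h \<cdot> b) = \<xi> h" if "h \<in> fibre H (r b)" for h
          using rho_delta[OF b'(1) right_translation_fibre(1)[OF b'(1) that]] right_translation_fibre(2)[OF b'(1) that] by simp
        then show "f b * T (rho (delta b) \<xi>) g = f b * T \<xi> (g \<cdot> inv b)"
          using invariantD[OF inv b'(1) \<xi> RL[OF b], of "g \<cdot> inv b"] right_translation_cases[OF b'] by simp
      qed
      also have "\<dots> = rho f (T \<xi>) g"
        using expand[of g "T \<xi>"] g by (simp add: fibre_iff)
      finally show ?thesis
        using \<xi> adjointable_L2[OF T \<xi>] by (simp add: rho_op_eq)
    qed
  qed
qed

lemma l2inner_translate: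
  assumes c: "c \<in> arrows H"
    and "\<And>h. h \<in> fibre H (r c) \<Longrightarrow> \<eta>' (h \<cdot> c) = \<eta> h" "\<And>h. h \<in> fibre H (r c) \<Longrightarrow> \<xi>' (h \<cdot> c) = \<xi> h"
  shows "l2inner H \<eta>' \<xi>' (s c) = l2inner H \<eta> \<xi> (r c)"
proof -
  have "(\<Sum>\<^sub>\<infinity>h\<in>fibre H (r c). cnj (\<eta>' (h \<cdot> c)) * \<xi>' (h \<cdot> c)) = (\<Sum>\<^sub>\<infinity>g\<in>fibre H (s c). cnj (\<eta>' g) * \<xi>' g)"
    by (rule infsum_reindex_bij_betw[OF bij_right_translation[OF c]])
  moreover have "(\<Sum>\<^sub>\<infinity>h\<in>fibre H (r c). cnj (\<eta>' (h \<cdot> c)) * \<xi>' (h \<cdot> c)) = (\<Sum>\<^sub>\<infinity>h\<in>fibre H (r c). cnj (\<eta> h) * \<xi> h)"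
    using assms by (intro infsum_cong) simp
  ultimately show ?thesis
    by (simp add: l2inner_def)
qed

lemma nrm_translate:
  assumes "c \<in> arrows H" "\<xi> \<in> L2 H" "\<xi>' \<in> L2 H" "\<And>h. h \<in> fibre H (r c) \<Longrightarrow> \<xi>' (h \<cdot> c) = \<xi> h"
  shows "nrm (s c) \<xi>' = nrm (r c) \<xi>"
  using l2inner_translate[where \<xi> = \<xi> and \<eta> = \<xi> and \<xi>' = \<xi>' and \<eta>' = \<xi>', OF assms(1,4,4)]
  by (simp add: nrm_eq assms)

lemma equivariant_ops_iff: "T \<in> equivariant_ops H \<longleftrightarrow> T \<in> adjointable H \<and> invariant T"
  using equivariant_iff_invariant by (auto simp: equivariant_ops_def)

lemma equivariant_ops_adjointable: "T \<in> equivariant_ops H \<Longrightarrow> T \<in> adjointable H"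
  by (simp add: equivariant_ops_def)

lemma delta_translate:
  assumes "c \<in> arrows H" "k \<in> fibre H (r c)" "h \<in> fibre H (r c)"
  shows "delta (k \<cdot> c) (h \<cdot> c) = delta k h"
proof -
  have k: "k \<cdot> c \<in> arrows H" "s (k \<cdot> c) = s c" "k \<in> arrows H" "s k = r c"
    using assms by (auto simp: fibre_iff)
  have "h \<cdot> c \<in> fibre H (s (k \<cdot> c))" "h \<in> fibre H (s k)"
    using assms k by (auto simp: fibre_iff)
  moreover have "h \<cdot> c = k \<cdot> c \<longleftrightarrow> h = k"
    using right_translation_fibre(2)[OF assms(1)] assms by metis
  ultimately show ?thesis
    using delta(3)[OF k(1)] delta(3)[OF k(3)] by simp
qed

text \<open>The value of the adjoint at \<open>k\<close> pairs \<open>T (delta k)\<close> with the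
  argument over one fibre, and both entries are carried along by right translation.\<close>

lemma invariant_adj:
  assumes T: "T \<in> adjointable H" and inv: "invariant T"
  shows "invariant (adj H T)"
  unfolding invariant_def
proof (intro ballI impI)
  fix c \<xi> \<eta> k
  assume c: "c \<in> arrows H" and L: "\<xi> \<in> L2 H" "\<eta> \<in> L2 H" and pair: "\<forall>h\<in>fibre H (r c). \<eta> (h \<cdot> c) = \<xi> h"
    and k: "k \<in> fibre H (r c)"
  have k': "k \<cdot> c \<in> arrows H" "s (k \<cdot> c) = s c" "k \<in> arrows H" "s k = r c"
    using c k by (auto simp: fibre_iff)
  have D: "delta k \<in> L2 H" "delta (k \<cdot> c) \<in> L2 H"
    using k' by (auto intro: delta_L2)
  have "adj H T \<eta> (k \<cdot> c) = l2inner H (T (delta (k \<cdot> c))) \<eta> (s c)"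
    using inner_delta[OF k'(1), of "adj H T \<eta>"] adj_inner'[OF T L(2) D(2)] k'(2) by simp
  also have "\<dots> = l2inner H (T (delta k)) \<xi> (r c)"
    using invariantD[OF inv c D delta_translate[OF c k]] pair by (intro l2inner_translate[OF c]) auto
  also have "\<dots> = adj H T \<xi> k"
    using inner_delta[OF k'(3), of "adj H T \<xi>"] adj_inner'[OF T L(1) D(1)] k'(4) by simp
  finally show "adj H T \<eta> (k \<cdot> c) = adj H T \<xi> k" .
qed

lemma star_algebra_equivariant: "star_algebra (equivariant_ops H)"
  unfolding star_algebra_def
proof (intro conjI ballI allI)
  show "equivariant_ops H \<subseteq> adjointable H"
    using equivariant_ops_adjointable by blast
  show "(\<lambda>_ _. 0) \<in> equivariant_ops H"
    by (simp add: equivariant_ops_iff adjointable_zero invariant_def)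
next
  fix S T assume "S \<in> equivariant_ops H" "T \<in> equivariant_ops H"
  then have S: "S \<in> adjointable H" "invariant S" and T: "T \<in> adjointable H" "invariant T"
    by (auto simp: equivariant_ops_iff)
  show "(\<lambda>\<xi> g. S \<xi> g + T \<xi> g) \<in> equivariant_ops H"
    using S T adjointable_add(1)[OF S(1) T(1)] by (simp add: equivariant_ops_iff invariant_def)
  have "invariant (S \<circ> T)"
    using S T adjointable_L2[OF T(1)] by (simp add: invariant_def)
  then show "S \<circ> T \<in> equivariant_ops H"
    using adjointable_comp(1)[OF S(1) T(1)] by (simp add: equivariant_ops_iff)
next
  fix c T assume "T \<in> equivariant_ops H"
  then show "(\<lambda>\<xi> g. c * T \<xi> g) \<in> equivariant_ops H"
    by (simp add: equivariant_ops_iff invariant_def adjointable_scale)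
next
  fix T assume "T \<in> equivariant_ops H"
  then show "adj H T \<in> equivariant_ops H"
    by (simp add: equivariant_ops_iff invariant_adj adj_adjointable)
qed

lemma approximating_sequence:
  assumes B: "B \<subseteq> adjointable H" and T: "T \<in> op_closure H B"
  obtains S where "\<And>n. S n \<in> B" "\<And>n. near T (S n) ((1/2) ^ n)"
proof -
  have "\<forall>n. \<exists>S\<in>B. near T S ((1/2) ^ n)"
    using T op_closure_iff[OF B] by simp
  then show thesis
    using that by metis
qed

lemma half_power_tendsto_0: "(\<lambda>n. (1/2) ^ n :: real) \<longlonglongrightarrow> 0"
  by (rule LIMSEQ_power_zero) simp

lemma equivariant_closed: "op_closure H (equivariant_ops H) \<subseteq> equivariant_ops H"
proof
  fix T assume "T \<in> op_closure H (equivariant_ops H)"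
  moreover have sub: "equivariant_ops H \<subseteq> adjointable H"
    using equivariant_ops_adjointable by blast
  ultimately obtain S where S: "\<And>n. S n \<in> equivariant_ops H" "\<And>n. near T (S n) ((1/2) ^ n)" and T: "T \<in> adjointable H"
    using approximating_sequence op_closure_adjointable by (metis subsetD)
  have SA: "S n \<in> adjointable H" "invariant (S n)" for n
    using S(1) equivariant_ops_iff by auto
  have lim: "(\<lambda>n. S n \<xi> g) \<longlonglongrightarrow> T \<xi> g" if "\<xi> \<in> L2 H" for \<xi> g
    by (rule near_pointwise[OF T SA(1) S(2) half_power_tendsto_0 that])
  have "invariant T"
    unfolding invariant_def
  proof (intro ballI impI)
    fix c \<xi> \<eta> h
    assume c: "c \<in> arrows H" and L: "\<xi> \<in> L2 H" "\<eta> \<in> L2 H" and pair: "\<forall>h\<in>fibre H (r c). \<eta> (h \<cdot> c) = \<xi> h"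
      and h: "h \<in> fibre H (r c)"
    have "S n \<eta> (h \<cdot> c) = S n \<xi> h" for n
      using invariantD[OF SA(2) c L] pair h by blast
    then show "T \<eta> (h \<cdot> c) = T \<xi> h"
      using lim[OF L(2), of "h \<cdot> c"] lim[OF L(1), of h] LIMSEQ_unique by auto
  qed
  then show "T \<in> equivariant_ops H"
    using T equivariant_ops_iff by blast
qed

text \<open>The kernel depends only on \<open>h \<cdot> inv b\<close>, which does not change when
  \<open>h\<close> and \<open>b\<close> are both multiplied by \<open>c\<close> on the
  right.\<close>

lemma Lambda_equivariant:
  assumes "f \<in> Cc X"
  shows "Lambda_op H f \<in> equivariant_ops H"
  unfolding equivariant_ops_iff invariant_def
proof (intro conjI ballI impI Lambda_adjointable[OF assms])
  fix c \<xi> \<eta> h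
  assume c: "c \<in> arrows H" and L: "\<xi> \<in> L2 H" "\<eta> \<in> L2 H" and pair: "\<forall>h\<in>fibre H (r c). \<eta> (h \<cdot> c) = \<xi> h"
    and h: "h \<in> fibre H (r c)"
  have hc: "h \<in> arrows H" "s h = r c" "h \<cdot> c \<in> arrows H" "s (h \<cdot> c) = s c"
    using h c by (auto simp: fibre_iff)
  have "conv f \<eta> (h \<cdot> c) = (\<Sum>\<^sub>\<infinity>a\<in>fibre H (s c). f ((h \<cdot> c) \<cdot> inv a) * \<eta> a)"
    using hc by (simp add: conv_def)
  also have "\<dots> = (\<Sum>\<^sub>\<infinity>b\<in>fibre H (r c). f ((h \<cdot> c) \<cdot> inv (b \<cdot> c)) * \<eta> (b \<cdot> c))"
    by (rule infsum_reindex_bij_betw[OF bij_right_translation[OF c], symmetric])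
  also have "\<dots> = (\<Sum>\<^sub>\<infinity>b\<in>fibre H (r c). f (h \<cdot> inv b) * \<xi> b)"
  proof (rule infsum_cong)
    fix b assume b: "b \<in> fibre H (r c)"
    then have "(h \<cdot> c) \<cdot> inv (b \<cdot> c) = h \<cdot> inv b"
      using hc c by (simp add: fibre_iff inv_mul mul_assoc)
    then show "f ((h \<cdot> c) \<cdot> inv (b \<cdot> c)) * \<eta> (b \<cdot> c) = f (h \<cdot> inv b) * \<xi> b"
      using pair b by simp
  qed
  also have "\<dots> = conv f \<xi> h"
    using hc by (simp add: conv_def)
  finally show "Lambda_op H f \<eta> (h \<cdot> c) = Lambda_op H f \<xi> h"
    using L by (simp add: Lambda_op_eq)
qed

text \<open>The matrix coefficients of \<open>T\<close> vanish at \<open>(g, h)\<close> unless \<open>g \<cdot> inv h \<in> K\<close>.\<close>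

definition propagation :: "'a set \<Rightarrow> ('a, 'a) oper \<Rightarrow> bool" where
  "propagation K T \<longleftrightarrow> (\<forall>\<xi>\<in>L2 H. \<forall>g\<in>arrows H.
     (\<forall>h\<in>fibre H (s g). g \<cdot> inv h \<in> K \<longrightarrow> \<xi> h = 0) \<longrightarrow> T \<xi> g = 0)"

lemma propagationD:
  "propagation K T \<Longrightarrow> \<xi> \<in> L2 H \<Longrightarrow> g \<in> arrows H \<Longrightarrow> (\<And>h. h \<in> fibre H (s g) \<Longrightarrow> g \<cdot> inv h \<in> K \<Longrightarrow> \<xi> h = 0) \<Longrightarrow> T \<xi> g = 0"
  unfolding propagation_def by blast

lemma propagation_mono: "propagation K T \<Longrightarrow> K \<subseteq> L \<Longrightarrow> propagation L T"
  unfolding propagation_def by blast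

lemma adj_delta:
  assumes T: "T \<in> adjointable H" and "g \<in> arrows H" "h \<in> fibre H (s g)"
  shows "adj H T (delta g) h = cnj (T (delta h) g)"
proof -
  have h: "h \<in> arrows H" "s h = s g"
    using assms by (auto simp: fibre_iff)
  have "adj H T (delta g) h = l2inner H (T (delta h)) (delta g) (s g)"
    using inner_delta[OF h(1), of "adj H T (delta g)"] adj_inner'[OF T delta_L2[OF assms(2)] delta_L2[OF h(1)]] h(2)
    by simp
  then show ?thesis
    using inner_delta_right[OF assms(2)] by simp
qed

text \<open>The coefficients in row \<open>g\<close> are the conjugated values of
  \<open>adj H T (delta g)\<close> on the fibre, so this is the evaluation formula for
  \<open>T\<close> written out.\<close>

lemma matrix_expansion:
  assumes T: "T \<in> adjointable H" and "\<xi> \<in> L2 H" "g \<in> arrows H"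
  shows "T \<xi> g = (\<Sum>\<^sub>\<infinity>h\<in>fibre H (s g). T (delta h) g * \<xi> h)"
proof -
  have "T \<xi> g = (\<Sum>\<^sub>\<infinity>h\<in>fibre H (s g). cnj (adj H T (delta g) h) * \<xi> h)"
    using adj_eval[OF assms] by (simp add: l2inner_def)
  then show ?thesis
    by (simp add: adj_delta[OF T assms(3)] cong: infsum_cong)
qed

lemma propagation_coefficients:
  assumes T: "T \<in> adjointable H"
    and zero: "\<And>g h. g \<in> arrows H \<Longrightarrow> h \<in> fibre H (s g) \<Longrightarrow> g \<cdot> inv h \<notin> K \<Longrightarrow> T (delta h) g = 0"
  shows "propagation K T"
  unfolding propagation_def
proof (intro ballI impI)
  fix \<xi> g assume \<xi>: "\<xi> \<in> L2 H" and g: "g \<in> arrows H"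
    and K: "\<forall>h\<in>fibre H (s g). g \<cdot> inv h \<in> K \<longrightarrow> \<xi> h = 0"
  have "T (delta h) g * \<xi> h = 0" if "h \<in> fibre H (s g)" for h
    using that K zero[OF g] by (cases "g \<cdot> inv h \<in> K") auto
  then show "T \<xi> g = 0"
    unfolding matrix_expansion[OF T \<xi> g] by (rule infsum_0)
qed

text \<open>If \<open>T\<close> has propagation in \<open>K\<close>, a nonzero value of
  \<open>g T f\<close> would exhibit a point of the support of \<open>g\<close> in \<open>K\<close>
  times the support of \<open>f\<close>. Conversely a coefficient is isolated by bumps at
  \<open>h\<close> and \<open>g\<close> whose supports are small enough to be separated.\<close>

lemma compactly_supported_iff:
  assumes T: "T \<in> adjointable H"
  shows "compactly_supported H T \<longleftrightarrow> (\<exists>K. compactin X K \<and> propagation K T)"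
proof
  assume "\<exists>K. compactin X K \<and> propagation K T"
  then obtain K where K: "compactin X K" "propagation K T" by blast
  have "(\<lambda>a. g a * T (\<lambda>b. f b * \<xi> b) a) = (\<lambda>_. 0)"
    if f: "f \<in> Cb X" and g: "g \<in> Cb X" and sep: "K_separated H K f g" and \<xi>: "\<xi> \<in> L2 H" for f g \<xi>
  proof
    fix a
    show "g a * T (\<lambda>b. f b * \<xi> b) a = 0"
    proof (cases "g a = 0")
      case False
      then have a: "a \<in> arrows H" "a \<in> supp_on X g"
        using g in_supp_on[of a X g] by (auto simp: Cb_def)
      have "T (\<lambda>b. f b * \<xi> b) a = 0"
      proof (rule propagationD[OF K(2) Cb_mult_L2[OF f \<xi>] a(1)])
        fix h assume h: "h \<in> fibre H (s a)" "a \<cdot> inv h \<in> K"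
        have "f h = 0"
        proof (rule ccontr)
          assume "f h \<noteq> 0"
          then have "h \<in> supp_on X f"
            using h by (intro in_supp_on) (auto simp: fibre_iff)
          moreover have "a = (a \<cdot> inv h) \<cdot> h" "s (a \<cdot> inv h) = r h"
            using h a by (auto simp: fibre_iff)
          ultimately have "a \<in> set_mul H K (supp_on X f)"
            unfolding set_mul_def using h(2) by blast
          then show False
            using sep a(2) by (auto simp: K_separated_def)
        qed
        then show "f h * \<xi> h = 0" by simp
      qed
      then show ?thesis by simp
    qed simp
  qed
  then show "compactly_supported H T"
    unfolding compactly_supported_def using K(1) by blast
next
  assume "compactly_supported H T"
  then obtain K where K: "compactin X K" and sep': "\<forall>f\<in>Cb X. \<forall>g\<in>Cb X. K_separated H K f g \<longrightarrow>
      (\<forall>\<xi>\<in>L2 H. (\<lambda>a. g a * T (\<lambda>b. f b * \<xi> b) a) = (\<lambda>_. 0))"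
    unfolding compactly_supported_def by (elim exE conjE) (rule that)
  have sep: "g a * T (\<lambda>b. f b * \<xi> b) a = 0"
    if "f \<in> Cb X" "g \<in> Cb X" "K_separated H K f g" "\<xi> \<in> L2 H" for f g \<xi> a
    using fun_cong[OF sep'[THEN bspec, OF that(1), THEN bspec, OF that(2), THEN mp, OF that(3), THEN bspec, OF that(4)], of a] .
  \<comment> \<open>Separation is a condition on both orders of the supports, so both
    \<open>g \<cdot> inv h\<close> and its inverse must avoid \<open>K\<close>.\<close>
  let ?K = "K \<union> inv ` K"
  have K': "compactin X ?K"
    using K by (intro compactin_Un compactin_inv)
  have "propagation ?K T"
  proof (rule propagation_coefficients[OF T])
    fix g h assume g: "g \<in> arrows H" and h: "h \<in> fibre H (s g)" and gh: "g \<cdot> inv h \<notin> ?K"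
    have h': "h \<in> arrows H" "s h = s g"
      using h by (auto simp: fibre_iff)
    \<comment> \<open>Among pairs with equal source, those whose quotient avoids \<open>?K\<close>
      form a relatively open set; a box \<open>B \<times> A\<close> around \<open>(g, h)\<close>
      gives room for the two bumps.\<close>
    let ?P = "prod_topology X X"
    let ?S = "{p. s (fst p) = s (snd p)}"
    have cont: "continuous_map (subtopology ?P ?S) X (\<lambda>p. fst p \<cdot> inv (snd p))"
      by (intro continuous_mul continuous_inv' continuous_map_from_subtopology continuous_map_fst continuous_map_snd) auto
    have "openin X (topspace X - ?K)"
      using Hausdorff K' compactin_imp_closedin by blast
    with cont have "openin (subtopology ?P ?S) {p \<in> topspace (subtopology ?P ?S). fst p \<cdot> inv (snd p) \<in> topspace X - ?K}"
      by (rule openin_continuous_map_preimage)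
    then obtain W where W: "openin ?P W"
        "{p \<in> topspace (subtopology ?P ?S). fst p \<cdot> inv (snd p) \<in> topspace X - ?K} = W \<inter> ?S"
      unfolding openin_subtopology by blast
    have "(g, h) \<in> W \<inter> ?S"
      unfolding W(2)[symmetric] using g h' gh by auto
    then obtain B A where BA: "openin X B" "openin X A" "g \<in> B" "h \<in> A" "B \<times> A \<subseteq> W"
      using W(1) unfolding openin_prod_topology_alt by (metis IntD1)
    have far: "b \<cdot> inv a \<notin> K" "a \<cdot> inv b \<notin> K" if "b \<in> B" "a \<in> A" "s b = s a" for a b
    proof -
      have ab: "a \<in> arrows H" "b \<in> arrows H"
        using that BA openin_subset by fastforce+
      have "(b, a) \<in> W \<inter> ?S"
        using that BA(5) by auto
      then have *: "b \<cdot> inv a \<notin> ?K"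
        unfolding W(2)[symmetric] by auto
      then show "b \<cdot> inv a \<notin> K" by blast
      have "b \<cdot> inv a = inv (a \<cdot> inv b)"
        using ab that(3) inv_mul[of a "inv b"] by simp
      then show "a \<cdot> inv b \<notin> K"
        using * by blast
    qed
    obtain f where f: "f \<in> Cc X" "f h = 1" "supp_on X f \<subseteq> A"
      using delta_exists[OF BA(2,4)] by metis
    obtain \<phi> where \<phi>: "\<phi> \<in> Cc X" "\<phi> g = 1" "supp_on X \<phi> \<subseteq> B"
      using delta_exists[OF BA(1,3)] by metis
    have KA: "K \<subseteq> arrows H" "A \<subseteq> arrows H" "B \<subseteq> arrows H"
      using compactin_subset_topspace[OF K(1)] openin_subset[OF BA(1)] openin_subset[OF BA(2)] by simp_all
    have "K_separated H K f \<phi>"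
      unfolding K_separated_def
    proof (intro conjI)
      have "k \<cdot> a \<notin> B" if ka: "k \<in> K" "a \<in> A" "s k = r a" for k a
      proof -
        have "k \<in> arrows H" "a \<in> arrows H"
          using ka KA by blast+
        then have "s (k \<cdot> a) = s a" "(k \<cdot> a) \<cdot> inv a = k"
          using ka(3) by simp_all
        then show ?thesis
          using far(1)[of "k \<cdot> a" a] ka by metis
      qed
      then show "set_mul H K (supp_on X f) \<inter> supp_on X \<phi> = {}"
        using f(3) \<phi>(3) by (auto simp: set_mul_def)
      have "k \<cdot> b \<notin> A" if kb: "k \<in> K" "b \<in> B" "s k = r b" for k b
      proof -
        have "k \<in> arrows H" "b \<in> arrows H"
          using kb KA by blast+
        then have "s (k \<cdot> b) = s b" "(k \<cdot> b) \<cdot> inv b = k"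
          using kb(3) by simp_all
        then show ?thesis
          using far(2)[of b "k \<cdot> b"] kb by metis
      qed
      then show "supp_on X f \<inter> set_mul H K (supp_on X \<phi>) = {}"
        using f(3) \<phi>(3) by (auto simp: set_mul_def)
    qed
    then have "\<phi> g * T (\<lambda>b. f b * delta h b) g = 0"
      by (rule sep[OF Cc_subset_Cb[OF f(1)] Cc_subset_Cb[OF \<phi>(1)] _ delta_L2[OF h'(1)]])
    moreover have "T (\<lambda>b. f b * delta h b) g = T (delta h) g"
    proof (rule fibre_local[OF T Cb_mult_L2[OF Cc_subset_Cb[OF f(1)] delta_L2[OF h'(1)]] delta_L2[OF h'(1)], of "s h"])
      show "f b * delta h b = delta h b" if "b \<in> fibre H (s h)" for b
        using delta(3)[OF h'(1) that] f(2) by simp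
    qed (use g h' in \<open>auto simp: fibre_iff\<close>)
    ultimately show "T (delta h) g = 0"
      using \<phi>(2) by simp
  qed
  then show "\<exists>K. compactin X K \<and> propagation K T"
    using K' by blast
qed

lemma Cu_alg_iff: "T \<in> Cu_alg H \<longleftrightarrow> T \<in> adjointable H \<and> (\<exists>K. compactin X K \<and> propagation K T)"
  using compactly_supported_iff by (auto simp: Cu_alg_def)

lemma Cu_alg_adjointable: "Cu_alg H \<subseteq> adjointable H"
  by (auto simp: Cu_alg_def)

text \<open>Propagation sets behave like supports: sums, composites and adjoints lead to unions,
  products and inverses, all of them again compact.\<close>

lemma star_algebra_Cu_alg: "star_algebra (Cu_alg H)"
  unfolding star_algebra_def
proof (intro conjI ballI allI Cu_alg_adjointable)
  show "(\<lambda>_ _. 0) \<in> Cu_alg H"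
    unfolding Cu_alg_iff by (auto simp: adjointable_zero propagation_def intro!: exI[of _ "{}"])
next
  fix S T assume "S \<in> Cu_alg H" "T \<in> Cu_alg H"
  then obtain K L where S: "S \<in> adjointable H" "compactin X K" "propagation K S"
    and T: "T \<in> adjointable H" "compactin X L" "propagation L T"
    by (auto simp: Cu_alg_iff)
  have "propagation (K \<union> L) (\<lambda>\<xi> g. S \<xi> g + T \<xi> g)"
    using propagation_mono[OF S(3), of "K \<union> L"] propagation_mono[OF T(3), of "K \<union> L"] by (simp add: propagation_def)
  then show "(\<lambda>\<xi> g. S \<xi> g + T \<xi> g) \<in> Cu_alg H"
    unfolding Cu_alg_iff using adjointable_add(1)[OF S(1) T(1)] compactin_Un[OF S(2) T(2)] by blast
  have "propagation (set_mul H K L) (S \<circ> T)"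
    unfolding propagation_def
  proof (intro ballI impI)
    fix \<xi> g assume \<xi>: "\<xi> \<in> L2 H" and g: "g \<in> arrows H"
      and zero: "\<forall>h\<in>fibre H (s g). g \<cdot> inv h \<in> set_mul H K L \<longrightarrow> \<xi> h = 0"
    have "T \<xi> k = 0" if k: "k \<in> fibre H (s g)" "g \<cdot> inv k \<in> K" for k
    proof (rule propagationD[OF T(3) \<xi>])
      show "k \<in> arrows H" using k by (simp add: fibre_iff)
      fix h assume h: "h \<in> fibre H (s k)" "k \<cdot> inv h \<in> L"
      have "g \<cdot> inv h = (g \<cdot> inv k) \<cdot> (k \<cdot> inv h)" "s (g \<cdot> inv k) = r (k \<cdot> inv h)"
        using k h g mul_assoc[of "g \<cdot> inv k" k "inv h"] by (auto simp: fibre_iff)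
      then have "g \<cdot> inv h \<in> set_mul H K L"
        unfolding set_mul_def using k(2) h(2) by blast
      then show "\<xi> h = 0"
        using zero h k by (auto simp: fibre_iff)
    qed
    then show "(S \<circ> T) \<xi> g = 0"
      using propagationD[OF S(3) adjointable_L2[OF T(1) \<xi>] g] by simp
  qed
  then show "S \<circ> T \<in> Cu_alg H"
    unfolding Cu_alg_iff using adjointable_comp(1)[OF S(1) T(1)] compactin_set_mul[OF S(2) T(2)] by blast
next
  fix c T assume "T \<in> Cu_alg H"
  then show "(\<lambda>\<xi> g. c * T \<xi> g) \<in> Cu_alg H"
    unfolding Cu_alg_iff using adjointable_scale(1) by (auto simp: propagation_def)
next
  fix T assume "T \<in> Cu_alg H"
  then obtain L where T: "T \<in> adjointable H" "compactin X L" "propagation L T"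
    by (auto simp: Cu_alg_iff)
  have "propagation (inv ` L) (adj H T)"
  proof (rule propagation_coefficients[OF adj_adjointable[OF T(1)]])
    fix g h assume g: "g \<in> arrows H" and h: "h \<in> fibre H (s g)" and gh: "g \<cdot> inv h \<notin> inv ` L"
    have h': "h \<in> arrows H" "s h = s g" "g \<in> fibre H (s h)"
      using g h by (auto simp: fibre_iff)
    have "T (delta g) h = 0"
    proof (rule propagationD[OF T(3) delta_L2[OF g] h'(1)])
      fix k assume k: "k \<in> fibre H (s h)" "h \<cdot> inv k \<in> L"
      have "k \<noteq> g"
      proof
        assume "k = g"
        then have "inv (h \<cdot> inv g) \<in> inv ` L"
          using k by blast
        then show False
          using gh g h' inv_mul[of h "inv g"] by simp
      qed
      then show "delta g k = 0"
        using delta(3)[OF g, of k] k h' by simp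
    qed
    then show "adj H T (delta h) g = 0"
      using adj_delta[OF T(1) h'(1,3)] by simp
  qed
  then show "adj H T \<in> Cu_alg H"
    unfolding Cu_alg_iff using adj_adjointable[OF T(1)] compactin_inv[OF T(2)] by blast
qed

lemma Cu_alg_equivariant_eq: "Cu_alg_equivariant H = Cu_alg H \<inter> equivariant_ops H"
  by (auto simp: Cu_alg_equivariant_def Cu_alg_def equivariant_ops_def)

lemma star_algebra_Cu_alg_equivariant: "star_algebra (Cu_alg_equivariant H)"
  using star_algebra_Cu_alg star_algebra_equivariant
  unfolding Cu_alg_equivariant_eq star_algebra_def by blast

lemma Lambda_propagation: "propagation (supp_on X f) (Lambda_op H f)" if "f \<in> Cc X"
  unfolding propagation_def
proof (intro ballI impI)
  fix \<xi> g assume \<xi>: "\<xi> \<in> L2 H" "g \<in> arrows H" "\<forall>h\<in>fibre H (s g). g \<cdot> inv h \<in> supp_on X f \<longrightarrow> \<xi> h = 0"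
  then have "f (g \<cdot> inv a) * \<xi> a = 0" if "a \<in> fibre H (s g)" for a
    using that Cc_supp[OF \<open>f \<in> Cc X\<close>] by (metis mult_eq_0_iff)
  then show "Lambda_op H f \<xi> g = 0"
    by (auto simp: Lambda_op_eq conv_def intro!: infsum_0)
qed

lemma Lambda_Cu_alg_equivariant: "f \<in> Cc X \<Longrightarrow> Lambda_op H f \<in> Cu_alg_equivariant H"
  unfolding Cu_alg_equivariant_eq
  using Lambda_adjointable Lambda_equivariant Lambda_propagation Cc_compact Cu_alg_iff by blast

end

section \<open>The fibrewise Stone--Cech compactification\<close>

lemma Cb_add: "f \<in> Cb X \<Longrightarrow> g \<in> Cb X \<Longrightarrow> (\<lambda>x. f x + g x) \<in> Cb X"
proof -
  assume f: "f \<in> Cb X" and g: "g \<in> Cb X"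
  obtain B C where "\<And>x. cmod (f x) \<le> B" "\<And>x. cmod (g x) \<le> C"
    using Cb_bounded[OF f] Cb_bounded[OF g] by metis
  then have "cmod (f x + g x) \<le> B + C" for x
    by (rule norm_triangle_mono)
  then show ?thesis
    using f g by (intro CbI[where C = "B + C"] continuous_map_add) (auto simp: Cb_def)
qed

lemma Cb_mult: "f \<in> Cb X \<Longrightarrow> g \<in> Cb X \<Longrightarrow> (\<lambda>x. f x * g x) \<in> Cb X"
proof -
  assume f: "f \<in> Cb X" and g: "g \<in> Cb X"
  obtain B C where B: "\<And>x. cmod (f x) \<le> B" "\<And>x. cmod (g x) \<le> C" "B \<ge> 0" "C \<ge> 0"
    using Cb_bounded[OF f] Cb_bounded[OF g] by metis
  have "cmod (f x * g x) \<le> B * C" for x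
    unfolding norm_mult using B by (intro mult_mono) auto
  then show ?thesis
    using f g by (intro CbI[where C = "B * C"] continuous_map_mult) (auto simp: Cb_def)
qed

lemma Cb_cnj: "f \<in> Cb X \<Longrightarrow> (\<lambda>x. cnj (f x)) \<in> Cb X"
proof -
  assume f: "f \<in> Cb X"
  obtain B where B: "\<And>x. cmod (f x) \<le> B"
    using Cb_bounded[OF f] by metis
  show ?thesis
    using f B by (intro CbI[where C = B] continuous_map_compose_real[of X f cnj])
      (auto simp: Cb_def intro: continuous_intros)
qed

lemma continuous_map_inverse:
  fixes f :: "'a \<Rightarrow> 'b::real_normed_field"
  assumes "continuous_map X euclidean f" "\<And>x. x \<in> topspace X \<Longrightarrow> f x \<noteq> 0"
  shows "continuous_map X euclidean (\<lambda>x. inverse (f x))"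
  using assms by (auto simp: continuous_map_atin intro: tendsto_inverse)

context etale
begin

lemma C0r_Cb: "f \<in> C0r H \<Longrightarrow> f \<in> Cb X"
  by (simp add: C0r_def)

lemma C0r_outside: "f \<in> C0r H \<Longrightarrow> g \<notin> arrows H \<Longrightarrow> f g = 0"
  using C0r_Cb by (fastforce simp: Cb_def)

text \<open>The arrows with range in \<open>K\<close> form a closed set, so it suffices to control
  where the approximant is nonzero in place of its support.\<close>

lemma C0rI:
  assumes "f \<in> Cb X"
    and "\<And>\<epsilon>. \<epsilon> > 0 \<Longrightarrow> \<exists>h\<in>Cb X. \<exists>K. compactin X K \<and> K \<subseteq> units H \<and> (\<forall>g\<in>arrows H. h g \<noteq> 0 \<longrightarrow> r g \<in> K) \<and>
        (\<forall>g\<in>arrows H. cmod (f g - h g) \<le> \<epsilon>)"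
  shows "f \<in> C0r H"
  unfolding C0r_def
proof (intro CollectI conjI allI impI assms(1))
  fix \<epsilon> :: real assume "\<epsilon> > 0"
  then obtain h K where h: "h \<in> Cb X" "compactin X K" "K \<subseteq> units H" "\<And>g. g \<in> arrows H \<Longrightarrow> h g \<noteq> 0 \<Longrightarrow> r g \<in> K"
      "\<forall>g\<in>arrows H. cmod (f g - h g) \<le> \<epsilon>"
    using assms(2) by blast
  have "supp_on X h \<subseteq> {g \<in> topspace X. r g \<in> K}"
  proof (rule supp_on_minimal)
    show "closedin X {g \<in> topspace X. r g \<in> K}"
      by (rule closedin_continuous_map_preimage[OF continuous_range compactin_imp_closedin[OF Hausdorff h(2)]])
  qed (use h(4) in auto)
  then show "\<exists>h\<in>Cb X. (\<exists>K. compactin (unit_space H) K \<and> supp_on X h \<subseteq> {g \<in> arrows H. r g \<in> K}) \<and>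
      (\<forall>g\<in>arrows H. cmod (f g - h g) \<le> \<epsilon>)"
    using h by (intro bexI[of _ h] conjI exI[of _ K]) (auto simp: compactin_unit_space)
qed

lemma C0r_generator:
  assumes "f \<in> Cb X" "compactin X K" "K \<subseteq> units H" "\<And>g. g \<in> arrows H \<Longrightarrow> f g \<noteq> 0 \<Longrightarrow> r g \<in> K"
  shows "f \<in> C0r H"
proof (rule C0rI[OF assms(1)])
  fix \<epsilon> :: real assume "\<epsilon> > 0"
  then show "\<exists>h\<in>Cb X. \<exists>K. compactin X K \<and> K \<subseteq> units H \<and> (\<forall>g\<in>arrows H. h g \<noteq> 0 \<longrightarrow> r g \<in> K) \<and>
        (\<forall>g\<in>arrows H. cmod (f g - h g) \<le> \<epsilon>)"
    using assms by (intro bexI[of _ f] exI[of _ K]) auto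
qed

lemma C0r_approx:
  assumes "f \<in> C0r H" "\<epsilon> > 0"
  obtains h K where "h \<in> Cb X" "compactin X K" "K \<subseteq> units H" "\<And>g. g \<in> arrows H \<Longrightarrow> h g \<noteq> 0 \<Longrightarrow> r g \<in> K"
    "\<And>g. g \<in> arrows H \<Longrightarrow> cmod (f g - h g) \<le> \<epsilon>" "h \<in> C0r H"
proof -
  obtain h K where h: "h \<in> Cb X" "compactin (unit_space H) K" "supp_on X h \<subseteq> {g \<in> arrows H. r g \<in> K}"
      "\<And>g. g \<in> arrows H \<Longrightarrow> cmod (f g - h g) \<le> \<epsilon>"
    using assms unfolding C0r_def by blast
  have K: "compactin X K" "K \<subseteq> units H"
    using h(2) by (auto simp: compactin_unit_space)
  have "r g \<in> K" if "g \<in> arrows H" "h g \<noteq> 0" for g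
    using in_supp_on[of g X h] that h(3) by auto
  then show thesis
    using that h K C0r_generator[OF h(1) K] by blast
qed

lemma C0r_add: "f \<in> C0r H \<Longrightarrow> f' \<in> C0r H \<Longrightarrow> (\<lambda>g. f g + f' g) \<in> C0r H"
proof (rule C0rI)
  fix \<epsilon> :: real assume f: "f \<in> C0r H" "f' \<in> C0r H" and e: "\<epsilon> > 0"
  obtain h K where h: "h \<in> Cb X" "compactin X K" "K \<subseteq> units H" "\<And>g. g \<in> arrows H \<Longrightarrow> h g \<noteq> 0 \<Longrightarrow> r g \<in> K"
    "\<And>g. g \<in> arrows H \<Longrightarrow> cmod (f g - h g) \<le> \<epsilon> / 2"
    using C0r_approx[OF f(1), of "\<epsilon> / 2"] e by (metis half_gt_zero)
  obtain h' K' where h': "h' \<in> Cb X" "compactin X K'" "K' \<subseteq> units H" "\<And>g. g \<in> arrows H \<Longrightarrow> h' g \<noteq> 0 \<Longrightarrow> r g \<in> K'"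
    "\<And>g. g \<in> arrows H \<Longrightarrow> cmod (f' g - h' g) \<le> \<epsilon> / 2"
    using C0r_approx[OF f(2), of "\<epsilon> / 2"] e by (metis half_gt_zero)
  have "cmod (f g + f' g - (h g + h' g)) \<le> \<epsilon>" if "g \<in> arrows H" for g
    using norm_triangle_mono[OF h(5)[OF that] h'(5)[OF that]] by (simp add: algebra_simps)
  moreover have "r g \<in> K \<union> K'" if "g \<in> arrows H" "h g + h' g \<noteq> 0" for g
    using h(4)[OF that(1)] h'(4)[OF that(1)] that(2) by (cases "h g = 0") auto
  ultimately show "\<exists>h\<in>Cb X. \<exists>K. compactin X K \<and> K \<subseteq> units H \<and> (\<forall>g\<in>arrows H. h g \<noteq> 0 \<longrightarrow> r g \<in> K) \<and>
        (\<forall>g\<in>arrows H. cmod (f g + f' g - h g) \<le> \<epsilon>)"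
    using Cb_add[OF h(1) h'(1)] compactin_Un[OF h(2) h'(2)] h(3) h'(3)
    by (intro bexI[of _ "\<lambda>g. h g + h' g"] exI[of _ "K \<union> K'"]) auto
qed (intro Cb_add C0r_Cb; assumption)

text \<open>\<open>C0r H\<close> is an ideal of \<open>Cb X\<close>; this makes it possible to
  multiply by the inverse of a function bounded below when characters are studied.\<close>

lemma Cb_mult_C0r: "b \<in> Cb X \<Longrightarrow> f \<in> C0r H \<Longrightarrow> (\<lambda>g. b g * f g) \<in> C0r H"
proof (rule C0rI)
  fix \<epsilon> :: real assume b: "b \<in> Cb X" and f: "f \<in> C0r H" and e: "\<epsilon> > 0"
  obtain B where B: "B \<ge> 0" "\<And>g. cmod (b g) \<le> B"
    using Cb_bounded[OF b] by blast
  have "\<epsilon> / (B + 1) > 0"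
    using e B(1) by simp
  then obtain h K where h: "h \<in> Cb X" "compactin X K" "K \<subseteq> units H" "\<And>g. g \<in> arrows H \<Longrightarrow> h g \<noteq> 0 \<Longrightarrow> r g \<in> K"
    "\<And>g. g \<in> arrows H \<Longrightarrow> cmod (f g - h g) \<le> \<epsilon> / (B + 1)"
    using C0r_approx[OF f] by metis
  have "cmod (b g * f g - b g * h g) \<le> \<epsilon>" if "g \<in> arrows H" for g
  proof -
    have "cmod (b g * f g - b g * h g) = cmod (b g) * cmod (f g - h g)"
      by (simp add: norm_mult flip: right_diff_distrib)
    also have "\<dots> \<le> (B + 1) * (\<epsilon> / (B + 1))"
      using B(1) B(2)[of g] h(5)[OF that] by (intro mult_mono) auto
    finally show ?thesis
      using B(1) by simp
  qed
  then show "\<exists>h\<in>Cb X. \<exists>K. compactin X K \<and> K \<subseteq> units H \<and> (\<forall>g\<in>arrows H. h g \<noteq> 0 \<longrightarrow> r g \<in> K) \<and>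
        (\<forall>g\<in>arrows H. cmod (b g * f g - h g) \<le> \<epsilon>)"
    using Cb_mult[OF b h(1)] h(2-4) by (intro bexI[of _ "\<lambda>g. b g * h g"] exI[of _ K]) auto
qed (rule Cb_mult, assumption, rule C0r_Cb)

lemma C0r_mult: "f \<in> C0r H \<Longrightarrow> f' \<in> C0r H \<Longrightarrow> (\<lambda>g. f g * f' g) \<in> C0r H"
  by (intro Cb_mult_C0r C0r_Cb)

lemma Cb_const: "(\<lambda>g. if g \<in> arrows H then c else 0) \<in> Cb X"
proof (rule CbI[where C = "cmod c"])
  show "continuous_map X euclidean (\<lambda>g. if g \<in> arrows H then c else 0)"
    by (rule continuous_map_eq[of _ _ "\<lambda>_. c"]) auto
qed auto

lemma C0r_scale: "f \<in> C0r H \<Longrightarrow> (\<lambda>g. c * f g) \<in> C0r H"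
proof -
  assume f: "f \<in> C0r H"
  have "(\<lambda>g. (if g \<in> arrows H then c else 0) * f g) = (\<lambda>g. c * f g)"
    using C0r_outside[OF f] by auto
  then show ?thesis
    using Cb_mult_C0r[OF Cb_const f, of c] by simp
qed

lemma C0r_diff: "f \<in> C0r H \<Longrightarrow> f' \<in> C0r H \<Longrightarrow> (\<lambda>g. f g - f' g) \<in> C0r H"
  using C0r_add[OF _ C0r_scale[of f' "-1"]] by simp

lemma C0r_cnj: "f \<in> C0r H \<Longrightarrow> (\<lambda>g. cnj (f g)) \<in> C0r H"
proof (rule C0rI)
  fix \<epsilon> :: real assume f: "f \<in> C0r H" and e: "\<epsilon> > 0"
  obtain h K where h: "h \<in> Cb X" "compactin X K" "K \<subseteq> units H" "\<And>g. g \<in> arrows H \<Longrightarrow> h g \<noteq> 0 \<Longrightarrow> r g \<in> K"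
    "\<And>g. g \<in> arrows H \<Longrightarrow> cmod (f g - h g) \<le> \<epsilon>"
    using C0r_approx[OF f e] by metis
  have "cmod (cnj (f g) - cnj (h g)) \<le> \<epsilon>" if "g \<in> arrows H" for g
    using h(5)[OF that] by (metis complex_cnj_diff complex_mod_cnj)
  then show "\<exists>h\<in>Cb X. \<exists>K. compactin X K \<and> K \<subseteq> units H \<and> (\<forall>g\<in>arrows H. h g \<noteq> 0 \<longrightarrow> r g \<in> K) \<and>
        (\<forall>g\<in>arrows H. cmod (cnj (f g) - h g) \<le> \<epsilon>)"
    using Cb_cnj[OF h(1)] h(2-4) by (intro bexI[of _ "\<lambda>g. cnj (h g)"] exI[of _ K]) auto
qed (intro Cb_cnj C0r_Cb; assumption)

lemma C0r_zero: "(\<lambda>_. 0) \<in> C0r H"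
  by (rule C0r_generator[where K = "{}"]) (simp_all add: Cc_subset_Cb[OF zero_in_Cc])

text \<open>On such functions a character turns out to be evaluation at a unit, and that unit is the
  value of \<open>r_beta\<close>.\<close>

definition pull :: "('a \<Rightarrow> complex) \<Rightarrow> 'a \<Rightarrow> complex" where
  "pull \<phi> g = (if g \<in> arrows H then \<phi> (r g) else 0)"

lemma pull_Cb: "\<phi> \<in> Cb X \<Longrightarrow> pull \<phi> \<in> Cb X"
  using Cb_pullback[OF continuous_range, of \<phi>] by (simp add: pull_def[abs_def])

lemma pull_C0r:
  assumes "\<phi> \<in> Cc X"
  shows "pull \<phi> \<in> C0r H"
proof (rule C0r_generator[OF pull_Cb[OF Cc_subset_Cb[OF assms]]])
  show "compactin X (units H \<inter> supp_on X \<phi>)"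
    by (rule closed_Int_compactin[OF closedin_units Cc_compact[OF assms]])
  show "r g \<in> units H \<inter> supp_on X \<phi>" if "g \<in> arrows H" "pull \<phi> g \<noteq> 0" for g
    using that Cc_supp[OF assms] by (simp add: pull_def)
qed simp

section \<open>Characters, density of the arrows, and the extended range map\<close>

abbreviation chars where "chars \<equiv> characters (C0r H)"

lemma topspace_beta [simp]: "topspace (beta_r H) = chars"
  by (simp add: beta_r_def)

lemma beta_eq: "beta_r H = top_of_set chars"
  by (simp add: beta_r_def euclidean_product_topology)

lemma character_simps:
  assumes "z \<in> chars"
  shows "f \<notin> C0r H \<Longrightarrow> z f = 0" "\<exists>f\<in>C0r H. z f \<noteq> 0"
    "f \<in> C0r H \<Longrightarrow> h \<in> C0r H \<Longrightarrow> z (\<lambda>x. f x + h x) = z f + z h"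
    "f \<in> C0r H \<Longrightarrow> h \<in> C0r H \<Longrightarrow> z (\<lambda>x. f x * h x) = z f * z h"
    "f \<in> C0r H \<Longrightarrow> z (\<lambda>x. c * f x) = c * z f"
    "f \<in> C0r H \<Longrightarrow> z (\<lambda>x. cnj (f x)) = cnj (z f)"
  using assms by (auto simp: characters_def)

lemma character_diff: "z \<in> chars \<Longrightarrow> f \<in> C0r H \<Longrightarrow> h \<in> C0r H \<Longrightarrow> z (\<lambda>x. f x - h x) = z f - z h"
  using character_simps(3)[OF _ _ C0r_scale[of h "-1"], of z f] character_simps(5)[of z h "-1"] by simp

lemma character_zero: "z \<in> chars \<Longrightarrow> z (\<lambda>_. 0) = 0"
  using character_simps(5)[of z "\<lambda>_. 0" 0] C0r_zero by simp

lemma character_sum: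
  assumes "z \<in> chars" "finite I" "\<And>i. i \<in> I \<Longrightarrow> f i \<in> C0r H"
  shows "(\<lambda>x. \<Sum>i\<in>I. f i x) \<in> C0r H \<and> z (\<lambda>x. \<Sum>i\<in>I. f i x) = (\<Sum>i\<in>I. z (f i))"
  using assms(2,3)
  by (induction I rule: finite_induct) (auto simp: character_simps[OF assms(1)] character_zero[OF assms(1)] C0r_zero C0r_add)

text \<open>If no \<open>g\<close> approximated \<open>z\<close> on \<open>S\<close>, then \<open>p = (\<Sum>F\<in>S. \<bar>F - z F\<bar>\<^sup>2)\<close> would be bounded below, so every \<open>h\<close> would
  be a multiple \<open>(h / p) * p\<close> of \<open>p\<close>, on which \<open>z\<close> vanishes.\<close>

lemma character_dense:
  assumes z: "z \<in> chars" and S: "finite S" "S \<subseteq> C0r H" and e: "\<epsilon> > 0"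
  obtains g where "g \<in> arrows H" "\<And>F. F \<in> S \<Longrightarrow> cmod (F g - z F) < \<epsilon>"
proof (rule ccontr)
  note thesisI = that
  assume contra: "\<not> thesis"
  have far: "\<exists>F\<in>S. cmod (F g - z F) \<ge> \<epsilon>" if g: "g \<in> arrows H" for g
  proof (rule ccontr)
    assume "\<not> ?thesis"
    then have "thesis"
      using g by (intro thesisI[of g]) (auto simp: not_le)
    with contra show False ..
  qed
  \<comment> \<open>The squared distances are written as polynomials in the functions and their
    conjugates, to which the character applies.\<close>
  define p where "p g = (\<Sum>F\<in>S. (F g - z F) * cnj (F g - z F))" for g
  have p_real: "p g = complex_of_real (\<Sum>F\<in>S. (cmod (F g - z F))\<^sup>2)" for g
    unfolding p_def of_real_sum by (intro sum.cong refl complex_norm_square[symmetric])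
  have p_ge: "cmod (p g) \<ge> \<epsilon>\<^sup>2" if g: "g \<in> arrows H" for g
  proof -
    obtain F where F: "F \<in> S" "cmod (F g - z F) \<ge> \<epsilon>"
      using far[OF g] by blast
    have "\<epsilon>\<^sup>2 \<le> (cmod (F g - z F))\<^sup>2"
      using F e by (intro power_mono) auto
    also have "\<dots> \<le> (\<Sum>F\<in>S. (cmod (F g - z F))\<^sup>2)"
      using S F by (intro member_le_sum) auto
    also have "\<dots> \<le> cmod (p g)"
      unfolding p_real norm_of_real by simp
    finally show ?thesis .
  qed
  have p0: "p g \<noteq> 0" if "g \<in> arrows H" for g
    using p_ge[OF that] zero_less_power[OF e, of 2] by (metis linorder_not_less norm_zero)
  have Fc: "continuous_map X euclidean F" if "F \<in> S" for F
    using C0r_Cb[OF subsetD[OF S(2) that]] by (simp add: Cb_def)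
  have "continuous_map X euclidean p"
    unfolding p_def[abs_def]
  proof (rule continuous_map_sum'[OF S(1)])
    fix F assume "F \<in> S"
    then have d: "continuous_map X euclidean (\<lambda>g. F g - z F)"
      using Fc by (intro continuous_map_diff) auto
    have "continuous_map X euclidean (\<lambda>g. cnj (F g - z F))"
      by (rule continuous_map_compose_real[OF d]) (intro continuous_intros)
    with d show "continuous_map X euclidean (\<lambda>g. (F g - z F) * cnj (F g - z F))"
      by (rule continuous_map_mult)
  qed
  then have "continuous_map X euclidean (\<lambda>g. inverse (p g))"
    by (rule continuous_map_inverse) (use p0 in auto)
  then have c: "continuous_map X euclidean (\<lambda>g. if g \<in> arrows H then inverse (p g) else 0)"
    by (rule continuous_map_eq) auto
  have q: "(\<lambda>g. if g \<in> arrows H then inverse (p g) else 0) \<in> Cb X"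
  proof (rule CbI[OF c, where C = "inverse (\<epsilon>\<^sup>2)"])
    fix g assume "g \<in> topspace X"
    then show "cmod (if g \<in> arrows H then inverse (p g) else 0) \<le> inverse (\<epsilon>\<^sup>2)"
      using p_ge[of g] e by (simp add: norm_inverse le_imp_inverse_le)
  qed auto
  obtain h where h: "h \<in> C0r H" "z h \<noteq> 0"
    using character_simps(2)[OF z] by blast
  let ?b = "\<lambda>g. (if g \<in> arrows H then inverse (p g) else 0) * h g"
  have b: "?b \<in> C0r H"
    by (rule Cb_mult_C0r[OF q h(1)])
  let ?t = "\<lambda>F g. ?b g * (F g - z F) * cnj (F g - z F)"
  have t: "?t F \<in> C0r H \<and> z (?t F) = 0" if "F \<in> S" for F
  proof -
    have F: "F \<in> C0r H"
      using that S by blast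
    \<comment> \<open>Constants need not lie in \<open>C0r H\<close>, so \<open>F - z F\<close> is
      first multiplied by \<open>?b\<close>; the product \<open>?u\<close> is in the algebra and is
      killed by \<open>z\<close>.\<close>
    let ?u = "\<lambda>g. ?b g * F g - z F * ?b g"
    have u: "?u \<in> C0r H" and bF: "(\<lambda>g. ?b g * F g) \<in> C0r H" and zb: "(\<lambda>g. z F * ?b g) \<in> C0r H"
      using C0r_diff[OF C0r_mult[OF b F] C0r_scale[OF b]] C0r_mult[OF b F] C0r_scale[OF b] by blast+
    have zu: "z ?u = 0"
      unfolding character_diff[OF z bF zb] character_simps(4)[OF z b F] character_simps(5)[OF z b] by simp
    have uF: "(\<lambda>g. ?u g * cnj (F g)) \<in> C0r H" and zu': "(\<lambda>g. cnj (z F) * ?u g) \<in> C0r H"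
      by (rule C0r_mult[OF u C0r_cnj[OF F]], rule C0r_scale[OF u])
    have "?t F = (\<lambda>g. ?u g * cnj (F g) - cnj (z F) * ?u g)"
      by (auto simp: algebra_simps)
    then show ?thesis
      using C0r_diff[OF uF zu'] character_diff[OF z uF zu'] character_simps(4)[OF z u C0r_cnj[OF F]]
        character_simps(5)[OF z u, of "cnj (z F)"] zu by simp
  qed
  have h_eq: "h = (\<lambda>g. \<Sum>F\<in>S. ?t F g)"
  proof
    fix g
    have "(\<Sum>F\<in>S. ?t F g) = ?b g * p g"
      unfolding p_def sum_distrib_left by (simp only: mult.assoc)
    also have "\<dots> = h g"
    proof (cases "g \<in> arrows H")
      case True
      then show ?thesis
        using p0[OF True] by simp
    qed (simp add: C0r_outside[OF h(1)])
    finally show "h g = (\<Sum>F\<in>S. ?t F g)" by simp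
  qed
  have "z h = z (\<lambda>g. \<Sum>F\<in>S. ?t F g)"
    by (rule arg_cong[OF h_eq])
  also have "\<dots> = (\<Sum>F\<in>S. z (?t F))"
    using character_sum[OF z S(1) conjunct1[OF t]] by (rule conjunct2)
  finally have "z h = (\<Sum>F\<in>S. z (?t F))" .
  then show False
    using t h(2) by simp
qed

text \<open>On a single function a character is a limit of evaluations at arrows, hence obeys the
  same bound.\<close>

lemma character_bound:
  assumes z: "z \<in> chars" and F: "F \<in> C0r H" "\<And>g. g \<in> arrows H \<Longrightarrow> cmod (F g) \<le> B"
  shows "cmod (z F) \<le> B"
proof (rule field_le_epsilon)
  fix e :: real assume "e > 0"
  then obtain g where g: "g \<in> arrows H" "cmod (F g - z F) < e"
    using character_dense[OF z, of "{F}" e] F(1) by auto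
  have "cmod (z F) \<le> cmod (F g) + cmod (F g - z F)"
    using norm_triangle_ineq4[of "F g" "F g - z F"] by simp
  then show "cmod (z F) \<le> B + e"
    using F(2)[OF g(1)] g(2) by linarith
qed

lemma unit_bump:
  assumes "openin X W" "x \<in> W"
  obtains \<phi> where "\<phi> \<in> Cc X" "\<phi> x = 1" "supp_on X \<phi> \<subseteq> W" "\<And>y. cmod (\<phi> y) \<le> 1"
  using bump[OF assms] by (metis subset_trans)

lemma emb_character:
  assumes "g \<in> arrows H"
  shows "beta_emb H g \<in> chars"
proof -
  obtain \<phi> where "\<phi> \<in> Cc X" "\<phi> (r g) = 1"
    using unit_bump[OF openin_topspace, of "r g"] assms by (metis closed_arrows(1) topspace_X)
  then have "pull \<phi> \<in> C0r H" "pull \<phi> g \<noteq> 0"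
    using assms by (auto simp: pull_C0r) (simp add: pull_def)
  then show ?thesis
    unfolding characters_def beta_emb_def by (auto simp: C0r_add C0r_mult C0r_scale C0r_cnj intro!: bexI[of _ "pull \<phi>"])
qed

lemma emb_eval: "F \<in> C0r H \<Longrightarrow> beta_emb H g F = F g"
  by (simp add: beta_emb_def)

text \<open>Some \<open>h\<close> with \<open>z h \<noteq> 0\<close> vanishes off the arrows with
  range in a compact \<open>K\<close>. If no point of \<open>K\<close> worked, finitely many test
  functions would witness this, and the total deviation \<open>q\<close> would stay above some
  \<open>\<delta> > 0\<close> on \<open>K\<close>. An arrow \<open>g\<close> approximating
  \<open>z\<close> on \<open>h\<close> and on these functions has \<open>r g\<close> in
  \<open>K\<close> and a deviation too small.\<close>

lemma character_range:
  assumes z: "z \<in> chars"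
  obtains x where "x \<in> units H" "\<And>\<phi>. \<phi> \<in> Cc X \<Longrightarrow> z (pull \<phi>) = \<phi> x"
proof (rule ccontr)
  note thesisI = that
  assume contra: "\<not> thesis"
  obtain F where F: "F \<in> C0r H" "z F \<noteq> 0"
    using character_simps(2)[OF z] by blast
  then obtain h K where h: "compactin X K" "K \<subseteq> units H" "\<And>g. g \<in> arrows H \<Longrightarrow> h g \<noteq> 0 \<Longrightarrow> r g \<in> K"
    "\<And>g. g \<in> arrows H \<Longrightarrow> cmod (F g - h g) \<le> cmod (z F) / 2" "h \<in> C0r H"
    using C0r_approx[OF F(1), of "cmod (z F) / 2"] by (metis half_gt_zero zero_less_norm_iff)
  have "cmod (z F - z h) \<le> cmod (z F) / 2"
    using character_bound[OF z C0r_diff[OF F(1) h(5)] h(4)] character_diff[OF z F(1) h(5)] by simp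
  then have zh: "z h \<noteq> 0"
    using F(2) by auto
  let ?V = "\<lambda>\<phi>. {y \<in> topspace X. \<phi> y \<in> - {z (pull \<phi>)}}"
  have "openin X (?V \<phi>)" if "\<phi> \<in> Cc X" for \<phi>
    using Cc_continuous[OF that] by (rule openin_continuous_map_preimage) auto
  moreover have "K \<subseteq> \<Union>(?V ` Cc X)"
  proof
    fix x assume "x \<in> K"
    then have x: "x \<in> units H" "x \<in> topspace X"
      using h(2) units_subset by auto
    obtain \<phi> where "\<phi> \<in> Cc X" "z (pull \<phi>) \<noteq> \<phi> x"
    proof (rule ccontr)
      assume "\<not> thesis"
      then have "\<And>\<phi>. \<phi> \<in> Cc X \<Longrightarrow> z (pull \<phi>) = \<phi> x"
        using that by blast
      then show False
        using thesisI[OF x(1)] contra by blast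
    qed
    then show "x \<in> \<Union>(?V ` Cc X)"
      using x(2) by force
  qed
  ultimately have "\<exists>\<F>. finite \<F> \<and> \<F> \<subseteq> ?V ` Cc X \<and> K \<subseteq> \<Union>\<F>"
    by (intro compactinD[OF h(1)]) auto
  then obtain \<F> where \<F>: "finite \<F>" "\<F> \<subseteq> ?V ` Cc X" "K \<subseteq> \<Union>\<F>"
    by (elim exE conjE) (rule that)
  obtain \<Phi> where \<Phi>: "\<Phi> \<subseteq> Cc X" "finite \<Phi>" "\<F> = ?V ` \<Phi>"
    using finite_subset_image[OF \<F>(1,2)] by (elim exE conjE) (rule that)
  define q where "q y = (\<Sum>\<phi>\<in>\<Phi>. cmod (\<phi> y - z (pull \<phi>)))" for y
  have "continuous_map X euclidean q"
    unfolding q_def[abs_def] using \<Phi>(1)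
    by (intro continuous_map_sum' \<Phi>(2) continuous_map_norm continuous_map_diff) (auto intro: Cc_continuous)
  then have qK: "compact (q ` K)"
    using image_compactin[OF h(1)] by fastforce
  have qpos: "q y > 0" if y: "y \<in> K" for y
  proof -
    obtain \<phi> where "\<phi> \<in> \<Phi>" "\<phi> y \<noteq> z (pull \<phi>)"
      using \<Phi>(3) \<F>(3) y by auto
    then show ?thesis
      unfolding q_def using \<Phi>(2) by (intro sum_pos2[of _ \<phi>]) auto
  qed
  obtain \<delta> where \<delta>: "\<delta> > 0" "\<And>y. y \<in> K \<Longrightarrow> \<delta> \<le> q y"
  proof (cases "K = {}")
    case True
    then show thesis using that[of 1] by auto
  next
    case False
    then obtain m where "m \<in> q ` K" "\<forall>t\<in>q ` K. m \<le> t"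
      using compact_attains_inf[OF qK] by blast
    then show thesis
      using that[of m] qpos by auto
  qed
  let ?S = "insert h (pull ` \<Phi>)"
  \<comment> \<open>Below \<open>cmod (z h)\<close>, so that \<open>h g\<close> cannot vanish; the
    denominator \<open>card \<Phi> + 1\<close> makes the final inequality strict and admits an empty
    \<open>\<Phi>\<close>.\<close>
  define \<epsilon> where "\<epsilon> = min (cmod (z h)) (\<delta> / (card \<Phi> + 1))"
  have "\<epsilon> * (card \<Phi> + 1) \<le> \<delta> / (card \<Phi> + 1) * (card \<Phi> + 1)"
    unfolding \<epsilon>_def by (intro mult_right_mono) auto
  then have e: "\<epsilon> > 0" "\<epsilon> * (card \<Phi> + 1) \<le> \<delta>"
    using zh \<delta>(1) by (auto simp: \<epsilon>_def)
  obtain g where g: "g \<in> arrows H" "\<And>F. F \<in> ?S \<Longrightarrow> cmod (F g - z F) < \<epsilon>"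
  proof (rule character_dense[OF z])
    show "finite ?S" "?S \<subseteq> C0r H"
      using \<Phi>(1,2) h(5) pull_C0r by auto
  qed (use e(1) in auto)
  have "h g \<noteq> 0"
    using g(2)[of h] by (auto simp: \<epsilon>_def)
  then have rK: "r g \<in> K"
    using h(3)[OF g(1)] by blast
  have "q (r g) \<le> (\<Sum>\<phi>\<in>\<Phi>. \<epsilon>)"
    unfolding q_def
  proof (rule sum_mono)
    fix \<phi> assume "\<phi> \<in> \<Phi>"
    then show "cmod (\<phi> (r g) - z (pull \<phi>)) \<le> \<epsilon>"
      using g(2)[of "pull \<phi>"] g(1) by (simp add: pull_def)
  qed
  also have "\<dots> < \<epsilon> * (card \<Phi> + 1)"
    using e(1) by simp
  finally show False
    using \<delta>(2)[OF rK] e(2) by simp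
qed

lemma continuous_beta_eval: "continuous_map (beta_r H) euclidean (\<lambda>z. z F)"
  unfolding beta_r_def
  by (rule continuous_map_from_subtopology, rule continuous_map_product_projection) simp

lemma continuous_into_beta:
  assumes "\<And>F. F \<in> C0r H \<Longrightarrow> continuous_map Y euclidean (\<lambda>y. f y F)" "\<And>y. y \<in> topspace Y \<Longrightarrow> f y \<in> chars"
  shows "continuous_map Y (beta_r H) f"
  unfolding beta_r_def
proof (rule continuous_map_into_subtopology)
  show "continuous_map Y (product_topology (\<lambda>_. euclidean) UNIV) f"
    unfolding continuous_map_componentwise_UNIV
  proof
    fix F
    show "continuous_map Y euclidean (\<lambda>y. f y F)"
    proof (cases "F \<in> C0r H")
      case False
      show ?thesis
      proof (rule continuous_map_eq[of Y euclidean "\<lambda>_. 0"])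
        show "0 = f y F" if "y \<in> topspace Y" for y
          using character_simps(1)[OF assms(2)[OF that] False] by simp
      qed simp
    qed (rule assms(1))
  qed
qed (use assms(2) in auto)

lemma continuous_emb: "continuous_map X (beta_r H) (beta_emb H)"
proof (rule continuous_into_beta)
  fix F assume F: "F \<in> C0r H"
  then show "continuous_map X euclidean (\<lambda>g. beta_emb H g F)"
    using C0r_Cb[OF F] by (simp add: emb_eval Cb_def)
qed (simp add: emb_character)

lemma Hausdorff_beta: "Hausdorff_space (beta_r H)"
  unfolding beta_r_def by (intro Hausdorff_space_subtopology) (simp add: Hausdorff_space_product_topology)

text \<open>A basic open set restricts finitely many coordinates. Those outside \<open>C0r H\<close>
  are 0 for every character, and the others are handled by \<open>character_dense\<close>.\<close>

lemma beta_dense_open: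
  assumes W: "openin (beta_r H) W" and z: "z \<in> W"
  obtains g where "g \<in> arrows H" "beta_emb H g \<in> W"
proof -
  obtain V where V: "openin (product_topology (\<lambda>_. euclidean) UNIV) V" "W = V \<inter> chars"
    using W by (auto simp: beta_r_def openin_subtopology)
  have zc: "z \<in> chars"
    using z V by auto
  obtain U where U: "z \<in> PiE UNIV U" "\<And>F. openin euclidean (U F)" "finite {F. U F \<noteq> topspace (euclidean :: complex topology)}" "PiE UNIV U \<subseteq> V"
    using product_topology_open_contains_basis[OF V(1), of z] z V(2) by auto
  let ?S = "{F \<in> C0r H. U F \<noteq> UNIV}"
  have fin: "finite ?S"
    using U(3) by (auto intro: finite_subset)
  have "\<exists>e>0. \<forall>w. dist w (z F) < e \<longrightarrow> w \<in> U F" for F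
  proof -
    have "z F \<in> U F" "open (U F)"
      using U(1,2) by auto
    then show ?thesis
      by (simp add: open_dist)
  qed
  then obtain e where e: "\<And>F. e F > 0" "\<And>F w. dist w (z F) < e F \<Longrightarrow> w \<in> U F"
    by metis
  define \<epsilon> where "\<epsilon> = Min (insert 1 (e ` ?S))"
  have \<epsilon>: "\<epsilon> > 0" "\<And>F. F \<in> ?S \<Longrightarrow> \<epsilon> \<le> e F"
    unfolding \<epsilon>_def using fin e(1) by (auto simp: Min_gr_iff)
  obtain g where g: "g \<in> arrows H" "\<And>F. F \<in> ?S \<Longrightarrow> cmod (F g - z F) < \<epsilon>"
    using character_dense[OF zc fin _ \<epsilon>(1)] by auto
  have "beta_emb H g F \<in> U F" for F
  proof -
    consider "F \<in> ?S" | "F \<notin> C0r H" | "U F = UNIV" by blast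
    then show ?thesis
    proof cases
      case 1
      then have "dist (F g) (z F) < e F"
        using g(2)[OF 1] \<epsilon>(2)[OF 1] by (simp add: dist_norm)
      then show ?thesis
        using e(2) 1 by (simp add: emb_eval)
    next
      case 2
      then show ?thesis
        using U(1) character_simps(1)[OF zc] by (auto simp: beta_emb_def PiE_def Pi_iff dest: spec[of _ F])
    qed simp
  qed
  then have "beta_emb H g \<in> W"
    using V(2) U(4) emb_character[OF g(1)] by auto
  then show thesis
    using that g(1) by blast
qed

lemma beta_density:
  assumes "Hausdorff_space Y" "continuous_map (beta_r H) Y f" "continuous_map (beta_r H) Y f'"
    "\<And>g. g \<in> arrows H \<Longrightarrow> f (beta_emb H g) = f' (beta_emb H g)" "z \<in> chars"
  shows "f z = f' z"
proof (rule ccontr)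
  assume "f z \<noteq> f' z"
  moreover have "closedin (beta_r H) {z \<in> topspace (beta_r H). f z = f' z}"
    by (rule closedin_continuous_maps_eq[OF assms(1-3)])
  then have "openin (beta_r H) (chars - {z \<in> chars. f z = f' z})"
    by (metis openin_diff openin_topspace topspace_beta)
  ultimately show False
    using beta_dense_open[of "chars - {z \<in> chars. f z = f' z}" z] assms(4,5) emb_character by auto
qed

text \<open>Needed before anything can be said about the chosen \<open>r_beta\<close>. The candidate
  comes from \<open>character_range\<close>; it is continuous because a bump in \<open>V\<close> at
  \<open>p z\<close>, pulled back, has a nonvanishing set that is mapped into
  \<open>V\<close>.\<close>

lemma r_beta_exists:
  "\<exists>p. continuous_map (beta_r H) (unit_space H) p \<and> (\<forall>g\<in>arrows H. p (beta_emb H g) = r g)"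
proof -
  have "\<forall>z. \<exists>x. z \<in> chars \<longrightarrow> x \<in> units H \<and> (\<forall>\<phi>\<in>Cc X. z (pull \<phi>) = \<phi> x)"
    using character_range by metis
  from choice[OF this] obtain p where p: "\<And>z. z \<in> chars \<Longrightarrow> p z \<in> units H"
      "\<And>z \<phi>. z \<in> chars \<Longrightarrow> \<phi> \<in> Cc X \<Longrightarrow> z (pull \<phi>) = \<phi> (p z)"
    by blast
  have "continuous_map (beta_r H) X p"
    unfolding continuous_map
  proof (intro conjI allI impI)
    show "p ` topspace (beta_r H) \<subseteq> topspace X"
      using p(1) units_subset by auto
    fix V assume V: "openin X V"
    show "openin (beta_r H) {z \<in> topspace (beta_r H). p z \<in> V}"
    proof (subst openin_subopen, intro ballI)
      fix z assume z: "z \<in> {z \<in> topspace (beta_r H). p z \<in> V}"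
      then obtain \<phi> where \<phi>: "\<phi> \<in> Cc X" "\<phi> (p z) = 1" "supp_on X \<phi> \<subseteq> V"
        using unit_bump[OF V, of "p z"] by (metis mem_Collect_eq)
      let ?T = "{w \<in> topspace (beta_r H). w (pull \<phi>) \<in> - {0}}"
      have "openin (beta_r H) ?T"
        using continuous_beta_eval by (rule openin_continuous_map_preimage) auto
      moreover have "z \<in> ?T"
        using z p(2)[of z \<phi>] \<phi> by auto
      moreover have "?T \<subseteq> {z \<in> topspace (beta_r H). p z \<in> V}"
        using p(2)[OF _ \<phi>(1)] Cc_supp[OF \<phi>(1)] \<phi>(3) by auto
      ultimately show "\<exists>T. openin (beta_r H) T \<and> z \<in> T \<and> T \<subseteq> {z \<in> topspace (beta_r H). p z \<in> V}"
        by blast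
    qed
  qed
  then have "continuous_map (beta_r H) (unit_space H) p"
    unfolding unit_space_def using p(1) by (intro continuous_map_into_subtopology) auto
  moreover have "p (beta_emb H g) = r g" if g: "g \<in> arrows H" for g
  proof (rule ccontr)
    assume ne: "p (beta_emb H g) \<noteq> r g"
    have px: "p (beta_emb H g) \<in> arrows H"
      using p(1)[OF emb_character[OF g]] unit_arrow by blast
    then have "openin X (topspace X - {p (beta_emb H g)})" "r g \<in> topspace X - {p (beta_emb H g)}"
      using openin_diff[OF openin_topspace closedin_Hausdorff_singleton[OF Hausdorff]] g ne by auto
    then obtain \<phi> where \<phi>: "\<phi> \<in> Cc X" "\<phi> (r g) = 1" "supp_on X \<phi> \<subseteq> topspace X - {p (beta_emb H g)}"
      using unit_bump by metis
    have "\<phi> (p (beta_emb H g)) = 1"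
      using p(2)[OF emb_character[OF g] \<phi>(1)] g \<phi>(2) by (simp add: emb_eval[OF pull_C0r[OF \<phi>(1)]] pull_def)
    then show False
      using Cc_supp[OF \<phi>(1), of "p (beta_emb H g)"] \<phi>(3) by auto
  qed
  ultimately show ?thesis by blast
qed

lemma continuous_r_beta: "continuous_map (beta_r H) (unit_space H) (r_beta H)"
  and r_beta_emb: "g \<in> arrows H \<Longrightarrow> r_beta H (beta_emb H g) = r g"
  using someI_ex[OF r_beta_exists] unfolding r_beta_def[symmetric] by blast+

lemma continuous_r_beta': "continuous_map (beta_r H) X (r_beta H)"
  using continuous_r_beta unfolding unit_space_def by (rule continuous_map_into_fulltopology)

lemma r_beta_unit: "z \<in> chars \<Longrightarrow> r_beta H z \<in> units H"
  using continuous_r_beta by (auto simp: continuous_map_def Pi_iff)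

lemma r_beta_eval:
  assumes "z \<in> chars" "\<phi> \<in> Cc X"
  shows "z (pull \<phi>) = \<phi> (r_beta H z)"
proof (rule beta_density[OF _ continuous_beta_eval _ _ assms(1)])
  show "continuous_map (beta_r H) euclidean (\<lambda>z. \<phi> (r_beta H z))"
    using continuous_map_compose[OF continuous_r_beta' Cc_continuous[OF assms(2)]] by (simp add: comp_def)
  show "beta_emb H g (pull \<phi>) = \<phi> (r_beta H (beta_emb H g))" if "g \<in> arrows H" for g
    using that by (simp add: emb_eval pull_C0r assms r_beta_emb pull_def)
qed simp

text \<open>Compactness is that of a product of discs. Multiplicative functionals normalised by
  \<open>z (pull f) = 1\<close> form a closed subset of it; the normalisation keeps limits from
  degenerating to zero and holds over \<open>K\<close>, where \<open>f\<close> is 1.\<close>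

lemma r_beta_proper:
  assumes K: "compactin X K"
  shows "compactin (beta_r H) {z \<in> chars. r_beta H z \<in> K}"
proof -
  obtain f where f: "f \<in> Cc X" "\<And>x. x \<in> K \<Longrightarrow> f x = 1"
    using compact_bump[OF locally_compact Hausdorff K openin_topspace compactin_subset_topspace[OF K]] by metis
  have "\<exists>B. \<forall>g. cmod (F g) \<le> B" if "F \<in> C0r H" for F
    using Cb_bounded[OF C0r_Cb[OF that]] by blast
  then obtain B where B: "\<And>F g. F \<in> C0r H \<Longrightarrow> cmod (F g) \<le> B F"
    by metis
  let ?L = "{z. (\<forall>f. f \<notin> C0r H \<longrightarrow> z f = 0) \<and>
     (\<forall>f\<in>C0r H. \<forall>h\<in>C0r H. z (\<lambda>x. f x + h x) = z f + z h \<and> z (\<lambda>x. f x * h x) = z f * z h) \<and>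
     (\<forall>c. \<forall>f\<in>C0r H. z (\<lambda>x. c * f x) = c * z f) \<and>
     (\<forall>f\<in>C0r H. z (\<lambda>x. cnj (f x)) = cnj (z f)) \<and> z (pull f) = 1}"
  have L: "?L \<subseteq> chars"
    unfolding characters_def using pull_C0r[OF f(1)] by (auto intro!: bexI[of _ "pull f"])
  have closed: "closed ?L"
  proof -
    have coord: "continuous_on UNIV (\<lambda>z :: 'a beta_pt. z F)" for F
      by (rule continuous_on_product_coordinates)
    let ?M = "(\<Inter>f\<in>- C0r H. {z. z f = 0}) \<inter>
      (\<Inter>f\<in>C0r H. \<Inter>h\<in>C0r H. {z. z (\<lambda>x. f x + h x) = z f + z h} \<inter> {z. z (\<lambda>x. f x * h x) = z f * z h}) \<inter>
      (\<Inter>c. \<Inter>f\<in>C0r H. {z. z (\<lambda>x. c * f x) = c * z f}) \<inter>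
      (\<Inter>f\<in>C0r H. {z. z (\<lambda>x. cnj (f x)) = cnj (z f)}) \<inter> {z. z (pull f) = 1}"
    have "closed ?M"
      by (intro closed_Int closed_INT ballI closed_Collect_eq continuous_on_add continuous_on_mult
          continuous_on_cnj continuous_on_const coord)
    moreover have "?L = ?M"
      by auto
    ultimately show ?thesis by simp
  qed
  let ?P = "PiE UNIV (\<lambda>F. cball 0 (max 0 (B F)) :: complex set)"
  have "compactin (product_topology (\<lambda>_. euclidean) UNIV) ?P"
    by (rule compactin_PiE[THEN iffD2]) auto
  then have cP: "compact ?P"
    by (simp add: euclidean_product_topology)
  have LP: "?L \<subseteq> ?P"
  proof
    fix z assume "z \<in> ?L"
    then have z: "z \<in> chars"
      using L by blast
    have "cmod (z F) \<le> max 0 (B F)" for F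
    proof (cases "F \<in> C0r H")
      case True
      then show ?thesis
        using character_bound[OF z True B[OF True]] by simp
    qed (simp add: character_simps(1)[OF z])
    then show "z \<in> ?P"
      by auto
  qed
  have "compact ?L"
    using compact_Int_closed[OF cP closed] unfolding Int_absorb1[OF LP] .
  then have "compactin (beta_r H) ?L"
    unfolding beta_eq compactin_subtopology compactin_euclidean_iff using L by (rule conjI)
  moreover have "closedin (beta_r H) {z \<in> topspace (beta_r H). r_beta H z \<in> K}"
    by (rule closedin_continuous_map_preimage[OF continuous_r_beta' compactin_imp_closedin[OF Hausdorff K]])
  moreover have "{z \<in> topspace (beta_r H). r_beta H z \<in> K} \<subseteq> ?L"
  proof
    fix z assume "z \<in> {z \<in> topspace (beta_r H). r_beta H z \<in> K}"
    then have z: "z \<in> chars" "r_beta H z \<in> K" by auto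
    then have "z (pull f) = 1"
      using r_beta_eval[OF z(1) f(1)] f(2) by simp
    then show "z \<in> ?L"
      using character_simps[OF z(1)] by simp
  qed
  ultimately show ?thesis
    using closed_compactin by fastforce
qed

lemma locally_compact_beta: "locally_compact_space (beta_r H)"
  unfolding locally_compact_space_def
proof (intro ballI)
  fix z assume z: "z \<in> topspace (beta_r H)"
  then have "r_beta H z \<in> topspace X"
    using r_beta_unit unit_arrow by auto
  then obtain U K where U: "openin X U" "compactin X K" "r_beta H z \<in> U" "U \<subseteq> K"
    using locally_compact unfolding locally_compact_space_def by blast
  have "openin (beta_r H) {z \<in> topspace (beta_r H). r_beta H z \<in> U}"
    by (rule openin_continuous_map_preimage[OF continuous_r_beta' U(1)])
  then show "\<exists>U K. openin (beta_r H) U \<and> compactin (beta_r H) K \<and> z \<in> U \<and> U \<subseteq> K"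
    using r_beta_proper[OF U(2)] U z by (intro exI[of _ "{z \<in> topspace (beta_r H). r_beta H z \<in> U}"] exI[of _ "{z \<in> chars. r_beta H z \<in> K}"]) auto
qed

end

section \<open>The action on the compactification\<close>

context etale
begin

text \<open>\<open>lact \<phi> F\<close> is \<open>g \<mapsto> \<phi> u * F (u \<cdot> g)\<close>, where \<open>u\<close> is the arrow with source \<open>r g\<close> in a bisection supporting \<open>\<phi>\<close>;
  the action is characterized by \<open>z (lact \<phi> F) = \<phi> u * (u z) F\<close>.\<close>

definition lact :: "('a \<Rightarrow> complex) \<Rightarrow> ('a \<Rightarrow> complex) \<Rightarrow> 'a \<Rightarrow> complex" where
  "lact \<phi> F g = (if g \<in> arrows H then \<Sum>\<^sub>\<infinity>u\<in>fibre H (r g). \<phi> u * F (u \<cdot> g) else 0)"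

lemma lact_section:
  assumes "bisection U" "\<phi> \<in> Cc X" "supp_on X \<phi> \<subseteq> U" "g \<in> arrows H"
  shows "lact \<phi> F g = (if r g \<in> s ` U then \<phi> (inv_into U s (r g)) * F (inv_into U s (r g) \<cdot> g) else 0)"
  using infsum_bisection[OF assms(1-3), where k = "\<lambda>u. F (u \<cdot> g)" and x = "r g"] assms(4) by (simp add: lact_def)

lemma bisection_source_section:
  assumes "bisection U" "x \<in> s ` U"
  shows "inv_into U s x \<in> U" "s (inv_into U s x) = x" "inv_into U s x \<in> arrows H"
proof -
  show *: "inv_into U s x \<in> U" "s (inv_into U s x) = x"
    using assms inv_into_into f_inv_into_f by metis+
  show "inv_into U s x \<in> arrows H"
    using bisection_arrow[OF assms(1) *(1)] .
qed

lemma bisection_source_section_eq: "bisection U \<Longrightarrow> u \<in> U \<Longrightarrow> inv_into U s (s u) = u"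
  by (simp add: bisection_def)

lemma lact_at:
  assumes "bisection U" "\<phi> \<in> Cc X" "supp_on X \<phi> \<subseteq> U" "u \<in> U" "g \<in> arrows H" "s u = r g"
  shows "lact \<phi> F g = \<phi> u * F (u \<cdot> g)"
proof -
  have "inv_into U s (r g) = u" "r g \<in> s ` U"
    using bisection_source_section_eq[OF assms(1,4)] assms(4,6) by (metis, metis image_eqI)
  then show ?thesis
    using lact_section[OF assms(1-3,5), of F] by simp
qed

lemma lact_cases:
  assumes U: "bisection U" and g: "g \<in> arrows H"
  obtains (arrow) u where "u \<in> U" "u \<in> arrows H" "s u = r g"
    | (zero) "\<And>\<phi> F. \<phi> \<in> Cc X \<Longrightarrow> supp_on X \<phi> \<subseteq> U \<Longrightarrow> lact \<phi> F g = 0"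
  using bisection_source_section[OF U, of "r g"] lact_section[OF U _ _ g] by (cases "r g \<in> s ` U") auto

lemma lact_C0r:
  assumes U: "bisection U" and \<phi>: "\<phi> \<in> Cc X" "supp_on X \<phi> \<subseteq> U" and F: "F \<in> C0r H"
  shows "lact \<phi> F \<in> C0r H"
proof (rule C0r_generator)
  obtain A where A: "A \<ge> 0" "\<And>g. cmod (\<phi> g) \<le> A"
    using Cb_bounded[OF Cc_subset_Cb[OF \<phi>(1)]] by blast
  obtain B where B: "B \<ge> 0" "\<And>g. cmod (F g) \<le> B"
    using Cb_bounded[OF C0r_Cb[OF F]] by blast
  let ?W = "{y \<in> topspace X. r y \<in> s ` U}"
  have "continuous_map (subtopology X ?W) X (\<lambda>y. inv_into U s (r y))"
    by (intro bisection_section_compose(2)[OF U _ continuous_range]) simp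
  then have "continuous_map (subtopology X ?W) X (\<lambda>y. inv_into U s (r y) \<cdot> y)"
    using continuous_map_from_subtopology[OF continuous_map_id, of X ?W] bisection_source_section[OF U]
    by (intro continuous_mul) (auto simp: id_def)
  moreover have "continuous_map X euclidean F"
    using C0r_Cb[OF F] by (simp add: Cb_def)
  ultimately have "continuous_map (subtopology X ?W) euclidean (\<lambda>y. F (inv_into U s (r y) \<cdot> y))"
    using continuous_map_compose by (fastforce simp: comp_def)
  then have "continuous_map X euclidean (\<lambda>y. if r y \<in> s ` U then \<phi> (inv_into U s (r y)) * F (inv_into U s (r y) \<cdot> y) else 0)"
    using bisection_extend[OF U disjI2[OF refl] continuous_range \<phi>] by blast
  then have cont: "continuous_map X euclidean (lact \<phi> F)"
    by (rule continuous_map_eq) (simp add: lact_section[OF U \<phi>])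
  show "lact \<phi> F \<in> Cb X"
  proof (rule CbI[OF cont, where C = "A * B"])
    fix g assume "g \<in> topspace X"
    then have g: "g \<in> arrows H" by simp
    show "cmod (lact \<phi> F g) \<le> A * B"
      using lact_section[OF U \<phi> g, of F] A B by (auto simp: norm_mult intro!: mult_mono)
  qed (simp add: lact_def)
  show "compactin X (s ` supp_on X \<phi>)"
    by (rule image_compactin[OF Cc_compact[OF \<phi>(1)] continuous_source])
  show "s ` supp_on X \<phi> \<subseteq> units H"
    using supp_on_subset[of X \<phi>] by auto
  show "r g \<in> s ` supp_on X \<phi>" if "g \<in> arrows H" "lact \<phi> F g \<noteq> 0" for g
    using U that(1)
  proof (cases rule: lact_cases)
    case (arrow u)
    then have "\<phi> u \<noteq> 0"
      using lact_at[OF U \<phi> arrow(1) that(1) arrow(3), of F] that(2) by auto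
    then show ?thesis
      using Cc_supp[OF \<phi>(1)] arrow(3) by (metis image_eqI)
  next
    case zero
    then show ?thesis using that \<phi> by auto
  qed
qed

text \<open>A bump pulled back from \<open>s u\<close> has value 1 under \<open>z\<close>, so the
  difference may be cut down to ranges where \<open>c\<close> is smaller than
  \<open>\<epsilon>\<close>. Thus \<open>z\<close> sees only the germ at \<open>u\<close>;
  well-definedness and multiplicativity of the action rest on this.\<close>

lemma character_local:
  assumes z: "z \<in> chars" and F: "F \<in> C0r H" "F' \<in> C0r H"
    and U: "openin X U" "u \<in> U" "s u = r_beta H z"
    and c: "continuous_map (subtopology X U) euclidean c" "c u = (0::complex)"
    and bound: "\<And>v g. v \<in> U \<Longrightarrow> g \<in> arrows H \<Longrightarrow> s v = r g \<Longrightarrow> cmod (F g - F' g) \<le> cmod (c v)"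
  shows "z F = z F'"
proof -
  have "cmod (z F - z F') \<le> 0 + \<epsilon>" if e: "\<epsilon> > 0" for \<epsilon>
  proof -
    have sub: "U \<subseteq> topspace X"
      using openin_subset[OF U(1)] .
    let ?W = "{v \<in> topspace (subtopology X U). c v \<in> ball 0 \<epsilon>}"
    have "openin (subtopology X U) ?W"
      using c(1) by (rule openin_continuous_map_preimage) simp
    then have W: "openin X ?W"
      using U(1) openin_open_subtopology by blast
    have "u \<in> ?W"
      using U(2) sub c(2) e by auto
    then obtain \<phi> where \<phi>: "\<phi> \<in> Cc X" "\<phi> (s u) = 1" "supp_on X \<phi> \<subseteq> s ` ?W" "\<And>y. cmod (\<phi> y) \<le> 1"
      using unit_bump[OF open_source[OF W], of "s u"] by blast
    let ?D = "\<lambda>g. pull \<phi> g * (F g - F' g)"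
    have D: "?D \<in> C0r H" "z ?D = z F - z F'"
      using C0r_mult[OF pull_C0r[OF \<phi>(1)] C0r_diff[OF F]] character_simps(4)[OF z pull_C0r[OF \<phi>(1)] C0r_diff[OF F]]
        r_beta_eval[OF z \<phi>(1)] \<phi>(2) U(3) character_diff[OF z F] by auto
    have "cmod (?D g) \<le> \<epsilon>" if g: "g \<in> arrows H" for g
    proof (cases "\<phi> (r g) = 0")
      case True
      then show ?thesis
        using g e by (simp add: pull_def)
    next
      case False
      then obtain v where v: "v \<in> ?W" "s v = r g"
        using Cc_supp[OF \<phi>(1)] \<phi>(3) by fastforce
      have "cmod (F g - F' g) \<le> \<epsilon>"
        using bound[OF _ g v(2)] v(1) by auto
      moreover have "cmod (?D g) \<le> 1 * cmod (F g - F' g)"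
        unfolding norm_mult using g \<phi>(4) by (intro mult_right_mono) (auto simp: pull_def)
      ultimately show ?thesis by simp
    qed
    then show ?thesis
      using character_bound[OF z D(1)] D(2) by simp
  qed
  then have "cmod (z F - z F') \<le> 0"
    by (rule field_le_epsilon)
  then show ?thesis by simp
qed

text \<open>A normalised bump at \<open>u\<close> used to define the action; that any other bump
  gives the same result is \<open>baction_eval\<close>.\<close>

definition bmp :: "'a \<Rightarrow> 'a \<Rightarrow> complex" where
  "bmp u = (SOME \<phi>. \<phi> \<in> Cc X \<and> (\<exists>U. bisection U \<and> u \<in> U \<and> supp_on X \<phi> \<subseteq> U) \<and> \<phi> u = 1)"

lemma bmp:
  assumes "u \<in> arrows H"
  obtains U where "bmp u \<in> Cc X" "bisection U" "u \<in> U" "supp_on X (bmp u) \<subseteq> U" "bmp u u = 1"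
proof -
  have "\<exists>\<phi>. \<phi> \<in> Cc X \<and> (\<exists>U. bisection U \<and> u \<in> U \<and> supp_on X \<phi> \<subseteq> U) \<and> \<phi> u = 1"
    using bump[OF openin_topspace, of u] assms by (metis topspace_X)
  from someI_ex[OF this] show thesis
    unfolding bmp_def[symmetric] using that by blast
qed

definition baction :: "'a \<Rightarrow> 'a beta_pt \<Rightarrow> 'a beta_pt" where
  "baction u z F = (if F \<in> C0r H then z (lact (bmp u) F) else 0)"

lemma continuous_map_sub:
  "continuous_map X euclidean f \<Longrightarrow> continuous_map (subtopology X U) euclidean f"
  by (rule continuous_map_from_subtopology)

text \<open>Near \<open>u\<close> both \<open>lact \<phi> F\<close> and
  \<open>\<phi> u * lact (bmp u) F\<close> are multiples of the same translate of \<open>F\<close>,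
  and the two factors agree at \<open>u\<close> itself, so \<open>character_local\<close>
  applies.\<close>

lemma baction_eval:
  assumes u: "u \<in> arrows H" and z: "z \<in> chars" "s u = r_beta H z" and F: "F \<in> C0r H"
    and U: "bisection U" "u \<in> U" and \<phi>: "\<phi> \<in> Cc X" "supp_on X \<phi> \<subseteq> U"
  shows "z (lact \<phi> F) = \<phi> u * baction u z F"
proof -
  let ?\<psi> = "bmp u"
  obtain V where V: "?\<psi> \<in> Cc X" "bisection V" "u \<in> V" "supp_on X ?\<psi> \<subseteq> V" "?\<psi> u = 1"
    using bmp[OF u] by blast
  obtain B where B: "B \<ge> 0" "\<And>g. cmod (F g) \<le> B"
    using Cb_bounded[OF C0r_Cb[OF F]] by blast
  note L = lact_C0r[OF U(1) \<phi> F] lact_C0r[OF V(2,1,4) F]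
  have "z (lact \<phi> F) = z (\<lambda>g. \<phi> u * lact ?\<psi> F g)"
  proof (rule character_local[OF z(1) L(1) C0r_scale[OF L(2)], of "U \<inter> V" u])
    show "openin X (U \<inter> V)"
      using U V bisection_open by blast
    show "continuous_map (subtopology X (U \<inter> V)) euclidean (\<lambda>v. (\<phi> v - \<phi> u * ?\<psi> v) * complex_of_real B)"
      using Cc_continuous[OF V(1)] Cc_continuous[OF \<phi>(1)]
      by (intro continuous_map_sub continuous_map_mult continuous_map_diff) auto
    fix v g assume v: "v \<in> U \<inter> V" "g \<in> arrows H" "s v = r g"
    then have "lact \<phi> F g - \<phi> u * lact ?\<psi> F g = (\<phi> v - \<phi> u * ?\<psi> v) * F (v \<cdot> g)"
      using lact_at[OF U(1) \<phi>, of v g F] lact_at[OF V(2,1,4), of v g F] by (simp add: algebra_simps)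
    then show "cmod (lact \<phi> F g - \<phi> u * lact ?\<psi> F g) \<le> cmod ((\<phi> v - \<phi> u * ?\<psi> v) * complex_of_real B)"
      using B by (simp add: norm_mult mult_left_mono)
  qed (use U V z in auto)
  then show ?thesis
    using F character_simps(5)[OF z(1) L(2)] by (simp add: baction_def)
qed

text \<open>With at most one arrow contributing, \<open>lact\<close> is multiplicative up to its
  weight: products need the squared weight and conjugates the conjugated one. Both weights are again
  bumps at \<open>u\<close>, so \<open>baction_eval\<close> absorbs them.\<close>

lemma lact_algebra:
  assumes U: "bisection U" and \<phi>: "\<phi> \<in> Cc X" "supp_on X \<phi> \<subseteq> U"
  shows "lact \<phi> (\<lambda>g. F g + F' g) = (\<lambda>g. lact \<phi> F g + lact \<phi> F' g)"
    "lact \<phi> (\<lambda>g. c * F g) = (\<lambda>g. c * lact \<phi> F g)"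
    "lact (\<lambda>v. \<phi> v * \<phi> v) (\<lambda>g. F g * F' g) = (\<lambda>g. lact \<phi> F g * lact \<phi> F' g)"
    "lact (\<lambda>v. cnj (\<phi> v)) (\<lambda>g. cnj (F g)) = (\<lambda>g. cnj (lact \<phi> F g))"
    "(\<lambda>v. \<phi> v * \<phi> v) \<in> Cc X" "supp_on X (\<lambda>v. \<phi> v * \<phi> v) \<subseteq> U"
    "(\<lambda>v. cnj (\<phi> v)) \<in> Cc X" "supp_on X (\<lambda>v. cnj (\<phi> v)) \<subseteq> U"
proof -
  show sq: "(\<lambda>v. \<phi> v * \<phi> v) \<in> Cc X"
    by (rule Cb_mult_Cc[OF Hausdorff Cc_subset_Cb[OF \<phi>(1)] \<phi>(1)])
  show cn: "(\<lambda>v. cnj (\<phi> v)) \<in> Cc X"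
    by (rule Cc_cnj[OF Hausdorff \<phi>(1)])
  have "supp_on X (\<lambda>v. \<phi> v * \<phi> v) \<subseteq> supp_on X \<phi>" "supp_on X (\<lambda>v. cnj (\<phi> v)) \<subseteq> supp_on X \<phi>"
    by (rule supp_on_minimal; auto intro: closedin_supp_on in_supp_on)+
  then show sq': "supp_on X (\<lambda>v. \<phi> v * \<phi> v) \<subseteq> U" and cn': "supp_on X (\<lambda>v. cnj (\<phi> v)) \<subseteq> U"
    using \<phi>(2) by auto
  show "lact \<phi> (\<lambda>g. F g + F' g) = (\<lambda>g. lact \<phi> F g + lact \<phi> F' g)"
  proof
    fix g show "lact \<phi> (\<lambda>g. F g + F' g) g = lact \<phi> F g + lact \<phi> F' g"
      by (cases "g \<in> arrows H") (auto simp: lact_section[OF U \<phi>] distrib_left, auto simp: lact_def)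
  qed
  show "lact \<phi> (\<lambda>g. c * F g) = (\<lambda>g. c * lact \<phi> F g)"
  proof
    fix g show "lact \<phi> (\<lambda>g. c * F g) g = c * lact \<phi> F g"
      by (cases "g \<in> arrows H") (auto simp: lact_section[OF U \<phi>], auto simp: lact_def)
  qed
  show "lact (\<lambda>v. \<phi> v * \<phi> v) (\<lambda>g. F g * F' g) = (\<lambda>g. lact \<phi> F g * lact \<phi> F' g)"
  proof
    fix g show "lact (\<lambda>v. \<phi> v * \<phi> v) (\<lambda>g. F g * F' g) g = lact \<phi> F g * lact \<phi> F' g"
      by (cases "g \<in> arrows H") (auto simp: lact_section[OF U \<phi>] lact_section[OF U sq sq'], auto simp: lact_def)
  qed
  show "lact (\<lambda>v. cnj (\<phi> v)) (\<lambda>g. cnj (F g)) = (\<lambda>g. cnj (lact \<phi> F g))"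
  proof
    fix g show "lact (\<lambda>v. cnj (\<phi> v)) (\<lambda>g. cnj (F g)) g = cnj (lact \<phi> F g)"
      by (cases "g \<in> arrows H") (auto simp: lact_section[OF U \<phi>] lact_section[OF U cn cn'], auto simp: lact_def)
  qed
qed

text \<open>Translating by an arrow \<open>v\<close> near \<open>u\<close> replaces the range
  \<open>r g\<close> by \<open>r v\<close>, which tends to \<open>r u\<close>. This determines
  \<open>r_beta\<close> on the translated character.\<close>

lemma baction_pull:
  assumes u: "u \<in> arrows H" and z: "z \<in> chars" "s u = r_beta H z" and \<omega>: "\<omega> \<in> Cc X"
  shows "baction u z (pull \<omega>) = \<omega> (r u)"
proof -
  let ?\<psi> = "bmp u"
  obtain V where V: "?\<psi> \<in> Cc X" "bisection V" "u \<in> V" "supp_on X ?\<psi> \<subseteq> V" "?\<psi> u = 1"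
    using bmp[OF u] by blast
  \<comment> \<open>Constants may fail to lie in \<open>C0r H\<close>; \<open>pull \<phi>\<close>
    serves as a local 1 on which \<open>z\<close> takes the value 1.\<close>
  obtain \<phi> where \<phi>: "\<phi> \<in> Cc X" "\<phi> (s u) = 1"
    using unit_bump[OF openin_topspace, of "s u"] u by (metis closed_arrows(2) topspace_X)
  note L = lact_C0r[OF V(2,1,4) pull_C0r[OF \<omega>]]
  have "z (lact ?\<psi> (pull \<omega>)) = z (\<lambda>g. \<omega> (r u) * pull \<phi> g)"
  proof (rule character_local[OF z(1) L C0r_scale[OF pull_C0r[OF \<phi>(1)]], of V u])
    have "continuous_map X euclidean (\<lambda>v. \<omega> (r v))" "continuous_map X euclidean (\<lambda>v. \<phi> (s v))"
      using continuous_map_compose[OF continuous_range Cc_continuous[OF \<omega>]]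
        continuous_map_compose[OF continuous_source Cc_continuous[OF \<phi>(1)]] by (auto simp: comp_def)
    then show "continuous_map (subtopology X V) euclidean (\<lambda>v. ?\<psi> v * \<omega> (r v) - \<omega> (r u) * \<phi> (s v))"
      using Cc_continuous[OF V(1)] by (intro continuous_map_sub continuous_map_mult continuous_map_diff) auto
    fix v g assume v: "v \<in> V" "g \<in> arrows H" "s v = r g"
    then have "v \<in> arrows H"
      using bisection_arrow[OF V(2)] by blast
    then show "cmod (lact ?\<psi> (pull \<omega>) g - \<omega> (r u) * pull \<phi> g) \<le> cmod (?\<psi> v * \<omega> (r v) - \<omega> (r u) * \<phi> (s v))"
      using lact_at[OF V(2,1,4) v, of "pull \<omega>"] v by (simp add: pull_def)
  qed (use V z \<phi> bisection_open in auto)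
  also have "\<dots> = \<omega> (r u)"
    using character_simps(5)[OF z(1) pull_C0r[OF \<phi>(1)]] r_beta_eval[OF z(1) \<phi>(1)] \<phi>(2) z(2) by simp
  finally show ?thesis
    using pull_C0r[OF \<omega>] by (simp add: baction_def)
qed

lemma baction_character:
  assumes u: "u \<in> arrows H" and z: "z \<in> chars" "s u = r_beta H z"
  shows "baction u z \<in> chars" "r_beta H (baction u z) = r u"
proof -
  let ?\<phi> = "bmp u"
  obtain U where U: "?\<phi> \<in> Cc X" "bisection U" "u \<in> U" "supp_on X ?\<phi> \<subseteq> U" "?\<phi> u = 1"
    using bmp[OF u] by blast
  note alg = lact_algebra[OF U(2,1,4)] and L = lact_C0r[OF U(2,1,4)]
  note ev = baction_eval[OF u z _ U(2,3)]
  obtain \<omega> where \<omega>: "\<omega> \<in> Cc X" "\<omega> (r u) = 1"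
    using unit_bump[OF openin_topspace, of "r u"] u by (metis closed_arrows(1) topspace_X)
  show c: "baction u z \<in> chars"
    unfolding characters_def
  proof (intro CollectI conjI allI impI ballI)
    show "baction u z F = 0" if "F \<notin> C0r H" for F
      using that by (simp add: baction_def)
    show "\<exists>F\<in>C0r H. baction u z F \<noteq> 0"
      using baction_pull[OF u z \<omega>(1)] \<omega> pull_C0r by (intro bexI[of _ "pull \<omega>"]) auto
    fix F assume F: "F \<in> C0r H"
    show "baction u z (\<lambda>x. c * F x) = c * baction u z F" for c
      using F L[OF F] by (simp add: baction_def alg(2) character_simps(5)[OF z(1)] C0r_scale)
    show "baction u z (\<lambda>x. cnj (F x)) = cnj (baction u z F)"
    proof -
      have "z (lact (\<lambda>v. cnj (?\<phi> v)) (\<lambda>g. cnj (F g))) = cnj (?\<phi> u) * baction u z (\<lambda>x. cnj (F x))"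
        by (rule ev[OF C0r_cnj[OF F] alg(7,8)])
      then show ?thesis
        using F L[OF F] U(5) by (simp add: alg(4) character_simps(6)[OF z(1)] baction_def)
    qed
    fix F' assume F': "F' \<in> C0r H"
    show "baction u z (\<lambda>x. F x + F' x) = baction u z F + baction u z F'"
      using F F' L[OF F] L[OF F'] by (simp add: baction_def alg(1) character_simps(3)[OF z(1)] C0r_add)
    have "z (lact (\<lambda>v. ?\<phi> v * ?\<phi> v) (\<lambda>g. F g * F' g)) = ?\<phi> u * ?\<phi> u * baction u z (\<lambda>x. F x * F' x)"
      by (rule ev[OF C0r_mult[OF F F'] alg(5,6)])
    then show "baction u z (\<lambda>x. F x * F' x) = baction u z F * baction u z F'"
      using F F' L[OF F] L[OF F'] U(5) by (simp add: alg(3) character_simps(4)[OF z(1)] baction_def)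
  qed
  show "r_beta H (baction u z) = r u"
  proof (rule ccontr)
    assume ne: "r_beta H (baction u z) \<noteq> r u"
    have "r_beta H (baction u z) \<in> topspace X"
      using r_beta_unit[OF c] unit_arrow by simp
    then have "openin X (topspace X - {r_beta H (baction u z)})"
      by (intro openin_diff openin_topspace closedin_Hausdorff_singleton[OF Hausdorff])
    then obtain \<omega> where \<omega>: "\<omega> \<in> Cc X" "\<omega> (r u) = 1" "supp_on X \<omega> \<subseteq> topspace X - {r_beta H (baction u z)}"
      by (rule unit_bump[of _ "r u"]) (use u ne in auto)
    have "\<omega> (r_beta H (baction u z)) = 1"
      using r_beta_eval[OF c \<omega>(1)] baction_pull[OF u z \<omega>(1)] \<omega>(2) by simp
    then show False
      using Cc_supp[OF \<omega>(1), of "r_beta H (baction u z)"] \<omega>(3) by auto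
  qed
qed

text \<open>The units form a bisection themselves, and a bump on them acts through
  \<open>lact\<close> as multiplication by its pullback.\<close>

lemma baction_unit:
  assumes z: "z \<in> chars"
  shows "baction (r_beta H z) z = z"
proof
  fix F
  let ?x = "r_beta H z"
  have x: "?x \<in> units H"
    using r_beta_unit[OF z] .
  have U: "bisection (units H)"
    unfolding bisection_def using openin_units by (auto simp: inj_on_def)
  show "baction ?x z F = z F"
  proof (cases "F \<in> C0r H")
    case True
    obtain \<phi> where \<phi>: "\<phi> \<in> Cc X" "\<phi> ?x = 1" "supp_on X \<phi> \<subseteq> units H"
      using unit_bump[OF openin_units x] by metis
    have "lact \<phi> F = (\<lambda>g. pull \<phi> g * F g)"
    proof
      fix g show "lact \<phi> F g = pull \<phi> g * F g"
      proof (cases "g \<in> arrows H")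
        case g: True
        then show ?thesis
          using lact_at[OF U \<phi>(1,3), of "r g" g F] by (simp add: pull_def)
      qed (simp add: lact_def pull_def)
    qed
    then have "z (lact \<phi> F) = z F"
      using character_simps(4)[OF z pull_C0r[OF \<phi>(1)] True] r_beta_eval[OF z \<phi>(1)] \<phi>(2) by simp
    then show ?thesis
      using baction_eval[OF unit_arrow[OF x] z _ True U x \<phi>(1,3)] \<phi>(2) x by simp
  qed (simp add: baction_def character_simps(1)[OF z])
qed

text \<open>Both iterated and single translation evaluate \<open>F\<close> at the same product, by
  associativity; the weights \<open>?\<psi> w * ?\<phi> (?u w)\<close> and
  \<open>?\<omega> (?u w \<cdot> w)\<close> agree at \<open>w = v\<close>, which is all a character
  can see.\<close>

lemma baction_mul:
  assumes u: "u \<in> arrows H" and v: "v \<in> arrows H" and uv: "s u = r v" and z: "z \<in> chars" "s v = r_beta H z"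
  shows "baction (u \<cdot> v) z = baction u (baction v z)"
proof
  fix F
  let ?\<phi> = "bmp u" and ?\<psi> = "bmp v" and ?\<omega> = "bmp (u \<cdot> v)"
  obtain U where U: "?\<phi> \<in> Cc X" "bisection U" "u \<in> U" "supp_on X ?\<phi> \<subseteq> U" "?\<phi> u = 1"
    using bmp[OF u] by blast
  obtain V where V: "?\<psi> \<in> Cc X" "bisection V" "v \<in> V" "supp_on X ?\<psi> \<subseteq> V" "?\<psi> v = 1"
    using bmp[OF v] by blast
  have uv': "u \<cdot> v \<in> arrows H" "s (u \<cdot> v) = r_beta H z"
    using u v uv z by auto
  obtain W where W: "?\<omega> \<in> Cc X" "bisection W" "u \<cdot> v \<in> W" "supp_on X ?\<omega> \<subseteq> W" "?\<omega> (u \<cdot> v) = 1"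
    using bmp[OF uv'(1)] by blast
  show "baction (u \<cdot> v) z F = baction u (baction v z) F"
  proof (cases "F \<in> C0r H")
    case F: True
    obtain B where B: "B \<ge> 0" "\<And>g. cmod (F g) \<le> B"
      using Cb_bounded[OF C0r_Cb[OF F]] by blast
    note L = lact_C0r[OF U(2,1,4) F]
    note LL = lact_C0r[OF V(2,1,4) L]
    note LW = lact_C0r[OF W(2,1,4) F]
    let ?A = "{w \<in> topspace X. r w \<in> s ` U}"
    let ?u = "\<lambda>w. inv_into U s (r w)"
    have A: "openin X ?A" "continuous_map (subtopology X ?A) X ?u"
      using bisection_section_compose[OF U(2) disjI2[OF refl] continuous_range] by auto
    have m: "continuous_map (subtopology X ?A) X (\<lambda>w. ?u w \<cdot> w)"
      using A(2) continuous_map_from_subtopology[OF continuous_map_id, of X ?A] bisection_source_section[OF U(2)]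
      by (intro continuous_mul) (auto simp: id_def)
    let ?B = "{w \<in> topspace (subtopology X ?A). ?u w \<cdot> w \<in> W}"
    have "openin (subtopology X ?A) ?B"
      by (rule openin_continuous_map_preimage[OF m bisection_open[OF W(2)]])
    then have B': "openin X ?B"
      using A(1) openin_open_subtopology by blast
    \<comment> \<open>On this set all three bumps are governed by single arrows: \<open>w\<close> in
      \<open>V\<close>, the arrow of \<open>U\<close> composable with it, and their product in
      \<open>W\<close>.\<close>
    let ?N = "V \<inter> ?B"
    have N: "openin X ?N"
      using B' bisection_open[OF V(2)] by blast
    have uv_eq: "?u v = u"
      using bisection_source_section_eq[OF U(2,3)] uv by simp
    have vN: "v \<in> ?N"
      using V(3) v uv U(3) W(3) uv_eq by (auto intro: image_eqI[of _ s u])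
    have NA: "?N \<subseteq> ?A" by auto
    let ?c = "\<lambda>w. (?\<psi> w * ?\<phi> (?u w) - ?\<omega> (?u w \<cdot> w)) * complex_of_real B"
    have "z (lact ?\<psi> (lact ?\<phi> F)) = z (lact ?\<omega> F)"
    proof (rule character_local[OF z(1) LL LW N vN z(2)])
      have 1: "continuous_map (subtopology X ?N) X ?u" "continuous_map (subtopology X ?N) X (\<lambda>w. ?u w \<cdot> w)"
        using A(2) m continuous_map_from_subtopology_mono[OF _ NA] by blast+
      have "continuous_map (subtopology X ?N) euclidean (\<lambda>w. ?\<phi> (?u w))"
          "continuous_map (subtopology X ?N) euclidean (\<lambda>w. ?\<omega> (?u w \<cdot> w))"
        using continuous_map_compose[OF 1(1) Cc_continuous[OF U(1)]] continuous_map_compose[OF 1(2) Cc_continuous[OF W(1)]]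
        by (auto simp: comp_def)
      then show "continuous_map (subtopology X ?N) euclidean ?c"
        using continuous_map_sub[OF Cc_continuous[OF V(1)]] by (intro continuous_map_mult continuous_map_diff) auto
      show "?c v = 0"
        unfolding uv_eq using U(5) V(5) W(5) by simp
      fix w g assume w: "w \<in> ?N" and g: "g \<in> arrows H" and wg: "s w = r g"
      have w': "w \<in> V" "w \<in> arrows H" "r w \<in> s ` U" "?u w \<cdot> w \<in> W"
        using w by auto
      note uw = bisection_source_section[OF U(2) w'(3)]
      have wg': "w \<cdot> g \<in> arrows H" "r (w \<cdot> g) = r w"
        using w'(2) g wg by auto
      have a: "lact ?\<psi> (lact ?\<phi> F) g = ?\<psi> w * (?\<phi> (?u w) * F (?u w \<cdot> (w \<cdot> g)))"
        using lact_at[OF V(2,1,4) w'(1) g wg] lact_at[OF U(2,1,4) uw(1) wg'(1)] uw(2) wg'(2) by simp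
      have b: "lact ?\<omega> F g = ?\<omega> (?u w \<cdot> w) * F ((?u w \<cdot> w) \<cdot> g)"
        using lact_at[OF W(2,1,4) w'(4) g] uw w'(2) wg by simp
      have "(?u w \<cdot> w) \<cdot> g = ?u w \<cdot> (w \<cdot> g)"
        using mul_assoc[OF uw(3) w'(2) g uw(2) wg] .
      then have "lact ?\<psi> (lact ?\<phi> F) g - lact ?\<omega> F g = (?\<psi> w * ?\<phi> (?u w) - ?\<omega> (?u w \<cdot> w)) * F (?u w \<cdot> (w \<cdot> g))"
        unfolding a b by (simp add: algebra_simps)
      then show "cmod (lact ?\<psi> (lact ?\<phi> F) g - lact ?\<omega> F g) \<le> cmod (?c w)"
        using B by (simp add: norm_mult mult_left_mono)
    qed
    then show ?thesis
      using F L by (simp add: baction_def)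
  qed (simp add: baction_def)
qed

lemma baction_emb:
  assumes "u \<in> arrows H" "g \<in> arrows H" "s u = r g"
  shows "baction u (beta_emb H g) = beta_emb H (u \<cdot> g)"
proof
  fix F
  obtain U where U: "bmp u \<in> Cc X" "bisection U" "u \<in> U" "supp_on X (bmp u) \<subseteq> U" "bmp u u = 1"
    using bmp[OF assms(1)] by blast
  show "baction u (beta_emb H g) F = beta_emb H (u \<cdot> g) F"
    using lact_C0r[OF U(2,1,4)] lact_at[OF U(2,1,4,3) assms(2,3)] U(5)
    by (auto simp: baction_def beta_emb_def)
qed

text \<open>The bump chosen at one arrow \<open>u\<close> serves for all nearby arrows
  \<open>v\<close> where it is nonzero: by \<open>baction_eval\<close> the action is there a
  quotient by \<open>bmp u v\<close>, jointly continuous in arrow and character.\<close>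

lemma baction_continuous:
  "continuous_map (subtopology (prod_topology X (beta_r H)) {(g, z). s g = r_beta H z}) (beta_r H) (\<lambda>(g, z). baction g z)"
  (is "continuous_map ?Y _ _")
proof (rule continuous_into_beta)
  show "(case p of (g, z) \<Rightarrow> baction g z) \<in> chars" if "p \<in> topspace ?Y" for p
    using that baction_character(1) by auto
  fix F assume F: "F \<in> C0r H"
  show "continuous_map ?Y euclidean (\<lambda>p. (case p of (g, z) \<Rightarrow> baction g z) F)"
  proof (rule continuous_map_transfer)
    fix p assume p: "p \<in> topspace ?Y"
    obtain u z where uz: "p = (u, z)" by (cases p)
    have u: "u \<in> arrows H" and z: "z \<in> chars" "s u = r_beta H z"
      using p uz by auto
    let ?\<phi> = "bmp u"
    obtain U where U: "?\<phi> \<in> Cc X" "bisection U" "u \<in> U" "supp_on X ?\<phi> \<subseteq> U" "?\<phi> u = 1"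
      using bmp[OF u] by blast
    let ?N = "{g \<in> topspace X. ?\<phi> g \<in> - {0}}"
    have N: "openin X ?N"
      using Cc_continuous[OF U(1)] by (rule openin_continuous_map_preimage) auto
    let ?W = "{q \<in> topspace ?Y. fst q \<in> ?N}"
    have fst: "continuous_map ?Y X fst" and snd: "continuous_map ?Y (beta_r H) snd"
      by (intro continuous_map_from_subtopology continuous_map_fst continuous_map_snd)+
    have W: "openin ?Y ?W"
      by (rule openin_continuous_map_preimage[OF fst N])
    have pW: "p \<in> ?W"
      using p uz u U(5) by auto
    have c1: "continuous_map (subtopology ?Y ?W) euclidean (\<lambda>q. snd q (lact ?\<phi> F))"
      by (rule continuous_map_from_subtopology[OF continuous_map_compose[OF snd continuous_beta_eval, unfolded comp_def]])
    have c2: "continuous_map (subtopology ?Y ?W) euclidean (\<lambda>q. ?\<phi> (fst q))"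
      by (rule continuous_map_from_subtopology[OF continuous_map_compose[OF fst Cc_continuous[OF U(1)], unfolded comp_def]])
    have c3: "continuous_map (subtopology ?Y ?W) euclidean (\<lambda>q. inverse (?\<phi> (fst q)))"
      by (rule continuous_map_inverse[OF c2]) auto
    have "(case q of (g, z) \<Rightarrow> baction g z) F = snd q (lact ?\<phi> F) * inverse (?\<phi> (fst q))" if q: "q \<in> ?W" for q
    proof -
      obtain v w where vw: "q = (v, w)" by (cases q)
      have v: "v \<in> arrows H" "w \<in> chars" "s v = r_beta H w" "?\<phi> v \<noteq> 0"
        using q vw by auto
      have "v \<in> U"
        using Cc_supp[OF U(1) v(4)] U(4) by blast
      then show ?thesis
        using baction_eval[OF v(1-3) F U(2) _ U(1,4)] v(4) vw by simp
    qed
    then show "\<exists>W f. openin ?Y W \<and> p \<in> W \<and> continuous_map (subtopology ?Y W) euclidean f \<and>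
        (\<forall>q\<in>W. (case q of (g, z) \<Rightarrow> baction g z) F = f q)"
      using W pW continuous_map_mult[OF c1 c3] by blast
  qed
qed

lemma beta_act_exists:
  "\<exists>act. continuous_action H (beta_r H) (r_beta H) act \<and>
     (\<forall>g\<in>arrows H. \<forall>h\<in>arrows H. s g = r h \<longrightarrow> act g (beta_emb H h) = beta_emb H (g \<cdot> h))"
  unfolding continuous_action_def
  by (intro exI[of _ baction])
    (simp add: baction_continuous baction_character baction_unit baction_mul baction_emb)

lemma beta_action: "continuous_action H (beta_r H) (r_beta H) (beta_act H)"
  and beta_act_emb: "g \<in> arrows H \<Longrightarrow> h \<in> arrows H \<Longrightarrow> s g = r h \<Longrightarrow> beta_act H g (beta_emb H h) = beta_emb H (g \<cdot> h)"
  using someI_ex[OF beta_act_exists] unfolding beta_act_def[symmetric] by blast+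

lemma continuous_beta_act:
  assumes "continuous_map Y X a" "continuous_map Y (beta_r H) b" "\<And>y. y \<in> topspace Y \<Longrightarrow> s (a y) = r_beta H (b y)"
  shows "continuous_map Y (beta_r H) (\<lambda>y. beta_act H (a y) (b y))"
proof -
  have "continuous_map Y (subtopology (prod_topology X (beta_r H)) {(g, z). s g = r_beta H z}) (\<lambda>y. (a y, b y))"
    using assms by (intro continuous_map_into_subtopology continuous_map_pairedI) auto
  moreover have "continuous_map (subtopology (prod_topology X (beta_r H)) {(g, z). s g = r_beta H z}) (beta_r H) (\<lambda>(g, z). beta_act H g z)"
    using beta_action by (simp add: continuous_action_def)
  ultimately have "continuous_map Y (beta_r H) ((\<lambda>(g, z). beta_act H g z) \<circ> (\<lambda>y. (a y, b y)))"
    by (rule continuous_map_compose)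
  then show ?thesis
    by (simp add: comp_def)
qed

lemma beta_act:
  assumes "g \<in> arrows H" "z \<in> chars" "s g = r_beta H z"
  shows "beta_act H g z \<in> chars" "r_beta H (beta_act H g z) = r g"
proof -
  show "r_beta H (beta_act H g z) = r g"
    using beta_action assms by (simp add: continuous_action_def)
  have "(g, z) \<in> topspace (subtopology (prod_topology X (beta_r H)) {(g, z). s g = r_beta H z})"
    using assms by simp
  moreover have "continuous_map (subtopology (prod_topology X (beta_r H)) {(g, z). s g = r_beta H z}) (beta_r H) (\<lambda>(g, z). beta_act H g z)"
    using beta_action by (simp add: continuous_action_def)
  ultimately have "(\<lambda>(g, z). beta_act H g z) (g, z) \<in> topspace (beta_r H)"
    by (rule continuous_map_image_subset_topspace[THEN subsetD, OF _ imageI, rotated])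
  then show "beta_act H g z \<in> chars"
    by simp
qed

lemma beta_act_unit: "z \<in> chars \<Longrightarrow> beta_act H (r_beta H z) z = z"
  using beta_action by (simp add: continuous_action_def)

lemma beta_act_mul:
  "g \<in> arrows H \<Longrightarrow> h \<in> arrows H \<Longrightarrow> z \<in> chars \<Longrightarrow> s g = r h \<Longrightarrow> s h = r_beta H z \<Longrightarrow>
    beta_act H (g \<cdot> h) z = beta_act H g (beta_act H h z)"
  using beta_action by (simp add: continuous_action_def)

end

section \<open>The semi-direct product\<close>

lemma sqs_reindex: "bij_betw \<tau> A B \<Longrightarrow> sqs B f \<longleftrightarrow> sqs A (\<lambda>a. f (\<tau> a))"
  unfolding sqs_def by (rule summable_on_reindex_bij_betw[symmetric])

lemma en_reindex: "bij_betw \<tau> A B \<Longrightarrow> en B f = en A (\<lambda>a. f (\<tau> a))"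
  unfolding en_def by (simp add: infsum_reindex_bij_betw[of \<tau> A B "\<lambda>b. (cmod (f b))\<^sup>2"])

context etale
begin

abbreviation S where "S \<equiv> semidirect H"

lemma sd_simps [simp]:
  "gtop S = subtopology (prod_topology (beta_r H) X) {(z, g). r_beta H z = r g}"
  "grng S (z, g) = (z, r g)" "gsrc S (z, g) = (beta_act H (inv g) z, s g)"
  "gmul S (z, g) (z', g') = (z, g \<cdot> g')" "ginv S (z, g) = (beta_act H (inv g) z, inv g)"
  by (simp_all add: semidirect_def)

lemma sd_arrows: "p \<in> arrows S \<longleftrightarrow> fst p \<in> chars \<and> snd p \<in> arrows H \<and> r_beta H (fst p) = r (snd p)"
  by (cases p) (auto simp: arrows_def[of S])

lemma sd_source:
  assumes "z \<in> chars" "g \<in> arrows H" "r_beta H z = r g"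
  shows "beta_act H (inv g) z \<in> chars" "r_beta H (beta_act H (inv g) z) = s g"
    "beta_act H g (beta_act H (inv g) z) = z" "beta_act H (s g) (beta_act H (inv g) z) = beta_act H (inv g) z"
    "beta_act H (r g) z = z"
proof -
  show *: "beta_act H (inv g) z \<in> chars" "r_beta H (beta_act H (inv g) z) = s g"
    using beta_act[of "inv g" z] assms by auto
  show "beta_act H (r g) z = z"
    using beta_act_unit[OF assms(1)] assms(3) by simp
  then show "beta_act H g (beta_act H (inv g) z) = z"
    using beta_act_mul[of g "inv g" z] assms by simp
  show "beta_act H (s g) (beta_act H (inv g) z) = beta_act H (inv g) z"
    using beta_act_unit[OF *(1)] *(2) by simp
qed

lemma sd_groupoid: "is_groupoid S"
  unfolding is_groupoid_def
proof (intro conjI ballI impI)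
  fix p assume p: "p \<in> arrows S"
  obtain z g where zg: "p = (z, g)" by (cases p)
  have g: "z \<in> chars" "g \<in> arrows H" "r_beta H z = r g"
    using p zg by (auto simp: sd_arrows)
  note src = sd_source[OF g]
  show "grng S p \<in> arrows S" "gsrc S p \<in> arrows S" "ginv S p \<in> arrows S"
    using g src by (simp_all add: zg sd_arrows)
  show "grng S (grng S p) = grng S p" "gsrc S (grng S p) = grng S p"
    "grng S (gsrc S p) = gsrc S p" "gsrc S (gsrc S p) = gsrc S p"
    using g src by (simp_all add: zg)
  show "gmul S (grng S p) p = p" "gmul S p (gsrc S p) = p"
    using g by (simp_all add: zg)
  show "grng S (ginv S p) = gsrc S p" "gsrc S (ginv S p) = grng S p"
    "gmul S p (ginv S p) = grng S p" "gmul S (ginv S p) p = gsrc S p"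
    using g src by (simp_all add: zg)
next
  fix p q assume p: "p \<in> arrows S" and q: "q \<in> arrows S" and pq: "gsrc S p = grng S q"
  obtain z g where zg: "p = (z, g)" by (cases p)
  obtain w h where wh: "q = (w, h)" by (cases q)
  have g: "z \<in> chars" "g \<in> arrows H" "r_beta H z = r g" and h: "w \<in> chars" "h \<in> arrows H" "r_beta H w = r h"
    and gh: "s g = r h" "beta_act H (inv g) z = w"
    using p q pq zg wh by (auto simp: sd_arrows)
  show "gmul S p q \<in> arrows S" "grng S (gmul S p q) = grng S p"
    using g h gh by (simp_all add: zg wh sd_arrows)
  have "beta_act H (inv (g \<cdot> h)) z = beta_act H (inv h) (beta_act H (inv g) z)"
    using beta_act_mul[of "inv h" "inv g" z] inv_mul[of g h] g h gh by simp
  then show "gsrc S (gmul S p q) = gsrc S q"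
    using g h gh by (simp add: zg wh)
next
  fix p q t assume p: "p \<in> arrows S" and q: "q \<in> arrows S" and t: "t \<in> arrows S"
    and pq: "gsrc S p = grng S q" and qt: "gsrc S q = grng S t"
  then show "gmul S (gmul S p q) t = gmul S p (gmul S q t)"
    by (cases p; cases q; cases t) (simp add: sd_arrows mul_assoc)
qed

lemma sd_continuous_components:
  "continuous_map (gtop S) (beta_r H) fst" "continuous_map (gtop S) X snd"
  by (auto intro: continuous_map_from_subtopology continuous_map_fst continuous_map_snd)

lemma sd_continuous_into:
  assumes "continuous_map Y (beta_r H) a" "continuous_map Y X b" "\<And>y. y \<in> topspace Y \<Longrightarrow> r_beta H (a y) = r (b y)"
  shows "continuous_map Y (gtop S) (\<lambda>y. (a y, b y))"
  unfolding sd_simps using assms by (intro continuous_map_into_subtopology continuous_map_pairedI) auto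

lemma topspace_sd: "topspace (gtop S) = arrows S"
  by (simp only: arrows_def)

lemma sd_topological: "topological_groupoid S"
  unfolding topological_groupoid_def
proof (intro conjI sd_groupoid)
  let ?Y = "subtopology (prod_topology (gtop S) (gtop S)) {(p, q). gsrc S p = grng S q}"
  have p: "continuous_map ?Y (gtop S) fst" "continuous_map ?Y (gtop S) snd"
    by (intro continuous_map_from_subtopology[of "prod_topology (gtop S) (gtop S)"] continuous_map_fst continuous_map_snd)+
  have c: "continuous_map ?Y (beta_r H) (\<lambda>pq. fst (fst pq))" "continuous_map ?Y X (\<lambda>pq. snd (fst pq))"
     "continuous_map ?Y X (\<lambda>pq. snd (snd pq))"
    using continuous_map_compose[OF p(1) sd_continuous_components(1)] continuous_map_compose[OF p(1) sd_continuous_components(2)]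
      continuous_map_compose[OF p(2) sd_continuous_components(2)] by (simp_all add: comp_def)
  have top: "fst pq \<in> arrows S \<and> snd pq \<in> arrows S \<and> gsrc S (fst pq) = grng S (snd pq)" if "pq \<in> topspace ?Y" for pq
    using that by (auto simp: topspace_sd[symmetric] simp del: sd_simps)
  have comp: "s (snd (fst pq)) = r (snd (snd pq)) \<and> snd (fst pq) \<in> arrows H \<and> snd (snd pq) \<in> arrows H \<and> r_beta H (fst (fst pq)) = r (snd (fst pq))"
    if "pq \<in> topspace ?Y" for pq
  proof -
    obtain z g w h where pq: "pq = ((z, g), (w, h))"
      by (metis surj_pair)
    show ?thesis
      using top[OF that] unfolding pq by (simp add: sd_arrows)
  qed
  have m: "continuous_map ?Y X (\<lambda>pq. snd (fst pq) \<cdot> snd (snd pq))"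
    by (rule continuous_mul[OF c(2,3)]) (use comp in blast)
  have "continuous_map ?Y (gtop S) (\<lambda>pq. (fst (fst pq), snd (fst pq) \<cdot> snd (snd pq)))"
    by (rule sd_continuous_into[OF c(1) m]) (use comp in simp)
  moreover have "(\<lambda>(p, q). gmul S p q) = (\<lambda>pq. (fst (fst pq), snd (fst pq) \<cdot> snd (snd pq)))"
    by (auto simp: fun_eq_iff semidirect_def)
  ultimately show "continuous_map ?Y (gtop S) (\<lambda>(p, q). gmul S p q)"
    by simp
  have i: "continuous_map (gtop S) X (\<lambda>p. inv (snd p))"
    by (rule continuous_inv'[OF sd_continuous_components(2)])
  have arr: "fst p \<in> chars \<and> snd p \<in> arrows H \<and> r_beta H (fst p) = r (snd p)" if "p \<in> topspace (gtop S)" for p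
    using that sd_arrows topspace_sd by blast
  have "continuous_map (gtop S) (beta_r H) (\<lambda>p. beta_act H (inv (snd p)) (fst p))"
    by (rule continuous_beta_act[OF i sd_continuous_components(1)]) (use arr in auto)
  then have "continuous_map (gtop S) (gtop S) (\<lambda>p. (beta_act H (inv (snd p)) (fst p), inv (snd p)))"
  proof (rule sd_continuous_into[OF _ i])
    show "r_beta H (beta_act H (inv (snd p)) (fst p)) = r (inv (snd p))" if "p \<in> topspace (gtop S)" for p
      using arr[OF that] sd_source(2) by simp
  qed
  moreover have "ginv S = (\<lambda>p. (beta_act H (inv (snd p)) (fst p), inv (snd p)))"
    by (auto simp: fun_eq_iff semidirect_def)
  ultimately show "continuous_map (gtop S) (gtop S) (ginv S)"
    by simp
qed

lemma sd_Hausdorff: "Hausdorff_space (gtop S)"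
  unfolding sd_simps
  by (intro Hausdorff_space_subtopology) (simp add: Hausdorff_space_prod_topology Hausdorff_beta Hausdorff)

text \<open>The equalizer of two continuous maps into a Hausdorff space; local compactness and
  compact sets are inherited from the product.\<close>

lemma sd_closed: "closedin (prod_topology (beta_r H) X) (arrows S)"
proof -
  let ?P = "prod_topology (beta_r H) X"
  have "continuous_map ?P X (\<lambda>p. r_beta H (fst p))" "continuous_map ?P X (\<lambda>p. r (snd p))"
    using continuous_map_compose[OF continuous_map_fst continuous_r_beta'] continuous_range'[OF continuous_map_snd]
    by (auto simp: comp_def)
  then have "closedin ?P {p \<in> topspace ?P. r_beta H (fst p) = r (snd p)}"
    by (rule closedin_continuous_maps_eq[OF Hausdorff])
  moreover have "{p \<in> topspace ?P. r_beta H (fst p) = r (snd p)} = arrows S"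
    by (auto simp: sd_arrows)
  ultimately show ?thesis by simp
qed

lemma gtop_sd: "gtop S = subtopology (prod_topology (beta_r H) X) (arrows S)"
proof -
  have "topspace (prod_topology (beta_r H) X) \<inter> {(z, g). r_beta H z = r g} = arrows S"
    by (auto simp: sd_arrows)
  then show ?thesis
    using subtopology_restrict[of "prod_topology (beta_r H) X" "{(z, g). r_beta H z = r g}"] by simp
qed

lemma sd_locally_compact: "locally_compact_space (gtop S)"
  unfolding gtop_sd
  by (rule locally_compact_space_closed_subset[OF _ sd_closed])
    (simp add: locally_compact_space_prod_topology locally_compact_beta locally_compact)

lemma sd_unit: "p \<in> units S \<longleftrightarrow> (\<exists>z\<in>chars. p = (z, r_beta H z))"
proof
  assume "p \<in> units S"
  then obtain q where "q \<in> arrows S" "p = grng S q"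
    by (auto simp: units_def)
  then show "\<exists>z\<in>chars. p = (z, r_beta H z)"
    by (cases q) (auto simp: sd_arrows)
next
  assume "\<exists>z\<in>chars. p = (z, r_beta H z)"
  then obtain z where z: "z \<in> chars" "p = (z, r_beta H z)" by blast
  have "(z, r_beta H z) \<in> arrows S" "p = grng S (z, r_beta H z)"
    using z r_beta_unit[OF z(1)] unit_arrow by (auto simp: sd_arrows)
  then show "p \<in> units S"
    unfolding units_def by blast
qed

text \<open>Over a bisection \<open>U\<close> the range map leaves the first component alone and is
  \<open>r\<close> on the second, so the section of \<open>r\<close> on \<open>U\<close> inverts
  it.\<close>

lemma sd_local_homeo: "local_homeomorphism (gtop S) (unit_space S) (grng S)"
  unfolding local_homeomorphism_def
proof
  fix p assume p: "p \<in> topspace (gtop S)"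
  have psnd: "snd p \<in> arrows H"
    using p unfolding topspace_sd sd_arrows by blast
  then obtain U where U: "bisection U" "snd p \<in> U"
    using bisection_neighbourhood[OF openin_topspace, of "snd p"] by auto
  let ?W = "{q \<in> topspace (gtop S). snd q \<in> U}"
  have W: "openin (gtop S) ?W"
    by (rule openin_continuous_map_preimage[OF sd_continuous_components(2) bisection_open[OF U(1)]])
  have us: "continuous_map (unit_space S) (gtop S) id"
    unfolding unit_space_def by (rule continuous_map_from_subtopology[OF continuous_map_id])
  have tus: "topspace (unit_space S) = units S"
  proof -
    have "grng S q \<in> arrows S" if "q \<in> arrows S" for q
      using sd_groupoid that unfolding is_groupoid_def by blast
    then show ?thesis
      unfolding unit_space_def topspace_subtopology topspace_sd units_def by blast
  qed
  have us2: "continuous_map (unit_space S) (beta_r H) fst" "continuous_map (unit_space S) X snd"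
    using continuous_map_compose[OF us sd_continuous_components(1)] continuous_map_compose[OF us sd_continuous_components(2)]
    by simp_all
  have img: "grng S ` ?W = {q \<in> topspace (unit_space S). snd q \<in> r ` U}"
  proof (intro set_eqI iffI)
    fix q assume "q \<in> grng S ` ?W"
    then obtain t where t: "t \<in> arrows S" "snd t \<in> U" "q = grng S t"
      unfolding topspace_sd by blast
    then have "q \<in> units S"
      unfolding units_def by blast
    moreover have "snd q \<in> r ` U"
      using t by (cases t) auto
    ultimately show "q \<in> {q \<in> topspace (unit_space S). snd q \<in> r ` U}"
      unfolding tus by blast
  next
    fix q assume "q \<in> {q \<in> topspace (unit_space S). snd q \<in> r ` U}"
    then obtain z where z: "z \<in> chars" "q = (z, r_beta H z)" and "r_beta H z \<in> r ` U"
      unfolding tus sd_unit by auto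
    then obtain u where u: "u \<in> U" "r_beta H z = r u" by blast
    have "(z, u) \<in> ?W" "q = grng S (z, u)"
      using u z bisection_arrow[OF U(1) u(1)] unfolding topspace_sd by (simp_all add: sd_arrows)
    then show "q \<in> grng S ` ?W"
      by blast
  qed
  have open_img: "openin (unit_space S) (grng S ` ?W)"
    unfolding img by (rule bisection_section_compose(1)[OF U(1) disjI1[OF refl] us2(2)])
  let ?i = "\<lambda>q. (fst q, inv_into U r (snd q))"
  have eqr: "grng S = (\<lambda>q. (fst q, r (snd q)))"
    by (auto simp: fun_eq_iff semidirect_def)
  have "homeomorphic_maps (subtopology (gtop S) ?W) (subtopology (unit_space S) (grng S ` ?W)) (grng S) ?i"
    unfolding homeomorphic_maps_def
  proof (intro conjI ballI)
    have "continuous_map (gtop S) (gtop S) (grng S)"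
      unfolding eqr
      by (rule sd_continuous_into[OF sd_continuous_components(1) continuous_range'[OF sd_continuous_components(2)]])
        (auto simp: sd_arrows topspace_sd simp del: sd_simps)
    moreover have "grng S q \<in> units S" if "q \<in> topspace (gtop S)" for q
      using that unfolding topspace_sd units_def by blast
    ultimately have "continuous_map (gtop S) (unit_space S) (grng S)"
      unfolding unit_space_def by (intro continuous_map_into_subtopology) auto
    then show "continuous_map (subtopology (gtop S) ?W) (subtopology (unit_space S) (grng S ` ?W)) (grng S)"
      by (intro continuous_map_into_subtopology continuous_map_from_subtopology[of "gtop S"]) auto
    let ?V = "subtopology (unit_space S) (grng S ` ?W)"
    have V: "\<exists>z u. q = (z, r u) \<and> z \<in> chars \<and> r_beta H z = r u \<and> u \<in> U" if "q \<in> topspace ?V" for q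
    proof -
      have "q \<in> topspace (unit_space S)" "snd q \<in> r ` U"
        using that unfolding img topspace_subtopology by blast+
      then show ?thesis
        unfolding tus sd_unit by auto
    qed
    have c1: "continuous_map ?V (beta_r H) fst"
      by (rule continuous_map_from_subtopology[OF us2(1)])
    have c2: "continuous_map ?V X (\<lambda>q. inv_into U r (snd q))"
      unfolding img by (rule bisection_section_compose(2)[OF U(1) disjI1[OF refl] us2(2)])
    have "continuous_map ?V (gtop S) ?i"
    proof (rule sd_continuous_into[OF c1 c2])
      fix q assume "q \<in> topspace ?V"
      then obtain z u where "q = (z, r u)" "r_beta H z = r u" "u \<in> U"
        using V by blast
      then show "r_beta H (fst q) = r (inv_into U r (snd q))"
        using bisection_range_section_eq[OF U(1)] by simp
    qed
    then show "continuous_map ?V (subtopology (gtop S) ?W) ?i"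
    proof (rule continuous_map_into_subtopology, intro Pi_I)
      fix q assume "q \<in> topspace ?V"
      then obtain z u where q: "q = (z, r u)" "z \<in> chars" "r_beta H z = r u" "u \<in> U"
        using V by blast
      then show "?i q \<in> ?W"
        using bisection_range_section_eq[OF U(1) q(4)] bisection_arrow[OF U(1) q(4)]
        unfolding topspace_sd by (simp add: sd_arrows)
    qed
    show "?i (grng S q) = q" if "q \<in> topspace (subtopology (gtop S) ?W)" for q
    proof -
      have "snd q \<in> U"
        using that by simp
      then show ?thesis
        using bisection_range_section_eq[OF U(1)] by (simp add: eqr)
    qed
    show "grng S (?i q) = q" if "q \<in> topspace ?V" for q
      using V[OF that] bisection_range_section_eq[OF U(1)] by auto
  qed
  then have "homeomorphic_map (subtopology (gtop S) ?W) (subtopology (unit_space S) (grng S ` ?W)) (grng S)"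
    unfolding homeomorphic_map_maps by blast
  moreover have "p \<in> ?W"
    using p U(2) by blast
  ultimately show "\<exists>U. openin (gtop S) U \<and> p \<in> U \<and> openin (unit_space S) (grng S ` U) \<and>
      homeomorphic_map (subtopology (gtop S) U) (subtopology (unit_space S) (grng S ` U)) (grng S)"
    using W open_img by blast
qed

lemma semidirect_etale: "etale S"
  by unfold_locales
    (simp only: lc_etale_groupoid_def sd_topological sd_locally_compact sd_Hausdorff sd_local_homeo simp_thms)

declare sd_simps(1) [simp del]

end

section \<open>The two Hilbert modules\<close>

context etale
begin

lemma star_algebra_diff:
  assumes B: "star_algebra B" and "R \<in> B" "T \<in> B"
  shows "(\<lambda>\<xi> g. R \<xi> g - T \<xi> g) \<in> B"
proof -
  have add: "\<And>R T. R \<in> B \<Longrightarrow> T \<in> B \<Longrightarrow> (\<lambda>\<xi> g. R \<xi> g + T \<xi> g) \<in> B"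
    and scale: "\<And>T. T \<in> B \<Longrightarrow> (\<lambda>\<xi> g. - 1 * T \<xi> g) \<in> B"
    using B by (simp_all only: star_algebra_def)
  show ?thesis
    using add[OF assms(2) scale[OF assms(3)]] by simp
qed

interpretation sd: etale S
  by (rule semidirect_etale)

definition iota_fun :: "('a \<Rightarrow> complex) \<Rightarrow> 'a beta_pt \<times> 'a \<Rightarrow> complex" where
  "iota_fun \<xi> p = (if p \<in> arrows S then \<xi> (snd p) else 0)"

text \<open>The arrow with range \<open>beta_emb H g\<close>, seen as a unit, and source
  \<open>diag (s g)\<close>. It carries source fibres to source fibres but does not respect ranges,
  so it is no groupoid morphism.\<close>

definition diag :: "'a \<Rightarrow> 'a beta_pt \<times> 'a" where
  "diag g = (beta_emb H g, g)"

definition kappa_fun :: "('a beta_pt \<times> 'a \<Rightarrow> complex) \<Rightarrow> 'a \<Rightarrow> complex" where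
  "kappa_fun \<eta> g = (if g \<in> arrows H then \<eta> (diag g) else 0)"

lemma iota_eq: "iota H \<xi> = (if \<xi> \<in> L2 H then iota_fun \<xi> else (\<lambda>_. 0))"
  by (auto simp: iota_def on_L2_def iota_fun_def fun_eq_iff)

lemma kappa_eq: "kappa H \<eta> = (if \<eta> \<in> L2 S then kappa_fun \<eta> else (\<lambda>_. 0))"
  by (auto simp: kappa_def on_L2_def kappa_fun_def diag_def fun_eq_iff)

text \<open>Bounding the second component confines the first to the preimage of a compact set of
  units, which is compact as \<open>r_beta\<close> is proper. Compact supports therefore need
  control of the second component only.\<close>

lemma sd_compact:
  assumes K: "compactin X K"
  shows "compactin (gtop S) {p \<in> arrows S. snd p \<in> K}"
proof -
  let ?C = "{z \<in> chars. r_beta H z \<in> r ` K}"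
  let ?P = "prod_topology (beta_r H) X"
  have "compactin (beta_r H) ?C"
    by (rule r_beta_proper[OF image_compactin[OF K continuous_range]])
  then have "compactin ?P (?C \<times> K)"
    using K by (simp add: compactin_Times)
  then have "compactin ?P (arrows S \<inter> (?C \<times> K))"
    by (rule closed_Int_compactin[OF sd_closed])
  moreover have "arrows S \<inter> (?C \<times> K) = {p \<in> arrows S. snd p \<in> K}"
    by (auto simp: sd_arrows)
  ultimately show ?thesis
    unfolding gtop_sd compactin_subtopology by auto
qed

lemma sd_Cc:
  assumes "continuous_map (gtop S) euclidean f" "\<And>p. p \<notin> arrows S \<Longrightarrow> f p = 0"
    "compactin X K" "\<And>p. p \<in> arrows S \<Longrightarrow> f p \<noteq> 0 \<Longrightarrow> snd p \<in> K"
  shows "f \<in> Cc (gtop S)"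
  by (rule CcI(1)[OF assms(1) _ sd.Hausdorff sd_compact[OF assms(3)]]) (use assms in auto)

lemma iota_Cc:
  assumes \<xi>: "\<xi> \<in> Cc X"
  shows "iota_fun \<xi> \<in> Cc (gtop S)"
proof (rule sd_Cc[OF _ _ Cc_compact[OF \<xi>]])
  have "continuous_map (gtop S) euclidean (\<lambda>p. \<xi> (snd p))"
    using continuous_map_compose[OF sd_continuous_components(2) Cc_continuous[OF \<xi>]] by (simp add: comp_def)
  then show "continuous_map (gtop S) euclidean (iota_fun \<xi>)"
    by (rule continuous_map_eq) (simp add: iota_fun_def)
qed (auto simp: iota_fun_def Cc_supp[OF \<xi>])

text \<open>An arrow with source \<open>z\<close> and second component \<open>g\<close> must have
  range \<open>g z\<close>, so the fibre over \<open>z\<close> is a copy of the fibre over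
  \<open>r_beta H z\<close>.\<close>

lemma fibre_bij:
  assumes z: "z \<in> chars"
  shows "bij_betw (\<lambda>g. (beta_act H g z, g)) (fibre H (r_beta H z)) (fibre S (z, r_beta H z))"
proof (rule bij_betwI[where g = snd])
  show "(\<lambda>g. (beta_act H g z, g)) \<in> fibre H (r_beta H z) \<rightarrow> fibre S (z, r_beta H z)"
  proof
    fix g assume "g \<in> fibre H (r_beta H z)"
    then have g: "g \<in> arrows H" "s g = r_beta H z"
      by (auto simp: fibre_iff)
    have "beta_act H (inv g) (beta_act H g z) = z"
      using beta_act_mul[of "inv g" g z] g z beta_act_unit[OF z] by simp
    then show "(beta_act H g z, g) \<in> fibre S (z, r_beta H z)"
      using beta_act[OF g(1) z g(2)] g by (simp add: sd.fibre_iff sd_arrows)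
  qed
  show "snd \<in> fibre S (z, r_beta H z) \<rightarrow> fibre H (r_beta H z)"
    by (auto simp: sd.fibre_iff fibre_iff sd_arrows)
  show "(beta_act H (snd p) z, snd p) = p" if "p \<in> fibre S (z, r_beta H z)" for p
    using that sd_source(3)[of "fst p" "snd p"] by (cases p) (auto simp: sd.fibre_iff sd_arrows)
qed simp

lemma iota_nrm:
  assumes "\<And>x. sqs (fibre H x) \<xi>"
  shows "sqs (fibre S p) (iota_fun \<xi>)" "sd.nrm p (iota_fun \<xi>) \<le> nrm (snd p) \<xi>"
proof -
  have "sqs (fibre S p) (iota_fun \<xi>) \<and> sd.nrm p (iota_fun \<xi>) \<le> nrm (snd p) \<xi>"
  proof (cases "p \<in> units S")
    case True
    then obtain z where z: "z \<in> chars" "p = (z, r_beta H z)"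
      unfolding sd_unit by blast
    have val: "iota_fun \<xi> (beta_act H g z, g) = \<xi> g" if "g \<in> fibre H (r_beta H z)" for g
    proof -
      have "(beta_act H g z, g) \<in> fibre S (z, r_beta H z)"
        using bij_betw_apply[OF fibre_bij[OF z(1)] that] .
      then show ?thesis
        by (simp add: iota_fun_def sd.fibre_iff)
    qed
    have "sqs (fibre S p) (iota_fun \<xi>)"
      unfolding z(2) sqs_reindex[OF fibre_bij[OF z(1)]]
      by (rule sqs_cong[THEN iffD2, OF _ assms]) (rule val)
    moreover have "sd.nrm p (iota_fun \<xi>) = nrm (snd p) \<xi>"
      unfolding z(2) en_reindex[OF fibre_bij[OF z(1)]] snd_conv by (rule en_cong[OF val])
    ultimately show ?thesis by simp
  qed simp
  then show "sqs (fibre S p) (iota_fun \<xi>)" "sd.nrm p (iota_fun \<xi>) \<le> nrm (snd p) \<xi>"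
    by auto
qed

lemma iota_fun_diff: "iota_fun (\<lambda>g. \<xi> g - \<eta> g) = (\<lambda>p. iota_fun \<xi> p - iota_fun \<eta> p)"
  by (auto simp: iota_fun_def)

lemma iota_L2:
  assumes "\<xi> \<in> L2 H"
  shows "iota_fun \<xi> \<in> L2 S"
proof (rule sd.L2_closed)
  fix \<epsilon> :: real assume "\<epsilon> > 0"
  then obtain \<eta> where \<eta>: "\<eta> \<in> Cc X" "\<And>x. sqs (fibre H x) (\<lambda>g. \<xi> g - \<eta> g)" "\<And>x. nrm x (\<lambda>g. \<xi> g - \<eta> g) \<le> \<epsilon>"
    using L2_approx[OF assms] by metis
  have "sqs (fibre S p) (\<lambda>q. iota_fun \<xi> q - iota_fun \<eta> q) \<and> sd.nrm p (\<lambda>q. iota_fun \<xi> q - iota_fun \<eta> q) \<le> \<epsilon>" for p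
    using iota_nrm[OF \<eta>(2), of p] \<eta>(3)[of "snd p"] by (simp add: iota_fun_diff)
  then show "\<exists>\<eta>\<in>L2 S. \<forall>p. sqs (fibre S p) (\<lambda>q. iota_fun \<xi> q - \<eta> q) \<and> sd.nrm p (\<lambda>q. iota_fun \<xi> q - \<eta> q) \<le> \<epsilon>"
    using sd.Cc_in_L2[OF iota_Cc[OF \<eta>(1)]] by blast
qed (simp add: iota_fun_def)

lemma continuous_diag: "continuous_map X (gtop S) diag"
  unfolding diag_def[abs_def]
  by (rule sd_continuous_into[OF continuous_emb continuous_map_id[unfolded id_def]]) (simp add: r_beta_emb)

lemma diag_arrow: "g \<in> arrows H \<Longrightarrow> diag g \<in> arrows S"
  by (simp add: diag_def sd_arrows emb_character r_beta_emb)

lemma diag_source: "g \<in> arrows H \<Longrightarrow> gsrc S (diag g) = diag (s g)"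
  by (simp add: diag_def beta_act_emb)

lemma diag_division:
  assumes "g \<in> arrows H" "a \<in> fibre H (s g)"
  shows "gmul S (diag g) (ginv S (diag a)) = (beta_emb H g, g \<cdot> inv a)"
  by (simp add: diag_def)

lemma diag_bij: "bij_betw diag (fibre H x) (fibre S (diag x))"
proof (cases "x \<in> units H")
  case True
  note x = unit_arrow[OF True]
  have "bij_betw (\<lambda>g. (beta_act H g (beta_emb H x), g)) (fibre H x) (fibre S (diag x))"
    using fibre_bij[OF emb_character[OF x]] True by (simp add: r_beta_emb[OF x] diag_def)
  moreover have "(beta_act H g (beta_emb H x), g) = diag g" if "g \<in> fibre H x" for g
  proof -
    have "g \<in> arrows H" "s g = r x" "g \<cdot> x = g"
      using that True by (auto simp: fibre_iff)
    then show ?thesis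
      by (simp add: beta_act_emb[OF _ x] diag_def)
  qed
  ultimately show ?thesis
    using bij_betw_cong by (metis (no_types, lifting))
next
  case False
  have "diag x \<notin> units S"
  proof
    assume "diag x \<in> units S"
    then obtain z where "z \<in> chars" "x = r_beta H z"
      unfolding sd_unit diag_def by blast
    then show False
      using False r_beta_unit by blast
  qed
  then show ?thesis
    using False by (simp add: fibre_non_unit sd.fibre_non_unit bij_betw_def)
qed

lemma kappa_on_fibre: "g \<in> fibre H x \<Longrightarrow> kappa_fun \<eta> g = \<eta> (diag g)"
  by (simp add: kappa_fun_def fibre_iff)

lemma kappa_nrm: "nrm x (kappa_fun \<eta>) = sd.nrm (diag x) \<eta>"
  and kappa_sqs: "sqs (fibre H x) (kappa_fun \<eta>) \<longleftrightarrow> sqs (fibre S (diag x)) \<eta>"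
  unfolding en_reindex[OF diag_bij] sqs_reindex[OF diag_bij]
  by (rule en_cong, simp add: kappa_on_fibre, rule sqs_cong, simp add: kappa_on_fibre)

lemma kappa_inner: "l2inner H (kappa_fun \<eta>) (kappa_fun \<zeta>) x = l2inner S \<eta> \<zeta> (diag x)"
proof -
  have "l2inner S \<eta> \<zeta> (diag x) = (\<Sum>\<^sub>\<infinity>g\<in>fibre H x. cnj (\<eta> (diag g)) * \<zeta> (diag g))"
    unfolding l2inner_def by (rule infsum_reindex_bij_betw[OF diag_bij, symmetric])
  also have "\<dots> = l2inner H (kappa_fun \<eta>) (kappa_fun \<zeta>) x"
    unfolding l2inner_def by (rule infsum_cong) (simp add: kappa_on_fibre)
  finally show ?thesis ..
qed

lemma kappa_Cc:
  assumes \<eta>: "\<eta> \<in> Cc (gtop S)"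
  shows "kappa_fun \<eta> \<in> Cc X"
proof (rule CcI(1)[OF _ _ Hausdorff])
  have "continuous_map X euclidean (\<lambda>g. \<eta> (diag g))"
    using continuous_map_compose[OF continuous_diag Cc_continuous[OF \<eta>]] by (simp add: comp_def)
  then show "continuous_map X euclidean (kappa_fun \<eta>)"
    by (rule continuous_map_eq) (simp add: kappa_fun_def)
  show "compactin X (snd ` supp_on (gtop S) \<eta>)"
    by (rule image_compactin[OF Cc_compact[OF \<eta>] sd_continuous_components(2)])
  show "g \<in> snd ` supp_on (gtop S) \<eta>" if "kappa_fun \<eta> g \<noteq> 0" for g
  proof -
    have "diag g \<in> supp_on (gtop S) \<eta>"
      using that Cc_supp[OF \<eta>] by (auto simp: kappa_fun_def split: if_splits)
    then show ?thesis
      by (intro image_eqI[of _ _ "diag g"]) (simp_all add: diag_def)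
  qed
qed (simp add: kappa_fun_def)

lemma kappa_fun_diff: "kappa_fun (\<lambda>q. \<eta> q - \<zeta> q) = (\<lambda>g. kappa_fun \<eta> g - kappa_fun \<zeta> g)"
  by (auto simp: kappa_fun_def)

lemma kappa_L2:
  assumes "\<eta> \<in> L2 S"
  shows "kappa_fun \<eta> \<in> L2 H"
proof (rule L2_closed)
  fix \<epsilon> :: real assume "\<epsilon> > 0"
  then obtain \<zeta> where \<zeta>: "\<zeta> \<in> Cc (gtop S)" "\<And>p. sqs (fibre S p) (\<lambda>q. \<eta> q - \<zeta> q)" "\<And>p. sd.nrm p (\<lambda>q. \<eta> q - \<zeta> q) \<le> \<epsilon>"
    by (rule sd.L2_approx[OF assms]) (rule that)
  have "sqs (fibre H x) (\<lambda>g. kappa_fun \<eta> g - kappa_fun \<zeta> g) \<and> nrm x (\<lambda>g. kappa_fun \<eta> g - kappa_fun \<zeta> g) \<le> \<epsilon>" for x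
    using kappa_nrm[of x "\<lambda>q. \<eta> q - \<zeta> q"] kappa_sqs[of x "\<lambda>q. \<eta> q - \<zeta> q"] \<zeta>(2,3) by (simp add: kappa_fun_diff)
  then show "\<exists>\<zeta>\<in>L2 H. \<forall>x. sqs (fibre H x) (\<lambda>g. kappa_fun \<eta> g - \<zeta> g) \<and> nrm x (\<lambda>g. kappa_fun \<eta> g - \<zeta> g) \<le> \<epsilon>"
    using Cc_in_L2[OF kappa_Cc[OF \<zeta>(1)]] by blast
qed (simp add: kappa_fun_def)

lemma kappa_iota:
  assumes "\<xi> \<in> L2 H"
  shows "kappa_fun (iota_fun \<xi>) = \<xi>"
proof
  fix g
  show "kappa_fun (iota_fun \<xi>) g = \<xi> g"
  proof (cases "g \<in> arrows H")
    case True
    then show ?thesis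
      unfolding kappa_fun_def iota_fun_def by (simp only: diag_arrow if_True) (simp only: diag_def snd_conv)
  qed (simp add: kappa_fun_def L2_zero_outside[OF assms])
qed

lemma iota_kappa:
  assumes "p \<in> fibre S (diag x)"
  shows "iota_fun (kappa_fun \<eta>) p = \<eta> p"
proof -
  obtain g where g: "g \<in> fibre H x" "p = diag g"
    using assms bij_betw_imp_surj_on[OF diag_bij[of x]] by blast
  have "diag g \<in> arrows S" "snd (diag g) = g"
    using g(1) diag_arrow by (auto simp: fibre_iff) (simp add: diag_def)
  then show ?thesis
    unfolding g(2) by (simp add: iota_fun_def kappa_on_fibre[OF g(1)])
qed

section \<open>The homomorphism on equivariant operators\<close>

lemma Theta_eq:
  assumes T: "T \<in> adjointable S"
  shows "Theta H T \<xi> = (if \<xi> \<in> L2 H then kappa_fun (T (iota_fun \<xi>)) else (\<lambda>_. 0))"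
proof -
  have "kappa_fun (\<lambda>_. 0) = (\<lambda>_. 0)"
    by (auto simp: kappa_fun_def)
  then show ?thesis
    using sd.adjointable_zero_vector[OF T] sd.adjointable_L2[OF T iota_L2]
    by (auto simp: Theta_def iota_eq kappa_eq)
qed

text \<open>\<open>kappa_fun\<close> turns inner products at \<open>diag x\<close> into inner
  products at \<open>x\<close>, and \<open>iota_fun\<close> is a right inverse of it; the adjoint
  relation is read off at the points \<open>diag x\<close>.\<close>

lemma Theta_adjointable:
  assumes T: "T \<in> adjointable S"
  shows "Theta H T \<in> adjointable H" "adj H (Theta H T) = Theta H (adj S T)"
proof -
  note T' = sd.adj_adjointable[OF T]
  have L: "Theta H T \<xi> \<in> L2 H" "Theta H (adj S T) \<xi> \<in> L2 H" if "\<xi> \<in> L2 H" for \<xi>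
    using that by (simp_all add: Theta_eq T T' kappa_L2 sd.adjointable_L2 iota_L2)
  have inner: "l2inner H \<eta> (Theta H T \<xi>) x = l2inner H (Theta H (adj S T) \<eta>) \<xi> x" if "\<xi> \<in> L2 H" "\<eta> \<in> L2 H" for \<xi> \<eta> x
  proof -
    have "l2inner H \<eta> (Theta H T \<xi>) x = l2inner H (kappa_fun (iota_fun \<eta>)) (kappa_fun (T (iota_fun \<xi>))) x"
      using that by (simp add: Theta_eq T kappa_iota)
    also have "\<dots> = l2inner S (adj S T (iota_fun \<eta>)) (iota_fun \<xi>) (diag x)"
      unfolding kappa_inner by (rule sd.adj_inner[OF T iota_L2[OF that(1)] iota_L2[OF that(2)]])
    also have "\<dots> = l2inner H (Theta H (adj S T) \<eta>) \<xi> x"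
      using kappa_inner[of "adj S T (iota_fun \<eta>)" "iota_fun \<xi>" x] that by (simp add: Theta_eq T' kappa_iota)
    finally show ?thesis .
  qed
  show "Theta H T \<in> adjointable H" "adj H (Theta H T) = Theta H (adj S T)"
    using adjointableI[where T = "Theta H T" and S = "Theta H (adj S T)", OF L(1) _ L(2) _ inner]
    by (simp_all add: Theta_eq[OF T] Theta_eq[OF T'])
qed

lemma Theta_linear:
  assumes "R \<in> adjointable S" "T \<in> adjointable S"
  shows "Theta H (\<lambda>\<xi> g. R \<xi> g + T \<xi> g) = (\<lambda>\<xi> g. Theta H R \<xi> g + Theta H T \<xi> g)"
    "Theta H (\<lambda>\<xi> g. c * T \<xi> g) = (\<lambda>\<xi> g. c * Theta H T \<xi> g)"
  by (auto simp: fun_eq_iff Theta_eq assms sd.adjointable_add sd.adjointable_scale kappa_fun_def)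

text \<open>On the fibre over \<open>diag x\<close>, \<open>iota \<circ> kappa\<close> is the identity, and operators act fibrewise.\<close>

lemma operator_on_diag_fibre:
  assumes T: "T \<in> adjointable S" and \<eta>: "\<eta> \<in> L2 S" and p: "p \<in> fibre S (diag x)"
  shows "T (iota_fun (kappa_fun \<eta>)) p = T \<eta> p"
  by (rule sd.fibre_local[OF T iota_L2[OF kappa_L2[OF \<eta>]] \<eta> _ p]) (rule iota_kappa)

text \<open>The composite of \<open>kappa_fun\<close> followed by \<open>iota_fun\<close> is not the
  identity in general, but the outer \<open>kappa_fun\<close> reads only fibres over points
  \<open>diag x\<close>, where inserting it is invisible.\<close>

lemma Theta_comp:
  assumes R: "R \<in> adjointable S" and T: "T \<in> adjointable S"
  shows "Theta H (R \<circ> T) = Theta H R \<circ> Theta H T"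
proof
  fix \<xi>
  show "Theta H (R \<circ> T) \<xi> = (Theta H R \<circ> Theta H T) \<xi>"
  proof (cases "\<xi> \<in> L2 H")
    case True
    have L: "T (iota_fun \<xi>) \<in> L2 S"
      by (rule sd.adjointable_L2[OF T iota_L2[OF True]])
    have "kappa_fun (R (T (iota_fun \<xi>))) = kappa_fun (R (iota_fun (kappa_fun (T (iota_fun \<xi>)))))"
    proof
      fix g show "kappa_fun (R (T (iota_fun \<xi>))) g = kappa_fun (R (iota_fun (kappa_fun (T (iota_fun \<xi>))))) g"
        using operator_on_diag_fibre[OF R L, of "diag g" "s g"] diag_arrow[of g] diag_source[of g]
        by (simp add: kappa_fun_def sd.fibre_iff)
    qed
    then show ?thesis
      using True kappa_L2[OF L] by (simp add: Theta_eq sd.adjointable_comp(1)[OF R T] R T)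
  next
    case False
    then show ?thesis
      using adjointable_zero_vector[OF Theta_adjointable(1)[OF R]] by (simp add: Theta_eq sd.adjointable_comp(1)[OF R T] T)
  qed
qed

lemma Theta_near:
  assumes "R \<in> adjointable S" "T \<in> adjointable S" "sd.near R T c" "0 \<le> c"
  shows "near (Theta H R) (Theta H T) c"
  unfolding near_def
proof (intro ballI allI)
  fix \<xi> x assume \<xi>: "\<xi> \<in> L2 H"
  have "nrm x (\<lambda>g. Theta H R \<xi> g - Theta H T \<xi> g) = sd.nrm (diag x) (\<lambda>p. R (iota_fun \<xi>) p - T (iota_fun \<xi>) p)"
    using \<xi> kappa_nrm[of x "\<lambda>p. R (iota_fun \<xi>) p - T (iota_fun \<xi>) p"] by (simp add: Theta_eq assms kappa_fun_diff)
  also have "\<dots> \<le> c * sd.nrm (diag x) (iota_fun \<xi>)"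
    by (rule sd.nearD[OF assms(3) iota_L2[OF \<xi>]])
  also have "sd.nrm (diag x) (iota_fun \<xi>) = nrm x \<xi>"
    using kappa_nrm[of x "iota_fun \<xi>"] kappa_iota[OF \<xi>] by simp
  finally show "nrm x (\<lambda>g. Theta H R \<xi> g - Theta H T \<xi> g) \<le> c * nrm x \<xi>" .
qed

text \<open>By equivariance, the fibre of \<open>T\<close> over \<open>beta_emb H g\<close> is unitarily equivalent to the one over the unit \<open>s g\<close>,
  which is the fibre of \<open>Theta H T\<close>; the points \<open>beta_emb H g\<close> are dense.\<close>

lemma Theta_bounded_below:
  assumes T: "T \<in> equivariant_ops S" and C: "0 \<le> C"
    and bound: "\<And>\<xi> x. \<xi> \<in> L2 H \<Longrightarrow> nrm x (Theta H T \<xi>) \<le> C * nrm x \<xi>"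
    and \<zeta>: "\<zeta> \<in> L2 S"
  shows "sd.nrm p (T \<zeta>) \<le> C * sd.nrm p \<zeta>"
proof (cases "p \<in> units S")
  case True
  have TA: "T \<in> adjointable S" and inv: "sd.invariant T"
    using T sd.equivariant_ops_iff by auto
  have at_diag: "sd.nrm (diag x) (T \<zeta>) \<le> C * sd.nrm (diag x) \<zeta>" if \<zeta>: "\<zeta> \<in> L2 S" for x \<zeta>
  proof -
    have "sd.nrm (diag x) (T \<zeta>) = sd.nrm (diag x) (T (iota_fun (kappa_fun \<zeta>)))"
      by (rule en_cong) (rule operator_on_diag_fibre[OF TA \<zeta>, symmetric])
    also have "\<dots> = nrm x (Theta H T (kappa_fun \<zeta>))"
      using kappa_L2[OF \<zeta>] by (simp add: Theta_eq TA kappa_nrm)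
    also have "\<dots> \<le> C * nrm x (kappa_fun \<zeta>)"
      by (rule bound[OF kappa_L2[OF \<zeta>]])
    finally show ?thesis
      by (simp add: kappa_nrm)
  qed
  have at_emb: "sd.nrm (beta_emb H g, r g) (T \<zeta>) \<le> C * sd.nrm (beta_emb H g, r g) \<zeta>" if g: "g \<in> arrows H" for g
  proof -
    note d = diag_arrow[OF g]
    have rg: "grng S (diag g) = (beta_emb H g, r g)"
      by (simp add: diag_def)
    \<comment> \<open>The vector is moved along the arrow \<open>diag g\<close>, from the fibre over
      its range \<open>(beta_emb H g, r g)\<close> to the fibre over its source
      \<open>diag (s g)\<close>, where the bound is known.\<close>
    let ?\<zeta>' = "sd.rho (sd.delta (diag g)) \<zeta>"
    have L: "?\<zeta>' \<in> L2 S"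
      by (rule sd.rho_L2[OF sd.delta(1)[OF d] \<zeta>])
    have pair: "?\<zeta>' (gmul S h (diag g)) = \<zeta> h" if "h \<in> fibre S (grng S (diag g))" for h
      using sd.rho_delta[OF d sd.right_translation_fibre(1)[OF d that]] sd.right_translation_fibre(2)[OF d that] by simp
    have "sd.nrm (gsrc S (diag g)) ?\<zeta>' = sd.nrm (grng S (diag g)) \<zeta>"
      by (rule sd.nrm_translate[OF d \<zeta> L pair])
    moreover have "sd.nrm (gsrc S (diag g)) (T ?\<zeta>') = sd.nrm (grng S (diag g)) (T \<zeta>)"
      by (rule sd.nrm_translate[OF d sd.adjointable_L2[OF TA \<zeta>] sd.adjointable_L2[OF TA L]])
        (rule sd.invariantD[OF inv d \<zeta> L pair])
    ultimately show ?thesis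
      using at_diag[OF L, of "s g"] unfolding rg diag_source[OF g] by simp
  qed
  obtain z where z: "z \<in> chars" "p = (z, r_beta H z)"
    using True unfolding sd_unit by blast
  have unit: "continuous_map (beta_r H) (gtop S) (\<lambda>z. (z, r_beta H z))"
    by (rule sd_continuous_into[OF continuous_map_id[unfolded id_def] continuous_r_beta']) (simp add: r_beta_unit)
  let ?f = "\<lambda>z. sd.nrm (z, r_beta H z) (T \<zeta>) - C * sd.nrm (z, r_beta H z) \<zeta>"
  have "continuous_map (beta_r H) euclidean (\<lambda>z. sd.nrm (z, r_beta H z) \<eta>)" if "\<eta> \<in> L2 S" for \<eta>
    using continuous_map_compose[OF unit sd.continuous_nrm[OF that]] by (simp add: comp_def)
  then have "continuous_map (beta_r H) euclidean ?f"
    using \<zeta> sd.adjointable_L2[OF TA \<zeta>] by (intro continuous_map_diff continuous_map_mult) auto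
  then have op: "openin (beta_r H) {z \<in> topspace (beta_r H). ?f z \<in> {0<..}}"
    by (rule openin_continuous_map_preimage) simp
  have "\<not> ?f z > 0"
  proof
    assume "?f z > 0"
    then have zW: "z \<in> {z \<in> topspace (beta_r H). ?f z \<in> {0<..}}"
      using z(1) by simp
    obtain g where "g \<in> arrows H" "?f (beta_emb H g) > 0"
      by (rule beta_dense_open[OF op zW]) auto
    then show False
      using at_emb[of g] by (simp add: r_beta_emb)
  qed
  then show ?thesis
    by (simp add: z(2))
qed simp

text \<open>The bound from below is applied to the difference, which is again equivariant.
  Injectivity and the transfer of Cauchy sequences back along \<open>Theta\<close> both use this
  form of isometry.\<close>

lemma Theta_near_iff:
  assumes "R \<in> equivariant_ops S" "T \<in> equivariant_ops S" "0 \<le> c"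
  shows "near (Theta H R) (Theta H T) c \<longleftrightarrow> sd.near R T c"
proof
  have RT: "R \<in> adjointable S" "T \<in> adjointable S"
    using assms sd.equivariant_ops_adjointable by auto
  show "near (Theta H R) (Theta H T) c" if "sd.near R T c"
    by (rule Theta_near[OF RT that assms(3)])
  assume near: "near (Theta H R) (Theta H T) c"
  let ?D = "\<lambda>\<xi> g. R \<xi> g - T \<xi> g"
  have D: "?D \<in> equivariant_ops S"
    by (rule sd.star_algebra_diff[OF sd.star_algebra_equivariant assms(1,2)])
  have "Theta H ?D \<xi> = (\<lambda>g. Theta H R \<xi> g - Theta H T \<xi> g)" for \<xi>
    using sd.adjointable_diff(1)[OF RT] by (auto simp: Theta_eq RT kappa_fun_diff)
  then have "sd.nrm p (?D \<zeta>) \<le> c * sd.nrm p \<zeta>" if "\<zeta> \<in> L2 S" for \<zeta> p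
    using nearD[OF near] by (intro Theta_bounded_below[OF D assms(3) _ that]) simp
  then show "sd.near R T c"
    by (simp add: sd.near_def)
qed

lemma Theta_inj: "inj_on (Theta H) (equivariant_ops S)"
proof (rule inj_onI)
  fix R T assume RT: "R \<in> equivariant_ops S" "T \<in> equivariant_ops S" and eq: "Theta H R = Theta H T"
  show "R = T"
  proof (rule sd.opnorm_zeroD)
    fix \<epsilon> :: real assume "\<epsilon> > 0"
    then show "sd.near R T \<epsilon>"
      using Theta_near_iff[OF RT, of \<epsilon>] eq by (simp add: near_def)
  qed (use RT sd.equivariant_ops_adjointable in auto)
qed

lemma Theta_cstar_mono:
  "cstar_mono S (equivariant_ops S) H (adjointable H) (Theta H)"
  unfolding cstar_mono_def star_hom_def
proof (intro conjI ballI allI Theta_inj)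
  show "cstar_subalgebra S (equivariant_ops S)"
    unfolding sd.cstar_subalgebra_iff using sd.star_algebra_equivariant sd.equivariant_closed by blast
  show "cstar_subalgebra H (adjointable H)"
    unfolding cstar_subalgebra_iff using star_algebra_adjointable op_closure_adjointable by blast
next
next
  fix T assume "T \<in> equivariant_ops S"
  then have T: "T \<in> adjointable S"
    by (rule sd.equivariant_ops_adjointable)
  show "Theta H T \<in> adjointable H" "Theta H (adj S T) = adj H (Theta H T)"
    using Theta_adjointable[OF T] by simp_all
  show "Theta H (\<lambda>\<xi> g. c * T \<xi> g) = (\<lambda>\<xi> g. c * Theta H T \<xi> g)" for c
    by (rule Theta_linear(2)[OF T T])
next
  fix R T assume "R \<in> equivariant_ops S" "T \<in> equivariant_ops S"
  then have RT: "R \<in> adjointable S" "T \<in> adjointable S"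
    by (auto intro: sd.equivariant_ops_adjointable)
  show "Theta H (\<lambda>\<xi> g. R \<xi> g + T \<xi> g) = (\<lambda>\<xi> g. Theta H R \<xi> g + Theta H T \<xi> g)"
    by (rule Theta_linear(1)[OF RT])
  show "Theta H (R \<circ> T) = Theta H R \<circ> Theta H T"
    by (rule Theta_comp[OF RT])
qed

end

section \<open>Compactly supported operators as convolution operators\<close>

context etale
begin

interpretation sd: etale S
  by (rule semidirect_etale)

lemma theta_eq:
  "theta H f \<xi> g = (if \<xi> \<in> L2 H \<and> g \<in> arrows H then
    \<Sum>\<^sub>\<infinity>a\<in>fibre H (s g). f (beta_emb H g, g \<cdot> inv a) * \<xi> a else 0)"
  by (simp add: theta_def on_L2_def)

text \<open>Along the fibre through \<open>diag g\<close> the quotient of \<open>diag g\<close> by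
  \<open>diag a\<close> is \<open>(beta_emb H g, g \<cdot> inv a)\<close>, the argument at which
  \<open>theta\<close> evaluates \<open>f\<close>.\<close>

lemma Theta_Lambda:
  assumes f: "f \<in> Cc (gtop S)"
  shows "Theta H (Lambda_op S f) = theta H f"
proof (intro ext)
  fix \<xi> g
  show "Theta H (Lambda_op S f) \<xi> g = theta H f \<xi> g"
  proof (cases "\<xi> \<in> L2 H \<and> g \<in> arrows H")
    case True
    then have \<xi>: "\<xi> \<in> L2 H" and g: "g \<in> arrows H" by auto
    have "Theta H (Lambda_op S f) \<xi> g = sd.conv f (iota_fun \<xi>) (diag g)"
      using \<xi> g iota_L2[OF \<xi>] by (simp add: Theta_eq[OF sd.Lambda_adjointable[OF f]] kappa_fun_def sd.Lambda_op_eq)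
    also have "\<dots> = (\<Sum>\<^sub>\<infinity>p\<in>fibre S (diag (s g)). f (gmul S (diag g) (ginv S p)) * iota_fun \<xi> p)"
      using diag_arrow[OF g] diag_source[OF g] by (simp add: sd.conv_def)
    also have "\<dots> = (\<Sum>\<^sub>\<infinity>a\<in>fibre H (s g). f (gmul S (diag g) (ginv S (diag a))) * iota_fun \<xi> (diag a))"
      by (rule infsum_reindex_bij_betw[OF diag_bij, symmetric])
    also have "\<dots> = (\<Sum>\<^sub>\<infinity>a\<in>fibre H (s g). f (beta_emb H g, g \<cdot> inv a) * \<xi> a)"
    proof (rule infsum_cong)
      fix a assume a: "a \<in> fibre H (s g)"
      have "iota_fun \<xi> (diag a) = \<xi> a"
        using kappa_on_fibre[OF a, of "iota_fun \<xi>"] kappa_iota[OF \<xi>] by simp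
      then show "f (gmul S (diag g) (ginv S (diag a))) * iota_fun \<xi> (diag a) = f (beta_emb H g, g \<cdot> inv a) * \<xi> a"
        by (simp only: diag_division[OF g a])
    qed
    also have "\<dots> = theta H f \<xi> g"
      using True by (simp add: theta_eq)
    finally show ?thesis .
  next
    case False
    then show ?thesis
      by (auto simp: theta_eq Theta_eq[OF sd.Lambda_adjointable[OF f]] kappa_fun_def)
  qed
qed

lemma coefficient_bound:
  assumes T: "T \<in> adjointable H" and g: "g \<in> arrows H" and h: "h \<in> fibre H (s g)"
  shows "cmod (T (delta h) g) \<le> opnorm H T"
proof -
  have h': "h \<in> arrows H" "s h = s g"
    using h by (auto simp: fibre_iff)
  have "cmod (T (delta h) g) \<le> nrm (s g) (T (delta h))"
    by (rule cmod_le_nrm[OF adjointable_L2[OF T delta_L2[OF h'(1)]] g])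
  also have "\<dots> \<le> opnorm H T * nrm (s g) (delta h)"
    by (rule opnorm_fibre[OF T delta_L2[OF h'(1)]])
  also have "nrm (s g) (delta h) = 1"
    using nrm_delta[OF h'(1)] h'(2) by simp
  finally show ?thesis by simp
qed

text \<open>Along a bisection, a continuous section \<open>y \<mapsto> k y\<close> of the fibres of \<open>s\<close> can locally be followed by a bump
  supported in a bisection, so the coefficients \<open>T (delta (k y)) y\<close> are locally quotients of the continuous functions
  \<open>T \<xi>\<close> and \<open>\<xi> \<circ> k\<close>.\<close>

lemma coefficient_continuous:
  assumes T: "T \<in> adjointable H" and A: "openin X A"
    and k: "continuous_map (subtopology X A) X k" "\<And>y. y \<in> A \<Longrightarrow> k y \<in> fibre H (s y)"
  shows "continuous_map (subtopology X A) euclidean (\<lambda>y. T (delta (k y)) y)"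
proof (rule continuous_map_transfer)
  let ?Y = "subtopology X A"
  fix y assume y: "y \<in> topspace ?Y"
  then have yA: "y \<in> A" "y \<in> arrows H" by auto
  have "k y \<in> topspace X"
    using k(2)[OF yA(1)] by (simp add: fibre_iff)
  then obtain \<xi> U where \<xi>: "\<xi> \<in> Cc X" "bisection U" "supp_on X \<xi> \<subseteq> U" "\<xi> (k y) = 1"
    using bump[OF openin_topspace, of "k y"] by metis
  note \<xi>L = Cc_in_L2[OF \<xi>(1)]
  let ?W = "{w \<in> topspace ?Y. k w \<in> {v \<in> topspace X. \<xi> v \<in> - {0}}}"
  have "openin X {v \<in> topspace X. \<xi> v \<in> - {0}}"
    using Cc_continuous[OF \<xi>(1)] by (rule openin_continuous_map_preimage) auto
  then have W: "openin ?Y ?W"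
    by (rule openin_continuous_map_preimage[OF k(1)])
  have yW: "y \<in> ?W"
    using y \<xi>(4) \<open>k y \<in> topspace X\<close> by simp
  have c1: "continuous_map (subtopology ?Y ?W) euclidean (T \<xi>)"
    by (intro continuous_map_from_subtopology L2_continuous adjointable_L2[OF T \<xi>L])
  have c2: "continuous_map (subtopology ?Y ?W) euclidean (\<lambda>w. \<xi> (k w))"
    by (rule continuous_map_from_subtopology[OF continuous_map_compose[OF k(1) Cc_continuous[OF \<xi>(1)], unfolded comp_def]])
  have c3: "continuous_map (subtopology ?Y ?W) euclidean (\<lambda>w. inverse (\<xi> (k w)))"
    by (rule continuous_map_inverse[OF c2]) auto
  have "T (delta (k w)) w = T \<xi> w * inverse (\<xi> (k w))" if w: "w \<in> ?W" for w
  proof -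
    have w': "w \<in> A" "w \<in> arrows H" "\<xi> (k w) \<noteq> 0"
      using w by auto
    have kw: "k w \<in> arrows H" "s (k w) = s w"
      using k(2)[OF w'(1)] by (auto simp: fibre_iff)
    have "\<xi> v = \<xi> (k w) * delta (k w) v" if v: "v \<in> fibre H (s w)" for v
    proof (cases "\<xi> v = 0")
      case True
      then have "v \<noteq> k w"
        using w'(3) by auto
      then show ?thesis
        using True delta(3)[OF kw(1), of v] v kw(2) by simp
    next
      case False
      then have "v \<in> U" "k w \<in> U"
        using Cc_supp[OF \<xi>(1)] w'(3) \<xi>(3) by blast+
      moreover have "s v = s (k w)"
        using v kw by (simp add: fibre_iff)
      moreover have "inj_on s U"
        using \<xi>(2) by (simp add: bisection_def)
      ultimately have "v = k w"
        using inj_onD by metis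
      then show ?thesis
        using delta(2)[OF kw(1)] by simp
    qed
    then have "T \<xi> w = T (\<lambda>v. \<xi> (k w) * delta (k w) v) w"
      using w'(2) by (intro fibre_local[OF T \<xi>L L2_scale[OF delta_L2[OF kw(1)]], of "s w"]) (auto simp: fibre_iff)
    also have "\<dots> = \<xi> (k w) * T (delta (k w)) w"
      using adjointable_linear(2)[OF T delta_L2[OF kw(1)] delta_L2[OF kw(1)]] by simp
    finally show ?thesis
      using w'(3) by simp
  qed
  then show "\<exists>W f. openin ?Y W \<and> y \<in> W \<and> continuous_map (subtopology ?Y W) euclidean f \<and>
      (\<forall>w\<in>W. T (delta (k w)) w = f w)"
    using W yW continuous_map_mult[OF c1 c3] by blast
qed

text \<open>On a bisection \<open>c\<close> is determined by \<open>r g\<close>, so the weighted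
  coefficient is a function of \<open>g\<close> alone. It is continuous, bounded by the operator
  norm, and vanishes unless \<open>r g\<close> lies in the compact range of the support of
  \<open>\<phi>\<close>.\<close>

lemma diagonal_coefficient:
  assumes T: "T \<in> adjointable H" and U: "bisection U" and \<phi>: "\<phi> \<in> Cc X" "supp_on X \<phi> \<subseteq> U"
  obtains F where "F \<in> C0r H"
    "\<And>g c. g \<in> arrows H \<Longrightarrow> c \<in> U \<Longrightarrow> r g = r c \<Longrightarrow> F g = \<phi> c * T (delta (inv c \<cdot> g)) g"
proof -
  let ?A = "{y \<in> topspace X. r y \<in> r ` U}"
  let ?u = "\<lambda>y. inv_into U r (r y)"
  let ?k = "\<lambda>y. inv (?u y) \<cdot> y"
  have A: "openin X ?A"
    by (rule bisection_section_compose(1)[OF U disjI1[OF refl] continuous_range])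
  have u: "?u y \<in> U" "r (?u y) = r y" "?u y \<in> arrows H" "y \<in> arrows H" if "y \<in> ?A" for y
    using that bisection_range_section[OF U, of "r y"] by auto
  have "continuous_map (subtopology X ?A) X (\<lambda>y. inv (?u y))"
    by (intro continuous_inv' bisection_section_compose(2)[OF U _ continuous_range]) simp
  then have kc: "continuous_map (subtopology X ?A) X ?k"
    using continuous_map_from_subtopology[OF continuous_map_id, of X ?A] bisection_range_section[OF U]
    by (intro continuous_mul) (auto simp: id_def)
  have kf: "?k y \<in> fibre H (s y)" if "y \<in> ?A" for y
    using u(2-4)[OF that] by (simp add: fibre_iff)
  \<comment> \<open>The inner case distinction forces the value 0 off the arrows, where
    \<open>r y\<close> is arbitrary.\<close>
  define F where "F y = (if r y \<in> r ` U then \<phi> (?u y) * (if y \<in> arrows H then T (delta (?k y)) y else 0) else 0)" for y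
  have "continuous_map (subtopology X ?A) euclidean (\<lambda>y. if y \<in> arrows H then T (delta (?k y)) y else 0)"
    by (rule continuous_map_eq[OF coefficient_continuous[OF T A kc kf]]) auto
  then have cont: "continuous_map X euclidean F"
    unfolding F_def[abs_def] by (rule bisection_extend[OF U disjI1[OF refl] continuous_range \<phi>])
  obtain B where B: "B \<ge> 0" "\<And>c. cmod (\<phi> c) \<le> B"
    using Cb_bounded[OF Cc_subset_Cb[OF \<phi>(1)]] by blast
  have n: "0 \<le> opnorm H T"
    by (rule opnorm_nonneg[OF T])
  have "F \<in> Cb X"
  proof (rule CbI[OF cont, where C = "B * opnorm H T"])
    fix y assume y: "y \<in> topspace X"
    show "cmod (F y) \<le> B * opnorm H T"
    proof (cases "r y \<in> r ` U")
      case True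
      then have "cmod (T (delta (?k y)) y) \<le> opnorm H T"
        using coefficient_bound[OF T _ kf[of y]] y by simp
      then have "cmod (\<phi> (?u y)) * cmod (T (delta (?k y)) y) \<le> B * opnorm H T"
        using B by (intro mult_mono) auto
      then show ?thesis
        using True y by (simp add: F_def norm_mult)
    qed (use B n in \<open>simp add: F_def\<close>)
  qed (simp add: F_def)
  moreover have "r y \<in> r ` supp_on X \<phi>" if "F y \<noteq> 0" for y
  proof -
    have "r y \<in> r ` U" "\<phi> (?u y) \<noteq> 0"
      using that by (auto simp: F_def split: if_splits)
    then show ?thesis
      using Cc_supp[OF \<phi>(1)] bisection_range_section(2)[OF U] by (metis image_eqI)
  qed
  moreover have "compactin X (r ` supp_on X \<phi>)"
    by (rule image_compactin[OF Cc_compact[OF \<phi>(1)] continuous_range])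
  moreover have "r ` supp_on X \<phi> \<subseteq> units H"
    using supp_on_subset[of X \<phi>] by auto
  ultimately have "F \<in> C0r H"
    by (intro C0r_generator) auto
  moreover have "F g = \<phi> c * T (delta (inv c \<cdot> g)) g" if "g \<in> arrows H" "c \<in> U" "r g = r c" for g c
    using that bisection_range_section_eq[OF U that(2)] by (simp add: F_def)
  ultimately show thesis
    using that by blast
qed

text \<open>On a bisection the extension is \<open>z F * \<omega> c\<close>, with \<open>F\<close>
  from \<open>diagonal_coefficient\<close> and \<open>\<omega>\<close> a bump equal to 1 on the
  support of \<open>\<phi>\<close>; general \<open>\<phi>\<close> follow by addition. Compactness in
  the direction of \<open>z\<close> is automatic by \<open>sd_compact\<close>.\<close>

lemma coefficient_extension:
  assumes T: "T \<in> adjointable H" and "\<phi> \<in> Cc X"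
  shows "\<exists>f\<in>Cc (gtop S). \<forall>g\<in>arrows H. \<forall>c\<in>arrows H. r g = r c \<longrightarrow>
    f (beta_emb H g, c) = \<phi> c * T (delta (inv c \<cdot> g)) g"
  using assms(2)
proof (induction rule: Cc_induct)
  case (add \<phi> \<psi>)
  from add(3) obtain f where f: "f \<in> Cc (gtop S)" "\<forall>g\<in>arrows H. \<forall>c\<in>arrows H. r g = r c \<longrightarrow>
      f (beta_emb H g, c) = \<phi> c * T (delta (inv c \<cdot> g)) g" ..
  from add(4) obtain f' where f': "f' \<in> Cc (gtop S)" "\<forall>g\<in>arrows H. \<forall>c\<in>arrows H. r g = r c \<longrightarrow>
      f' (beta_emb H g, c) = \<psi> c * T (delta (inv c \<cdot> g)) g" ..
  show ?case
    using Cc_add[OF sd.Hausdorff f(1) f'(1)] f(2) f'(2)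
    by (intro bexI[of _ "\<lambda>p. f p + f' p"]) (simp_all add: distrib_right)
next
  case (bisection \<phi> U)
  note U = bisection
  obtain F where F: "F \<in> C0r H" "\<And>g c. g \<in> arrows H \<Longrightarrow> c \<in> U \<Longrightarrow> r g = r c \<Longrightarrow> F g = \<phi> c * T (delta (inv c \<cdot> g)) g"
    by (rule diagonal_coefficient[OF T U(2,1,3)]) (rule that)
  obtain \<omega> where \<omega>: "\<omega> \<in> Cc X" "supp_on X \<omega> \<subseteq> U" "\<And>c. c \<in> supp_on X \<phi> \<Longrightarrow> \<omega> c = 1"
    using compact_bump[OF locally_compact Hausdorff Cc_compact[OF U(1)] bisection_open[OF U(2)] U(3)] by metis
  define f where "f p = (if p \<in> arrows S then fst p F * \<omega> (snd p) else 0)" for p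
  have "f \<in> Cc (gtop S)"
  proof (rule sd_Cc[OF _ _ Cc_compact[OF \<omega>(1)]])
    have "continuous_map (gtop S) euclidean (\<lambda>p. fst p F)" "continuous_map (gtop S) euclidean (\<lambda>p. \<omega> (snd p))"
      using continuous_map_compose[OF sd_continuous_components(1) continuous_beta_eval[of F]]
        continuous_map_compose[OF sd_continuous_components(2) Cc_continuous[OF \<omega>(1)]] by (auto simp: comp_def)
    then have "continuous_map (gtop S) euclidean (\<lambda>p. fst p F * \<omega> (snd p))"
      by (rule continuous_map_mult)
    then show "continuous_map (gtop S) euclidean f"
      by (rule continuous_map_eq) (simp add: f_def)
  qed (auto simp: f_def Cc_supp[OF \<omega>(1)])
  moreover have "f (beta_emb H g, c) = \<phi> c * T (delta (inv c \<cdot> g)) g"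
    if g: "g \<in> arrows H" and c: "c \<in> arrows H" and rg: "r g = r c" for g c
  proof -
    have "(beta_emb H g, c) \<in> arrows S"
      using g c rg by (simp add: sd_arrows emb_character r_beta_emb)
    then have f: "f (beta_emb H g, c) = F g * \<omega> c"
      by (simp add: f_def emb_eval[OF F(1)])
    show ?thesis
    proof (cases "c \<in> U")
      case True
      then have "f (beta_emb H g, c) = \<phi> c * T (delta (inv c \<cdot> g)) g * \<omega> c"
        using f F(2)[OF g True rg] by simp
      then show ?thesis
        using \<omega>(3)[of c] Cc_supp[OF U(1), of c] by (cases "\<phi> c = 0") auto
    next
      case False
      then have "\<omega> c = 0" "\<phi> c = 0"
        using Cc_supp[OF \<omega>(1)] Cc_supp[OF U(1)] \<omega>(2) U(3) by blast+
      then show ?thesis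
        using f by simp
    qed
  qed
  ultimately show ?case
    by blast
qed

text \<open>With \<open>\<phi>\<close> equal to 1 on the propagation set \<open>K\<close>, the
  extended function reproduces the coefficients of \<open>T\<close> for quotients in
  \<open>K\<close>; for the others the coefficient of \<open>T\<close> is already 0.\<close>

lemma Cu_alg_theta:
  assumes "T \<in> Cu_alg H"
  obtains f where "f \<in> Cc (gtop S)" "theta H f = T"
proof -
  obtain K where T: "T \<in> adjointable H" and K: "compactin X K" "propagation K T"
    using assms Cu_alg_iff by auto
  obtain \<phi> where \<phi>: "\<phi> \<in> Cc X" "\<And>c. c \<in> K \<Longrightarrow> \<phi> c = 1"
    using compact_bump[OF locally_compact Hausdorff K(1) openin_topspace compactin_subset_topspace[OF K(1)]] by metis
  from coefficient_extension[OF T \<phi>(1)] obtain f where f: "f \<in> Cc (gtop S)" "\<forall>g\<in>arrows H. \<forall>c\<in>arrows H. r g = r c \<longrightarrow>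
      f (beta_emb H g, c) = \<phi> c * T (delta (inv c \<cdot> g)) g" ..
  have "theta H f \<xi> g = T \<xi> g" for \<xi> g
  proof (cases "\<xi> \<in> L2 H \<and> g \<in> arrows H")
    case True
    then have \<xi>: "\<xi> \<in> L2 H" and g: "g \<in> arrows H" by auto
    have "f (beta_emb H g, g \<cdot> inv a) = T (delta a) g" if a: "a \<in> fibre H (s g)" for a
    proof -
      have c: "g \<cdot> inv a \<in> arrows H"
        using g a by (simp add: fibre_iff)
      have "f (beta_emb H g, g \<cdot> inv a) = \<phi> (g \<cdot> inv a) * T (delta a) g"
        using f(2)[rule_format, OF g c] division_fibre(2,3)[OF g a] by simp
      moreover have "T (delta a) g = 0" if far: "g \<cdot> inv a \<notin> K"
      proof -
        have a': "a \<in> arrows H" "s a = s g"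
          using a by (auto simp: fibre_iff)
        show ?thesis
        proof (rule propagationD[OF K(2) delta_L2[OF a'(1)] g])
          fix h assume "h \<in> fibre H (s g)" "g \<cdot> inv h \<in> K"
          then show "delta a h = 0"
            using delta(3)[OF a'(1), of h] a'(2) far by auto
        qed
      qed
      ultimately show ?thesis
        using \<phi>(2)[of "g \<cdot> inv a"] by (cases "g \<cdot> inv a \<in> K") auto
    qed
    then have "theta H f \<xi> g = (\<Sum>\<^sub>\<infinity>a\<in>fibre H (s g). T (delta a) g * \<xi> a)"
      using True unfolding theta_eq by (simp cong: infsum_cong)
    then show ?thesis
      using matrix_expansion[OF T \<xi> g] by simp
  next
    case False
    then show ?thesis
      using adjointable_outside[OF T] L2_zero_outside[OF adjointable_L2[OF T]] by (cases "\<xi> \<in> L2 H") (auto simp: theta_eq)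
  qed
  then have "theta H f = T"
    by (intro ext)
  then show thesis
    using that f(1) by blast
qed

text \<open>Quotients along \<open>diag g\<close> have the form
  \<open>(beta_emb H g, g \<cdot> inv a)\<close>, so the second components of a compact propagation
  set form one for the image.\<close>

lemma Theta_Cu_alg:
  assumes "T \<in> Cu_alg S"
  shows "Theta H T \<in> Cu_alg H"
proof -
  obtain K where T: "T \<in> adjointable S" and K: "compactin (gtop S) K" "sd.propagation K T"
    using assms sd.Cu_alg_iff by auto
  have "propagation (snd ` K) (Theta H T)"
    unfolding propagation_def
  proof (intro ballI impI)
    fix \<xi> g assume \<xi>: "\<xi> \<in> L2 H" and g: "g \<in> arrows H" and zero: "\<forall>h\<in>fibre H (s g). g \<cdot> inv h \<in> snd ` K \<longrightarrow> \<xi> h = 0"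
    have "T (iota_fun \<xi>) (diag g) = 0"
    proof (rule sd.propagationD[OF K(2) iota_L2[OF \<xi>] diag_arrow[OF g]])
      fix p assume p: "p \<in> fibre S (gsrc S (diag g))" "gmul S (diag g) (ginv S p) \<in> K"
      obtain a where a: "a \<in> fibre H (s g)" "p = diag a"
        using p(1) bij_betw_imp_surj_on[OF diag_bij[of "s g"]] unfolding diag_source[OF g] by blast
      have "(beta_emb H g, g \<cdot> inv a) \<in> K"
        using p(2) diag_division[OF g a(1)] a(2) by simp
      then have "g \<cdot> inv a \<in> snd ` K"
        by force
      then have "\<xi> a = 0"
        using zero a(1) by blast
      then show "iota_fun \<xi> p = 0"
        using kappa_on_fibre[OF a(1), of "iota_fun \<xi>"] kappa_iota[OF \<xi>] a(2) by simp
    qed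
    then show "Theta H T \<xi> g = 0"
      using \<xi> by (simp add: Theta_eq[OF T] kappa_fun_def)
  qed
  then show ?thesis
    unfolding Cu_alg_iff using Theta_adjointable(1)[OF T] image_compactin[OF K(1) sd_continuous_components(2)] by blast
qed

text \<open>The coefficients of \<open>T\<close> itself are never examined: its image under
  \<open>Theta\<close> is compactly supported, hence equals the image of some
  \<open>Lambda_op S f\<close>, and \<open>Theta\<close> is injective on equivariant
  operators.\<close>

lemma Cu_alg_equivariant_Lambda:
  assumes T: "T \<in> Cu_alg_equivariant S"
  obtains f where "f \<in> Cc (gtop S)" "T = Lambda_op S f"
proof -
  have T': "T \<in> Cu_alg S" "T \<in> equivariant_ops S"
    using T unfolding sd.Cu_alg_equivariant_eq by auto
  obtain f where f: "f \<in> Cc (gtop S)" "theta H f = Theta H T"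
    by (rule Cu_alg_theta[OF Theta_Cu_alg[OF T'(1)]]) (rule that)
  have "T = Lambda_op S f"
    using inj_onD[OF Theta_inj _ T'(2) sd.Lambda_equivariant[OF f(1)]] Theta_Lambda[OF f(1)] f(2) by simp
  then show thesis
    using that f(1) by blast
qed

section \<open>The isomorphism of closures and its uniqueness\<close>

abbreviation uniform_closure where
  "uniform_closure \<equiv> op_closure S (Cu_alg_equivariant S)"

lemma Cu_alg_equivariant_adjointable: "Cu_alg_equivariant S \<subseteq> adjointable S"
  using sd.Cu_alg_adjointable unfolding sd.Cu_alg_equivariant_eq by blast

lemma uniform_closure_equivariant: "uniform_closure \<subseteq> equivariant_ops S"
proof -
  have "uniform_closure \<subseteq> op_closure S (equivariant_ops S)"
    by (rule sd.op_closure_mono) (simp add: sd.Cu_alg_equivariant_eq)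
  then show ?thesis
    using sd.equivariant_closed by blast
qed

lemma uniform_closure_approx:
  assumes "T \<in> uniform_closure"
  obtains f where "\<And>n. f n \<in> Cc (gtop S)" "\<And>n. sd.near T (Lambda_op S (f n)) ((1/2) ^ n)"
proof -
  obtain R where R: "\<And>n. R n \<in> Cu_alg_equivariant S" "\<And>n. sd.near T (R n) ((1/2) ^ n)"
    by (rule sd.approximating_sequence[OF Cu_alg_equivariant_adjointable assms]) (rule that)
  have "\<forall>n. \<exists>f. f \<in> Cc (gtop S) \<and> R n = Lambda_op S f"
    using Cu_alg_equivariant_Lambda[OF R(1)] by metis
  then obtain f where f: "\<And>n. f n \<in> Cc (gtop S)" "\<And>n. R n = Lambda_op S (f n)"
    by metis
  show thesis
    by (rule that[of f]) (use f R(2) in auto)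
qed

text \<open>For surjectivity, compactly supported approximants of \<open>R\<close> are lifted to
  operators \<open>Lambda_op S (f n)\<close>. These are Cauchy because \<open>Theta\<close> is
  isometric, and completeness of the adjointable operators provides a preimage.\<close>

lemma Theta_uniform_closure: "Theta H ` uniform_closure = Cu_star H"
proof (intro equalityI subsetI)
  fix R assume "R \<in> Theta H ` uniform_closure"
  then obtain T where T: "T \<in> uniform_closure" "R = Theta H T" by blast
  have TA: "T \<in> adjointable S"
    using T(1) sd.op_closure_adjointable by blast
  have "\<exists>Q\<in>Cu_alg H. near (Theta H T) Q \<epsilon>" if e: "\<epsilon> > 0" for \<epsilon>
  proof -
    obtain R where R: "R \<in> Cu_alg_equivariant S" "sd.near T R \<epsilon>"
      using T(1) e unfolding sd.op_closure_iff[OF Cu_alg_equivariant_adjointable] by blast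
    have "near (Theta H T) (Theta H R) \<epsilon>"
      using R Cu_alg_equivariant_adjointable TA e by (intro Theta_near) auto
    then show ?thesis
      using Theta_Cu_alg[of R] R(1) unfolding sd.Cu_alg_equivariant_eq by blast
  qed
  then show "R \<in> Cu_star H"
    unfolding Cu_star_def op_closure_iff[OF Cu_alg_adjointable] T(2) using Theta_adjointable(1)[OF TA] by blast
next
  fix R assume "R \<in> Cu_star H"
  then have R: "R \<in> op_closure H (Cu_alg H)" "R \<in> adjointable H"
    using op_closure_adjointable unfolding Cu_star_def by blast+
  obtain Q where Q: "\<And>n. Q n \<in> Cu_alg H" "\<And>n. near R (Q n) ((1/2) ^ n)"
    by (rule approximating_sequence[OF Cu_alg_adjointable R(1)]) (rule that)
  have QA: "Q n \<in> adjointable H" for n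
    using Q(1) Cu_alg_adjointable by blast
  have "\<forall>n. \<exists>f. f \<in> Cc (gtop S) \<and> theta H f = Q n"
    using Cu_alg_theta[OF Q(1)] by metis
  then obtain f where f: "\<And>n. f n \<in> Cc (gtop S)" "\<And>n. theta H (f n) = Q n"
    by metis
  define T where "T n = Lambda_op S (f n)" for n
  have TE: "T n \<in> Cu_alg_equivariant S" for n
    unfolding T_def by (rule sd.Lambda_Cu_alg_equivariant[OF f(1)])
  have Teq: "T n \<in> equivariant_ops S" and TA: "T n \<in> adjointable S" for n
    using TE Cu_alg_equivariant_adjointable unfolding sd.Cu_alg_equivariant_eq by auto
  have TQ: "Theta H (T n) = Q n" for n
    unfolding T_def using Theta_Lambda[OF f(1)] f(2) by simp
  \<comment> \<open>The errors \<open>(1/2) ^ Suc n\<close> and \<open>(1/2) ^ n\<close> add up to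
    less than \<open>2 * (1/2) ^ n\<close>; summing the geometric tail doubles this to the factor 4
    used below.\<close>
  have step: "sd.near (T (Suc n)) (T n) (2 * (1/2) ^ n)" for n
  proof -
    have "near (Q (Suc n)) (Q n) ((1/2) ^ Suc n + (1/2) ^ n)"
      by (rule near_trans[OF near_sym[OF Q(2)] Q(2) QA R(2) QA])
    then have "near (Q (Suc n)) (Q n) (2 * (1/2) ^ n)"
      by (rule near_mono) simp
    then show ?thesis
      using Theta_near_iff[OF Teq Teq, of "2 * (1/2) ^ n" "Suc n" n] by (simp add: TQ)
  qed
  obtain L where L: "L \<in> adjointable S" "\<And>n. sd.near L (T n) (2 * (1/2) ^ n / (1 - 1/2))"
    by (rule sd.op_geometric_limit[OF TA step]) (simp_all add: that)
  have L4: "sd.near L (T n) (4 * (1/2) ^ n)" for n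
    using L(2)[of n] by simp
  have lim4: "(\<lambda>n. 4 * (1/2) ^ n :: real) \<longlonglongrightarrow> 0"
    using tendsto_mult_left[OF half_power_tendsto_0, of 4] by simp
  have LU: "L \<in> uniform_closure"
    unfolding sd.op_closure_iff[OF Cu_alg_equivariant_adjointable]
  proof (intro conjI allI impI L(1))
    fix \<epsilon> :: real assume "\<epsilon> > 0"
    then have "eventually (\<lambda>n. 4 * (1/2) ^ n < \<epsilon>) sequentially"
      using order_tendstoD(2)[OF lim4] by blast
    then obtain n where "4 * (1/2) ^ n < \<epsilon>"
      by (auto simp: eventually_sequentially)
    then have "sd.near L (T n) \<epsilon>"
      by (intro sd.near_mono[OF L4]) simp
    then show "\<exists>S\<in>Cu_alg_equivariant S. sd.near L S \<epsilon>"
      using TE by blast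
  qed
  have "Theta H L = R"
  proof (rule oper_eqI[OF Theta_adjointable(1)[OF L(1)] R(2)])
    fix \<xi> g assume \<xi>: "\<xi> \<in> L2 H"
    have "near (Theta H L) (Q n) (4 * (1/2) ^ n)" for n
      using Theta_near[OF L(1) TA L4] by (simp add: TQ)
    then have "(\<lambda>n. Q n \<xi> g) \<longlonglongrightarrow> Theta H L \<xi> g"
      by (rule near_pointwise[OF Theta_adjointable(1)[OF L(1)] QA _ lim4 \<xi>])
    moreover have "(\<lambda>n. Q n \<xi> g) \<longlonglongrightarrow> R \<xi> g"
      by (rule near_pointwise[OF R(2) QA Q(2) half_power_tendsto_0 \<xi>])
    ultimately show "Theta H L \<xi> g = R \<xi> g"
      by (rule LIMSEQ_unique)
  qed
  then show "R \<in> Theta H ` uniform_closure"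
    using LU by blast
qed

lemma Theta_star_iso: "star_iso S uniform_closure H (Cu_star H) (Theta H)"
  unfolding star_iso_def
proof
  have hom: "star_hom S (equivariant_ops S) H (adjointable H) (Theta H)"
    using Theta_cstar_mono by (simp add: cstar_mono_def)
  have sub: "T \<in> uniform_closure \<Longrightarrow> T \<in> equivariant_ops S" for T
    using uniform_closure_equivariant by blast
  have "cstar_subalgebra S uniform_closure"
    by (rule sd.cstar_subalgebra_closure[OF sd.star_algebra_Cu_alg_equivariant])
  moreover have "cstar_subalgebra H (Cu_star H)"
    unfolding Cu_star_def by (rule cstar_subalgebra_closure[OF star_algebra_Cu_alg])
  moreover have "Theta H T \<in> Cu_star H" if "T \<in> uniform_closure" for T
    using that Theta_uniform_closure by blast
  ultimately show "star_hom S uniform_closure H (Cu_star H) (Theta H)"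
    using hom sub unfolding star_hom_def by simp
  show "bij_betw (Theta H) uniform_closure (Cu_star H)"
    unfolding bij_betw_def using inj_on_subset[OF Theta_inj uniform_closure_equivariant] Theta_uniform_closure by blast
qed

text \<open>Contractivity of \<open>\<Psi>\<close> puts \<open>\<Psi> T\<close> close to
  \<open>\<Psi> (Lambda_op S (f n))\<close>, which by assumption is \<open>theta H (f n)\<close>;
  the same sequence converges to \<open>Theta H T\<close>.\<close>

lemma star_iso_unique:
  assumes iso: "star_iso S uniform_closure H (Cu_star H) \<Psi>"
    and eq: "\<And>f. f \<in> Cc (gtop S) \<Longrightarrow> \<Psi> (Lambda_op S f) = theta H f" and T: "T \<in> uniform_closure"
  shows "\<Psi> T = Theta H T"
proof -
  have hom: "star_hom S uniform_closure H (Cu_star H) \<Psi>"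
    using iso by (simp add: star_iso_def)
  have img: "\<Psi> R \<in> adjointable H" if "R \<in> uniform_closure" for R
    using hom that op_closure_adjointable unfolding star_hom_def Cu_star_def by blast
  have UA: "R \<in> adjointable S" if "R \<in> uniform_closure" for R
    using that sd.op_closure_adjointable by blast
  obtain f where f: "\<And>n. f n \<in> Cc (gtop S)" "\<And>n. sd.near T (Lambda_op S (f n)) ((1/2) ^ n)"
    by (rule uniform_closure_approx[OF T]) (rule that)
  let ?R = "\<lambda>n. Lambda_op S (f n)"
  have R: "?R n \<in> uniform_closure" for n
    using sd.Lambda_Cu_alg_equivariant[OF f(1)] sd.op_closure_superset[OF Cu_alg_equivariant_adjointable] by blast
  have \<Psi>R: "\<Psi> (?R n) = Theta H (?R n)" for n
    using eq[OF f(1)] Theta_Lambda[OF f(1)] by simp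
  have add: "\<And>Q R. Q \<in> uniform_closure \<Longrightarrow> R \<in> uniform_closure \<Longrightarrow> \<Psi> (\<lambda>\<xi> g. Q \<xi> g + R \<xi> g) = (\<lambda>\<xi> g. \<Psi> Q \<xi> g + \<Psi> R \<xi> g)"
    and scale: "\<And>c R. R \<in> uniform_closure \<Longrightarrow> \<Psi> (\<lambda>\<xi> g. c * R \<xi> g) = (\<lambda>\<xi> g. c * \<Psi> R \<xi> g)"
    using hom by (simp_all add: star_hom_def)
  have alg: "sd.star_algebra uniform_closure"
    using hom unfolding star_hom_def sd.cstar_subalgebra_iff by blast
  have near: "near (\<Psi> T) (\<Psi> (?R n)) ((1/2) ^ n)" for n
  proof -
    let ?D = "\<lambda>\<xi> g. T \<xi> g - ?R n \<xi> g"
    have scaled: "(\<lambda>\<xi> g. - 1 * ?R n \<xi> g) \<in> uniform_closure"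
      using alg R[of n] by (simp only: sd.star_algebra_def)
    have D: "?D \<in> uniform_closure"
      by (rule sd.star_algebra_diff[OF alg T R])
    have "\<Psi> ?D = (\<lambda>\<xi> g. \<Psi> T \<xi> g - \<Psi> (?R n) \<xi> g)"
      using add[OF T scaled] scale[OF R[of n], of "- 1"] by simp
    then have "opnorm H (\<lambda>\<xi> g. \<Psi> T \<xi> g - \<Psi> (?R n) \<xi> g) \<le> opnorm S ?D"
      using star_hom_contractive[OF semidirect_etale etale_axioms hom D] by simp
    also have "\<dots> \<le> (1/2) ^ n"
      by (rule sd.near_opnorm(2)[OF UA[OF T] UA[OF R] _ f(2)]) simp
    finally show ?thesis
      by (rule near_mono[OF near_opnorm(1)[OF img[OF T] img[OF R]]])
  qed
  have near': "near (Theta H T) (\<Psi> (?R n)) ((1/2) ^ n)" for n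
    unfolding \<Psi>R by (rule Theta_near[OF UA[OF T] UA[OF R] f(2)]) simp
  show ?thesis
  proof (rule oper_eqI[OF img[OF T] Theta_adjointable(1)[OF UA[OF T]]])
    fix \<xi> g assume \<xi>: "\<xi> \<in> L2 H"
    have "(\<lambda>n. \<Psi> (?R n) \<xi> g) \<longlonglongrightarrow> \<Psi> T \<xi> g"
      by (rule near_pointwise[OF img[OF T] img[OF R] near half_power_tendsto_0 \<xi>])
    moreover have "(\<lambda>n. \<Psi> (?R n) \<xi> g) \<longlonglongrightarrow> Theta H T \<xi> g"
      by (rule near_pointwise[OF Theta_adjointable(1)[OF UA[OF T]] img[OF R] near' half_power_tendsto_0 \<xi>])
    ultimately show "\<Psi> T \<xi> g = Theta H T \<xi> g"
      by (rule LIMSEQ_unique)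
  qed
qed

lemma Lambda_uniform_closure: "f \<in> Cc (gtop S) \<Longrightarrow> Lambda_op S f \<in> uniform_closure"
  using sd.Lambda_Cu_alg_equivariant sd.op_closure_superset[OF Cu_alg_equivariant_adjointable] by blast

end

theorem corollary7p7:
  fixes G :: "'a groupoid"
  assumes "lc_etale_groupoid G"
  shows "cstar_mono (semidirect G) (equivariant_ops (semidirect G)) G (adjointable G) (Theta G) \<and>
    (let A = op_closure (semidirect G) (Cu_alg_equivariant (semidirect G)) in
       A \<subseteq> equivariant_ops (semidirect G) \<and>
       (\<forall>f\<in>Cc (gtop (semidirect G)). Lambda_op (semidirect G) f \<in> A) \<and>
       (\<exists>\<Phi>. star_iso (semidirect G) A G (Cu_star G) \<Phi> \<and>
            (\<forall>f\<in>Cc (gtop (semidirect G)). \<Phi> (Lambda_op (semidirect G) f) = theta G f) \<and>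
            (\<forall>\<Psi>. star_iso (semidirect G) A G (Cu_star G) \<Psi> \<and>
                 (\<forall>f\<in>Cc (gtop (semidirect G)). \<Psi> (Lambda_op (semidirect G) f) = theta G f) \<longrightarrow>
                 (\<forall>T\<in>A. \<Psi> T = \<Phi> T)) \<and>
            (\<forall>T\<in>A. Theta G T = \<Phi> T)))"
proof -
  interpret etale G
    by unfold_locales (rule assms)
  show ?thesis
    unfolding Let_def
  \<comment> \<open>The isomorphism is taken to be \<open>Theta G\<close> itself, so the clause on
    extension becomes reflexive.\<close>
  proof (intro conjI exI[of _ "Theta G"] ballI allI impI)
    show "cstar_mono (semidirect G) (equivariant_ops (semidirect G)) G (adjointable G) (Theta G)"
      by (rule Theta_cstar_mono)
    show "op_closure (semidirect G) (Cu_alg_equivariant (semidirect G)) \<subseteq> equivariant_ops (semidirect G)"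
      by (rule uniform_closure_equivariant)
    show "star_iso (semidirect G) (op_closure (semidirect G) (Cu_alg_equivariant (semidirect G))) G (Cu_star G) (Theta G)"
      by (rule Theta_star_iso)
  qed (auto simp: Theta_Lambda intro: Lambda_uniform_closure star_iso_unique)
qed

end
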